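(* Let $n,i,r$ be positive integers with $n\ge i+r$, let $0<q<1$, $Q=-q$, and $\gamma_1,\dots,\gamma_n>\frac12$ real. With the notation of the context, the overlap coefficients between the eigenbases $\{|\mathbf j^{(1,1)}\rangle\}$ of $\mathcal Y_{1,1}$ and $\{|\mathbf j^{(i,r)}\rangle\}$ of $\mathcal Y_{i,r}$ can be expressed as $$\langle \mathbf j^{(i,r)}|\mathbf j^{(1,1)}\rangle=\delta_{S_{i+r-1},J_{i+r-1}}\prod_{\ell=1}^{i-1}\delta_{j^{(1,1)}_\ell,j^{(i,r)}_\ell}\prod_{\ell=i+r}^{n-1}\delta_{j^{(1,1)}_\ell,j^{(i,r)}_\ell}\ \sqrt{\frac{\rho^{(i,r)}(\mathbf j^{(1,1)})}{h_{\mathbf j^{(i,r)}}}}\ R_{\mathbf n}\!\left(\mathbf x;\,a_1,\dots,a_r,\,b,\,M\,|\,-q\right),$$ where $S_\ell=\sum_{t=1}^{\ell}j^{(1,1)}_t$, $J_\ell=\sum_{t=1}^{\ell}j^{(i,r)}_t$, $\mathbf n=(n_1,\dots,n_{r-1})$ with $n_k=j^{(i,r)}_{i+k-1}$, $\mathbf x=(x_1,\dots,x_{r-1})$ with $x_k=S_{i+k-1}-S_{i-1}$, $a_1=(-q)^{2S_{i-1}-1}q^{2\gamma_{[1;i+1]}}$, $a_k=q^{2\gamma_{i+k}}$ for $2\le k\le r$, $b=-q^{2\gamma_{i+1}-1}$, $M=S_{i+r-1}-S_{i-1}$, $R_{\mathbf n}$ is the multivariate $(-q)$-Racah polynomial in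 $r-1$ variables, and $\rho^{(i,r)}$, $h$ are the explicit functions given in the context.
   Context: Notation: $\mathbb N=\{0,1,2,\dots\}$, $[k;l]=\{k,\dots,l\}$, $\gamma_A=\sum_{t\in A}\gamma_t$, $[x]_q=\frac{q^x-q^{-x}}{q-q^{-1}}$, $|\mathbf v_m|=v_1+\dots+v_m$, $|\mathbf v|$ the full sum, $\sigma_m^{(\gamma)}=[m+\gamma-\frac12]_q-(-1)^m[\gamma-\frac12]_q$, $(a;Q)_m=\prod_{t=0}^{m-1}(1-aQ^t)$, $(a_1,\dots,a_p;Q)_m=\prod_t(a_t;Q)_m$. Algebra: $\mathfrak{osp}_q(1|2)$ is the unital associative algebra with generators $A_\pm,K^{\pm1},P$ and relations $KA_\pm K^{-1}=q^{\pm1/2}A_\pm$, $A_+A_-+A_-A_+=\frac{K^2-K^{-2}}{q^{1/2}-q^{-1/2}}$, $PA_\pm=-A_\pm P$, $PK=KP$, $KK^{-1}=K^{-1}K=1$, $P^2=1$. Casimir $\Gamma^q=\big(-A_+A_-+\frac{q^{-1/2}K^2-q^{1/2}K^{-2}}{q-q^{-1}}\big)P$. Coproduct $\Delta(A_\pm)=A_\pm\otimes KP+K^{-1}\otimes A_\pm$, $\Delta(K)=K\otimes K$, $\Delta(P)=P\otimes P$ (componentwise product on tensor powers); $\Delta^{(1)}=\mathrm{id}$, $\Delta^{(d)}=(1^{\otimes(d-2)}\otimes\Delta)\Delta^{(d-1)}$; $X_{[1;d]}=\Delta^{(d)}(X)$; $\Gamma^q_{[k;l]}=1^{\otimes(k-1)}\otimes\Delta^{(l-k+1)}(\Gamma^q)\otimes1^{\otimes(n-l)}$.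 $\mathcal Y_{i,r}$ is the (abelian) algebra generated by $\Gamma^q_{[1;m]}$ for $m\in[2;i]\cup[i+r;n]$ and $\Gamma^q_{[i+1;i+m]}$ for $m\in[2;r]$; $\mathcal Y_{1,1}$ is generated by $\Gamma^q_{[1;m]}$, $m\in[2;n]$. Module $W^{(\gamma)}$: orthonormal basis $|m\rangle_\gamma$, $m\in\mathbb N$, with $A_+|m\rangle_\gamma=\sqrt{\sigma^{(\gamma)}_{m+1}}|m+1\rangle_\gamma$, $A_-|m\rangle_\gamma=\sqrt{\sigma^{(\gamma)}_m}|m-1\rangle_\gamma$, $K|m\rangle_\gamma=q^{(m+\gamma)/2}|m\rangle_\gamma$, $P|m\rangle_\gamma=(-1)^m|m\rangle_\gamma$. Everything acts on $W^{(\gamma_1)}\otimes\dots\otimes W^{(\gamma_n)}$ with the product inner product. Vectors. For $\delta=(\delta_1,\dots,\delta_d)$, $\mathbf h\in\mathbb N^{d-1}$, $p\in\mathbb N$ define $\psi_\delta(\mathbf h,p)\in W^{(\delta_1)}\otimes\dots\otimes W^{(\delta_d)}$ recursively: for $d=1$, $\psi_\delta(p)=\prod_{\ell=1}^p\sqrt{\sigma_\ell^{(\delta_1)}}\,|p\rangle_{\delta_1}$; for $d\ge2$, $$\psi_\delta(h_1,\dots,h_{d-1},p)=(A_+)_{[1;d]}^p\sum_{k=0}^{h_{d-1}}c_k\,\psi_{(\delta_1,\dots,\delta_{d-1})}(h_1,\dots,h_{d-2},k)\otimes|h_{d-1}-k\rangle_{\delta_d},$$ $$c_k=(-1)^{k(h_{d-1}+\frac{k-1}2)}q^{-\frac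 k2(|\mathbf h_{d-1}|+\delta_1+\dots+\delta_d-1)}\prod_{\ell=0}^{k-1}\frac{\sqrt{\sigma^{(\delta_d)}_{h_{d-1}-\ell}}}{\sigma_{\ell+1}^{(|\mathbf h_{d-2}|+\delta_1+\dots+\delta_{d-1})}}.$$ Put $\psi^{(i)}=\psi_{(\gamma_1,\dots,\gamma_i)}$, $\varphi^{(r)}=\psi_{(\gamma_{i+1},\dots,\gamma_{i+r})}$. For $\mathbf h\in\mathbb N^{i-1}$, $\mathbf k\in\mathbb N^{r-1}$, $s,t\in\mathbb N$, $$\Psi^{(i,r)}(\mathbf h,\mathbf k,s,t)=(A_+)_{[1;i+r]}^t\sum_{p=0}^s\epsilon_p\,\psi^{(i)}(\mathbf h,p)\otimes\varphi^{(r)}(\mathbf k,s-p),\quad\epsilon_p=(-1)^p\frac{\beta_{s-p+1}\cdots\beta_s}{\alpha_1\cdots\alpha_p},$$ $\alpha_p=(-1)^{|\mathbf k|+s-p}q^{\frac12(\gamma_{[i+1;i+r]}+s-p+|\mathbf k|)}\sigma_p^{(|\mathbf h|+\gamma_{[1;i]})}$, $\beta_{p'}=q^{-\frac12(\gamma_{[1;i]}+s-p'+|\mathbf h|)}\sigma_{p'}^{(|\mathbf k|+\gamma_{[i+1;i+r]})}$. $\Theta^{(i,r)}$ is defined recursively on the number $n$ of factors: for $n=i+r$, $\Theta^{(i,r)}(j_1,\dots,j_{n-1},N)=\Psi^{(i,r)}((j_1,\dots,j_{i-1}),(j_i,\dots,j_{i+r-2}),j_{i+r-1},N)$; for $n>i+r$,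 $$\Theta^{(i,r)}(j_1,\dots,j_{n-1},N)=(A_+)_{[1;n]}^N\sum_{k=0}^{j_{n-1}}e_k\,\Theta^{(i,r)}(j_1,\dots,j_{n-2},k)\otimes|j_{n-1}-k\rangle_{\gamma_n},$$ $e_k=(-1)^{k(j_{n-1}+\frac{k-1}2)}q^{-\frac k2(|\mathbf j_{n-1}|+\gamma_{[1;n]}-1)}\prod_{\ell=0}^{k-1}\sqrt{\sigma^{(\gamma_n)}_{j_{n-1}-\ell}}\big/\sigma_{\ell+1}^{(|\mathbf j_{n-2}|+\gamma_{[1;n-1]})}$. For $\mathbf j^{(i,r)}\in\mathbb N^{n-1}$ and $N\in\mathbb N$, $|\mathbf j^{(i,r)};N\rangle=\eta\,\Theta^{(i,r)}(j^{(i,r)}_1,\dots,j^{(i,r)}_{n-1},N)$, where $\eta=\eta_{\mathbf j^{(i,r)},N}$ is a normalization constant chosen such that the vector has norm $1$; and $|\mathbf j^{(i,r)}\rangle=|\mathbf j^{(i,r)};0\rangle$. These vectors are joint eigenvectors of $\mathcal Y_{i,r}$; $|\mathbf j^{(1,1)}\rangle$ is the case $i=r=1$. Multivariate Racah polynomials: for base $Q$, $$r_m(x;a,b,c,N|Q)=(aQ,bcQ,Q^{-N};Q)_m\Big(\tfrac{Q^N}{c}\Big)^{m/2}\sum_{t=0}^{\infty}\frac{(Q^{-m},abQ^{m+1},Q^{-x},cQ^{x-N};Q)_t}{(aQ,bcQ,Q^{-N},Q;Q)_t}Q^t,$$ and for $\mathbf n\in\mathbb N^s$, with $N_k=n_1+\dots+n_k$,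 $A_k=a_1\cdots a_k$, $x_{s+1}=M$, $$R_{\mathbf n}(\mathbf x;a_1,\dots,a_{s+1},b,M|Q)=\prod_{k=1}^s r_{n_k}\Big(x_k-N_{k-1};\tfrac{bA_k}{a_1}Q^{2N_{k-1}},\tfrac{a_{k+1}}{Q},A_kQ^{x_{k+1}+N_{k-1}},x_{k+1}-N_{k-1}\Big|Q\Big).$$ Explicit functions (with $Q=-q$, $M=S_{i+r-1}-S_{i-1}$, $j_\ell=j^{(1,1)}_\ell$): $$\rho^{(i,r)}(\mathbf j^{(1,1)})=\frac{(Q,Q^{2S_{i-1}}q^{2\gamma_{[1;i+r-1]}};Q)_M}{(q^{2\gamma_{i+r}},Q^{2S_{i-1}-1}q^{2\gamma_{[1;i+r]}};Q)_M}\cdot\frac{(Q^{2S_{i-1}-1}q^{2\gamma_{[1;i+1]}},q^{2\gamma_{i+1}};Q)_{j_i}}{(Q,Q^{2S_{i-1}}q^{2\gamma_{[1;i]}};Q)_{j_i}}$$ $$\times\prod_{k=1}^{r-1}\left[\frac{(q^{2\gamma_{i+k+1}};Q)_{j_{i+k}}}{(Q;Q)_{j_{i+k}}}\frac{(Q^{2S_{i-1}-1}q^{2\gamma_{[1;i+k+1]}};Q)_{S_{i+k-1}+S_{i+k}-2S_{i-1}}}{(Q^{2S_{i-1}}q^{2\gamma_{[1;i+k]}};Q)_{S_{i+k-1}+S_{i+k}-2S_{i-1}}}\cdot\frac{1-Q^{2S_{i+k-1}-1}q^{2\gamma_{[1;i+k]}}}{1-Q^{2S_{i-1}-1}q^{2\gamma_{[1;i+k]}}}\,(q^{2\gamma_{i+k}})^{-S_{i+k-1}+S_{i-1}}\right],$$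 $$h_{\mathbf j^{(i,r)}}=\frac{(Q^{2S_{i-1}}q^{2\gamma_{[1;i+r-1]}},q^{2\gamma_{[i+1;i+r]}};Q)_M}{(q^{2\gamma_{i+r}},Q^{2S_{i-1}}q^{2\gamma_{[1;i]}};Q)_M}\,(q^{-2\gamma_{[i+1;i+r-1]}})^M$$ $$\times(Q^Mq^{2\gamma_{[i+1;i+r]}},Q^{S_{i+r-1}+S_{i-1}-1}q^{2\gamma_{[1;i+r]}},Q^{1-S_{i+r-1}-S_{i-1}}q^{-2\gamma_{[1;i]}},Q^{-M};Q)_{J_{i+r-2}-J_{i-1}}$$ $$\times\prod_{k=1}^{r-1}\left[(Q,q^{2\gamma_{i+k+1}};Q)_{j^{(i,r)}_{i+k-1}}\frac{(q^{2\gamma_{[i+1;i+k]}};Q)_{J_{i+k-2}+J_{i+k-1}-2J_{i-1}}}{(-q^{2\gamma_{[i+1;i+k+1]}-1};Q)_{J_{i+k-2}+J_{i+k-1}-2J_{i-1}}}\cdot\frac{1+q^{2\gamma_{[i+1;i+k+1]}-1}}{1+q^{2\gamma_{[i+1;i+k+1]}-1-2S_{i-1}+2J_{i+k-1}}}\right].$$ *)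

theory Defs
  imports "HOL-Analysis.Analysis" "HOL-Library.Poly_Mapping"
begin

definition ket :: "'a \<Rightarrow> 'a \<Rightarrow>\<^sub>0 complex" where
  "ket a = Poly_Mapping.single a 1"

definition vscale :: "complex \<Rightarrow> ('a \<Rightarrow>\<^sub>0 complex) \<Rightarrow> 'a \<Rightarrow>\<^sub>0 complex" where
  "vscale c v = Poly_Mapping.map (\<lambda>x. c * x) v"

definition lin_ext :: "('a \<Rightarrow> 'b \<Rightarrow>\<^sub>0 complex) \<Rightarrow> ('a \<Rightarrow>\<^sub>0 complex) \<Rightarrow> 'b \<Rightarrow>\<^sub>0 complex" where
  "lin_ext f v = (\<Sum>a\<in>Poly_Mapping.keys v. vscale (Poly_Mapping.lookup v a) (f a))"

definition braket :: "('a \<Rightarrow>\<^sub>0 complex) \<Rightarrow> ('a \<Rightarrow>\<^sub>0 complex) \<Rightarrow> complex" where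
  "braket v w = (\<Sum>a\<in>Poly_Mapping.keys v. cnj (Poly_Mapping.lookup v a) * Poly_Mapping.lookup w a)"

definition vnorm :: "('a \<Rightarrow>\<^sub>0 complex) \<Rightarrow> real" where
  "vnorm v = sqrt (Re (braket v v))"

text \<open>An element of a \<open>d\<close>-fold tensor product of modules with bases indexed by \<open>nat\<close> is a
  finitely supported function on lists of length \<open>d\<close>: the list \<open>[m1, ..., md]\<close> stands for
  \<open>|m1> \<otimes> ... \<otimes> |md>\<close>.\<close>

type_synonym tvec = "nat list \<Rightarrow>\<^sub>0 complex"

definition tens :: "tvec \<Rightarrow> tvec \<Rightarrow> tvec" where
  "tens v w = lin_ext (\<lambda>a. lin_ext (\<lambda>b. ket (a @ b)) w) v"

text \<open>Lists of generators are products (the empty list is the unit), and a list of such words is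
  an elementary tensor. A list of elementary tensors is their sum, so coefficients are all 1.\<close>

datatype gen = A_plus | A_minus | K_gen | K_inv | P_gen

fun coprod_gen :: "gen \<Rightarrow> (gen list \<times> gen list) list" where
  "coprod_gen A_plus = [([A_plus], [K_gen, P_gen]), ([K_inv], [A_plus])]"
| "coprod_gen A_minus = [([A_minus], [K_gen, P_gen]), ([K_inv], [A_minus])]"
| "coprod_gen K_gen = [([K_gen], [K_gen])]"
| "coprod_gen K_inv = [([K_inv], [K_inv])]"
| "coprod_gen P_gen = [([P_gen], [P_gen])]"

fun coprod :: "gen list \<Rightarrow> (gen list \<times> gen list) list" where
  "coprod [] = [([], [])]"
| "coprod (x # w) = [(a @ c, b @ d). (a, b) \<leftarrow> coprod_gen x, (c, d) \<leftarrow> coprod w]"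

text \<open>The value at 0 is a dummy; \<open>coprod_iter d\<close> produces \<open>d\<close>-fold tensors by
  repeatedly applying the coproduct to the last tensor factor.\<close>

fun coprod_iter :: "nat \<Rightarrow> gen list \<Rightarrow> gen list list list" where
  "coprod_iter 0 w = []"
| "coprod_iter (Suc 0) w = [[w]]"
| "coprod_iter (Suc (Suc d)) w =
     [butlast ws @ [a, b]. ws \<leftarrow> coprod_iter (Suc d) w, (a, b) \<leftarrow> coprod (last ws)]"

definition qbr :: "real \<Rightarrow> real \<Rightarrow> real" where
  "qbr q x = (q powr x - q powr (- x)) / (q - inverse q)"

definition sig :: "real \<Rightarrow> real \<Rightarrow> nat \<Rightarrow> real" where
  "sig q g m = qbr q (real m + g - 1 / 2) - (- 1) ^ m * qbr q (g - 1 / 2)"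

text \<open>For \<open>A_minus\<close> at \<open>m = 0\<close> the coefficient \<^term>\<open>sig q g 0\<close> vanishes, so the
  truncated index is irrelevant.\<close>

fun act_gen :: "real \<Rightarrow> real \<Rightarrow> gen \<Rightarrow> nat \<Rightarrow> nat \<Rightarrow>\<^sub>0 complex" where
  "act_gen q g A_plus m = vscale (complex_of_real (sqrt (sig q g (m + 1)))) (ket (m + 1))"
| "act_gen q g A_minus m = vscale (complex_of_real (sqrt (sig q g m))) (ket (m - 1))"
| "act_gen q g K_gen m = vscale (complex_of_real (q powr ((real m + g) / 2))) (ket m)"
| "act_gen q g K_inv m = vscale (complex_of_real (q powr (- ((real m + g) / 2)))) (ket m)"
| "act_gen q g P_gen m = vscale ((- 1) ^ m) (ket m)"

definition act_word :: "real \<Rightarrow> real \<Rightarrow> gen list \<Rightarrow> nat \<Rightarrow> nat \<Rightarrow>\<^sub>0 complex" where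
  "act_word q g w m = foldr (\<lambda>x. lin_ext (act_gen q g x)) w (ket m)"

fun act_tensor :: "real \<Rightarrow> real list \<Rightarrow> gen list list \<Rightarrow> nat list \<Rightarrow> tvec" where
  "act_tensor q (g # gs) (w # ws) (m # ms) =
     lin_ext (\<lambda>m'. lin_ext (\<lambda>ms'. ket (m' # ms')) (act_tensor q gs ws ms)) (act_word q g w m)"
| "act_tensor q [] [] [] = ket []"
| "act_tensor q _ _ _ = 0"

definition act :: "real \<Rightarrow> real list \<Rightarrow> gen list list list \<Rightarrow> tvec \<Rightarrow> tvec" where
  "act q gs X = lin_ext (\<lambda>ms. \<Sum>ws\<leftarrow>X. act_tensor q gs ws ms)"

definition raise :: "real \<Rightarrow> (nat \<Rightarrow> real) \<Rightarrow> nat \<Rightarrow> tvec \<Rightarrow> tvec" where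
  "raise q \<delta> d = act q (map \<delta> [1..<d + 1]) (coprod_iter d [A_plus])"

text \<open>Tuples are 1-based functions on \<open>nat\<close>; a length argument says which entries are used.
  The sign exponent \<open>k (h + (k - 1) / 2)\<close> is written as the natural number
  \<open>k h + k (k - 1) / 2\<close>.\<close>

definition cg_coeff :: "real \<Rightarrow> (nat \<Rightarrow> real) \<Rightarrow> nat \<Rightarrow> (nat \<Rightarrow> nat) \<Rightarrow> nat \<Rightarrow> real" where
  "cg_coeff q \<delta> d h k =
     (- 1) ^ (k * h (d - 1) + k * (k - 1) div 2)
     * q powr (- (real k / 2) * (real (\<Sum>t=1..d - 1. h t) + (\<Sum>t=1..d. \<delta> t) - 1))
     * (\<Prod>l<k. sqrt (sig q (\<delta> d) (h (d - 1) - l))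
               / sig q (real (\<Sum>t=1..d - 2. h t) + (\<Sum>t=1..d - 1. \<delta> t)) (l + 1))"

fun psi :: "real \<Rightarrow> (nat \<Rightarrow> real) \<Rightarrow> nat \<Rightarrow> (nat \<Rightarrow> nat) \<Rightarrow> nat \<Rightarrow> tvec" where
  "psi q \<delta> 0 h p = 0"
| "psi q \<delta> (Suc 0) h p =
     vscale (complex_of_real (\<Prod>l=1..p. sqrt (sig q (\<delta> 1) l))) (ket [p])"
| "psi q \<delta> (Suc (Suc d)) h p =
     (raise q \<delta> (d + 2) ^^ p)
       (\<Sum>k=0..h (d + 1).
          vscale (complex_of_real (cg_coeff q \<delta> (d + 2) h k))
            (tens (psi q \<delta> (Suc d) h k) (ket [h (d + 1) - k])))"

definition Psi ::
  "real \<Rightarrow> (nat \<Rightarrow> real) \<Rightarrow> nat \<Rightarrow> nat \<Rightarrow> (nat \<Rightarrow> nat) \<Rightarrow> (nat \<Rightarrow> nat) \<Rightarrow> nat \<Rightarrow> nat \<Rightarrow> tvec" where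
  "Psi q \<gamma> i r h k s t =
     (let H = real (\<Sum>l=1..i - 1. h l);
          K = (\<Sum>l=1..r - 1. k l);
          G1 = (\<Sum>l=1..i. \<gamma> l);
          G2 = (\<Sum>l=i + 1..i + r. \<gamma> l);
          \<alpha> = (\<lambda>p. (- 1) ^ (K + s - p) * q powr ((G2 + real s - real p + real K) / 2)
                    * sig q (H + G1) p);
          \<beta> = (\<lambda>p. q powr (- ((G1 + real s - real p + H) / 2)) * sig q (real K + G2) p);
          \<epsilon> = (\<lambda>p. (- 1) ^ p * (\<Prod>u=s - p + 1..s. \<beta> u) / (\<Prod>u=1..p. \<alpha> u))
      in (raise q \<gamma> (i + r) ^^ t)
           (\<Sum>p=0..s. vscale (complex_of_real (\<epsilon> p))
              (tens (psi q \<gamma> i h p) (psi q (\<lambda>l. \<gamma> (i + l)) r k (s - p)))))"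

text \<open>The recursion is on the number of tensor factors; only values with at least
  \<open>i + r\<close> factors are meaningful.\<close>

primrec Theta ::
  "real \<Rightarrow> (nat \<Rightarrow> real) \<Rightarrow> nat \<Rightarrow> nat \<Rightarrow> nat \<Rightarrow> (nat \<Rightarrow> nat) \<Rightarrow> nat \<Rightarrow> tvec" where
  "Theta q \<gamma> i r 0 j N = 0"
| "Theta q \<gamma> i r (Suc n) j N =
     (if Suc n < i + r then 0
      else if Suc n = i + r then Psi q \<gamma> i r j (\<lambda>l. j (i - 1 + l)) (j (i + r - 1)) N
      else (raise q \<gamma> (Suc n) ^^ N)
             (\<Sum>k=0..j n.
                vscale (complex_of_real (cg_coeff q \<gamma> (Suc n) j k))
                  (tens (Theta q \<gamma> i r n j k) (ket [j n - k]))))"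

definition tuples :: "nat \<Rightarrow> (nat \<Rightarrow> nat) set" where
  "tuples n = ({1..n - 1} \<rightarrow>\<^sub>E UNIV)"

text \<open>The scalar \<open>\<eta> j N\<close> is determined up to a phase, which is not prescribed.\<close>

definition jket ::
  "real \<Rightarrow> (nat \<Rightarrow> real) \<Rightarrow> nat \<Rightarrow> ((nat \<Rightarrow> nat) \<Rightarrow> nat \<Rightarrow> complex) \<Rightarrow> nat \<Rightarrow> nat
    \<Rightarrow> (nat \<Rightarrow> nat) \<Rightarrow> nat \<Rightarrow> tvec" where
  "jket q \<gamma> n \<eta> i r j N = vscale (\<eta> j N) (Theta q \<gamma> i r n j N)"

definition normalization ::
  "real \<Rightarrow> (nat \<Rightarrow> real) \<Rightarrow> nat \<Rightarrow> ((nat \<Rightarrow> nat) \<Rightarrow> nat \<Rightarrow> complex) \<Rightarrow> nat \<Rightarrow> nat \<Rightarrow> bool" where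
  "normalization q \<gamma> n \<eta> i r \<longleftrightarrow> (\<forall>j\<in>tuples n. \<forall>N. vnorm (jket q \<gamma> n \<eta> i r j N) = 1)"

definition qpoch :: "real \<Rightarrow> real \<Rightarrow> nat \<Rightarrow> real" where
  "qpoch a Q m = (\<Prod>t<m. 1 - a * Q ^ t)"

definition qpochs :: "real list \<Rightarrow> real \<Rightarrow> nat \<Rightarrow> real" where
  "qpochs as Q m = (\<Prod>a\<leftarrow>as. qpoch a Q m)"

text \<open>The series terminates, since its terms vanish for \<open>t > m\<close>. The base \<open>Q\<close> may be negative, so
  the half-integer power is a principal complex power.\<close>

definition racah_uni ::
  "nat \<Rightarrow> int \<Rightarrow> real \<Rightarrow> real \<Rightarrow> real \<Rightarrow> int \<Rightarrow> real \<Rightarrow> complex" where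
  "racah_uni m x a b c N Q =
     complex_of_real (qpochs [a * Q, b * c * Q, Q powi (- N)] Q m)
     * complex_of_real (Q powi N / c) powr (of_nat m / 2)
     * complex_of_real (suminf (\<lambda>t.
         qpochs [Q powi (- int m), a * b * Q ^ (m + 1), Q powi (- x), c * Q powi (x - N)] Q t
         / qpochs [a * Q, b * c * Q, Q powi (- N), Q] Q t * Q ^ t))"

definition racah_multi ::
  "nat \<Rightarrow> (nat \<Rightarrow> nat) \<Rightarrow> (nat \<Rightarrow> int) \<Rightarrow> (nat \<Rightarrow> real) \<Rightarrow> real \<Rightarrow> int \<Rightarrow> real \<Rightarrow> complex" where
  "racah_multi s n x a b M Q =
     (let x' = x(s + 1 := M);
          Nn = (\<lambda>k. \<Sum>l=1..k. n l);
          A = (\<lambda>k. \<Prod>l=1..k. a l)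
      in \<Prod>k=1..s. racah_uni (n k) (x' k - int (Nn (k - 1)))
            (b * A k / a 1 * Q ^ (2 * Nn (k - 1)))
            (a (k + 1) / Q)
            (A k * Q powi (x' (k + 1) + int (Nn (k - 1))))
            (x' (k + 1) - int (Nn (k - 1)))
            Q)"

definition psum :: "(nat \<Rightarrow> nat) \<Rightarrow> nat \<Rightarrow> nat" where
  "psum j l = (\<Sum>t=1..l. j t)"

definition gsum :: "(nat \<Rightarrow> real) \<Rightarrow> nat \<Rightarrow> nat \<Rightarrow> real" where
  "gsum \<gamma> k l = (\<Sum>t=k..l. \<gamma> t)"

definition rho :: "real \<Rightarrow> (nat \<Rightarrow> real) \<Rightarrow> nat \<Rightarrow> nat \<Rightarrow> (nat \<Rightarrow> nat) \<Rightarrow> real" where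
  "rho q \<gamma> i r j =
     (let Q = - q; S = psum j; S0 = S (i - 1); M = S (i + r - 1) - S0;
          G = (\<lambda>k l. q powr (2 * gsum \<gamma> k l));
          Qm = Q powi (2 * int S0 - 1)
      in qpochs [Q, Q ^ (2 * S0) * G 1 (i + r - 1)] Q M
           / qpochs [q powr (2 * \<gamma> (i + r)), Qm * G 1 (i + r)] Q M
         * (qpochs [Qm * G 1 (i + 1), q powr (2 * \<gamma> (i + 1))] Q (j i)
           / qpochs [Q, Q ^ (2 * S0) * G 1 i] Q (j i))
         * (\<Prod>k=1..r - 1.
              qpoch (q powr (2 * \<gamma> (i + k + 1))) Q (j (i + k)) / qpoch Q Q (j (i + k))
              * (qpoch (Qm * G 1 (i + k + 1)) Q (S (i + k - 1) + S (i + k) - 2 * S0)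
                / qpoch (Q ^ (2 * S0) * G 1 (i + k)) Q (S (i + k - 1) + S (i + k) - 2 * S0))
              * ((1 - Q powi (2 * int (S (i + k - 1)) - 1) * G 1 (i + k))
                / (1 - Qm * G 1 (i + k)))
              * (q powr (2 * \<gamma> (i + k))) powi (- int (S (i + k - 1)) + int S0)))"

text \<open>The first tuple \<open>j\<close> enters only through its partial sums \<open>S (i - 1)\<close> and
  \<open>S (i + r - 1)\<close>; \<open>J\<close> denotes the partial sums of the second tuple \<open>j'\<close>.\<close>

definition hnorm :: "real \<Rightarrow> (nat \<Rightarrow> real) \<Rightarrow> nat \<Rightarrow> nat \<Rightarrow> (nat \<Rightarrow> nat) \<Rightarrow> (nat \<Rightarrow> nat) \<Rightarrow> real" where
  "hnorm q \<gamma> i r j j' =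
     (let Q = - q; S0 = psum j (i - 1); S1 = psum j (i + r - 1); M = S1 - S0;
          J = psum j'; J0 = J (i - 1);
          G = (\<lambda>k l. q powr (2 * gsum \<gamma> k l))
      in qpochs [Q ^ (2 * S0) * G 1 (i + r - 1), G (i + 1) (i + r)] Q M
           / qpochs [q powr (2 * \<gamma> (i + r)), Q ^ (2 * S0) * G 1 i] Q M
         * (q powr (- 2 * gsum \<gamma> (i + 1) (i + r - 1))) ^ M
         * qpochs [Q ^ M * G (i + 1) (i + r),
                   Q powi (int S1 + int S0 - 1) * G 1 (i + r),
                   Q powi (1 - int S1 - int S0) * q powr (- 2 * gsum \<gamma> 1 i),
                   Q powi (- int M)] Q (J (i + r - 2) - J0)
         * (\<Prod>k=1..r - 1.
              qpochs [Q, q powr (2 * \<gamma> (i + k + 1))] Q (j' (i + k - 1))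
              * (qpoch (G (i + 1) (i + k)) Q (J (i + k - 2) + J (i + k - 1) - 2 * J0)
                / qpoch (- (q powr (2 * gsum \<gamma> (i + 1) (i + k + 1) - 1))) Q
                    (J (i + k - 2) + J (i + k - 1) - 2 * J0))
              * ((1 + q powr (2 * gsum \<gamma> (i + 1) (i + k + 1) - 1))
                / (1 + q powr (2 * gsum \<gamma> (i + 1) (i + k + 1) - 1
                               - 2 * real S0 + 2 * real (J (i + k - 1)))))))"

definition kdelta :: "nat \<Rightarrow> nat \<Rightarrow> complex" where
  "kdelta a b = (if a = b then 1 else 0)"

end

theory Submission
  imports Defs
begin

text \<open>Coupling two lowest-weight vectors gives one lowest-weight vector for each level, and every vector
  \<open>|j>\<close> is built by such couplings along a binary tree: a left comb for \<open>(1,1)\<close>, and for \<open>(i,r)\<close> a left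
  comb in which the factors \<open>i+1, ..., i+r\<close> are first coupled among themselves. Passing from one
  tree to the other is a sequence of three-factor recouplings. Since lowest-weight vectors are
  orthogonal to the image of the raising operator, one recoupling coefficient is a single
  terminating sum, which Sears' transformation turns into a univariate \<open>(-q)\<close>-Racah polynomial.
  Its squared normalization telescopes over the \<open>r - 1\<close> recouplings to \<open>\<rho> / \<bar>h\<bar>\<close>. The remaining signs and the
  powers of \<open>\<i>\<close> that come from the half-integer powers of negative numbers in \<open>r\<^sub>n\<close> separate into a function
  of the first tuple times a function of the second, and are absorbed in \<open>\<eta>\<close>.\<close>

section \<open>Raising and lowering operators on real coefficient functions\<close>

text \<open>The base -q is forced by \<open>sig_eq\<close>: the alternating sign in sigma makes it
  factor into 1 - Q^m and 1 - Q^(m-1) q^(2 mu) with Q = -q. The recouplings use no completeness of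
  the coupled vectors. What replaces it is multiplicity one: the lowest-weight equation leaves a
  single free constant at each level (\<open>comb_unique\<close>), so in every pairing with products
  of two chains a lowest-weight vector acts as a multiple of the coupled vector
  (\<open>ip_chain_tensor_prop\<close>). That an overlap or a squared norm does not become a
  multiple sum is due to a second expansion of a coupled vector,
  \<open>raise_coeff_expansion\<close>, in which all terms but one start with the raising operator.
  The computations are carried out with real functions on lists of indices, where the raising
  operator is a recursion over the tensor factors; non-real numbers enter only at the end, through
  the square root of a possibly negative quotient rho / h and through half-integer powers. When i =
  r = 1 both bases carry the same constants, so the two phases must agree in that case.\<close>

type_synonym vec = "nat list \<Rightarrow> real"

text \<open>Stated as an implication, so the zero function has every level. This is what allows a
  slice at a first index above the total level to be given the truncated level \<open>N - k\<close>
  in \<open>homog_Cons\<close>.\<close>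

definition homog :: "nat \<Rightarrow> nat \<Rightarrow> vec \<Rightarrow> bool" where
  "homog d N f \<longleftrightarrow> (\<forall>ks. f ks \<noteq> 0 \<longrightarrow> length ks = d \<and> sum_list ks = N)"

text \<open>The eigenvalue of \<open>K P\<close> on basis vectors of level \<open>b\<close> and total weight \<open>G\<close>.\<close>

definition kp :: "real \<Rightarrow> real \<Rightarrow> nat \<Rightarrow> real" where
  "kp q G b = (- 1) ^ b * q powr ((real b + G) / 2)"

text \<open>Coefficient form of the coproduct A_+ \<otimes> KP + K^(-1) \<otimes> A_+, peeled off at
  the first factor: the value at \<open>k # z\<close> collects what A_+ sends there. At
  \<open>k = 0\<close> the truncated index \<open>k - 1\<close> is harmless because
  \<open>sig q g 0 = 0\<close>. The value 0 without factors is the counit of A_+, which keeps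
  \<open>op_tns\<close> valid for an empty list.\<close>

fun Rop :: "real \<Rightarrow> real list \<Rightarrow> vec \<Rightarrow> vec" where
  "Rop q [] f ks = 0"
| "Rop q (g # gs) f [] = 0"
| "Rop q (g # gs) f (k # z) =
     sqrt (sig q g k) * kp q (sum_list gs) (sum_list z) * f ((k - 1) # z)
     + q powr (- ((real k + g) / 2)) * Rop q gs (\<lambda>z. f (k # z)) z"

text \<open>The same recursion for A_-. The first index now comes down from \<open>Suc k\<close>,
  which makes this the adjoint of \<open>Rop\<close>, see \<open>ip_adjoint\<close>.\<close>

fun Lop :: "real \<Rightarrow> real list \<Rightarrow> vec \<Rightarrow> vec" where
  "Lop q [] f ks = 0"
| "Lop q (g # gs) f [] = 0"
| "Lop q (g # gs) f (k # z) =
     sqrt (sig q g (Suc k)) * kp q (sum_list gs) (sum_list z) * f (Suc k # z)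
     + q powr (- ((real k + g) / 2)) * Lop q gs (\<lambda>z. f (k # z)) z"

definition tns :: "nat \<Rightarrow> vec \<Rightarrow> vec \<Rightarrow> vec" where
  "tns d v w = (\<lambda>ks. v (take d ks) * w (drop d ks))"

lemma sig_0 [simp]: "sig q g 0 = 0"
  by (simp add: sig_def)

lemma Rop_add: "Rop q gs (\<lambda>ks. f ks + g ks) ks = Rop q gs f ks + Rop q gs g ks"
proof (induction gs arbitrary: f g ks)
  case (Cons a gs) then show ?case by (cases ks) (auto simp: algebra_simps)
qed simp

lemma Rop_cmult: "Rop q gs (\<lambda>ks. c * f ks) ks = c * Rop q gs f ks"
proof (induction gs arbitrary: f ks)
  case (Cons a gs) then show ?case by (cases ks) (auto simp: algebra_simps)
qed simp

lemma Rop_zero [simp]: "Rop q gs (\<lambda>ks. 0) ks = 0"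
  using Rop_cmult[of q gs 0 "\<lambda>_. 0"] by simp

lemma Rop_sum: "Rop q gs (\<lambda>ks. \<Sum>i\<in>A. f i ks) ks = (\<Sum>i\<in>A. Rop q gs (f i) ks)"
  by (induction A rule: infinite_finite_induct) (simp_all add: Rop_add)

lemma Lop_add: "Lop q gs (\<lambda>ks. f ks + g ks) ks = Lop q gs f ks + Lop q gs g ks"
proof (induction gs arbitrary: f g ks)
  case (Cons a gs) then show ?case by (cases ks) (auto simp: algebra_simps)
qed simp

lemma Lop_cmult: "Lop q gs (\<lambda>ks. c * f ks) ks = c * Lop q gs f ks"
proof (induction gs arbitrary: f ks)
  case (Cons a gs) then show ?case by (cases ks) (auto simp: algebra_simps)
qed simp

lemma Lop_zero [simp]: "Lop q gs (\<lambda>ks. 0) ks = 0"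
  using Lop_cmult[of q gs 0 "\<lambda>_. 0"] by simp

lemma Lop_sum: "Lop q gs (\<lambda>ks. \<Sum>i\<in>A. f i ks) ks = (\<Sum>i\<in>A. Lop q gs (f i) ks)"
  by (induction A rule: infinite_finite_induct) (simp_all add: Lop_add)

lemma homog_Cons: "homog (Suc d) N f \<Longrightarrow> homog d (N - k) (\<lambda>z. f (k # z))"
  by (fastforce simp: homog_def)

lemma homog_Cons_gt: "homog d N f \<Longrightarrow> N < k \<Longrightarrow> f (k # z) = 0"
  by (fastforce simp: homog_def)

lemma homog_cmult: "homog d N f \<Longrightarrow> homog d N (\<lambda>ks. c * f ks)"
  by (auto simp: homog_def)

lemma homog_sum: "(\<And>i. i \<in> A \<Longrightarrow> homog d N (f i)) \<Longrightarrow> homog d N (\<lambda>ks. \<Sum>i\<in>A. f i ks)"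
proof -
  assume h: "\<And>i. i \<in> A \<Longrightarrow> homog d N (f i)"
  show ?thesis unfolding homog_def
  proof (intro allI impI)
    fix ks assume "(\<Sum>i\<in>A. f i ks) \<noteq> 0"
    then obtain i where "i \<in> A" "f i ks \<noteq> 0" by (rule sum.not_neutral_contains_not_neutral)
    then show "length ks = d \<and> sum_list ks = N" using h unfolding homog_def by blast
  qed
qed

lemma homog_tns: "homog d a v \<Longrightarrow> homog d' b w \<Longrightarrow> homog (d + d') (a + b) (tns d v w)"
  unfolding homog_def tns_def
proof (intro allI impI)
  fix ks assume *: "\<forall>ks. v ks \<noteq> 0 \<longrightarrow> length ks = d \<and> sum_list ks = a"
    "\<forall>ks. w ks \<noteq> 0 \<longrightarrow> length ks = d' \<and> sum_list ks = b"
    and "v (take d ks) * w (drop d ks) \<noteq> 0"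
  then have "length (take d ks) = d" "sum_list (take d ks) = a"
      "length (drop d ks) = d'" "sum_list (drop d ks) = b"
    by auto
  moreover have "ks = take d ks @ drop d ks" by simp
  ultimately show "length ks = d + d' \<and> sum_list ks = a + b"
    by (metis length_append sum_list.append)
qed

lemma homog_Rop: "homog (length gs) N f \<Longrightarrow> homog (length gs) (Suc N) (Rop q gs f)"
proof (induction gs arbitrary: N f)
  case (Cons g gs)
  show ?case unfolding homog_def
  proof (intro allI impI)
    fix ks assume nz: "Rop q (g # gs) f ks \<noteq> 0"
    then obtain k z where ks: "ks = k # z" by (cases ks) auto
    consider "k \<noteq> 0" "f ((k - 1) # z) \<noteq> 0" | "Rop q gs (\<lambda>z. f (k # z)) z \<noteq> 0"
      using nz unfolding ks by (cases "k = 0"; cases "f ((k - 1) # z) = 0") simp_all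
    then show "length ks = length (g # gs) \<and> sum_list ks = Suc N"
    proof cases
      case 1 then show ?thesis using Cons.prems unfolding homog_def ks by fastforce
    next
      case 2
      have "homog (length gs) (Suc (N - k)) (Rop q gs (\<lambda>z. f (k # z)))"
        by (intro Cons.IH homog_Cons) (use Cons.prems in simp)
      moreover have "k \<le> N"
        using 2 homog_Cons_gt[OF Cons.prems] by (cases "k \<le> N") (auto simp: fun_eq_iff)
      ultimately show ?thesis using 2 unfolding homog_def ks by fastforce
    qed
  qed
qed (simp add: homog_def)

text \<open>Proved in the untruncated form \<open>Suc (sum_list ks) = N\<close>, which gives both
  claims: the level drops by one, and at level 0, where \<open>N - 1\<close> would conceal it,
  nothing is left.\<close>

lemma homog_Lop:
  assumes "homog (length gs) N f" shows "homog (length gs) (N - 1) (Lop q gs f)"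
    and "N = 0 \<Longrightarrow> Lop q gs f ks = 0"
proof -
  have "Lop q gs f ks \<noteq> 0 \<Longrightarrow> length ks = length gs \<and> Suc (sum_list ks) = N" for ks
    using assms
  proof (induction gs arbitrary: N f ks)
    case (Cons g gs)
    then obtain k z where ks: "ks = k # z" by (cases ks) auto
    consider "f (Suc k # z) \<noteq> 0" | "Lop q gs (\<lambda>z. f (k # z)) z \<noteq> 0"
      using Cons.prems(1) unfolding ks by (cases "f (Suc k # z) = 0") simp_all
    then show ?case
    proof cases
      case 1 then show ?thesis using Cons.prems unfolding homog_def ks by fastforce
    next
      case 2
      have "length z = length gs \<and> Suc (sum_list z) = N - k"
        by (rule Cons.IH[OF 2]) (rule homog_Cons, use Cons.prems in simp)
      moreover have "k \<le> N"
        using 2 homog_Cons_gt[OF Cons.prems(2)] by (cases "k \<le> N") (auto simp: fun_eq_iff)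
      ultimately show ?thesis unfolding ks by auto
    qed
  qed simp
  then show "homog (length gs) (N - 1) (Lop q gs f)" "N = 0 \<Longrightarrow> Lop q gs f ks = 0"
    unfolding homog_def by fastforce+
qed

text \<open>K P is grouplike, so its eigenvalues multiply over tensor factors.\<close>

lemma kp_add: "0 < q \<Longrightarrow> kp q (G1 + G2) (a + b) = kp q G1 a * kp q G2 b"
  unfolding kp_def of_nat_add power_add
  by (simp add: powr_add[symmetric] add_divide_distrib[symmetric] algebra_simps)

text \<open>Coassociativity: cutting the list of factors at any place gives the same operator as
  peeling off the first one. On homogeneous \<open>v\<close> and \<open>w\<close> the operators
  K^(-1) and K P of the coproduct are scalars, so they appear as numbers.\<close>

lemma op_tns:
  assumes q: "0 < q" and v: "homog (length gs1) a v" and w: "homog d b w"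
  shows "Rop q (gs1 @ gs2) (tns (length gs1) v w) ks =
      kp q (sum_list gs2) b * tns (length gs1) (Rop q gs1 v) w ks
      + q powr (- ((real a + sum_list gs1) / 2)) * tns (length gs1) v (Rop q gs2 w) ks" (is ?R)
    and "Lop q (gs1 @ gs2) (tns (length gs1) v w) ks =
      kp q (sum_list gs2) b * tns (length gs1) (Lop q gs1 v) w ks
      + q powr (- ((real a + sum_list gs1) / 2)) * tns (length gs1) v (Lop q gs2 w) ks" (is ?L)
proof -
  have "?R \<and> ?L" using v
  proof (induction gs1 arbitrary: a v ks)
    case Nil
    then have "v [] \<noteq> 0 \<longrightarrow> a = 0" by (auto simp: homog_def)
    then show ?case using q by (auto simp: tns_def Rop_cmult Lop_cmult powr_def)
  next
    case (Cons g gs1)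
    show ?case
    proof (cases ks)
      case Nil
      have "v [] = 0" using Cons.prems by (auto simp: homog_def)
      then show ?thesis by (simp add: Nil tns_def)
    next
      case (Cons k z)
      define D where "D = length gs1"
      have hv: "homog (length gs1) (a - k) (\<lambda>z. v (k # z))"
        by (rule homog_Cons) (use Cons.prems in simp)
      have chain_tensor: "(\<lambda>z. tns (Suc D) v w (k # z)) = tns D (\<lambda>z. v (k # z)) w" for k
        by (simp add: tns_def)
      have IH: "Rop q (gs1 @ gs2) (tns D (\<lambda>z. v (k # z)) w) z =
            kp q (sum_list gs2) b * tns D (Rop q gs1 (\<lambda>z. v (k # z))) w z
            + q powr (- ((real (a - k) + sum_list gs1) / 2)) * tns D (\<lambda>z. v (k # z)) (Rop q gs2 w) z"
          "Lop q (gs1 @ gs2) (tns D (\<lambda>z. v (k # z)) w) z =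
            kp q (sum_list gs2) b * tns D (Lop q gs1 (\<lambda>z. v (k # z))) w z
            + q powr (- ((real (a - k) + sum_list gs1) / 2)) * tns D (\<lambda>z. v (k # z)) (Lop q gs2 w) z"
        using Cons.IH[OF hv] by (auto simp: D_def)
      \<comment> \<open>The eigenvalues of K^(-1) on the first factor and on the rest of
        \<open>gs1\<close> multiply to the one on \<open>v\<close>. For \<open>k > a\<close>, where
        \<open>a - k\<close> is truncated, the slice of \<open>v\<close> vanishes.\<close>
      have e: "q powr (- ((real k + g) / 2)) * (q powr (- ((real (a - k) + sum_list gs1) / 2))
            * tns D (\<lambda>z. v (k # z)) X z) =
          q powr (- ((real a + (g + sum_list gs1)) / 2)) * tns D (\<lambda>z. v (k # z)) X z" for X
      proof (cases "k \<le> a")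
        case True
        have "- ((real k + g) / 2) + - ((real (a - k) + sum_list gs1) / 2) =
            - ((real a + (g + sum_list gs1)) / 2)"
          using True by (simp add: of_nat_diff field_simps)
        then show ?thesis by (metis mult.assoc powr_add)
      next
        case False
        then show ?thesis using homog_Cons_gt[OF Cons.prems] by (simp add: tns_def)
      qed
      have k1: "kp q (sum_list gs1 + sum_list gs2) (sum_list z) * w (drop D z) =
           kp q (sum_list gs1) (sum_list (take D z)) * kp q (sum_list gs2) b * w (drop D z)"
      proof (cases "w (drop D z) = 0")
        case False
        then have "sum_list (drop D z) = b" using w by (auto simp: homog_def)
        moreover have "sum_list z = sum_list (take D z) + sum_list (drop D z)"
          by (metis append_take_drop_id sum_list.append)
        ultimately show ?thesis using kp_add[OF q] by auto
      qed simp
      have R: "Rop q ((g # gs1) @ gs2) (tns (Suc D) v w) (k # z) =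
          sqrt (sig q g k) * (kp q (sum_list gs1 + sum_list gs2) (sum_list z) * w (drop D z)) * v ((k - 1) # take D z)
          + q powr (- ((real k + g) / 2)) * Rop q (gs1 @ gs2) (tns D (\<lambda>z. v (k # z)) w) z"
        by (simp only: append_Cons Rop.simps chain_tensor) (simp add: tns_def)
      have L: "Lop q ((g # gs1) @ gs2) (tns (Suc D) v w) (k # z) =
          sqrt (sig q g (Suc k)) * (kp q (sum_list gs1 + sum_list gs2) (sum_list z) * w (drop D z)) * v (Suc k # take D z)
          + q powr (- ((real k + g) / 2)) * Lop q (gs1 @ gs2) (tns D (\<lambda>z. v (k # z)) w) z"
        by (simp only: append_Cons Lop.simps chain_tensor) (simp add: tns_def)
      have "tns (Suc D) v X (k # z) = tns D (\<lambda>z. v (k # z)) X z" for X by (simp add: tns_def)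
      then have e': "q powr (- ((real k + g) / 2)) * (q powr (- ((real (a - k) + sum_list gs1) / 2))
            * tns D (\<lambda>z. v (k # z)) X z) =
          q powr (- ((real a + (g + sum_list gs1)) / 2)) * tns (Suc D) v X (k # z)" for X
        using e by simp
      have "Rop q ((g # gs1) @ gs2) (tns (Suc D) v w) (k # z) =
         kp q (sum_list gs2) b * tns (Suc D) (Rop q (g # gs1) v) w (k # z)
          + q powr (- ((real a + sum_list (g # gs1)) / 2)) * tns (Suc D) v (Rop q gs2 w) (k # z)"
        unfolding R IH distrib_left e' k1 by (simp add: tns_def algebra_simps)
      moreover have "Lop q ((g # gs1) @ gs2) (tns (Suc D) v w) (k # z) =
         kp q (sum_list gs2) b * tns (Suc D) (Lop q (g # gs1) v) w (k # z)
          + q powr (- ((real a + sum_list (g # gs1)) / 2)) * tns (Suc D) v (Lop q gs2 w) (k # z)"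
        unfolding L IH distrib_left e' k1 by (simp add: tns_def algebra_simps)
      ultimately show ?thesis by (simp add: D_def Cons)
    qed
  qed
  then show ?R ?L by auto
qed

section \<open>The inner product on a level and the adjointness of raising and lowering\<close>

definition comps :: "nat \<Rightarrow> nat \<Rightarrow> nat list set" where
  "comps d N = {ks. length ks = d \<and> sum_list ks = N}"

definition ip :: "nat \<Rightarrow> nat \<Rightarrow> vec \<Rightarrow> vec \<Rightarrow> real" where
  "ip d N f g = (\<Sum>ks\<in>comps d N. f ks * g ks)"

lemma comps_0: "comps 0 N = (if N = 0 then {[]} else {})"
  by (auto simp: comps_def)

lemma comps_Suc: "comps (Suc d) N = (\<Union>k\<in>{..N}. (#) k ` comps d (N - k))"
  by (auto simp: comps_def length_Suc_conv image_iff)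

lemma finite_comps [simp]: "finite (comps d N)"
  by (induction d arbitrary: N) (auto simp: comps_0 comps_Suc)

lemma sum_comps_Suc: "(\<Sum>ks\<in>comps (Suc d) N. F ks) = (\<Sum>k\<le>N. \<Sum>z\<in>comps d (N - k). F (k # z))"
proof -
  have "(\<Sum>ks\<in>comps (Suc d) N. F ks) = (\<Sum>k\<le>N. sum F ((#) k ` comps d (N - k)))"
    unfolding comps_Suc by (rule sum.UNION_disjoint) auto
  also have "\<dots> = (\<Sum>k\<le>N. \<Sum>z\<in>comps d (N - k). F (k # z))"
    by (rule sum.cong) (simp_all add: sum.reindex)
  finally show ?thesis .
qed

lemma Rop_level_0: "sum_list ks = 0 \<Longrightarrow> Rop q gs f ks = 0"
proof (induction gs arbitrary: ks f)
  case (Cons g gs) then show ?case by (cases ks) auto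
qed simp

text \<open>Both operators have the same real matrix entries: shifting the first index by one leaves
  the tail \<open>z\<close>, hence the factor of K P, unchanged, and K^(-1) is diagonal. The
  remaining factors follow by induction.\<close>

lemma ip_adjoint: "ip (length gs) (Suc N) (Rop q gs f) g = ip (length gs) N f (Lop q gs g)"
proof (induction gs arbitrary: N f g)
  case Nil then show ?case by (simp add: ip_def comps_0)
next
  case (Cons a gs)
  define K where "K = kp q (sum_list gs)"
  define d where "d = length gs"
  define E where "E = (\<lambda>k. q powr (- ((real k + a) / 2)))"
  have IH: "(\<Sum>z\<in>comps d (Suc N). Rop q gs f z * g z) = (\<Sum>z\<in>comps d N. f z * Lop q gs g z)"
    for N f g using Cons.IH[of N f g] by (simp add: ip_def d_def)
  \<comment> \<open>Disposes of the summand \<open>k = Suc N\<close>, whose tail has level 0 and is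
    not reached by raising.\<close>
  have z0: "(\<Sum>z\<in>comps d 0. Rop q gs f z * g z) = 0" for f g
    by (rule sum.neutral) (simp add: comps_def Rop_level_0)
  have "ip (length (a # gs)) (Suc N) (Rop q (a # gs) f) g =
     (\<Sum>k\<le>Suc N. \<Sum>z\<in>comps d (Suc N - k). sqrt (sig q a k) * K (sum_list z) * f ((k - 1) # z) * g (k # z))
     + (\<Sum>k\<le>Suc N. E k * (\<Sum>z\<in>comps d (Suc N - k). Rop q gs (\<lambda>z. f (k # z)) z * g (k # z)))"
    by (simp only: ip_def list.size sum_comps_Suc add_0_right add_Suc_right d_def Rop.simps K_def E_def
        sum.distrib[symmetric] sum_distrib_left) (simp add: algebra_simps)
  also have "(\<Sum>k\<le>Suc N. \<Sum>z\<in>comps d (Suc N - k). sqrt (sig q a k) * K (sum_list z) * f ((k - 1) # z) * g (k # z)) =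
      (\<Sum>k\<le>N. \<Sum>z\<in>comps d (N - k). sqrt (sig q a (Suc k)) * K (sum_list z) * f (k # z) * g (Suc k # z))"
    by (subst sum.atMost_Suc_shift) simp
  also have "(\<Sum>k\<le>Suc N. E k * (\<Sum>z\<in>comps d (Suc N - k). Rop q gs (\<lambda>z. f (k # z)) z * g (k # z))) =
      (\<Sum>k\<le>N. E k * (\<Sum>z\<in>comps d (N - k). f (k # z) * Lop q gs (\<lambda>z. g (k # z)) z))"
    by (auto simp: z0 Suc_diff_le IH intro!: sum.cong)
  also have "(\<Sum>k\<le>N. \<Sum>z\<in>comps d (N - k). sqrt (sig q a (Suc k)) * K (sum_list z) * f (k # z) * g (Suc k # z))
      + \<dots> = ip (length (a # gs)) N f (Lop q (a # gs) g)"
    by (simp only: ip_def list.size sum_comps_Suc add_0_right add_Suc_right d_def Lop.simps K_def E_def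
        sum.distrib[symmetric] sum_distrib_left) (simp add: algebra_simps)
  finally show ?case .
qed

text \<open>Homogeneity of the left arguments alone forces the two pieces of a contributing list to
  have levels \<open>a\<close> and \<open>b\<close>, so only concatenations of such pieces
  matter.\<close>

lemma ip_tns:
  assumes "homog d a v" "homog d' b w"
  shows "ip (d + d') (a + b) (tns d v w) (tns d v' w') = ip d a v v' * ip d' b w w'"
proof -
  let ?F = "\<lambda>ks. tns d v w ks * tns d v' w' ks"
  have inj: "inj_on (\<lambda>(x, y). x @ y) (comps d a \<times> comps d' b)"
    by (auto simp: inj_on_def comps_def)
  have "ip d a v v' * ip d' b w w' = (\<Sum>(x, y)\<in>comps d a \<times> comps d' b. ?F (x @ y))"
    unfolding ip_def sum_product sum.cartesian_product
    by (rule sum.cong) (simp_all add: comps_def tns_def case_prod_unfold mem_Times_iff)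
  also have "\<dots> = sum ?F ((\<lambda>(x, y). x @ y) ` (comps d a \<times> comps d' b))"
    unfolding sum.reindex[OF inj] by (simp add: o_def case_prod_unfold)
  also have "\<dots> = ip (d + d') (a + b) (tns d v w) (tns d v' w')"
    unfolding ip_def
  proof (rule sum.mono_neutral_left)
    show "\<forall>ks\<in>comps (d + d') (a + b) - (\<lambda>(x, y). x @ y) ` (comps d a \<times> comps d' b). ?F ks = 0"
    proof
      fix ks assume ks: "ks \<in> comps (d + d') (a + b) - (\<lambda>(x, y). x @ y) ` (comps d a \<times> comps d' b)"
      show "?F ks = 0"
      proof (rule ccontr)
        assume "?F ks \<noteq> 0"
        then have "v (take d ks) \<noteq> 0" "w (drop d ks) \<noteq> 0" by (auto simp: tns_def)
        then have "take d ks \<in> comps d a" "drop d ks \<in> comps d' b"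
          using assms by (auto simp: homog_def comps_def)
        then have "(take d ks, drop d ks) \<in> comps d a \<times> comps d' b" by (rule SigmaI)
        then have "(\<lambda>(x, y). x @ y) (take d ks, drop d ks) \<in> (\<lambda>(x, y). x @ y) ` (comps d a \<times> comps d' b)"
          by (rule imageI)
        then show False using ks by simp
      qed
    qed
  next
    show "(\<lambda>(x, y). x @ y) ` (comps d a \<times> comps d' b) \<subseteq> comps (d + d') (a + b)"
      by (rule image_subsetI) (simp add: comps_def case_prod_unfold mem_Times_iff)
  qed simp
  finally show ?thesis by simp
qed

lemma ip_homog_ne:
  assumes "homog d a v" "a \<noteq> N" shows "ip d N v w = 0" "ip d N w v = 0"
proof -
  have "v ks = 0" if "ks \<in> comps d N" for ks
    using assms that by (fastforce simp: comps_def homog_def)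
  then show "ip d N v w = 0" "ip d N w v = 0" unfolding ip_def by simp_all
qed

lemma ip_commute: "ip d N f g = ip d N g f"
  by (simp add: ip_def mult.commute)

lemma ip_sum_left: "ip d N (\<lambda>ks. \<Sum>i\<in>A. c i * f i ks) g = (\<Sum>i\<in>A. c i * ip d N (f i) g)"
  unfolding ip_def sum_distrib_right sum_distrib_left by (subst sum.swap) (simp add: mult.assoc)

lemma ip_sum_right: "ip d N g (\<lambda>ks. \<Sum>i\<in>A. c i * f i ks) = (\<Sum>i\<in>A. c i * ip d N g (f i))"
  using ip_sum_left[of d N c f A g] by (simp add: ip_commute)

lemma ip_cmult_left: "ip d N (\<lambda>ks. c * f ks) g = c * ip d N f g"
  by (simp add: ip_def sum_distrib_left mult.assoc)

lemma ip_cmult_right: "ip d N g (\<lambda>ks. c * f ks) = c * ip d N g f"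
  using ip_cmult_left[of d N c f g] by (simp add: ip_commute)

lemma ip_add_left: "ip d N (\<lambda>ks. f ks + f' ks) g = ip d N f g + ip d N f' g"
  by (simp add: ip_def distrib_right sum.distrib)

lemma ip_add_right: "ip d N g (\<lambda>ks. f ks + f' ks) = ip d N g f + ip d N g f'"
  by (simp add: ip_def distrib_left sum.distrib)

lemma ip_zero [simp]: "ip d N (\<lambda>_. 0) g = 0" "ip d N g (\<lambda>_. 0) = 0"
  by (simp_all add: ip_def)

lemma ip_nonneg: "0 \<le> ip d N f f"
  by (simp add: ip_def sum_nonneg)

section \<open>Scalar identities for sigma and the anticommutation relation\<close>

definition tau :: "real \<Rightarrow> real \<Rightarrow> real" where
  "tau q T = (q powr T - q powr (- T)) / (q powr (1 / 2) - q powr (- (1 / 2)))"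

text \<open>\<open>tau q T\<close> is the eigenvalue of A_+ A_- + A_- A_+ where K^2 acts as q^T. The
  alternating terms of two consecutive sigma cancel, which gives the defining relation on a single
  factor.\<close>

lemma sig_add:
  assumes q: "0 < q" "q < 1"
  shows "sig q g (Suc m) + sig q g m = tau q (real m + g)"
proof -
  define h where "h = q powr (1 / 2)"
  define y where "y = q powr (real m + g)"
  have h: "0 < h" "h \<noteq> 1" "h * h = q" using q by (auto simp: h_def powr_add[symmetric] powr_eq_one_iff_gen)
  have y: "y > 0" using q by (simp add: y_def)
  have hm: "q powr (- (1/2)) = inverse h" by (simp add: h_def powr_minus)
  have a: "q powr (real m + g + 1/2) = y * h" "q powr (real m + g - 1/2) = y / h"
      "q powr (-(real m + g + 1/2)) = inverse (y * h)" "q powr (- (real m + g - 1/2)) = h / y"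
  proof -
    show 1: "q powr (real m + g + 1/2) = y * h" and 2: "q powr (real m + g - 1/2) = y / h"
      by (simp_all only: y_def h_def powr_add powr_diff)
    show "q powr (-(real m + g + 1/2)) = inverse (y * h)" by (simp only: powr_minus 1)
    have "q powr (- (real m + g - 1/2)) = inverse (y / h)" by (simp only: powr_minus 2)
    then show "q powr (- (real m + g - 1/2)) = h / y" by simp
  qed
  have s: "sig q g (Suc m) + sig q g m = qbr q (real m + g + 1/2) + qbr q (real m + g - 1/2)"
    by (simp add: sig_def algebra_simps)
  have e: "1 - h*h \<noteq> 0" "1 - h * (h * (h * h)) \<noteq> 0" "h\<^sup>2 \<noteq> 1"
  proof -
    have "h * h < 1" using h q by auto
    then show "1 - h*h \<noteq> 0" "h\<^sup>2 \<noteq> 1" by (auto simp: power2_eq_square)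
    have "(h * h) * (h * h) < 1 * 1" using \<open>h * h < 1\<close> h by (intro mult_strict_mono) auto
    then show "1 - h * (h * (h * h)) \<noteq> 0" by (simp add: mult.assoc)
  qed
  have ym: "q powr (- (real m + g)) = inverse y" by (simp only: y_def powr_minus)
  have "h - inverse h \<noteq> 0" using h e by (auto simp: field_simps power2_eq_square)
  have "h * h - inverse (h * h) = (h - inverse h) * (h + inverse h)"
    using h(1) by (simp add: field_simps)
  moreover have "h + inverse h \<noteq> 0" using h by (simp add: add_pos_pos less_imp_neq[symmetric])
  moreover have "y * h - inverse (y * h) + (y / h - h / y) = (y - inverse y) * (h + inverse h)"
    using h y by (simp add: field_simps)
  ultimately have "qbr q (real m + g + 1/2) + qbr q (real m + g - 1/2) = (y - inverse y) / (h - inverse h)"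
    using h(3) unfolding qbr_def a by (simp add: add_divide_distrib[symmetric])
  then show ?thesis unfolding s tau_def ym hm by (simp add: y_def h_def)
qed

text \<open>The coproduct of K^2 - K^(-2): with K^2 acting as q^a and q^b on two factors, the
  diagonal terms of the anticommutator recombine to the value on the product.\<close>

lemma tau_split:
  assumes q: "0 < q"
  shows "tau q a * q powr b + q powr (- a) * tau q b = tau q (a + b)"
proof -
  define D where "D = q powr (1 / 2) - q powr (- (1 / 2))"
  have "(q powr a - q powr (- a)) * q powr b + q powr (- a) * (q powr b - q powr (- b)) =
      q powr (a + b) - q powr (- a + - b)"
    by (simp only: powr_add) (simp add: algebra_simps)
  then show ?thesis
    unfolding tau_def D_def[symmetric] by (simp add: add_divide_distrib[symmetric])
qed

text \<open>With y = q^(mu - 1/2) and e = (-1)^m, the expression q^m y - 1/(q^m y) - e (y - 1/y)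
  factors because e^2 = 1. The factors are of the shape 1 - u Q^k, which is what later turns
  products of sigma into shifted factorials in base Q = -q.\<close>

lemma sig_eq:
  assumes q: "0 < q" "q < 1"
  shows "sig q \<mu> m = q powr (1/2 - \<mu> - real m) * (1 - (- q) ^ m) * (1 - (- q) ^ m / (- q) * q powr (2 * \<mu>)) / (1 / q - q)"
proof -
  define y where "y = q powr (\<mu> - 1/2)"
  have y: "y > 0" using q by (simp add: y_def)
  have qm: "q powr (real m) = q ^ m" by (simp add: powr_realpow q)
  have p: "q powr (real m + \<mu> - 1/2) = q ^ m * y" "q powr (- (real m + \<mu> - 1/2)) = inverse (q ^ m * y)"
      "q powr (\<mu> - 1/2) = y" "q powr (- (\<mu> - 1/2)) = inverse y"
      "q powr (1/2 - \<mu> - real m) = inverse (q ^ m * y)" "q powr (2 * \<mu>) = y * y * q"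
  proof -
    show "q powr (real m + \<mu> - 1/2) = q ^ m * y" using powr_add[of q "real m" "\<mu> - 1/2"] qm by (simp add: y_def add_diff_eq)
    then show "q powr (- (real m + \<mu> - 1/2)) = inverse (q ^ m * y)" by (simp only: powr_minus)
    moreover have "1/2 - \<mu> - real m = - (real m + \<mu> - 1/2)" by simp
    ultimately show "q powr (1/2 - \<mu> - real m) = inverse (q ^ m * y)" by metis
    show "q powr (- (\<mu> - 1/2)) = inverse y" by (simp only: y_def powr_minus)
    have "2 * \<mu> = (\<mu> - 1/2) + (\<mu> - 1/2) + 1" by simp
    then have "q powr (2 * \<mu>) = y * y * q powr 1" unfolding y_def by (metis powr_add)
    then show "q powr (2 * \<mu>) = y * y * q" using q by simp
  qed (simp add: y_def)
  define e :: real where "e = (-1) ^ m"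
  have e: "e * e = 1" by (simp add: e_def flip: power_mult_distrib)
  have Q: "(- q) ^ m = e * q ^ m" by (simp add: e_def power_minus[of q])
  have k: "1 / q - q > 0" using q by (simp add: field_simps) (metis less_eq_real_def mult_less_cancel_right2 mult_less_cancel_left2 mult_strict_mono not_less order_less_trans zero_less_one)
  have k2: "q - inverse q = - (1/q - q)" by (simp add: field_simps)
  have "q ^ m > 0" using q by simp
  define i where "i = inverse (q ^ m * y)"
  have i1: "i * (q ^ m * y) = 1" and i2: "i * q ^ m = inverse y"
    using y q by (simp_all add: i_def field_simps)
  have "- (i * (1 - e * q ^ m) * (1 + e * q ^ m * (y * y))) =
      - i - e * y * (i * (q ^ m * y)) + e * (i * q ^ m) + e * e * (i * (q ^ m * y)) * (q ^ m * y)"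
    by (simp add: algebra_simps)
  then have main: "q ^ m * y - i - e * (y - inverse y) = - (i * (1 - e * q ^ m) * (1 + e * q ^ m * (y * y)))"
    unfolding i1 i2 e by (simp add: algebra_simps)
  have last: "1 - e * q ^ m / (- q) * (y * y * q) = 1 + e * q ^ m * (y * y)" using q by simp
  have gen: "(a - b) / - k - c * ((y' - i') / - k) = - (a - b - c * (y' - i')) / k" for a b c y' i' k :: real
    by (cases "k = 0") (simp_all add: field_simps)
  have "(q ^ m * y - i) / - (1 / q - q) - e * ((y - inverse y) / - (1 / q - q)) =
      i * (1 - e * q ^ m) * (1 + e * q ^ m * (y * y)) / (1 / q - q)"
    by (simp only: gen main minus_minus)
  then show ?thesis unfolding sig_def qbr_def p Q e_def[symmetric] k2 last i_def[symmetric] .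
qed

text \<open>Positivity makes the square roots in the module action square back to sigma and keeps
  the denominators of the coupling coefficients away from 0.\<close>

lemma sig_pos:
  assumes q: "0 < q" "q < 1" and "0 < \<mu>" "0 < m"
  shows "0 < sig q \<mu> m"
proof -
  obtain k where m: "m = Suc k" using assms by (cases m) auto
  have 1: "\<bar>(- q) ^ k\<bar> \<le> 1" using q by (simp add: power_abs power_le_one)
  have "q ^ m < 1" unfolding m using q by (intro power_Suc_less_one) auto
  then have 2: "\<bar>(- q) ^ m\<bar> < 1" using q by (simp add: power_abs)
  have 3: "0 < q powr (2 * \<mu>)" "q powr (2 * \<mu>) < 1"
    using q assms by (auto simp: powr_def mult_less_0_iff)
  have "\<bar>(- q) ^ k * q powr (2 * \<mu>)\<bar> \<le> 1 * q powr (2 * \<mu>)"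
    unfolding abs_mult using 1 3 by (intro mult_mono) auto
  then have 4: "0 < 1 - (- q) ^ k * q powr (2 * \<mu>)" using 3 by linarith
  have 5: "(- q) ^ m / (- q) = (- q) ^ k" using q by (simp add: m)
  have "1 / q > 1" using q by simp
  then have 6: "0 < 1 / q - q" using q by linarith
  have 7: "0 < 1 - (- q) ^ m" using 2 by linarith
  have 8: "0 < q powr (1/2 - \<mu> - real m)" using q by simp
  show ?thesis unfolding sig_eq[OF q] 5 by (rule divide_pos_pos[OF mult_pos_pos[OF mult_pos_pos[OF 8 7] 4] 6])
qed

lemma sig_nonneg: "0 < q \<Longrightarrow> q < 1 \<Longrightarrow> 0 < \<mu> \<Longrightarrow> 0 \<le> sig q \<mu> m"
  using sig_pos[of q \<mu> m] by (cases m) auto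

lemma kp_square: "0 < q \<Longrightarrow> kp q G b * kp q G b = q powr (real b + G)"
proof -
  assume "0 < q"
  have "kp q G b * kp q G b = ((- 1) ^ b * (- 1) ^ b) * (q powr ((real b + G) / 2) * q powr ((real b + G) / 2))"
    by (simp add: kp_def)
  then show ?thesis by (simp add: powr_add[symmetric] flip: power_mult_distrib)
qed

text \<open>K contributes q^(1/2) and P the sign; without the sign the mixed terms in
  \<open>Lop_Rop\<close> would not cancel.\<close>

lemma kp_Suc:
  assumes "0 < q" shows "kp q G (Suc b) = - (q powr (1 / 2) * kp q G b)"
proof -
  have "(real (Suc b) + G) / 2 = 1 / 2 + (real b + G) / 2" by simp
  then show ?thesis unfolding kp_def by (simp only: powr_add) simp
qed

text \<open>The coproduct respects the anticommutation relation. Of the four products at the first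
  cut, the two diagonal ones add up by \<open>tau_split\<close> and the two mixed ones
  cancel.\<close>

lemma Lop_Rop:
  assumes q: "0 < q" "q < 1"
  shows "homog (length gs) N f \<Longrightarrow> \<forall>g\<in>set gs. 0 < g \<Longrightarrow>
    Lop q gs (Rop q gs f) ks + Rop q gs (Lop q gs f) ks = tau q (real N + sum_list gs) * f ks"
proof (induction gs arbitrary: N f ks)
  case Nil
  then have "f ks \<noteq> 0 \<Longrightarrow> N = 0" by (auto simp: homog_def)
  then show ?case by (cases "f ks = 0") (auto simp: tau_def)
next
  case (Cons g gs)
  let ?G = "sum_list gs"
  show ?case
  proof (cases ks)
    case Nil
    then have "f ks = 0" using Cons.prems by (auto simp: homog_def)
    then show ?thesis by (simp add: Nil)
  next
    case (Cons k z)
    define E where "E = (\<lambda>k. q powr (- ((real k + g) / 2)))"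
    have Ek: "q powr (- ((real k + g) / 2)) = E k" for k by (simp add: E_def)
    define f' where "f' = (\<lambda>k z. f (k # z))"
    have hf: "homog (length gs) (N - k) (f' k)" for k
      unfolding f'_def by (rule homog_Cons) (use Cons.prems in simp)
    have fz: "f' k z = 0" if "N < k" for k z using homog_Cons_gt[OF Cons.prems(1)] that by (simp add: f'_def)
    have fz0: "f' k = (\<lambda>_. 0)" if "N < k" for k using fz[OF that] by auto
    have kpf: "(\<lambda>z. kp q ?G (sum_list z) * f' j z) = (\<lambda>z. kp q ?G (N - j) * f' j z)" for j
      using hf[of j] by (auto simp: homog_def fun_eq_iff)
    have g0: "0 < g" and gs0: "\<forall>g\<in>set gs. 0 < g" using Cons.prems by auto
    have IH: "Lop q gs (Rop q gs (f' k)) z + Rop q gs (Lop q gs (f' k)) z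
       = tau q (real (N - k) + ?G) * f' k z" for k z
      by (rule Cons.IH[OF hf gs0])
    have R: "Rop q (g # gs) f (j # z) = sqrt (sig q g j) * kp q ?G (sum_list z) * f' (j - 1) z
        + E j * Rop q gs (f' j) z" for j z
      by (simp add: f'_def E_def)
    have L: "Lop q (g # gs) f (j # z) = sqrt (sig q g (Suc j)) * kp q ?G (sum_list z) * f' (Suc j) z
        + E j * Lop q gs (f' j) z" for j z
      by (simp add: f'_def E_def)
    have Rk: "(\<lambda>z. Rop q (g # gs) f (k # z)) = (\<lambda>z. (sqrt (sig q g k) * kp q ?G (N - (k - 1))) * f' (k - 1) z
        + E k * Rop q gs (f' k) z)"
      unfolding R mult.assoc using fun_cong[OF kpf[of "k - 1"]] by (auto simp: fun_eq_iff)
    have Lk: "(\<lambda>z. Lop q (g # gs) f (k # z)) = (\<lambda>z. (sqrt (sig q g (Suc k)) * kp q ?G (N - Suc k)) * f' (Suc k) z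
        + E k * Lop q gs (f' k) z)"
      unfolding L mult.assoc using fun_cong[OF kpf[of "Suc k"]] by (auto simp: fun_eq_iff)
    have LR: "Lop q (g # gs) (Rop q (g # gs) f) (k # z) =
        sqrt (sig q g (Suc k)) * kp q ?G (sum_list z) * (sqrt (sig q g (Suc k)) * kp q ?G (sum_list z) * f' k z
          + E (Suc k) * Rop q gs (f' (Suc k)) z)
        + E k * ((sqrt (sig q g k) * kp q ?G (N - (k - 1))) * Lop q gs (f' (k - 1)) z
          + E k * Lop q gs (Rop q gs (f' k)) z)"
      unfolding Lop.simps(3) Rk by (simp only: R Lop_add Lop_cmult Ek diff_Suc_1)
    have RL: "Rop q (g # gs) (Lop q (g # gs) f) (k # z) =
        sqrt (sig q g k) * kp q ?G (sum_list z) * (if k = 0 then 0 else sqrt (sig q g k) * kp q ?G (sum_list z) * f' k z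
          + E (k - 1) * Lop q gs (f' (k - 1)) z)
        + E k * ((sqrt (sig q g (Suc k)) * kp q ?G (N - Suc k)) * Rop q gs (f' (Suc k)) z
          + E k * Rop q gs (Lop q gs (f' k)) z)"
      unfolding Rop.simps(3) Lk by (simp only: L Rop_add Rop_cmult Ek) (cases k; simp)
    have q12: "E (Suc j) * q powr (1/2) = E j" for j
      unfolding E_def powr_add[symmetric] by (rule arg_cong) (simp add: field_simps)
    \<comment> \<open>\<open>c1\<close> and \<open>c2\<close> are the mixed terms. That the operator
      does not vanish fixes the level of \<open>z\<close>; exchanging the order then costs -q^(1/2)
      from K P and q^(1/2) from K^(-1), with opposite results.\<close>
    have c1: "kp q ?G (sum_list z) * E (Suc k) * Rop q gs (f' (Suc k)) z
        + E k * kp q ?G (N - Suc k) * Rop q gs (f' (Suc k)) z = 0"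
    proof (cases "Rop q gs (f' (Suc k)) z = 0")
      case False
      then have "Suc k \<le> N" using fz0[of "Suc k"] by fastforce
      moreover have "sum_list z = Suc (N - Suc k)"
        using homog_Rop[OF hf[of "Suc k"], of q] False by (auto simp: homog_def)
      ultimately show ?thesis using q12[of k] q kp_Suc[of q ?G "N - Suc k"] by (simp add: algebra_simps)
    qed simp
    have c2: "E k * kp q ?G (N - (k - 1)) * Lop q gs (f' (k - 1)) z
        + kp q ?G (sum_list z) * E (k - 1) * Lop q gs (f' (k - 1)) z = 0" if "k \<noteq> 0"
    proof (cases "Lop q gs (f' (k - 1)) z = 0")
      case False
      then have "k - 1 \<le> N" using fz0[of "k - 1"] by fastforce
      moreover have "N - (k - 1) \<noteq> 0" using homog_Lop(2)[OF hf[of "k - 1"]] False by metis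
      moreover have "sum_list z = N - (k - 1) - 1"
        using homog_Lop(1)[OF hf[of "k - 1"], of q] False by (auto simp: homog_def)
      ultimately have "N - (k - 1) = Suc (sum_list z)" by linarith
      then show ?thesis using q12[of "k - 1"] q kp_Suc[of q ?G "sum_list z"] that by (simp add: algebra_simps)
    qed simp
    have sq: "sqrt (sig q g j) * sqrt (sig q g j) = sig q g j" for j
      using sig_nonneg[OF q g0] by simp
    have EE: "E k * E k = q powr (- (real k + g))"
      unfolding E_def powr_add[symmetric] by (rule arg_cong) (simp add: field_simps)
    have "Lop q (g # gs) (Rop q (g # gs) f) (k # z) + Rop q (g # gs) (Lop q (g # gs) f) (k # z) =
       (sqrt (sig q g (Suc k)) * sqrt (sig q g (Suc k)) + sqrt (sig q g k) * sqrt (sig q g k))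
         * (kp q ?G (sum_list z) * kp q ?G (sum_list z)) * f' k z
       + E k * E k * (Lop q gs (Rop q gs (f' k)) z + Rop q gs (Lop q gs (f' k)) z)
       + sqrt (sig q g (Suc k)) * (kp q ?G (sum_list z) * E (Suc k) * Rop q gs (f' (Suc k)) z
            + E k * kp q ?G (N - Suc k) * Rop q gs (f' (Suc k)) z)
       + sqrt (sig q g k) * (if k = 0 then 0 else E k * kp q ?G (N - (k - 1)) * Lop q gs (f' (k - 1)) z
            + kp q ?G (sum_list z) * E (k - 1) * Lop q gs (f' (k - 1)) z)"
      unfolding LR RL by (simp add: algebra_simps del: real_sqrt_mult_self)
    also have "\<dots> = (tau q (real k + g) * q powr (real (sum_list z) + ?G)
        + q powr (- (real k + g)) * tau q (real (N - k) + ?G)) * f' k z"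
      unfolding sq IH EE c1 kp_square[OF q(1)] sig_add[OF q] using c2 by (simp add: algebra_simps)
    also have "\<dots> = tau q (real N + sum_list (g # gs)) * f' k z"
    proof (cases "f' k z = 0")
      case False
      then have "k \<le> N" using fz[of k z] by (cases "k \<le> N") auto
      moreover have "sum_list z = N - k" using False hf[of k] by (auto simp: homog_def)
      moreover have e: "real N + sum_list (g # gs) = real k + g + (real (N - k) + ?G)"
        using \<open>k \<le> N\<close> by (simp add: of_nat_diff)
      ultimately show ?thesis unfolding e by (simp only: tau_split[OF q(1), symmetric])
    qed simp
    finally show ?thesis by (simp add: Cons f'_def)
  qed
qed

section \<open>Lowest-weight vectors and their chains\<close>

text \<open>A node carries the weights \<open>\<gamma>\<close> of its tensor factors, its level, and a vector of that level.\<close>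

datatype node = Node (nw: "real list") (nl: nat) (nv: vec)

text \<open>K acts on the vector of the node as q^(wt/2), so this number plays the part of gamma for
  the module that the vector generates.\<close>

definition wt :: "node \<Rightarrow> real" where
  "wt A = sum_list (nw A) + real (nl A)"

definition sq :: "node \<Rightarrow> real" where
  "sq A = ip (length (nw A)) (nl A) (nv A) (nv A)"

text \<open>The nonzero norm excludes the zero vector, which also solves the lowest-weight equation;
  the positive weights give \<open>0 < wt A\<close>, hence positive sigma along the chain.\<close>

definition lw :: "real \<Rightarrow> node \<Rightarrow> bool" where
  "lw q A \<longleftrightarrow> nw A \<noteq> [] \<and> (\<forall>g\<in>set (nw A). 0 < g) \<and> homog (length (nw A)) (nl A) (nv A)
     \<and> (\<forall>ks. Lop q (nw A) (nv A) ks = 0) \<and> sq A \<noteq> 0"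

definition ch :: "real \<Rightarrow> node \<Rightarrow> nat \<Rightarrow> vec" where
  "ch q A p = (Rop q (nw A) ^^ p) (nv A)"

definition sigf :: "real \<Rightarrow> real \<Rightarrow> nat \<Rightarrow> real" where
  "sigf q \<mu> p = (\<Prod>l<p. sig q \<mu> (Suc l))"

lemma sigf_Suc: "sigf q \<mu> (Suc p) = sigf q \<mu> p * sig q \<mu> (Suc p)"
  by (simp add: sigf_def)

lemma sigf_0 [simp]: "sigf q \<mu> 0 = 1"
  by (simp add: sigf_def)

lemma lwD:
  assumes "lw q A"
  shows "homog (length (nw A)) (nl A) (nv A)" "Lop q (nw A) (nv A) ks = 0" "0 < sq A"
    "\<forall>g\<in>set (nw A). 0 < g" "0 < wt A"
proof -
  show "homog (length (nw A)) (nl A) (nv A)" "Lop q (nw A) (nv A) ks = 0" and *: "\<forall>g\<in>set (nw A). 0 < g"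
    using assms unfolding lw_def by blast+
  show "0 < sq A" using assms ip_nonneg[of "length (nw A)" "nl A" "nv A"] by (simp add: lw_def sq_def)
  obtain g gs where "nw A = g # gs" using assms by (auto simp: lw_def neq_Nil_conv)
  moreover from this have "0 \<le> sum_list gs" using * by (intro sum_list_nonneg) (auto intro: less_imp_le)
  ultimately have "0 < sum_list (nw A)" using * by simp
  then show "0 < wt A" by (simp add: wt_def)
qed

lemma ch_0 [simp]: "ch q A 0 = nv A" and ch_Suc: "ch q A (Suc p) = Rop q (nw A) (ch q A p)"
  by (simp_all add: ch_def)

lemma homog_ch: "homog (length (nw A)) (nl A) (nv A) \<Longrightarrow> homog (length (nw A)) (nl A + p) (ch q A p)"
proof (induction p)
  case (Suc p)
  then show ?case unfolding ch_Suc add_Suc_right by (intro homog_Rop)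
qed simp

context
  fixes q :: real assumes q: "0 < q" "q < 1"
begin

text \<open>The chain is a rescaled copy of W^(wt A): one anticommutation contributes sigma_(p+1) +
  sigma_p, and the part A_+ A_- takes sigma_p away again.\<close>

lemma Lop_ch:
  assumes A: "lw q A"
  shows "Lop q (nw A) (ch q A p) ks = sig q (wt A) p * ch q A (p - 1) ks"
proof (induction p arbitrary: ks)
  case 0 show ?case unfolding ch_0 sig_0 mult_zero_left by (rule lwD(2)[OF A])
next
  case (Suc p)
  have 1: "Lop q (nw A) (ch q A p) = (\<lambda>ks. sig q (wt A) p * ch q A (p - 1) ks)"
    by (rule ext) (rule Suc)
  have 2: "sig q (wt A) p * ch q A (Suc (p - 1)) ks = sig q (wt A) p * ch q A p ks"
    by (cases p) simp_all
  have 3: "real (nl A + p) + sum_list (nw A) = real p + wt A" by (simp add: wt_def)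
  have h: "homog (length (nw A)) (nl A + p) (ch q A p)" by (rule homog_ch[OF lwD(1)[OF A]])
  have 4: "Rop q (nw A) (Lop q (nw A) (ch q A p)) ks = sig q (wt A) p * ch q A p ks"
    unfolding 1 Rop_cmult ch_Suc[symmetric] by (rule 2)
  have "Lop q (nw A) (Rop q (nw A) (ch q A p)) ks + Rop q (nw A) (Lop q (nw A) (ch q A p)) ks
      = tau q (real (nl A + p) + sum_list (nw A)) * ch q A p ks"
    by (rule Lop_Rop[OF q h lwD(4)[OF A]])
  then have "Lop q (nw A) (ch q A (Suc p)) ks + sig q (wt A) p * ch q A p ks
     = (sig q (wt A) (Suc p) + sig q (wt A) p) * ch q A p ks"
    unfolding 4 3 ch_Suc[symmetric] sig_add[OF q] .
  then show ?case unfolding distrib_right by simp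
qed

lemma ip_ch:
  assumes "lw q A" "lw q B" "nw B = nw A" "nl B = nl A"
  shows "ip (length (nw A)) (nl A + p) (ch q A p) (ch q B p) =
    sigf q (wt A) p * ip (length (nw A)) (nl A) (nv A) (nv B)"
proof (induction p)
  case (Suc p)
  have "Lop q (nw A) (ch q B (Suc p)) = (\<lambda>ks. sig q (wt A) (Suc p) * ch q B p ks)"
    by (rule ext) (use Lop_ch[OF assms(2), of "Suc p"] assms in \<open>simp add: wt_def\<close>)
  then show ?case using Suc by (simp add: ch_Suc[of q A] ip_adjoint ip_cmult_right sigf_Suc)
qed simp

text \<open>On a common level, chains that start at different levels have different exponents.
  Moving the raising operators of the shorter chain across as lowering operators leaves at least one
  on the longer chain, and moving that one back kills the lowest-weight vector of the shorter
  chain.\<close>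

lemma ip_ch_ne:
  assumes "lw q A" "lw q B" "nw B = nw A" "nl B \<noteq> nl A"
  shows "ip (length (nw A)) N (ch q A p) (ch q B r) = 0"
proof -
  have main: "ip (length (nw A)) N (ch q A p) (ch q B (r + Suc p)) = 0"
    if "lw q A" "lw q B" "nw B = nw A" for A B r p N
  proof (induction p arbitrary: N)
    case 0
    have L0: "Lop q (nw A) (nv A) = (\<lambda>_. 0)" by (rule ext) (rule lwD(2)[OF that(1)])
    show ?case
    proof (cases N)
      case 0
      then show ?thesis
        using ip_homog_ne(2)[OF homog_ch[OF lwD(1)[OF that(2)], where p = "r + Suc 0"], where N = 0] that(3)
        by simp
    next
      case (Suc M)
      have "ip (length (nw A)) N (ch q B (Suc r)) (nv A) = 0"
        unfolding Suc ch_Suc that(3) ip_adjoint L0 by simp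
      then show ?thesis by (simp add: ip_commute[of _ _ "nv A"])
    qed
  next
    case (Suc p)
    have 1: "Lop q (nw A) (ch q B (r + Suc (Suc p))) =
        (\<lambda>ks. sig q (wt B) (r + Suc (Suc p)) * ch q B (r + Suc p) ks)"
      by (rule ext) (use Lop_ch[OF that(2), of "r + Suc (Suc p)"] that(3) in simp)
    show ?case
    proof (cases N)
      case 0
      show ?thesis unfolding 0 by (rule ip_homog_ne(1)[OF homog_ch[OF lwD(1)[OF that(1)]]]) simp
    next
      case (Suc M)
      show ?thesis unfolding Suc ch_Suc[of q A] ip_adjoint 1 ip_cmult_right Suc.IH by simp
    qed
  qed
  show ?thesis
  proof (cases "nl A + p = N \<and> nl B + r = N")
    case True
    then have "p \<noteq> r" using assms by auto
    then consider "p < r" | "r < p" by linarith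
    then show ?thesis
    proof cases
      case 1
      then have "r = (r - Suc p) + Suc p" by simp
      then show ?thesis using main[OF assms(1-3), of N p "r - Suc p"] by simp
    next
      case 2
      then have "p = (p - Suc r) + Suc r" by simp
      then show ?thesis using main[OF assms(2,1) assms(3)[symmetric], of N r "p - Suc r"] assms(3)
        by (simp add: ip_commute[of _ _ "ch q A p"])
    qed
  next
    case False
    then consider "nl A + p \<noteq> N" | "nl B + r \<noteq> N" by blast
    then show ?thesis
    proof cases
      case 1
      then show ?thesis by (rule ip_homog_ne(1)[OF homog_ch[OF lwD(1)[OF assms(1)]]])
    next
      case 2
      then show ?thesis
        using ip_homog_ne(2)[OF homog_ch[OF lwD(1)[OF assms(2)]]] assms(3) by simp
    qed
  qed
qed

end

section \<open>Coupling of two lowest-weight vectors\<close>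

text \<open>The eigenvalue of K P on the r-th chain vector of a node of weight nu and level e, see
  \<open>kp_kp_level\<close>. Since nu already contains e, the level occurs only in the
  sign.\<close>

definition kp_level :: "real \<Rightarrow> real \<Rightarrow> nat \<Rightarrow> nat \<Rightarrow> real" where
  "kp_level q \<nu> e r = (- 1) ^ (e + r) * q powr ((real r + \<nu>) / 2)"

text \<open>The coefficients are forced by the lowest-weight condition; \<open>cg_coeff\<close> and the numbers \<open>\<epsilon>\<close> of \<open>Psi\<close>
  are special cases up to a factor independent of the summation index.\<close>

definition couple_coeff :: "real \<Rightarrow> real \<Rightarrow> real \<Rightarrow> nat \<Rightarrow> nat \<Rightarrow> nat \<Rightarrow> real" where
  "couple_coeff q \<mu> \<nu> e s p = (\<Prod>u<p. - (q powr (- ((\<mu> + real u) / 2)) * sig q \<nu> (s - u))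
      / (kp_level q \<nu> e (s - Suc u) * sig q \<mu> (Suc u)))"

text \<open>The coefficients of the same vector in terms of \<open>A\<^sub>+^(s - t) (a\<^sub>t \<otimes> b\<^sub>0)\<close>. In an inner product with a lowest-weight
  vector only the term \<open>t = s\<close> survives.\<close>

definition raise_coeff :: "real \<Rightarrow> real \<Rightarrow> real \<Rightarrow> nat \<Rightarrow> nat \<Rightarrow> nat \<Rightarrow> real" where
  "raise_coeff q \<mu> \<nu> e s t = q powr (real s * \<mu> / 2) * (\<Prod>u<t. (- 1) ^ (s - u) * sig q (\<mu> + \<nu> + real u) (s - u)
      / (kp_level q \<nu> e 0 * sig q \<mu> (Suc u)))"

definition chain_tensor :: "real \<Rightarrow> node \<Rightarrow> node \<Rightarrow> nat \<Rightarrow> nat \<Rightarrow> vec" where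
  "chain_tensor q A B p r = tns (length (nw A)) (ch q A p) (ch q B r)"

definition couple :: "real \<Rightarrow> node \<Rightarrow> node \<Rightarrow> nat \<Rightarrow> node" where
  "couple q A B s = Node (nw A @ nw B) (nl A + nl B + s)
     (\<lambda>ks. \<Sum>p\<le>s. couple_coeff q (wt A) (wt B) (nl B) s p * chain_tensor q A B p (s - p) ks)"

lemma couple_sel [simp]: "nw (couple q A B s) = nw A @ nw B" "nl (couple q A B s) = nl A + nl B + s"
    "wt (couple q A B s) = wt A + wt B + real s"
    "nv (couple q A B s) = (\<lambda>ks. \<Sum>p\<le>s. couple_coeff q (wt A) (wt B) (nl B) s p * chain_tensor q A B p (s - p) ks)"
  by (simp_all add: couple_def wt_def)

lemma couple_coeff_0 [simp]: "couple_coeff q \<mu> \<nu> e s 0 = 1"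
  by (simp add: couple_coeff_def)

lemma tns_assoc: "tns (d1 + d2) (tns d1 a b) c = tns d1 a (tns d2 b c)"
  by (simp add: tns_def fun_eq_iff take_drop drop_drop add.commute min_def)

lemma kp_kp_level: "kp q (sum_list (nw B)) (nl B + r) = kp_level q (wt B) (nl B) r"
  by (simp add: kp_def kp_level_def wt_def algebra_simps)

context
  fixes q :: real assumes q: "0 < q" "q < 1"
begin

lemma kp_level_nonzero [simp]: "kp_level q \<nu> e r \<noteq> 0"
  using q by (simp add: kp_level_def)

lemma homog_chain_tensor:
  assumes "lw q A" "lw q B"
  shows "homog (length (nw A) + length (nw B)) (nl A + p + (nl B + r)) (chain_tensor q A B p r)"
  unfolding chain_tensor_def by (intro homog_tns homog_ch lwD(1)[OF assms(1)] lwD(1)[OF assms(2)])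

lemma Rop_chain_tensor:
  assumes "lw q A" "lw q B"
  shows "Rop q (nw A @ nw B) (chain_tensor q A B p r) ks = kp_level q (wt B) (nl B) r * chain_tensor q A B (Suc p) r ks
     + q powr (- ((wt A + real p) / 2)) * chain_tensor q A B p (Suc r) ks"
proof -
  have e: "real (nl A + p) + sum_list (nw A) = wt A + real p" by (simp add: wt_def)
  show ?thesis unfolding chain_tensor_def ch_Suc
      op_tns(1)[OF q(1) homog_ch[OF lwD(1)[OF assms(1)]] homog_ch[OF lwD(1)[OF assms(2)]]] kp_kp_level e ..
qed

lemma Lop_chain_tensor:
  assumes "lw q A" "lw q B"
  shows "Lop q (nw A @ nw B) (chain_tensor q A B p r) ks = kp_level q (wt B) (nl B) r * sig q (wt A) p * chain_tensor q A B (p - 1) r ks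
     + q powr (- ((wt A + real p) / 2)) * sig q (wt B) r * chain_tensor q A B p (r - 1) ks"
proof -
  have e: "real (nl A + p) + sum_list (nw A) = wt A + real p" by (simp add: wt_def)
  show ?thesis unfolding chain_tensor_def
      op_tns(2)[OF q(1) homog_ch[OF lwD(1)[OF assms(1)]] homog_ch[OF lwD(1)[OF assms(2)]]] kp_kp_level e
    by (simp add: tns_def Lop_ch[OF q assms(1)] Lop_ch[OF q assms(2)])
qed

text \<open>The product a_p \<otimes> b_(s-p-1) is reached in two ways, by lowering the left index
  from p + 1 or the right index from s - p. The terms at both ends of the sum carry sigma_0 =
  0.\<close>

lemma Lop_comb:
  assumes "lw q A" "lw q B"
  shows "Lop q (nw A @ nw B) (\<lambda>ks. \<Sum>p\<le>s. e p * chain_tensor q A B p (s - p) ks) ks =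
    (\<Sum>p<s. (e (Suc p) * kp_level q (wt B) (nl B) (s - Suc p) * sig q (wt A) (Suc p)
       + e p * q powr (- ((wt A + real p) / 2)) * sig q (wt B) (s - p)) * chain_tensor q A B p (s - Suc p) ks)"
proof -
  have "Lop q (nw A @ nw B) (\<lambda>ks. \<Sum>p\<le>s. e p * chain_tensor q A B p (s - p) ks) ks =
     (\<Sum>p<Suc s. e p * kp_level q (wt B) (nl B) (s - p) * sig q (wt A) p * chain_tensor q A B (p - 1) (s - p) ks)
     + (\<Sum>p<Suc s. e p * q powr (- ((wt A + real p) / 2)) * sig q (wt B) (s - p) * chain_tensor q A B p (s - p - 1) ks)"
    by (simp only: Lop_sum Lop_cmult Lop_chain_tensor[OF assms] distrib_left sum.distrib mult.assoc lessThan_Suc_atMost)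
  also have "(\<Sum>p<Suc s. e p * kp_level q (wt B) (nl B) (s - p) * sig q (wt A) p * chain_tensor q A B (p - 1) (s - p) ks)
     = (\<Sum>p<s. e (Suc p) * kp_level q (wt B) (nl B) (s - Suc p) * sig q (wt A) (Suc p) * chain_tensor q A B p (s - Suc p) ks)"
    by (simp only: sum.lessThan_Suc_shift) simp
  also have "(\<Sum>p<Suc s. e p * q powr (- ((wt A + real p) / 2)) * sig q (wt B) (s - p) * chain_tensor q A B p (s - p - 1) ks)
     = (\<Sum>p<s. e p * q powr (- ((wt A + real p) / 2)) * sig q (wt B) (s - p) * chain_tensor q A B p (s - Suc p) ks)"
    by simp
  finally show ?thesis by (simp only: distrib_right sum.distrib)
qed

lemma ip_chain_tensor:
  assumes "lw q A" "lw q B"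
  shows "ip (length (nw A) + length (nw B)) (nl A + p + (nl B + r)) (chain_tensor q A B p r) (chain_tensor q A B p' r') =
    (if p = p' \<and> r = r' then sigf q (wt A) p * sigf q (wt B) r * sq A * sq B else 0)"
proof -
  have "ip (length (nw A)) (nl A + p) (ch q A p) (ch q A p') = (if p = p' then sigf q (wt A) p * sq A else 0)"
    if "lw q A" for A p p'
  proof (cases "p = p'")
    case True then show ?thesis using ip_ch[OF q that that refl refl, of p] by (simp add: sq_def)
  next
    case False
    then show ?thesis
      using ip_homog_ne(2)[OF homog_ch[OF lwD(1)[OF that], where p = p'], where N = "nl A + p"] by simp
  qed
  note this[OF assms(1), of p p'] this[OF assms(2), of r r']
  then show ?thesis unfolding chain_tensor_def
    by (simp add: ip_tns[OF homog_ch[OF lwD(1)[OF assms(1)]] homog_ch[OF lwD(1)[OF assms(2)]]])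
qed

lemma ip_chain_tensor_level:
  assumes "lw q A" "lw q B" "D = length (nw A) + length (nw B)" "N = nl A + nl B + p + r"
  shows "ip D N (chain_tensor q A B p r) (chain_tensor q A B p' r') =
    (if p = p' \<and> r = r' then sigf q (wt A) p * sigf q (wt B) r * sq A * sq B else 0)"
proof -
  have N: "N = nl A + p + (nl B + r)" using assms(4) by simp
  show ?thesis unfolding N assms(3) by (rule ip_chain_tensor[OF assms(1,2)])
qed

lemma sigf_pos: "0 < \<mu> \<Longrightarrow> 0 < sigf q \<mu> p"
  unfolding sigf_def by (intro prod_pos) (simp add: sig_pos q)

text \<open>Pairing with the orthogonal vectors a_p \<otimes> b_(s-p-1) separates the coefficients
  in \<open>Lop_comb\<close> into a two-term recursion. Neither sigma_(p+1) nor the eigenvalue of K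
  P vanishes, so each coefficient determines the next one.\<close>

lemma comb_unique:
  assumes "lw q A" "lw q B"
    and "\<And>ks. Lop q (nw A @ nw B) (\<lambda>ks. \<Sum>p\<le>s. e p * chain_tensor q A B p (s - p) ks) ks = 0"
  shows "p \<le> s \<Longrightarrow> e p = e 0 * couple_coeff q (wt A) (wt B) (nl B) s p"
proof (induction p)
  case (Suc p)
  define f where "f = (\<lambda>p. e (Suc p) * kp_level q (wt B) (nl B) (s - Suc p) * sig q (wt A) (Suc p)
       + e p * q powr (- ((wt A + real p) / 2)) * sig q (wt B) (s - p))"
  define D where "D = length (nw A) + length (nw B)"
  define N where "N = nl A + nl B + p + (s - Suc p)"
  have pos: "sigf q (wt A) p * sigf q (wt B) (s - Suc p) * sq A * sq B \<noteq> 0"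
    by (intro less_imp_neq[symmetric] mult_pos_pos sigf_pos lwD(3,5)[OF assms(1)] lwD(3,5)[OF assms(2)])
  have "0 = ip D N (chain_tensor q A B p (s - Suc p)) (\<lambda>ks. \<Sum>p<s. f p * chain_tensor q A B p (s - Suc p) ks)"
    unfolding f_def Lop_comb[OF assms(1,2), symmetric] assms(3) by simp
  also have "\<dots> = (\<Sum>p'<s. if p' = p then f p' * (sigf q (wt A) p * sigf q (wt B) (s - Suc p) * sq A * sq B) else 0)"
    unfolding ip_sum_right by (rule sum.cong) (auto simp: ip_chain_tensor_level[OF assms(1,2) D_def N_def])
  also have "\<dots> = f p * (sigf q (wt A) p * sigf q (wt B) (s - Suc p) * sq A * sq B)"
    using Suc.prems by simp
  finally have "f p * (sigf q (wt A) p * sigf q (wt B) (s - Suc p) * sq A * sq B) = 0" by (rule sym)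
  then have "f p = 0" unfolding mult_eq_0_iff[of "f p"] using pos by blast
  moreover have "0 < sig q (wt A) (Suc p)" using lwD(5)[OF assms(1)] q by (intro sig_pos) auto
  ultimately have "e (Suc p) = e p * (- (q powr (- ((wt A + real p) / 2)) * sig q (wt B) (s - p))
      / (kp_level q (wt B) (nl B) (s - Suc p) * sig q (wt A) (Suc p)))"
    by (simp add: f_def field_simps)
  then show ?case using Suc by (simp add: couple_coeff_def)
qed simp

text \<open>The coefficients solve the recursion of \<open>Lop_comb\<close> by their definition. By
  orthogonality the squared norm is a sum of nonnegative terms, and the term p = 0 is
  positive.\<close>

lemma lw_couple:
  assumes "lw q A" "lw q B"
  shows "lw q (couple q A B s)"
proof -
  let ?c = "couple_coeff q (wt A) (wt B) (nl B) s"
  have h: "homog (length (nw A) + length (nw B)) (nl A + nl B + s) (nv (couple q A B s))"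
    unfolding couple_sel
  proof (intro homog_sum homog_cmult)
    fix p assume "p \<in> {..s}"
    then have e: "nl A + nl B + s = nl A + p + (nl B + (s - p))" by simp
    show "homog (length (nw A) + length (nw B)) (nl A + nl B + s) (chain_tensor q A B p (s - p))"
      unfolding e by (rule homog_chain_tensor[OF assms])
  qed
  have L: "Lop q (nw A @ nw B) (nv (couple q A B s)) ks = 0" for ks
  proof -
    have "?c (Suc p) * kp_level q (wt B) (nl B) (s - Suc p) * sig q (wt A) (Suc p)
       + ?c p * q powr (- ((wt A + real p) / 2)) * sig q (wt B) (s - p) = 0" for p
    proof -
      have "0 < sig q (wt A) (Suc p)" using lwD(5)[OF assms(1)] q by (intro sig_pos) auto
      then show ?thesis by (simp add: couple_coeff_def field_simps)
    qed
    then show ?thesis unfolding couple_sel Lop_comb[OF assms] by simp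
  qed
  have e1: "ip (length (nw A) + length (nw B)) (nl A + nl B + s) (chain_tensor q A B p (s - p)) (chain_tensor q A B p' (s - p'))
     = (if p' = p then sigf q (wt A) p * sigf q (wt B) (s - p) * sq A * sq B else 0)" if "p \<le> s" for p p'
    using that by (subst ip_chain_tensor_level[OF assms refl]) auto
  have "sq (couple q A B s) = ip (length (nw A) + length (nw B)) (nl A + nl B + s) (nv (couple q A B s)) (nv (couple q A B s))"
    by (simp only: sq_def couple_sel length_append)
  also have "\<dots> = (\<Sum>p\<le>s. ?c p * (\<Sum>p'\<le>s. ?c p' * (if p' = p then sigf q (wt A) p * sigf q (wt B) (s - p) * sq A * sq B else 0)))"
    unfolding couple_sel ip_sum_left ip_sum_right by (intro sum.cong refl arg_cong2[where f = "(*)"]) (simp_all add: e1)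
  also have "\<dots> = (\<Sum>p\<le>s. ?c p * ?c p * (sigf q (wt A) p * sigf q (wt B) (s - p) * sq A * sq B))"
    by (rule sum.cong) (simp_all add: if_distrib[of "(*) _"] cong: if_cong)
  also have "\<dots> > 0"
  proof (rule sum_pos2[of _ 0])
    fix p assume "p \<in> {..s}"
    show "0 \<le> ?c p * ?c p * (sigf q (wt A) p * sigf q (wt B) (s - p) * sq A * sq B)"
      unfolding mult.assoc[of "?c p"] using lwD(3,5)[OF assms(1)] lwD(3,5)[OF assms(2)]
      by (simp add: sigf_pos less_imp_le flip: mult.assoc[of "?c p"])
  next
    show "0 < ?c 0 * ?c 0 * (sigf q (wt A) 0 * sigf q (wt B) (s - 0) * sq A * sq B)"
      unfolding couple_coeff_0 mult_1 by (intro mult_pos_pos sigf_pos lwD(3,5)[OF assms(1)] lwD(3,5)[OF assms(2)])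
  qed auto
  finally have "sq (couple q A B s) \<noteq> 0" by simp
  moreover have "nw A \<noteq> []" using assms by (simp add: lw_def)
  ultimately show ?thesis unfolding lw_def using h L lwD(4)[OF assms(1)] lwD(4)[OF assms(2)] by auto
qed

lemma Rop_funpow_sum: "(Rop q gs ^^ m) (\<lambda>ks. \<Sum>i\<in>I. c i * f i ks) ks = (\<Sum>i\<in>I. c i * (Rop q gs ^^ m) (f i) ks)"
proof (induction m arbitrary: ks)
  case (Suc m)
  have "(Rop q gs ^^ m) (\<lambda>ks. \<Sum>i\<in>I. c i * f i ks) = (\<lambda>ks. \<Sum>i\<in>I. c i * (Rop q gs ^^ m) (f i) ks)"
    by (rule ext) (rule Suc)
  then show ?case by (simp add: Rop_sum Rop_cmult)
qed simp

lemma homog_Rop_funpow: "homog (length gs) N f \<Longrightarrow> homog (length gs) (N + m) ((Rop q gs ^^ m) f)"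
proof (induction m)
  case (Suc m)
  then show ?case unfolding funpow.simps(2) add_Suc_right o_def by (intro homog_Rop)
qed simp

text \<open>The iterated anticommutation relation. In contrast to \<open>Lop_ch\<close>, the vector
  may be moved by A_-, and this leaves the term with (-1)^m.\<close>

lemma Lop_Rop_funpow:
  assumes f: "homog (length gs) N f" and gs: "\<forall>g\<in>set gs. 0 < g"
  shows "Lop q gs ((Rop q gs ^^ m) f) ks = (- 1) ^ m * (Rop q gs ^^ m) (Lop q gs f) ks
     + sig q (real N + sum_list gs) m * (Rop q gs ^^ (m - 1)) f ks"
proof (induction m arbitrary: ks)
  case (Suc m)
  define T where "T = real N + sum_list gs"
  have e: "real (N + m) + sum_list gs = real m + T" by (simp add: T_def)
  have 1: "Lop q gs ((Rop q gs ^^ m) f) = (\<lambda>ks. (- 1) ^ m * (Rop q gs ^^ m) (Lop q gs f) ks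
     + sig q T m * (Rop q gs ^^ (m - 1)) f ks)"
    by (rule ext) (use Suc in \<open>simp add: T_def\<close>)
  have 2: "sig q T m * Rop q gs ((Rop q gs ^^ (m - 1)) f) ks = sig q T m * (Rop q gs ^^ m) f ks"
    by (cases m) simp_all
  have "Lop q gs (Rop q gs ((Rop q gs ^^ m) f)) ks + Rop q gs (Lop q gs ((Rop q gs ^^ m) f)) ks
      = (sig q T (Suc m) + sig q T m) * (Rop q gs ^^ m) f ks"
    unfolding sig_add[OF q] e[symmetric] by (rule Lop_Rop[OF q homog_Rop_funpow[OF f] gs])
  then show ?case unfolding 1 Rop_add Rop_cmult 2 T_def[symmetric] distrib_right by simp
qed simp

lemma Rop_comb:
  assumes "lw q A" "lw q B"
  shows "Rop q (nw A @ nw B) (\<lambda>ks. \<Sum>p\<le>n. e p * chain_tensor q A B p (n - p) ks) ks =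
    (\<Sum>p\<le>Suc n. ((if p = 0 then 0 else e (p - 1) * kp_level q (wt B) (nl B) (Suc n - p))
       + (if p \<le> n then e p * q powr (- ((wt A + real p) / 2)) else 0)) * chain_tensor q A B p (Suc n - p) ks)"
proof -
  have "Rop q (nw A @ nw B) (\<lambda>ks. \<Sum>p\<le>n. e p * chain_tensor q A B p (n - p) ks) ks =
     (\<Sum>p\<le>n. e p * kp_level q (wt B) (nl B) (n - p) * chain_tensor q A B (Suc p) (n - p) ks)
     + (\<Sum>p\<le>n. e p * q powr (- ((wt A + real p) / 2)) * chain_tensor q A B p (Suc (n - p)) ks)"
    by (simp only: Rop_sum Rop_cmult Rop_chain_tensor[OF assms] distrib_left sum.distrib mult.assoc)
  also have "(\<Sum>p\<le>n. e p * kp_level q (wt B) (nl B) (n - p) * chain_tensor q A B (Suc p) (n - p) ks) =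
     (\<Sum>p\<le>Suc n. (if p = 0 then 0 else e (p - 1) * kp_level q (wt B) (nl B) (Suc n - p)) * chain_tensor q A B p (Suc n - p) ks)"
    by (simp only: sum.atMost_Suc_shift) simp
  also have "(\<Sum>p\<le>n. e p * q powr (- ((wt A + real p) / 2)) * chain_tensor q A B p (Suc (n - p)) ks) =
     (\<Sum>p\<le>Suc n. (if p \<le> n then e p * q powr (- ((wt A + real p) / 2)) else 0) * chain_tensor q A B p (Suc n - p) ks)"
    by (auto simp: Suc_diff_le intro!: sum.cong)
  finally show ?thesis by (simp only: distrib_right sum.distrib)
qed

text \<open>Only the coefficient at p = 0 is recorded, since by \<open>comb_unique\<close> it
  determines a lowest-weight combination. Raising reaches p = 0 only through K^(-1) \<otimes> A_+,
  which contributes q^(- wt A / 2) each time.\<close>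

lemma Rop_funpow_comb:
  assumes "lw q A" "lw q B"
  shows "\<exists>e'. (Rop q (nw A @ nw B) ^^ m) (\<lambda>ks. \<Sum>p\<le>n. e p * chain_tensor q A B p (n - p) ks)
       = (\<lambda>ks. \<Sum>p\<le>n + m. e' p * chain_tensor q A B p (n + m - p) ks)
     \<and> e' 0 = q powr (- (real m * wt A / 2)) * e 0"
proof (induction m)
  case 0
  show ?case using q by (intro exI[of _ e]) simp
next
  case (Suc m)
  then obtain e1 where e1: "(Rop q (nw A @ nw B) ^^ m) (\<lambda>ks. \<Sum>p\<le>n. e p * chain_tensor q A B p (n - p) ks)
       = (\<lambda>ks. \<Sum>p\<le>n + m. e1 p * chain_tensor q A B p (n + m - p) ks)"
     "e1 0 = q powr (- (real m * wt A / 2)) * e 0" by auto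
  define e' where "e' = (\<lambda>p. (if p = 0 then 0 else e1 (p - 1) * kp_level q (wt B) (nl B) (Suc (n + m) - p))
     + (if p \<le> n + m then e1 p * q powr (- ((wt A + real p) / 2)) else 0))"
  have "- (real m * wt A / 2) + - ((wt A + real 0) / 2) = - (real (Suc m) * wt A / 2)" by (simp add: field_simps)
  then have "q powr (- (real m * wt A / 2)) * q powr (- ((wt A + real 0) / 2)) = q powr (- (real (Suc m) * wt A / 2))"
    by (metis powr_add)
  then have "e' 0 = q powr (- (real (Suc m) * wt A / 2)) * e 0"
    using e1(2) by (simp add: e'_def mult.commute mult.left_commute)
  moreover have "(Rop q (nw A @ nw B) ^^ Suc m) (\<lambda>ks. \<Sum>p\<le>n. e p * chain_tensor q A B p (n - p) ks)
       = (\<lambda>ks. \<Sum>p\<le>n + Suc m. e' p * chain_tensor q A B p (n + Suc m - p) ks)"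
    unfolding funpow.simps(2) o_def e1(1) add_Suc_right e'_def by (rule ext) (rule Rop_comb[OF assms])
  ultimately show ?case by blast
qed

text \<open>The right-hand side is annihilated by A_-: after \<open>Lop_Rop_funpow\<close> the
  contributions of t and t + 1 cancel by the recursion of \<open>raise_coeff\<close>. By
  \<open>comb_unique\<close> it is then a multiple of the coupled vector. Only t = 0 contributes to
  its coefficient at p = 0, and the prefactor q^(s mu / 2) makes that coefficient 1.\<close>

lemma raise_coeff_expansion:
  assumes "lw q A" "lw q B"
  shows "nv (couple q A B s) ks =
    (\<Sum>t\<le>s. raise_coeff q (wt A) (wt B) (nl B) s t * (Rop q (nw A @ nw B) ^^ (s - t)) (chain_tensor q A B t 0) ks)"
proof -
  define g where "g = raise_coeff q (wt A) (wt B) (nl B) s"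
  define R where "R = (\<lambda>m. Rop q (nw A @ nw B) ^^ m)"
  \<comment> \<open>Each vector A_+^(s-t) (a_t \<otimes> b_0) is rewritten in the products a_p
    \<otimes> b_(s-p), so that \<open>comb_unique\<close> can be applied to their
    combination.\<close>
  have "\<forall>t. \<exists>e. t \<le> s \<longrightarrow> R (s - t) (chain_tensor q A B t 0) = (\<lambda>ks. \<Sum>p\<le>s. e p * chain_tensor q A B p (s - p) ks)
     \<and> e 0 = (if t = 0 then q powr (- (real s * wt A / 2)) else 0)"
  proof
    fix t
    show "\<exists>e. t \<le> s \<longrightarrow> R (s - t) (chain_tensor q A B t 0) = (\<lambda>ks. \<Sum>p\<le>s. e p * chain_tensor q A B p (s - p) ks)
     \<and> e 0 = (if t = 0 then q powr (- (real s * wt A / 2)) else 0)"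
    proof (cases "t \<le> s")
      case True
      have "(\<lambda>ks. \<Sum>p\<le>t. (if p = t then 1 else 0) * chain_tensor q A B p (t - p) ks) = chain_tensor q A B t 0"
        by (auto simp: if_distrib[of "\<lambda>c. c * _"] fun_eq_iff cong: if_cong)
      then obtain e where "R (s - t) (chain_tensor q A B t 0) = (\<lambda>ks. \<Sum>p\<le>s. e p * chain_tensor q A B p (s - p) ks)"
         "e 0 = q powr (- (real (s - t) * wt A / 2)) * (if 0 = t then 1 else 0)"
        using Rop_funpow_comb[OF assms, where m = "s - t" and n = t and e = "\<lambda>p. if p = t then 1 else 0"] True by (auto simp: R_def)
      then show ?thesis by (intro exI[of _ e]) auto
    qed simp
  qed
  from choice[OF this] obtain e where "\<forall>t. t \<le> s \<longrightarrow> R (s - t) (chain_tensor q A B t 0) = (\<lambda>ks. \<Sum>p\<le>s. e t p * chain_tensor q A B p (s - p) ks)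
     \<and> e t 0 = (if t = 0 then q powr (- (real s * wt A / 2)) else 0)" ..
  then have e: "\<And>t. t \<le> s \<Longrightarrow> R (s - t) (chain_tensor q A B t 0) = (\<lambda>ks. \<Sum>p\<le>s. e t p * chain_tensor q A B p (s - p) ks)"
    "\<And>t. t \<le> s \<Longrightarrow> e t 0 = (if t = 0 then q powr (- (real s * wt A / 2)) else 0)"
    by blast+
  define d where "d = (\<lambda>p. \<Sum>t\<le>s. g t * e t p)"
  have z: "(\<Sum>t\<le>s. g t * R (s - t) (chain_tensor q A B t 0) ks) = (\<Sum>p\<le>s. d p * chain_tensor q A B p (s - p) ks)" for ks
  proof -
    have "(\<Sum>t\<le>s. g t * R (s - t) (chain_tensor q A B t 0) ks) = (\<Sum>t\<le>s. \<Sum>p\<le>s. g t * e t p * chain_tensor q A B p (s - p) ks)"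
      by (rule sum.cong) (simp_all add: e sum_distrib_left mult.assoc)
    also have "\<dots> = (\<Sum>p\<le>s. \<Sum>t\<le>s. g t * e t p * chain_tensor q A B p (s - p) ks)" by (rule sum.swap)
    finally show ?thesis by (simp add: d_def sum_distrib_right)
  qed
  have "Lop q (nw A @ nw B) (\<lambda>ks. \<Sum>t\<le>s. g t * R (s - t) (chain_tensor q A B t 0) ks) ks = 0" for ks
  proof -
    let ?k = "kp_level q (wt B) (nl B) 0"
    have h: "homog (length (nw A @ nw B)) (nl A + t + (nl B + 0)) (chain_tensor q A B t 0)" for t
      using homog_chain_tensor[OF assms] by (metis length_append)
    have ps: "\<forall>x\<in>set (nw A @ nw B). 0 < x" using lwD(4)[OF assms(1)] lwD(4)[OF assms(2)] by auto
    \<comment> \<open>Written as a sum over one element, so that \<open>Rop_funpow_sum\<close> can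
      pull the scalar through the powers of the raising operator.\<close>
    have L0: "Lop q (nw A @ nw B) (chain_tensor q A B t 0) = (\<lambda>ks. \<Sum>i\<in>{()}. ?k * sig q (wt A) t * chain_tensor q A B (t - 1) 0 ks)" for t
      by (rule ext) (simp add: Lop_chain_tensor[OF assms])
    have T: "real (nl A + t + (nl B + 0)) + sum_list (nw A @ nw B) = wt A + wt B + real t" for t
      by (simp add: wt_def)
    have "Lop q (nw A @ nw B) (\<lambda>ks. \<Sum>t\<le>s. g t * R (s - t) (chain_tensor q A B t 0) ks) ks =
       (\<Sum>t<Suc s. g t * ((- 1) ^ (s - t) * ?k * sig q (wt A) t) * R (s - t) (chain_tensor q A B (t - 1) 0) ks)
       + (\<Sum>t<Suc s. g t * sig q (wt A + wt B + real t) (s - t) * R (s - t - 1) (chain_tensor q A B t 0) ks)"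
      unfolding R_def Lop_sum Lop_cmult Lop_Rop_funpow[OF h ps] L0 Rop_funpow_sum T
      by (simp add: distrib_left sum.distrib mult.assoc lessThan_Suc_atMost)
    also have "(\<Sum>t<Suc s. g t * ((- 1) ^ (s - t) * ?k * sig q (wt A) t) * R (s - t) (chain_tensor q A B (t - 1) 0) ks) =
       (\<Sum>t<s. g (Suc t) * ((- 1) ^ (s - Suc t) * ?k * sig q (wt A) (Suc t)) * R (s - Suc t) (chain_tensor q A B t 0) ks)"
      by (simp only: sum.lessThan_Suc_shift) simp
    also have "(\<Sum>t<Suc s. g t * sig q (wt A + wt B + real t) (s - t) * R (s - t - 1) (chain_tensor q A B t 0) ks) =
       (\<Sum>t<s. g t * sig q (wt A + wt B + real t) (s - t) * R (s - Suc t) (chain_tensor q A B t 0) ks)"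
      by simp
    also have "(\<Sum>t<s. g (Suc t) * ((- 1) ^ (s - Suc t) * ?k * sig q (wt A) (Suc t)) * R (s - Suc t) (chain_tensor q A B t 0) ks)
        + \<dots> = (\<Sum>t<s. 0)"
      unfolding sum.distrib[symmetric] distrib_right[symmetric]
    proof (rule sum.cong)
      fix t assume "t \<in> {..<s}"
      have "0 < sig q (wt A) (Suc t)" using lwD(5)[OF assms(1)] q by (intro sig_pos) auto
      moreover have "s - t = Suc (s - Suc t)" using \<open>t \<in> {..<s}\<close> by simp
      then have "(- 1 :: real) ^ (s - t) = - ((- 1) ^ (s - Suc t))" by simp
      moreover have "((- 1 :: real) ^ (s - Suc t)) * (- 1) ^ (s - Suc t) = 1"
        by (simp flip: power_mult_distrib)
      ultimately have "g (Suc t) * ((- 1) ^ (s - Suc t) * ?k * sig q (wt A) (Suc t)) = - g t * sig q (wt A + wt B + real t) (s - t)"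
        by (simp add: g_def raise_coeff_def field_simps)
      then show "(g (Suc t) * ((- 1) ^ (s - Suc t) * ?k * sig q (wt A) (Suc t)) + g t * sig q (wt A + wt B + real t) (s - t))
         * R (s - Suc t) (chain_tensor q A B t 0) ks = 0" by simp
    qed simp
    finally show ?thesis by simp
  qed
  then have "Lop q (nw A @ nw B) (\<lambda>ks. \<Sum>p\<le>s. d p * chain_tensor q A B p (s - p) ks) ks = 0" for ks
    unfolding z .
  note dp = comb_unique[OF assms this]
  have "d 0 = (\<Sum>t\<le>s. if t = 0 then g 0 * q powr (- (real s * wt A / 2)) else 0)"
    unfolding d_def by (rule sum.cong) (auto simp: e(2))
  also have "\<dots> = 1" using q by (simp add: g_def raise_coeff_def powr_add[symmetric])
  finally have "d p = couple_coeff q (wt A) (wt B) (nl B) s p" if "p \<le> s" for p using dp[OF that] by simp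
  then show ?thesis using z[of ks] by (simp add: g_def R_def)
qed

end

section \<open>Squared norms and three-factor overlaps as single pairings\<close>

definition couple_norm :: "real \<Rightarrow> real \<Rightarrow> real \<Rightarrow> nat \<Rightarrow> nat \<Rightarrow> real" where
  "couple_norm q \<mu> \<nu> e s = raise_coeff q \<mu> \<nu> e s s * couple_coeff q \<mu> \<nu> e s s * sigf q \<mu> s"

context
  fixes q :: real assumes q: "0 < q" "q < 1"
begin

lemma ip_lw_Rop:
  assumes "lw q V" "d = length (nw V)"
  shows "ip d N (nv V) (Rop q (nw V) x) = 0"
proof -
  have L0: "Lop q (nw V) (nv V) = (\<lambda>_. 0)" by (rule ext) (rule lwD(2)[OF assms(1)])
  show ?thesis
  proof (cases N)
    case 0
    then show ?thesis by (simp add: ip_def comps_def Rop_level_0)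
  next
    case (Suc M)
    have "ip d N (Rop q (nw V) x) (nv V) = 0"
      unfolding Suc assms(2) ip_adjoint L0 by simp
    then show ?thesis by (simp add: ip_commute[of _ _ "nv V"])
  qed
qed

lemma ip_lw_Rop_funpow:
  assumes "lw q V" "d = length (nw V)" "0 < m"
  shows "ip d N (nv V) ((Rop q (nw V) ^^ m) x) = 0"
proof -
  obtain k where "m = Suc k" using assms(3) by (cases m) auto
  then show ?thesis using ip_lw_Rop[OF assms(1,2)] by simp
qed

lemma ip_couple_top:
  assumes "lw q V" "lw q Y" "lw q C" "nw V = nw Y @ nw C" "d = length (nw V)"
  shows "ip d N (nv V) (nv (couple q Y C M)) =
    raise_coeff q (wt Y) (wt C) (nl C) M M * ip d N (nv V) (chain_tensor q Y C M 0)"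
proof -
  have "nv (couple q Y C M) = (\<lambda>ks. \<Sum>t\<le>M. raise_coeff q (wt Y) (wt C) (nl C) M t * (Rop q (nw V) ^^ (M - t)) (chain_tensor q Y C t 0) ks)"
    by (rule ext) (simp only: raise_coeff_expansion[OF q assms(2,3)] assms(4))
  then have "ip d N (nv V) (nv (couple q Y C M)) =
     (\<Sum>t\<le>M. raise_coeff q (wt Y) (wt C) (nl C) M t * ip d N (nv V) ((Rop q (nw V) ^^ (M - t)) (chain_tensor q Y C t 0)))"
    by (simp only: ip_sum_right)
  also have "\<dots> = (\<Sum>t\<le>M. if t = M then raise_coeff q (wt Y) (wt C) (nl C) M M * ip d N (nv V) (chain_tensor q Y C M 0) else 0)"
    by (rule sum.cong) (use ip_lw_Rop_funpow[OF assms(1,5)] in auto)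
  finally show ?thesis by simp
qed

lemma ip_couple_chain_tensor:
  assumes "lw q A" "lw q B" "d = length (nw A) + length (nw B)" "N = nl A + nl B + s" "p + r = s"
  shows "ip d N (nv (couple q A B s)) (chain_tensor q A B p r) =
    couple_coeff q (wt A) (wt B) (nl B) s p * (sigf q (wt A) p * sigf q (wt B) r * sq A * sq B)"
proof -
  have N: "N = nl A + nl B + p + r" using assms by simp
  have "ip d N (chain_tensor q A B p r) (nv (couple q A B s)) =
     (\<Sum>t\<le>s. if t = p then couple_coeff q (wt A) (wt B) (nl B) s p * (sigf q (wt A) p * sigf q (wt B) r * sq A * sq B) else 0)"
    unfolding couple_sel ip_sum_right
    by (rule sum.cong) (use assms(5) in \<open>auto simp: ip_chain_tensor_level[OF q assms(1,2,3) N]\<close>)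
  also have "\<dots> = couple_coeff q (wt A) (wt B) (nl B) s p * (sigf q (wt A) p * sigf q (wt B) r * sq A * sq B)"
    using assms(5) by simp
  finally show ?thesis by (simp only: ip_commute)
qed

text \<open>One copy of the coupled vector is expanded by \<open>raise_coeff_expansion\<close>;
  against the other copy only the top term survives. The squared norm is therefore a product, in
  place of the sum over p that occurs in \<open>lw_couple\<close>.\<close>

lemma sq_couple:
  assumes "lw q A" "lw q B"
  shows "sq (couple q A B s) = couple_norm q (wt A) (wt B) (nl B) s * sq A * sq B"
proof -
  have "sq (couple q A B s) = raise_coeff q (wt A) (wt B) (nl B) s s *
     ip (length (nw A @ nw B)) (nl A + nl B + s) (nv (couple q A B s)) (chain_tensor q A B s 0)"
    unfolding sq_def using ip_couple_top[OF lw_couple[OF q assms] assms, of s "length (nw A @ nw B)" "nl A + nl B + s" s]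
    by (simp only: couple_sel length_append)
  also have "ip (length (nw A @ nw B)) (nl A + nl B + s) (nv (couple q A B s)) (chain_tensor q A B s 0)
     = couple_coeff q (wt A) (wt B) (nl B) s s * (sigf q (wt A) s * sq A * sq B)"
    by (subst ip_couple_chain_tensor[OF assms]) simp_all
  finally show ?thesis by (simp add: couple_norm_def)
qed

lemma couple_norm_pos:
  assumes "lw q A" "lw q B" shows "0 < couple_norm q (wt A) (wt B) (nl B) s"
  using lwD(3)[OF lw_couple[OF q assms], of s] lwD(3)[OF assms(1)] lwD(3)[OF assms(2)]
  unfolding sq_couple[OF assms] by (simp add: zero_less_mult_iff)

text \<open>The vector A_+ (u \<otimes> c_r) is orthogonal to \<open>V\<close>, so its two terms
  pair to opposite values. This trades a raising operator on the factors \<open>gs\<close> for one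
  on the chain of \<open>C\<close>, at the price of minus the eigenvalue of K^(-1) divided by that
  of K P; the formula collects \<open>m\<close> such prices.\<close>

lemma ip_shift:
  assumes V: "lw q V" and C: "lw q C" and u: "homog (length gs) N0 u" and nwV: "nw V = gs @ nw C"
    and d: "d = length (nw V)"
  shows "ip d N (nv V) (tns (length gs) ((Rop q gs ^^ m) u) (ch q C r)) =
    (\<Prod>l<m. (- 1) ^ (nl C + r + l + 1)) * q powr (- (real m * (real N0 + sum_list gs + wt C + real m - 1 + real r) / 2))
     * ip d N (nv V) (tns (length gs) u (ch q C (r + m)))"
proof (induction m arbitrary: r)
  case 0 then show ?case using q by simp
next
  case (Suc m)
  define u' where "u' = (Rop q gs ^^ m) u"
  define T where "T = real N0 + sum_list gs"
  have hu': "homog (length gs) (N0 + m) u'" unfolding u'_def by (rule homog_Rop_funpow[OF q u])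
  have k: "kp q (sum_list (nw C)) (nl C + r) = kp_level q (wt C) (nl C) r" by (rule kp_kp_level)
  have R: "Rop q (nw V) (tns (length gs) u' (ch q C r)) ks =
     kp_level q (wt C) (nl C) r * tns (length gs) (Rop q gs u') (ch q C r) ks
     + q powr (- ((T + real m) / 2)) * tns (length gs) u' (ch q C (Suc r)) ks" for ks
    unfolding nwV op_tns(1)[OF q(1) hu' homog_ch[OF lwD(1)[OF C]]] k ch_Suc by (simp add: T_def add.commute add.left_commute)
  have "0 = ip d N (nv V) (Rop q (nw V) (tns (length gs) u' (ch q C r)))"
    using ip_lw_Rop[OF V d] by simp
  also have "\<dots> = kp_level q (wt C) (nl C) r * ip d N (nv V) (tns (length gs) (Rop q gs u') (ch q C r))
     + q powr (- ((T + real m) / 2)) * ip d N (nv V) (tns (length gs) u' (ch q C (Suc r)))"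
    unfolding R[abs_def] by (simp only: ip_add_right ip_cmult_right)
  finally have "ip d N (nv V) (tns (length gs) (Rop q gs u') (ch q C r)) =
     - (q powr (- ((T + real m) / 2)) / kp_level q (wt C) (nl C) r) * ip d N (nv V) (tns (length gs) u' (ch q C (Suc r)))"
    using kp_level_nonzero[OF q, of "wt C" "nl C" r] by (simp add: field_simps)
  also have "- (q powr (- ((T + real m) / 2)) / kp_level q (wt C) (nl C) r) =
     (- 1) ^ (nl C + r + 1) * q powr (- ((T + wt C + real m + real r) / 2))"
  proof -
    have "- ((T + wt C + real m + real r) / 2) = - ((T + real m) / 2) - (real r + wt C) / 2" by (simp add: field_simps)
    then have "q powr (- ((T + wt C + real m + real r) / 2)) = q powr (- ((T + real m) / 2)) / q powr ((real r + wt C) / 2)"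
      by (metis powr_diff)
    then show ?thesis by (cases "even (nl C + r)") (simp_all add: kp_level_def)
  qed
  also have "ip d N (nv V) (tns (length gs) u' (ch q C (Suc r))) =
     (\<Prod>l<m. (- 1) ^ (nl C + Suc r + l + 1)) * q powr (- (real m * (T + wt C + real m - 1 + real (Suc r)) / 2))
     * ip d N (nv V) (tns (length gs) u (ch q C (Suc r + m)))"
    unfolding u'_def T_def by (rule Suc)
  finally have "ip d N (nv V) (tns (length gs) (Rop q gs u') (ch q C r)) =
     ((- 1) ^ (nl C + r + 1) * (\<Prod>l<m. (- 1) ^ (nl C + Suc r + l + 1)))
     * (q powr (- ((T + wt C + real m + real r) / 2)) * q powr (- (real m * (T + wt C + real m - 1 + real (Suc r)) / 2)))
     * ip d N (nv V) (tns (length gs) u (ch q C (Suc r + m)))" by (simp only: mult_ac)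
  also have "(- 1) ^ (nl C + r + 1) * (\<Prod>l<m. (- 1 :: real) ^ (nl C + Suc r + l + 1)) = (\<Prod>l<Suc m. (- 1) ^ (nl C + r + l + 1))"
    by (subst prod.lessThan_Suc_shift) simp
  also have "q powr (- ((T + wt C + real m + real r) / 2)) * q powr (- (real m * (T + wt C + real m - 1 + real (Suc r)) / 2))
     = q powr (- (real (Suc m) * (T + wt C + real (Suc m) - 1 + real r) / 2))"
    unfolding powr_add[symmetric] by (rule arg_cong[where f = "\<lambda>x. q powr x"]) (simp add: field_simps)
  finally show ?case by (simp add: u'_def T_def add.assoc)
qed

text \<open>Since b_0 is a lowest-weight vector, lowering b_0 \<otimes> c_r changes only the second
  index. The raising operators of the chain of \<open>W\<close> can thus be moved over one at a
  time, until the pairing with the coupled vector itself is left.\<close>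

lemma ip_ch_chain_tensor_0:
  assumes W: "lw q W" "lw q B" "lw q C" "W = couple q B C n" "d = length (nw W)"
  shows "ip d (nl W + m) (ch q W m) (chain_tensor q B C 0 (n + m)) =
    q powr (- (real m * wt B / 2)) * sigf q (wt C) (n + m) * sq B * sq C"
proof (induction m)
  case 0
  show ?case using q ip_couple_chain_tensor[OF assms(2,3), of d "nl B + nl C + n" n 0 n] by (simp add: assms(4,5))
next
  case (Suc m)
  have L: "Lop q (nw W) (chain_tensor q B C 0 (n + Suc m)) = (\<lambda>ks. (q powr (- (wt B / 2)) * sig q (wt C) (Suc (n + m))) * chain_tensor q B C 0 (n + m) ks)"
    by (rule ext) (simp add: Lop_chain_tensor[OF q assms(2,3)] assms(4))
  have p: "q powr (- (wt B / 2)) * q powr (- (real m * wt B / 2)) = q powr (- (real (Suc m) * wt B / 2))"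
    unfolding powr_add[symmetric] by (rule arg_cong[where f = "\<lambda>x. q powr x"]) (simp add: field_simps)
  show ?case unfolding ch_Suc add_Suc_right[of "nl W"] assms(5) ip_adjoint L ip_cmult_right Suc[unfolded assms(5)]
    unfolding p[symmetric] add_Suc_right sigf_Suc by (simp only: mult_ac)
qed

text \<open>Each expansion is cut to what survives against \<open>V\<close>: the coupling of
  \<open>Y\<close> with \<open>C\<close> to the product of the chain vector y_(N-x) with c_0, then
  \<open>Y\<close> is written with A_+^(x-t) (a_t \<otimes> b_0), and \<open>ip_shift\<close> turns
  all raising operators into the index N - t on the chain of \<open>C\<close>. Regrouped as a_t
  \<otimes> (b_0 \<otimes> c_(N-t)), this meets only the term p = t of \<open>V\<close>, which
  exists for t \<le> N - n.\<close>

lemma ip_recoupling: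
  assumes A: "lw q A" and B: "lw q B" and C: "lw q C" and nx: "n \<le> N" "x \<le> N"
    and d: "d = length (nw A @ nw B @ nw C)" and L: "L = nl A + nl B + nl C + N"
  defines "V \<equiv> couple q A (couple q B C n) (N - n)" and "Y \<equiv> couple q A B x"
  shows "ip d L (nv V) (nv (couple q Y C (N - x))) =
    raise_coeff q (wt Y) (wt C) (nl C) (N - x) (N - x) *
    (\<Sum>t\<le>x. raise_coeff q (wt A) (wt B) (nl B) x t * ((\<Prod>l<N - t. (- 1) ^ (nl C + l + 1))
       * q powr (- (real (N - t) * (wt A + wt B + wt C + real N - 1) / 2)))
      * (if t \<le> N - n then couple_coeff q (wt A) (wt B + wt C + real n) (nl B + nl C + n) (N - n) t * sigf q (wt A) t
           * q powr (- (real (N - n - t) * wt B / 2)) * sigf q (wt C) (N - t) * sq A * sq B * sq C else 0))"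
proof -
  define W where "W = couple q B C n"
  define dA dB where "dA = length (nw A)" and "dB = length (nw B)"
  have W: "lw q W" unfolding W_def by (rule lw_couple[OF q B C])
  have V: "lw q V" unfolding V_def W_def[symmetric] by (rule lw_couple[OF q A W])
  have Y: "lw q Y" unfolding Y_def by (rule lw_couple[OF q A B])
  have nwV: "nw V = (nw A @ nw B) @ nw C" "nw V = nw Y @ nw C" by (simp_all add: V_def Y_def)
  have dV: "d = length (nw V)" by (simp add: d V_def)
  have "ip d L (nv V) (nv (couple q Y C (N - x))) =
     raise_coeff q (wt Y) (wt C) (nl C) (N - x) (N - x) * ip d L (nv V) (chain_tensor q Y C (N - x) 0)"
    by (rule ip_couple_top[OF V Y C nwV(2) dV])
  also have "ip d L (nv V) (chain_tensor q Y C (N - x) 0) =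
    (\<Sum>t\<le>x. raise_coeff q (wt A) (wt B) (nl B) x t
       * ip d L (nv V) (tns (length (nw A @ nw B)) ((Rop q (nw A @ nw B) ^^ (N - t)) (chain_tensor q A B t 0)) (ch q C 0)))"
  proof -
    have 1: "nv Y = (\<lambda>ks. \<Sum>t\<le>x. raise_coeff q (wt A) (wt B) (nl B) x t * (Rop q (nw A @ nw B) ^^ (x - t)) (chain_tensor q A B t 0) ks)"
      unfolding Y_def by (rule ext) (rule raise_coeff_expansion[OF q A B])
    have F1: "ch q Y (N - x) ks = (\<Sum>t\<le>x. raise_coeff q (wt A) (wt B) (nl B) x t
        * (Rop q (nw A @ nw B) ^^ (N - x)) ((Rop q (nw A @ nw B) ^^ (x - t)) (chain_tensor q A B t 0)) ks)" for ks
    proof -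
      have "nw Y = nw A @ nw B" by (simp add: Y_def)
      then show ?thesis unfolding ch_def 1 by (simp only: Rop_funpow_sum[OF q])
    qed
    have F2: "(Rop q (nw A @ nw B) ^^ (N - x)) ((Rop q (nw A @ nw B) ^^ (x - t)) (chain_tensor q A B t 0))
       = (Rop q (nw A @ nw B) ^^ (N - t)) (chain_tensor q A B t 0)" if "t \<le> x" for t
    proof -
      have "N - t = (N - x) + (x - t)" using that nx by simp
      then show ?thesis by (simp add: funpow_add)
    qed
    have 2: "ch q Y (N - x) ks = (\<Sum>t\<le>x. raise_coeff q (wt A) (wt B) (nl B) x t
        * (Rop q (nw A @ nw B) ^^ (N - t)) (chain_tensor q A B t 0) ks)" for ks
      unfolding F1 by (rule sum.cong) (simp_all add: F2)
    have "chain_tensor q Y C (N - x) 0 = (\<lambda>ks. \<Sum>t\<le>x. raise_coeff q (wt A) (wt B) (nl B) x t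
       * tns (length (nw A @ nw B)) ((Rop q (nw A @ nw B) ^^ (N - t)) (chain_tensor q A B t 0)) (ch q C 0) ks)"
      unfolding chain_tensor_def[of q Y] tns_def[of "length (nw Y)"] 2 by (simp add: Y_def tns_def sum_distrib_right mult.assoc)
    then show ?thesis by (simp only: ip_sum_right)
  qed
  also have "\<dots> = (\<Sum>t\<le>x. raise_coeff q (wt A) (wt B) (nl B) x t * ((\<Prod>l<N - t. (- 1) ^ (nl C + l + 1))
       * q powr (- (real (N - t) * (wt A + wt B + wt C + real N - 1) / 2)))
      * (if t \<le> N - n then couple_coeff q (wt A) (wt B + wt C + real n) (nl B + nl C + n) (N - n) t * sigf q (wt A) t
           * q powr (- (real (N - n - t) * wt B / 2)) * sigf q (wt C) (N - t) * sq A * sq B * sq C else 0))"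
  proof (rule sum.cong)
    fix t assume "t \<in> {..x}"
    then have t: "t \<le> N" using nx by simp
    have h: "homog (length (nw A @ nw B)) (nl A + t + (nl B + 0)) (chain_tensor q A B t 0)"
      using homog_chain_tensor[OF q A B] by (metis length_append)
    have e: "real (nl A + t + (nl B + 0)) + sum_list (nw A @ nw B) + wt C + real (N - t) - 1 + real 0 =
       wt A + wt B + wt C + real N - 1" using t by (simp add: wt_def of_nat_diff)
    have "ip d L (nv V) (tns (length (nw A @ nw B)) (chain_tensor q A B t 0) (ch q C (N - t))) =
      (if t \<le> N - n then couple_coeff q (wt A) (wt B + wt C + real n) (nl B + nl C + n) (N - n) t * sigf q (wt A) t
           * q powr (- (real (N - n - t) * wt B / 2)) * sigf q (wt C) (N - t) * sq A * sq B * sq C else 0)"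
    proof -
      have a: "tns (length (nw A @ nw B)) (chain_tensor q A B t 0) (ch q C (N - t)) = tns dA (ch q A t) (chain_tensor q B C 0 (N - t))"
        by (simp add: chain_tensor_def tns_assoc dA_def)
      have hA: "homog dA (nl A + p) (ch q A p)" for p unfolding dA_def by (rule homog_ch[OF lwD(1)[OF A]])
      have hW: "homog (length (nw W)) (nl W + p) (ch q W p)" for p by (rule homog_ch[OF lwD(1)[OF W]])
      have nlW: "nl W = nl B + nl C + n" and wtW: "wt W = wt B + wt C + real n" by (simp_all add: W_def)
      have lower_coeff: "d = dA + length (nw W)" by (simp add: d dA_def W_def)
      have "ip d L (nv V) (tns dA (ch q A t) (chain_tensor q B C 0 (N - t))) =
         (\<Sum>p\<le>N - n. couple_coeff q (wt A) (wt W) (nl W) (N - n) p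
            * ip d L (chain_tensor q A W p (N - n - p)) (tns dA (ch q A t) (chain_tensor q B C 0 (N - t))))"
        unfolding V_def W_def[symmetric] couple_sel(4) ip_sum_left ..
      also have "\<dots> = (\<Sum>p\<le>N - n. if p = t then couple_coeff q (wt A) (wt W) (nl W) (N - n) t *
           (sigf q (wt A) t * sq A * (q powr (- (real (N - n - t) * wt B / 2)) * sigf q (wt C) (N - t) * sq B * sq C)) else 0)"
      proof (rule sum.cong)
        fix p assume "p \<in> {..N - n}"
        then have p: "p \<le> N - n" by simp
        have Le: "L = (nl A + p) + (nl W + (N - n - p))" using p nx by (simp add: L nlW)
        have "ip d L (chain_tensor q A W p (N - n - p)) (tns dA (ch q A t) (chain_tensor q B C 0 (N - t))) =
           ip dA (nl A + p) (ch q A p) (ch q A t) * ip (length (nw W)) (nl W + (N - n - p)) (ch q W (N - n - p)) (chain_tensor q B C 0 (N - t))"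
          unfolding Le lower_coeff chain_tensor_def[of q A W] dA_def[symmetric] by (rule ip_tns[OF hA hW])
        also have "ip dA (nl A + p) (ch q A p) (ch q A t) = (if p = t then sigf q (wt A) t * sq A else 0)"
          using ip_ch[OF q A A refl refl, of p] ip_homog_ne(2)[OF hA[of t], where N = "nl A + p"]
          by (cases "p = t") (simp_all add: sq_def dA_def)
        finally have 1: "ip d L (chain_tensor q A W p (N - n - p)) (tns dA (ch q A t) (chain_tensor q B C 0 (N - t))) =
           (if p = t then sigf q (wt A) t * sq A else 0) * ip (length (nw W)) (nl W + (N - n - p)) (ch q W (N - n - p)) (chain_tensor q B C 0 (N - t))" .
        show "couple_coeff q (wt A) (wt W) (nl W) (N - n) p * ip d L (chain_tensor q A W p (N - n - p)) (tns dA (ch q A t) (chain_tensor q B C 0 (N - t)))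
          = (if p = t then couple_coeff q (wt A) (wt W) (nl W) (N - n) t *
           (sigf q (wt A) t * sq A * (q powr (- (real (N - n - t) * wt B / 2)) * sigf q (wt C) (N - t) * sq B * sq C)) else 0)"
        proof (cases "p = t")
          case True
          have "N - t = n + (N - n - t)" using p True nx by simp
          then show ?thesis unfolding 1 using True ip_ch_chain_tensor_0[OF W B C W_def refl, of "N - n - t"] by simp
        next
          case False
          then show ?thesis unfolding 1 by simp
        qed
      qed simp
      also have "\<dots> = (if t \<le> N - n then couple_coeff q (wt A) (wt W) (nl W) (N - n) t *
           (sigf q (wt A) t * sq A * (q powr (- (real (N - n - t) * wt B / 2)) * sigf q (wt C) (N - t) * sq B * sq C)) else 0)"
        by simp
      finally show ?thesis unfolding a by (simp add: nlW wtW mult_ac)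
    qed
    then show "raise_coeff q (wt A) (wt B) (nl B) x t
       * ip d L (nv V) (tns (length (nw A @ nw B)) ((Rop q (nw A @ nw B) ^^ (N - t)) (chain_tensor q A B t 0)) (ch q C 0)) =
      raise_coeff q (wt A) (wt B) (nl B) x t * ((\<Prod>l<N - t. (- 1) ^ (nl C + l + 1))
       * q powr (- (real (N - t) * (wt A + wt B + wt C + real N - 1) / 2)))
      * (if t \<le> N - n then couple_coeff q (wt A) (wt B + wt C + real n) (nl B + nl C + n) (N - n) t * sigf q (wt A) t
           * q powr (- (real (N - n - t) * wt B / 2)) * sigf q (wt C) (N - t) * sq A * sq B * sq C else 0)"
      unfolding ip_shift[OF V C h nwV(1) dV] e by simp
  qed simp
  finally show ?thesis .
qed

end

section \<open>Recoupling\<close>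

definition ov :: "node \<Rightarrow> node \<Rightarrow> real" where
  "ov A B = ip (length (nw A)) (nl A) (nv A) (nv B)"

definition nov :: "node \<Rightarrow> node \<Rightarrow> real" where
  "nov A B = ov A B / (sqrt (sq A) * sqrt (sq B))"

lemma ov_self: "ov A A = sq A"
  by (simp add: ov_def sq_def)

text \<open>By the lowest-weight condition, the inner products of \<open>a\<^sub>p \<otimes> b_(x - p)\<close> with a lowest-weight vector are these
  multiples of the one for \<open>p = 0\<close>.\<close>

definition lower_coeff :: "real \<Rightarrow> real \<Rightarrow> real \<Rightarrow> nat \<Rightarrow> nat \<Rightarrow> nat \<Rightarrow> real" where
  "lower_coeff q \<mu> \<nu> e x p = (\<Prod>u<p. - (q powr (- ((\<mu> + real u) / 2)) / kp_level q \<nu> e (x - Suc u)))"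

context
  fixes q :: real assumes q: "0 < q" "q < 1"
begin

lemma ov_level:
  assumes "lw q B" "nw B = nw A" "nl B \<noteq> nl A"
  shows "ov A B = 0"
  unfolding ov_def using assms lwD(1)[OF assms(1)] by (intro ip_homog_ne(2)[of _ "nl B"]) auto

lemma nov_self: "lw q A \<Longrightarrow> nov A A = 1"
  using lwD(3)[of q A] by (simp add: nov_def ov_self)

text \<open>Products of the two chains start at level \<open>nl A + nl B\<close>, so none lies on
  the level of \<open>y\<close>. Lowering maps such products to multiples of such products, which
  extends the claim from \<open>nv y\<close> to its whole chain.\<close>

lemma ip_chain_tensor_zero:
  assumes A: "lw q A" and B: "lw q B" and y: "lw q y" and nw: "nw y = nw A @ nw B" and lt: "nl y < nl A + nl B"
    and d: "d = length (nw y)"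
  shows "ip d N (chain_tensor q A B p r) (ch q y m) = 0"
proof (induction m arbitrary: N p r)
  case 0
  have h: "homog d (nl A + p + (nl B + r)) (chain_tensor q A B p r)" "homog d (nl y) (nv y)"
    using homog_chain_tensor[OF q A B] lwD(1)[OF y] by (simp_all add: d nw)
  then show ?case using ip_homog_ne(1)[OF h(1), of N] ip_homog_ne(2)[OF h(2), of N] lt
    by (cases "nl y = N") auto
next
  case (Suc m)
  show ?case
  proof (cases N)
    case 0
    then show ?thesis by (simp add: ip_def comps_def ch_Suc Rop_level_0)
  next
    case (Suc M)
    have "ip d N (ch q y (Suc m)) (chain_tensor q A B p r) = ip d M (ch q y m) (Lop q (nw A @ nw B) (chain_tensor q A B p r))"
      unfolding ch_Suc Suc d ip_adjoint nw ..
    also have "\<dots> = ip d M (\<lambda>ks. Lop q (nw A @ nw B) (chain_tensor q A B p r) ks) (ch q y m)" by (rule ip_commute)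
    also have "\<dots> = 0" unfolding Lop_chain_tensor[OF q A B] ip_add_left ip_cmult_left Suc.IH by simp
    finally show ?thesis by (simp add: ip_commute)
  qed
qed

lemma ip_chain_tensor_lw:
  assumes A: "lw q A" and B: "lw q B" and y: "lw q y" and nw: "nw y = nw A @ nw B" and d: "d = length (nw y)"
  shows "p \<le> x \<Longrightarrow> ip d N (chain_tensor q A B p (x - p)) (nv y) = lower_coeff q (wt A) (wt B) (nl B) x p * ip d N (chain_tensor q A B 0 x) (nv y)"
proof (induction p)
  case (Suc p)
  have s: "x - p = Suc (x - Suc p)" using Suc.prems by simp
  have "0 = ip d N (nv y) (\<lambda>ks. Rop q (nw A @ nw B) (chain_tensor q A B p (x - Suc p)) ks)"
    using ip_lw_Rop[OF q y d] by (simp add: nw)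
  also have "\<dots> = kp_level q (wt B) (nl B) (x - Suc p) * ip d N (nv y) (chain_tensor q A B (Suc p) (x - Suc p))
     + q powr (- ((wt A + real p) / 2)) * ip d N (nv y) (chain_tensor q A B p (x - p))"
    unfolding Rop_chain_tensor[OF q A B] ip_add_right ip_cmult_right s ..
  finally have "ip d N (chain_tensor q A B (Suc p) (x - Suc p)) (nv y) =
     - (q powr (- ((wt A + real p) / 2)) / kp_level q (wt B) (nl B) (x - Suc p)) * ip d N (chain_tensor q A B p (x - p)) (nv y)"
    using kp_level_nonzero[OF q, of "wt B" "nl B" "x - Suc p"] by (simp add: field_simps ip_commute[of d N "nv y"])
  then show ?case using Suc by (simp add: lower_coeff_def)
qed (simp add: lower_coeff_def)

text \<open>Multiplicity one. By \<open>ip_chain_tensor_lw\<close> the pairings of a lowest-weight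
  vector with all a_p \<otimes> b_(x-p) are fixed multiples of the pairing with a_0 \<otimes> b_x,
  so on the span of these products \<open>y\<close> and the coupled vector are proportional. Pairing
  with the coupled vector itself identifies the constant; the part of \<open>y\<close> orthogonal to
  the span never enters.\<close>

lemma ip_chain_tensor_prop:
  assumes A: "lw q A" and B: "lw q B" and y: "lw q y" and nw: "nw y = nw A @ nw B" and nl: "nl y = nl A + nl B + x"
    and d: "d = length (nw y)"
  shows "ip d N (chain_tensor q A B p r) (ch q y m) =
    ov (couple q A B x) y / sq (couple q A B x) * ip d N (chain_tensor q A B p r) (ch q (couple q A B x) m)"
proof -
  define Z where "Z = couple q A B x"
  have Z: "lw q Z" unfolding Z_def by (rule lw_couple[OF q A B])
  have nwZ: "nw Z = nw A @ nw B" "nl Z = nl y" by (simp_all add: Z_def nl)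
  define c where "c = ov Z y / sq Z"
  \<comment> \<open>The factor that converts the pairing with a_0 \<otimes> b_x into the pairing
    with \<open>Z\<close>. It is nonzero because \<open>sq Z\<close> is, and it cancels in the
    constant \<open>c\<close>.\<close>
  define S where "S = (\<Sum>p\<le>x. couple_coeff q (wt A) (wt B) (nl B) x p * lower_coeff q (wt A) (wt B) (nl B) x p)"
  define fy where "fy = ip d (nl y) (chain_tensor q A B 0 x) (nv y)"
  define fZ where "fZ = ip d (nl y) (chain_tensor q A B 0 x) (nv Z)"
  have o: "ip d (nl y) (nv Z) (nv w) = S * ip d (nl y) (chain_tensor q A B 0 x) (nv w)" if w: "lw q w" "nw w = nw A @ nw B" for w
  proof -
    have "ip d (nl y) (nv Z) (nv w) = (\<Sum>p\<le>x. couple_coeff q (wt A) (wt B) (nl B) x p * ip d (nl y) (chain_tensor q A B p (x - p)) (nv w))"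
      unfolding Z_def couple_sel(4) ip_sum_left ..
    also have "\<dots> = (\<Sum>p\<le>x. couple_coeff q (wt A) (wt B) (nl B) x p * lower_coeff q (wt A) (wt B) (nl B) x p * ip d (nl y) (chain_tensor q A B 0 x) (nv w))"
      by (rule sum.cong) (use d nw w in \<open>simp_all add: ip_chain_tensor_lw[OF A B w]\<close>)
    finally show ?thesis by (simp add: S_def sum_distrib_right)
  qed
  have "sq Z = S * fZ" using o[OF Z nwZ(1)] by (simp add: sq_def fZ_def nwZ d nw)
  moreover have "ov Z y = S * fy" using o[OF y nw] by (simp add: ov_def fy_def nwZ d nw)
  moreover have "sq Z \<noteq> 0" using lwD(3)[OF Z] by simp
  ultimately have fyc: "fy = c * fZ" by (simp add: c_def field_simps)
  have "ip d N (chain_tensor q A B p r) (ch q y m) = c * ip d N (chain_tensor q A B p r) (ch q Z m)"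
  proof (induction m arbitrary: N p r)
    case 0
    have hy: "homog d (nl y) (nv y)" and hZ: "homog d (nl y) (nv Z)"
      using lwD(1)[OF y] lwD(1)[OF Z] by (simp_all add: d nwZ nw)
    have ht: "homog d (nl A + p + (nl B + r)) (chain_tensor q A B p r)"
      using homog_chain_tensor[OF q A B] by (simp add: d nw)
    show ?case
    proof (cases "N = nl y \<and> p + r = x")
      case True
      then have p: "p \<le> x" "r = x - p" by auto
      show ?thesis using True fyc d nw nwZ ip_chain_tensor_lw[OF A B y nw d p(1), of N] ip_chain_tensor_lw[OF A B Z nwZ(1) _ p(1), of d N]
        by (simp add: p(2) fy_def fZ_def)
    next
      case False
      then consider "nl y \<noteq> N" | "nl A + p + (nl B + r) \<noteq> N" using nl by fastforce
      then show ?thesis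
        by cases (use ip_homog_ne(2)[OF hy, of N] ip_homog_ne(2)[OF hZ, of N] ip_homog_ne(1)[OF ht, of N] in auto)
    qed
  next
    case (Suc m)
    show ?case
    proof (cases N)
      case 0
      then show ?thesis by (simp add: ip_def comps_def ch_Suc Rop_level_0)
    next
      case (Suc M)
      have *: "ip d N (chain_tensor q A B p r) (ch q w (Suc m)) = kp_level q (wt B) (nl B) r * sig q (wt A) p * ip d M (chain_tensor q A B (p - 1) r) (ch q w m)
         + q powr (- ((wt A + real p) / 2)) * sig q (wt B) r * ip d M (chain_tensor q A B p (r - 1)) (ch q w m)"
        if w: "nw w = nw A @ nw B" for w
      proof -
        have dw: "d = length (nw w)" by (simp add: d nw w)
        have "ip d N (ch q w (Suc m)) (chain_tensor q A B p r) = ip d M (ch q w m) (Lop q (nw A @ nw B) (chain_tensor q A B p r))"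
          unfolding ch_Suc Suc dw ip_adjoint w ..
        also have "\<dots> = ip d M (\<lambda>ks. Lop q (nw A @ nw B) (chain_tensor q A B p r) ks) (ch q w m)" by (rule ip_commute)
        also have "\<dots> = kp_level q (wt B) (nl B) r * sig q (wt A) p * ip d M (chain_tensor q A B (p - 1) r) (ch q w m)
         + q powr (- ((wt A + real p) / 2)) * sig q (wt B) r * ip d M (chain_tensor q A B p (r - 1)) (ch q w m)"
          unfolding Lop_chain_tensor[OF q A B] ip_add_left ip_cmult_left ..
        finally show ?thesis by (simp add: ip_commute)
      qed
      show ?thesis unfolding *[OF nw] *[OF nwZ(1)] Suc.IH by (simp add: algebra_simps)
    qed
  qed
  then show ?thesis by (simp add: c_def Z_def)
qed

text \<open>The chain of B C consists of combinations of products of the chains of \<open>B\<close>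
  and \<open>C\<close>. Hence, after regrouping, the tree A (B C) involves the first two factors
  only through products a_p \<otimes> b_j, and a proportionality of pairings with those products
  carries over to the tree.\<close>

lemma recouple_expand:
  fixes A B C :: node and n s :: nat
  assumes A: "lw q A" and B: "lw q B" and C: "lw q C"
  defines "V \<equiv> couple q A (couple q B C n) s" and "d \<equiv> length (nw A @ nw B @ nw C)"
  assumes R: "\<And>N p r. ip (length (nw A @ nw B)) N (chain_tensor q A B p r) f = c * ip (length (nw A @ nw B)) N (chain_tensor q A B p r) g"
  shows "ip d L (nv V) (tns (length (nw A @ nw B)) f h) = c * ip d L (nv V) (tns (length (nw A @ nw B)) g h)"
proof -
  define W where "W = couple q B C n"
  have "\<forall>r. \<exists>e. ch q W r = (\<lambda>ks. \<Sum>p\<le>n + r. e p * chain_tensor q B C p (n + r - p) ks)"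
  proof
    fix r show "\<exists>e. ch q W r = (\<lambda>ks. \<Sum>p\<le>n + r. e p * chain_tensor q B C p (n + r - p) ks)"
      unfolding ch_def W_def couple_sel using Rop_funpow_comb[OF q B C, where m = r and n = n and e = "couple_coeff q (wt B) (wt C) (nl C) n"] by blast
  qed
  from choice[OF this] obtain e where e: "\<And>r. ch q W r = (\<lambda>ks. \<Sum>p\<le>n + r. e r p * chain_tensor q B C p (n + r - p) ks)" by blast
  have t: "chain_tensor q A W p r ks = (\<Sum>j\<le>n + r. e r j * tns (length (nw A @ nw B)) (chain_tensor q A B p j) (ch q C (n + r - j)) ks)" for p r ks
    unfolding chain_tensor_def[of q A W] tns_def[of "length (nw A)"] e
    by (simp add: chain_tensor_def tns_def sum_distrib_left take_drop drop_drop min_def mult_ac add.commute)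
  have b: "ip d L (tns (length (nw A @ nw B)) (chain_tensor q A B p j) (ch q C k)) (tns (length (nw A @ nw B)) f h) =
     c * ip d L (tns (length (nw A @ nw B)) (chain_tensor q A B p j) (ch q C k)) (tns (length (nw A @ nw B)) g h)" for p j k
  proof -
    have h1: "homog (length (nw A @ nw B)) (nl A + p + (nl B + j)) (chain_tensor q A B p j)"
      using homog_chain_tensor[OF q A B] by simp
    have h2: "homog (length (nw C)) (nl C + k) (ch q C k)" by (rule homog_ch[OF lwD(1)[OF C]])
    have de: "d = length (nw A @ nw B) + length (nw C)" by (simp add: d_def)
    show ?thesis
    proof (cases "L = (nl A + p + (nl B + j)) + (nl C + k)")
      case True
      show ?thesis unfolding True de ip_tns[OF h1 h2] R by simp
    next
      case False
      then show ?thesis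
        using ip_homog_ne(1)[OF homog_tns[OF h1 h2], of L] by (simp add: de)
    qed
  qed
  show ?thesis unfolding V_def W_def[symmetric] couple_sel(4) ip_sum_left t b
    by (simp add: sum_distrib_left mult_ac)
qed

lemma recouple_zero:
  assumes A: "lw q A" and B: "lw q B" and C: "lw q C" and y: "lw q y" and nw: "nw y = nw A @ nw B"
    and lt: "nl y < nl A + nl B"
  shows "ov (couple q A (couple q B C n) s) (couple q y C m) = 0"
proof -
  define V where "V = couple q A (couple q B C n) s"
  have V: "lw q V" unfolding V_def by (intro lw_couple q A B C)
  have "ov V (couple q y C m) = raise_coeff q (wt y) (wt C) (nl C) m m *
      ip (length (nw V)) (nl V) (nv V) (tns (length (nw A @ nw B)) (ch q y m) (nv C))"
    unfolding ov_def by (subst ip_couple_top[OF q V y C]) (simp_all add: V_def nw chain_tensor_def)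
  also have "ip (length (nw V)) (nl V) (nv V) (tns (length (nw A @ nw B)) (ch q y m) (nv C)) =
      0 * ip (length (nw V)) (nl V) (nv V) (tns (length (nw A @ nw B)) (ch q y m) (nv C))"
    unfolding V_def couple_sel(1)
    by (rule recouple_expand[OF A B C]) (use ip_chain_tensor_zero[OF A B y nw lt refl] nw in simp)
  finally show ?thesis by (simp add: V_def)
qed

text \<open>Removes the unknown vector \<open>y\<close> from the overlap, so that only the
  three-factor coefficient and a smaller overlap remain. Since \<open>y\<close> and the coupled
  vector have the same weight, coupling with \<open>C\<close> multiplies both squared norms by the
  same constant, which cancels.\<close>

lemma recouple:
  fixes A B C :: node and n s :: nat
  assumes A: "lw q A" and B: "lw q B" and C: "lw q C" and y: "lw q y" and nw: "nw y = nw A @ nw B"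
    and nl: "nl y = nl A + nl B + x"
  defines "V \<equiv> couple q A (couple q B C n) s"
  shows "nov V (couple q y C m) = nov (couple q A B x) y * nov V (couple q (couple q A B x) C m)"
proof -
  define Z where "Z = couple q A B x"
  have Z: "lw q Z" unfolding Z_def by (rule lw_couple[OF q A B])
  have V: "lw q V" unfolding V_def by (intro lw_couple q A B C)
  have wtZ: "wt Z = wt y" by (simp add: Z_def wt_def nw nl)
  have nwZ: "nw Z = nw A @ nw B" by (simp add: Z_def)
  have top: "ov V (couple q w C m) = raise_coeff q (wt w) (wt C) (nl C) m m *
      ip (length (nw V)) (nl V) (nv V) (tns (length (nw A @ nw B)) (ch q w m) (nv C))" if "lw q w" "nw w = nw A @ nw B" for w
    unfolding ov_def by (subst ip_couple_top[OF q V that(1) C]) (simp_all add: V_def that chain_tensor_def)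
  have "ip (length (nw V)) (nl V) (nv V) (tns (length (nw A @ nw B)) (ch q y m) (nv C)) =
      ov Z y / sq Z * ip (length (nw V)) (nl V) (nv V) (tns (length (nw A @ nw B)) (ch q Z m) (nv C))"
    unfolding V_def couple_sel(1) Z_def
    by (rule recouple_expand[OF A B C]) (use ip_chain_tensor_prop[OF A B y nw nl refl] nw in simp)
  then have o: "ov V (couple q y C m) = ov Z y / sq Z * ov V (couple q Z C m)"
    unfolding top[OF y nw] top[OF Z nwZ] wtZ by simp
  define K where "K = couple_norm q (wt y) (wt C) (nl C) m"
  have K: "0 < K" unfolding K_def by (rule couple_norm_pos[OF q y C])
  have s: "sq (couple q y C m) = K * sq y * sq C" "sq (couple q Z C m) = K * sq Z * sq C"
    using sq_couple[OF q y C] sq_couple[OF q Z C] by (simp_all add: K_def wtZ)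
  have pos: "0 < sqrt K" "0 < sqrt (sq y)" "0 < sqrt (sq C)" "0 < sqrt (sq Z)" "0 < sqrt (sq V)"
    using K lwD(3)[OF y] lwD(3)[OF C] lwD(3)[OF Z] lwD(3)[OF V] by simp_all
  have "sq Z = sqrt (sq Z) * sqrt (sq Z)" using lwD(3)[OF Z] by simp
  then have o': "ov V (couple q y C m) = ov Z y / (sqrt (sq Z) * sqrt (sq Z)) * ov V (couple q Z C m)" using o by simp
  show ?thesis unfolding Z_def[symmetric] nov_def o' s real_sqrt_mult using pos by (simp add: field_simps)
qed

text \<open>By \<open>ip_ch\<close> and \<open>ip_ch_ne\<close> the two chains meet only for equal
  exponents and equal starting levels. The factor they then contribute to the overlap is the same as
  in both squared norms.\<close>

lemma nov_couple:
  assumes v: "lw q v" and v': "lw q v'" and C: "lw q C" and nw: "nw v' = nw v"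
  shows "nov (couple q v C s) (couple q v' C s') = (if s = s' then nov v v' else 0)"
proof -
  define d where "d = length (nw v) + length (nw C)"
  have lws: "lw q (couple q v C s)" by (rule lw_couple[OF q v C])
  have i1: "ip (length (nw v)) (nl v + s) (ch q v s) (ch q v' s') = (if s = s' then sigf q (wt v) s * ov v v' else 0)"
  proof (cases "nl v' = nl v")
    case True
    show ?thesis
    proof (cases "s = s'")
      case 1: True then show ?thesis using ip_ch[OF q v v' nw True, of s] by (simp add: ov_def)
    next
      case False
      then show ?thesis
        using ip_homog_ne(2)[OF homog_ch[OF lwD(1)[OF v'], where p = s' and q = q], where N = "nl v + s"] nw True by simp
    qed
  next
    case False
    then show ?thesis using ip_ch_ne[OF q v v' nw] ov_level[OF v' nw] by simp
  qed
  have "ov (couple q v C s) (couple q v' C s') = raise_coeff q (wt v') (wt C) (nl C) s' s' *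
      ip d (nl v + nl C + s) (nv (couple q v C s)) (chain_tensor q v' C s' 0)"
    unfolding ov_def by (subst ip_couple_top[OF q lws v' C]) (simp_all add: nw d_def)
  also have "ip d (nl v + nl C + s) (nv (couple q v C s)) (chain_tensor q v' C s' 0) =
     (\<Sum>p\<le>s. couple_coeff q (wt v) (wt C) (nl C) s p * ip d (nl v + nl C + s) (chain_tensor q v C p (s - p)) (chain_tensor q v' C s' 0))"
    unfolding couple_sel(4) ip_sum_left ..
  also have "\<dots> = (\<Sum>p\<le>s. if p = s then couple_coeff q (wt v) (wt C) (nl C) s s * (if s = s' then sigf q (wt v) s * ov v v' else 0) * sq C else 0)"
  proof (rule sum.cong)
    fix p assume "p \<in> {..s}"
    then have N: "nl v + nl C + s = (nl v + p) + (nl C + (s - p))" by simp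
    have "ip d (nl v + nl C + s) (chain_tensor q v C p (s - p)) (chain_tensor q v' C s' 0) =
      ip (length (nw v)) (nl v + p) (ch q v p) (ch q v' s') * ip (length (nw C)) (nl C + (s - p)) (ch q C (s - p)) (nv C)"
      unfolding chain_tensor_def nw d_def N
      using ip_tns[OF homog_ch[OF lwD(1)[OF v], where p = p] homog_ch[OF lwD(1)[OF C], where p = "s - p"]] by simp
    also have "ip (length (nw C)) (nl C + (s - p)) (ch q C (s - p)) (nv C) = (if p = s then sq C else 0)"
      using ip_homog_ne(2)[OF lwD(1)[OF C], where N = "nl C + (s - p)"] \<open>p \<in> {..s}\<close> by (auto simp: sq_def)
    finally show "couple_coeff q (wt v) (wt C) (nl C) s p * ip d (nl v + nl C + s) (chain_tensor q v C p (s - p)) (chain_tensor q v' C s' 0) =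
      (if p = s then couple_coeff q (wt v) (wt C) (nl C) s s * (if s = s' then sigf q (wt v) s * ov v v' else 0) * sq C else 0)"
      using i1 by auto
  qed simp
  finally have o: "ov (couple q v C s) (couple q v' C s') = raise_coeff q (wt v') (wt C) (nl C) s' s' *
     (couple_coeff q (wt v) (wt C) (nl C) s s * (if s = s' then sigf q (wt v) s * ov v v' else 0) * sq C)" by simp
  show ?thesis
  proof (cases "s = s' \<and> nl v' = nl v")
    case False
    then show ?thesis using o ov_level[OF v' nw] by (auto simp: nov_def)
  next
    case True
    then have w: "wt v' = wt v" by (simp add: wt_def nw)
    define K where "K = couple_norm q (wt v) (wt C) (nl C) s"
    have K: "0 < K" unfolding K_def by (rule couple_norm_pos[OF q v C])
    have "ov (couple q v C s) (couple q v' C s') = K * ov v v' * sq C" using o True by (simp add: w K_def couple_norm_def)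
    moreover have "sq (couple q v C s) = K * sq v * sq C" "sq (couple q v' C s') = K * sq v' * sq C"
      using sq_couple[OF q v C] sq_couple[OF q v' C] True by (simp_all add: K_def w)
    moreover have "sqrt K * sqrt K = K" "sqrt (sq C) * sqrt (sq C) = sq C" using K lwD(3)[OF C] by simp_all
    ultimately show ?thesis using True K lwD(3)[OF C] lwD(3)[OF v] lwD(3)[OF v']
      by (simp add: nov_def real_sqrt_mult field_simps)
  qed
qed

end

section \<open>Saalschuetz summation and Sears transformation\<close>

lemma qpoch_0 [simp]: "qpoch a Q 0 = 1"
  by (simp add: qpoch_def)

lemma qpoch_Suc: "qpoch a Q (Suc m) = qpoch a Q m * (1 - a * Q ^ m)"
  by (simp add: qpoch_def)

lemma qpoch_add: "qpoch a Q (m + k) = qpoch a Q m * qpoch (a * Q ^ m) Q k"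
  by (induction k) (simp_all add: qpoch_Suc power_add mult.assoc)

lemma qpoch_Suc_left: "qpoch a Q (Suc m) = (1 - a) * qpoch (a * Q) Q m"
  using qpoch_add[of a Q 1 m] by (simp add: qpoch_def)

lemma qpoch_nonzero: "(\<And>k. k < m \<Longrightarrow> a * Q ^ k \<noteq> 1) \<Longrightarrow> qpoch a Q m \<noteq> 0"
  by (auto simp: qpoch_def)

lemma qpoch_nonzeroD: "qpoch a Q m \<noteq> 0 \<Longrightarrow> k < m \<Longrightarrow> a * Q ^ k \<noteq> 1"
  by (auto simp: qpoch_def)

lemma qpoch_nonzero_mono: "qpoch a Q m \<noteq> 0 \<Longrightarrow> k \<le> m \<Longrightarrow> qpoch a Q k \<noteq> 0"
  by (rule qpoch_nonzero) (metis qpoch_nonzeroD order_less_le_trans)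

definition qbin :: "real \<Rightarrow> nat \<Rightarrow> nat \<Rightarrow> real" where
  "qbin Q n k = qpoch Q Q n / (qpoch Q Q k * qpoch Q Q (n - k))"

context
  fixes Q :: real assumes Q: "\<And>k. Q ^ Suc k \<noteq> 1" and Q0: "Q \<noteq> 0"
begin

lemma qpoch_Q_nonzero [simp]: "qpoch Q Q m \<noteq> 0"
  by (rule qpoch_nonzero) (use Q in \<open>simp add: mult.commute\<close>)

lemma one_minus_Q_nonzero: "0 < k \<Longrightarrow> 1 - Q ^ k \<noteq> 0"
  using Q[of "k - 1"] by simp

lemma qbin_0: "qbin Q n 0 = 1" and qbin_n: "qbin Q n n = 1"
  by (simp_all add: qbin_def)

lemma qbin_step: "k < n \<Longrightarrow> qbin Q n (Suc k) * (1 - Q ^ Suc k) = qbin Q n k * (1 - Q ^ (n - k))"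
proof -
  assume k: "k < n"
  then have e: "n - k = Suc (n - Suc k)" by simp
  show ?thesis unfolding qbin_def e qpoch_Suc[of Q Q k] qpoch_Suc[of Q Q "n - Suc k"]
    using one_minus_Q_nonzero[of "Suc k"] one_minus_Q_nonzero[of "Suc (n - Suc k)"]
    by (simp add: field_simps)
qed

lemma qbin_Pascal: "k < n \<Longrightarrow> qbin Q (Suc n) (Suc k) = qbin Q n (Suc k) + Q ^ (n - k) * qbin Q n k"
proof -
  assume k: "k < n"
  define j where "j = n - Suc k"
  have n: "n = Suc (k + j)" using k by (simp add: j_def)
  define X where "X = 1 - Q ^ Suc k"
  define Y where "Y = 1 - Q ^ Suc j"
  have nz: "X \<noteq> 0" "Y \<noteq> 0" using one_minus_Q_nonzero by (simp_all add: X_def Y_def del: power_Suc)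
  have s: "Suc n - Suc k = Suc j" "n - Suc k = j" "n - k = Suc j" by (simp_all add: n)
  have e1: "1 - Q * Q ^ n = Y + (1 - Y) * X" by (simp add: X_def Y_def n power_add algebra_simps)
  have e2: "Q ^ Suc j = 1 - Y" by (simp add: Y_def)
  have p: "qpoch Q Q (Suc n) = qpoch Q Q n * (1 - Q * Q ^ n)" "qpoch Q Q (Suc k) = qpoch Q Q k * X"
     "qpoch Q Q (Suc j) = qpoch Q Q j * Y" by (simp_all add: qpoch_Suc X_def Y_def)
  show ?thesis unfolding qbin_def s p e1 e2 using nz
    by (simp add: field_simps)
qed

text \<open>Induction on \<open>n\<close>: with \<open>c = a b z\<close>, the difference of the two sides of the recursion in \<open>n\<close>
  telescopes.\<close>

lemma saalschutz:
  assumes "\<And>k. k < n \<Longrightarrow> a * b * z * Q ^ k \<noteq> 1"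
  shows "(\<Sum>k\<le>n. qbin Q n k * qpoch a Q k * qpoch b Q k * qpoch (a * b * z * Q ^ k) Q (n - k) * qpoch z Q (n - k) * z ^ k)
    = qpoch (a * z) Q n * qpoch (b * z) Q n"
  using assms
proof (induction n)
  case 0 then show ?case by (simp add: qbin_0)
next
  case (Suc n)
  define c where "c = a * b * z"
  define N where "N = Q ^ n"
  \<comment> \<open>The common part of the terms for n and n + 1; \<open>A1\<close> and
    \<open>A2\<close> are the two contributions to the new term under Pascal's rule.\<close>
  define m where "m = (\<lambda>k. qbin Q n k * qpoch a Q k * qpoch b Q k * qpoch (c * Q ^ Suc k) Q (n - k) * qpoch z Q (n - k) * z ^ k)"
  define T where "T = (\<lambda>n k. qbin Q n k * qpoch a Q k * qpoch b Q k * qpoch (c * Q ^ k) Q (n - k) * qpoch z Q (n - k) * z ^ k)"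
  \<comment> \<open>The telescoping certificate. It vanishes at 0 through the factor 1 - Q^0 and is
    set to 0 beyond n, so that no boundary term is left.\<close>
  define G where "G = (\<lambda>k. if k \<le> n then (1 - Q ^ k) * qbin Q n k * qpoch a Q k * qpoch b Q k * qpoch (c * Q ^ k) Q (Suc (n - k))
     * qpoch z Q (Suc (n - k)) * z ^ k else 0)"
  have cN: "1 - c * N \<noteq> 0" using Suc.prems[of n] by (simp add: c_def N_def)
  have Tm: "T n k * (1 - c * N) = m k * (1 - c * Q ^ k)" if "k \<le> n" for k
  proof -
    have "qpoch (c * Q ^ k) Q (Suc (n - k)) = qpoch (c * Q ^ k) Q (n - k) * (1 - c * N)"
      using that by (simp add: qpoch_Suc N_def power_add[symmetric] mult.assoc)
    moreover have "qpoch (c * Q ^ k) Q (Suc (n - k)) = (1 - c * Q ^ k) * qpoch (c * Q ^ Suc k) Q (n - k)"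
      by (simp add: qpoch_Suc_left mult_ac)
    ultimately have "qpoch (c * Q ^ k) Q (n - k) * (1 - c * N) = (1 - c * Q ^ k) * qpoch (c * Q ^ Suc k) Q (n - k)" by simp
    then show ?thesis by (simp add: T_def m_def mult_ac)
  qed
  have zs: "qpoch z Q (Suc (n - k)) = qpoch z Q (n - k) * (1 - z * Q ^ (n - k))" for k by (simp add: qpoch_Suc)
  have cs: "qpoch (c * Q ^ k) Q (Suc (n - k)) = (1 - c * Q ^ k) * qpoch (c * Q ^ Suc k) Q (n - k)" for k
      by (simp add: qpoch_Suc_left mult_ac)
  have as: "qpoch a Q (Suc k) = qpoch a Q k * (1 - a * Q ^ k)" "qpoch b Q (Suc k) = qpoch b Q k * (1 - b * Q ^ k)" for k
    by (simp_all add: qpoch_Suc)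
  define A1 where "A1 = (\<lambda>k. if k \<le> n then m k * ((1 - c * Q ^ k) * (1 - z * Q ^ (n - k))) else 0)"
  define A2 where "A2 = (\<lambda>k. m k * ((1 - a * Q ^ k) * (1 - b * Q ^ k) * z * Q ^ (n - k)))"
  have "(\<Sum>k\<le>Suc n. T (Suc n) k) = T (Suc n) 0 + (\<Sum>k\<le>n. T (Suc n) (Suc k))"
    by (rule sum.atMost_Suc_shift)
  also have "T (Suc n) 0 = A1 0" by (simp add: T_def A1_def m_def qbin_0 qpoch_Suc_left[of c] qpoch_Suc[of z] mult_ac)
  also have "(\<Sum>k\<le>n. T (Suc n) (Suc k)) = (\<Sum>k\<le>n. A1 (Suc k) + A2 k)"
  proof (rule sum.cong)
    fix k assume "k \<in> {..n}"
    then consider "k < n" | "k = n" by force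
    then show "T (Suc n) (Suc k) = A1 (Suc k) + A2 k"
    proof cases
      case 1
      then have e: "Suc (n - Suc k) = n - k" by simp
      have "T (Suc n) (Suc k) = qbin Q (Suc n) (Suc k) * (qpoch a Q (Suc k) * qpoch b Q (Suc k) * qpoch (c * Q ^ Suc k) Q (n - k) * qpoch z Q (n - k) * z ^ Suc k)"
        by (simp add: T_def mult_ac)
      also have "\<dots> = qbin Q n (Suc k) * (qpoch a Q (Suc k) * qpoch b Q (Suc k) * qpoch (c * Q ^ Suc k) Q (Suc (n - Suc k)) * qpoch z Q (Suc (n - Suc k)) * z ^ Suc k)
         + Q ^ (n - k) * qbin Q n k * (qpoch a Q (Suc k) * qpoch b Q (Suc k) * qpoch (c * Q ^ Suc k) Q (n - k) * qpoch z Q (n - k) * z ^ Suc k)"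
        unfolding qbin_Pascal[OF 1] e by (simp only: distrib_right)
      also have "\<dots> = A1 (Suc k) + A2 k"
        unfolding cs zs as A2_def m_def using 1 by (simp add: A1_def m_def as mult_ac)
      finally show ?thesis .
    next
      case 2
      then show ?thesis by (simp add: T_def A1_def A2_def m_def qbin_n as mult_ac)
    qed
  qed simp
  also have "A1 0 + \<dots> = (\<Sum>k\<le>n. A1 k + A2 k)"
  proof -
    have "A1 0 + (\<Sum>k\<le>n. A1 (Suc k)) = (\<Sum>k\<le>Suc n. A1 k)" by (rule sum.atMost_Suc_shift[symmetric])
    also have "\<dots> = (\<Sum>k\<le>n. A1 k)" by (simp add: A1_def)
    finally show ?thesis by (simp add: sum.distrib)
  qed
  finally have S1: "(\<Sum>k\<le>Suc n. T (Suc n) k) = (\<Sum>k\<le>n. A1 k + A2 k)" .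
  \<comment> \<open>Up to the factor \<open>m k\<close> this is a polynomial identity in a, b, z,
    Q^k and Q^(n-k).\<close>
  have key: "(A1 k + A2 k) * (1 - c * N) = (1 - a * z * N) * (1 - b * z * N) * (T n k * (1 - c * N)) + c * N * (G (Suc k) - G k)"
    if k: "k \<le> n" for k
  proof -
    define y where "y = Q ^ k"
    define w where "w = Q ^ (n - k)"
    have N: "N = y * w" using k by (simp add: N_def y_def w_def power_add[symmetric])
    have G1: "G (Suc k) = m k * ((1 - w) * (1 - a * y) * (1 - b * y) * z)"
    proof (cases "k < n")
      case True
      then have e: "Suc (n - Suc k) = n - k" by simp
      have "G (Suc k) = (qbin Q n (Suc k) * (1 - Q ^ Suc k)) * (qpoch a Q (Suc k) * qpoch b Q (Suc k) * qpoch (c * Q ^ Suc k) Q (n - k)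
          * qpoch z Q (n - k) * z ^ Suc k)"
        using True by (simp only: G_def e Suc_leI[OF True] if_True mult_ac)
      then show ?thesis unfolding qbin_step[OF True] as by (simp add: m_def w_def y_def mult_ac)
    next
      case False
      then show ?thesis using k by (simp add: G_def w_def)
    qed
    have G0: "G k = m k * ((1 - y) * (1 - c * y) * (1 - z * w))"
      unfolding G_def cs zs using k by (simp add: m_def y_def w_def mult_ac)
    have "A1 k + A2 k = m k * ((1 - c * y) * (1 - z * w) + (1 - a * y) * (1 - b * y) * z * w)"
      using k by (simp add: A1_def A2_def y_def w_def distrib_left)
    moreover have "((1 - c * y) * (1 - z * w) + (1 - a * y) * (1 - b * y) * z * w) * (1 - c * N) =
       (1 - a * z * N) * (1 - b * z * N) * (1 - c * y) + c * N * ((1 - w) * (1 - a * y) * (1 - b * y) * z - (1 - y) * (1 - c * y) * (1 - z * w))"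
      unfolding N c_def by algebra
    moreover have "X * D = P * Y + E * (U - V) \<Longrightarrow> M * X * D = P * (M * Y) + E * (M * U - M * V)"
      for X D P Y E U V M :: real by algebra
    ultimately show ?thesis unfolding Tm[OF k] G0 G1 y_def[symmetric] by presburger
  qed
  have tel: "(\<Sum>k\<le>n. G (Suc k) - G k) = 0"
    by (simp add: sum_lessThan_telescope lessThan_Suc_atMost[symmetric] del: sum.lessThan_Suc) (simp add: G_def)
  have "(\<Sum>k\<le>Suc n. T (Suc n) k) * (1 - c * N) = (1 - a * z * N) * (1 - b * z * N) * ((\<Sum>k\<le>n. T n k) * (1 - c * N))"
  proof -
    have "(\<Sum>k\<le>Suc n. T (Suc n) k) * (1 - c * N) = (\<Sum>k\<le>n. (A1 k + A2 k) * (1 - c * N))"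
      unfolding S1 sum_distrib_right ..
    also have "\<dots> = (\<Sum>k\<le>n. (1 - a * z * N) * (1 - b * z * N) * (T n k * (1 - c * N)) + c * N * (G (Suc k) - G k))"
      by (rule sum.cong) (simp_all add: key)
    also have "\<dots> = (1 - a * z * N) * (1 - b * z * N) * (\<Sum>k\<le>n. T n k * (1 - c * N))"
      by (simp only: sum.distrib sum_distrib_left[symmetric] tel mult_zero_right add_0_right)
    finally show ?thesis unfolding sum_distrib_right .
  qed
  then have "(\<Sum>k\<le>Suc n. T (Suc n) k) = (1 - a * z * N) * (1 - b * z * N) * (\<Sum>k\<le>n. T n k)"
    using cN by (metis mult.assoc mult_right_cancel)
  also have "(\<Sum>k\<le>n. T n k) = qpoch (a * z) Q n * qpoch (b * z) Q n"
    unfolding T_def c_def by (rule Suc.IH) (use Suc.prems in simp)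
  finally show ?case by (simp add: T_def c_def qpoch_Suc N_def mult_ac)
qed

text \<open>The last k factors are reversed by 1 - u Q^j = - u Q^j (1 - Q^(-j) / u).\<close>

lemma qpoch_rev:
  assumes "u \<noteq> 0" "k \<le> x"
  shows "qpoch u Q x = qpoch u Q (x - k) * (qpoch (Q powi (1 - int x) / u) Q k * (\<Prod>i<k. - (u * Q ^ (x - Suc i))))"
  using assms(2)
proof (induction k)
  case (Suc k)
  have e: "x - k = Suc (x - Suc k)" using Suc.prems by simp
  have "Q powi (1 - int x) * Q ^ k * Q ^ (x - Suc k) = Q powi (1 - int x + int k + int (x - Suc k))"
    using Q0 by (simp add: power_int_add)
  also have "1 - int x + int k + int (x - Suc k) = 0" using Suc.prems by simp
  finally have "Q powi (1 - int x) * Q ^ k * Q ^ (x - Suc k) = 1" by simp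
  then have F: "(1 - Q powi (1 - int x) / u * Q ^ k) * - (u * Q ^ (x - Suc k)) = 1 - u * Q ^ (x - Suc k)"
    using assms(1) by (simp add: field_simps)
  have "qpoch u Q x = qpoch u Q (x - Suc k) * (1 - u * Q ^ (x - Suc k))
      * (qpoch (Q powi (1 - int x) / u) Q k * (\<Prod>i<k. - (u * Q ^ (x - Suc i))))"
    using Suc unfolding e qpoch_Suc[of u Q "x - Suc k"] by simp
  then show ?case unfolding qpoch_Suc[of _ _ k] prod.lessThan_Suc F[symmetric] by (simp only: mult_ac)
qed simp

end

section \<open>The classical form of Saalschuetz's sum and the terminating Sears
  transformation\<close>

lemma sum_triangle_shift:
  fixes F :: "nat \<Rightarrow> nat \<Rightarrow> real"
  shows "(\<Sum>t\<le>x. \<Sum>k\<le>t. F t k) = (\<Sum>k\<le>x. \<Sum>m\<le>x - k. F (k + m) k)"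
proof (induction x)
  case (Suc x)
  have "(\<Sum>k\<le>Suc x. \<Sum>m\<le>Suc x - k. F (k + m) k) = (\<Sum>k\<le>x. \<Sum>m\<le>Suc x - k. F (k + m) k) + F (Suc x) (Suc x)"
    by simp
  also have "(\<Sum>k\<le>x. \<Sum>m\<le>Suc x - k. F (k + m) k) = (\<Sum>k\<le>x. (\<Sum>m\<le>x - k. F (k + m) k) + F (Suc x) k)"
    by (rule sum.cong) (auto simp: Suc_diff_le)
  finally show ?case using Suc by (simp add: sum.distrib)
qed simp

context
  fixes Q :: real assumes Q: "\<And>k. Q ^ Suc k \<noteq> 1" and Q0: "Q \<noteq> 0"
begin

lemma qpoch_rev_Q:
  assumes "k \<le> n"
  shows "qpoch Q Q n = qpoch Q Q (n - k) * (qpoch (Q powi (- int n)) Q k * (\<Prod>i<k. - (Q * Q ^ (n - Suc i))))"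
proof -
  have "Q powi (1 - int n) / Q = Q powi (- int n)" using Q0 power_int_diff[of Q "1 - int n" 1] by simp
  then show ?thesis using qpoch_rev[OF Q Q0 Q0 assms] by simp
qed

text \<open>\<open>saalschutz\<close> divided by two full shifted factorials; reversal turns the
  factors of length n - m into the upper parameter Q^(-n) and the lower parameter Q^(1-n) /
  z.\<close>

lemma saalschutz_classical:
  assumes z: "z \<noteq> 0" "qpoch z Q n \<noteq> 0" and c: "qpoch (a * b * z) Q n \<noteq> 0"
  shows "(\<Sum>m\<le>n. qpoch (Q powi (- int n)) Q m * qpoch a Q m * qpoch b Q m * Q ^ m
      / (qpoch Q Q m * qpoch (a * b * z) Q m * qpoch (Q powi (1 - int n) / z) Q m))
    = qpoch (a * z) Q n * qpoch (b * z) Q n / (qpoch (a * b * z) Q n * qpoch z Q n)"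
proof -
  have "(\<Sum>m\<le>n. qpoch (Q powi (- int n)) Q m * qpoch a Q m * qpoch b Q m * Q ^ m
      / (qpoch Q Q m * qpoch (a * b * z) Q m * qpoch (Q powi (1 - int n) / z) Q m)) =
    (\<Sum>k\<le>n. qbin Q n k * qpoch a Q k * qpoch b Q k * qpoch (a * b * z * Q ^ k) Q (n - k) * qpoch z Q (n - k) * z ^ k)
     / (qpoch (a * b * z) Q n * qpoch z Q n)"
    unfolding sum_divide_distrib
  proof (rule sum.cong)
    fix m assume "m \<in> {..n}"
    then have m: "m \<le> n" by simp
    define PQ where "PQ = (\<Prod>i<m. - (Q * Q ^ (n - Suc i)))"
    have PQ: "PQ \<noteq> 0" using Q0 by (simp add: PQ_def)
    have "(\<Prod>i<m. - (z * Q ^ (n - Suc i))) = (\<Prod>i<m. z / Q * - (Q * Q ^ (n - Suc i)))"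
      using Q0 by simp
    then have Pz: "(\<Prod>i<m. - (z * Q ^ (n - Suc i))) = (z / Q) ^ m * PQ"
      unfolding PQ_def prod.distrib by simp
    have rz: "qpoch z Q n = qpoch z Q (n - m) * (qpoch (Q powi (1 - int n) / z) Q m * ((z / Q) ^ m * PQ))"
      using qpoch_rev[OF Q Q0 z(1) m] by (simp add: Pz)
    have rQ: "qpoch Q Q n = qpoch Q Q (n - m) * (qpoch (Q powi (- int n)) Q m * PQ)"
      using qpoch_rev_Q[OF m] by (simp add: PQ_def)
    have cs: "qpoch (a * b * z) Q n = qpoch (a * b * z) Q m * qpoch (a * b * z * Q ^ m) Q (n - m)"
      using qpoch_add[of "a * b * z" Q m "n - m"] m by simp
    define X1 where "X1 = qpoch (Q powi (- int n)) Q m"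
    define X2 where "X2 = qpoch (Q powi (1 - int n) / z) Q m"
    define X3 where "X3 = qpoch z Q (n - m)"
    define X4 where "X4 = qpoch (a * b * z) Q m"
    define X5 where "X5 = qpoch (a * b * z * Q ^ m) Q (n - m)"
    have nz: "X2 \<noteq> 0" "X3 \<noteq> 0" "X4 \<noteq> 0" "X5 \<noteq> 0"
      using z c rz cs by (auto simp: X2_def X3_def X4_def X5_def)
    show "X1 * qpoch a Q m * qpoch b Q m * Q ^ m / (qpoch Q Q m * X4 * X2) =
       qbin Q n m * qpoch a Q m * qpoch b Q m * X5 * X3 * z ^ m / (qpoch (a * b * z) Q n * qpoch z Q n)"
      unfolding qbin_def rQ rz cs X1_def[symmetric] X2_def[symmetric] X3_def[symmetric] X4_def[symmetric] X5_def[symmetric] power_divide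
      using nz PQ Q0 z qpoch_Q_nonzero[OF Q Q0, of "n - m"] qpoch_Q_nonzero[OF Q Q0, of m] by (simp add: field_simps)
  qed simp
  also have "(\<Sum>k\<le>n. qbin Q n k * qpoch a Q k * qpoch b Q k * qpoch (a * b * z * Q ^ k) Q (n - k) * qpoch z Q (n - k) * z ^ k)
    = qpoch (a * z) Q n * qpoch (b * z) Q n"
    by (rule saalschutz[OF Q Q0]) (rule qpoch_nonzeroD[OF c])
  finally show ?thesis .
qed

text \<open>The choice of \<open>w\<close>, \<open>z\<close> and \<open>f\<close> encodes the
  balancing condition d e f = A B C Q^(1-x). The product (B)_t (C)_t / (d)_t is expanded by
  \<open>saalschutz\<close> with ratio w, the two sums are exchanged, and the inner sum is an
  instance of \<open>saalschutz_classical\<close> with parameters shifted by Q^k.\<close>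

lemma sears:
  assumes nz: "A \<noteq> 0" "B \<noteq> 0" "C \<noteq> 0" "d \<noteq> 0" "e \<noteq> 0"
    and w: "w = B * C / d" and z: "z = e / (A * w)" and f: "f = Q powi (1 - int x) / z"
    and g: "g = A * Q powi (1 - int x) / e"
    and p: "qpoch d Q x \<noteq> 0" "qpoch e Q x \<noteq> 0" "qpoch f Q x \<noteq> 0" "qpoch z Q x \<noteq> 0" "qpoch (e / w) Q x \<noteq> 0" "qpoch g Q x \<noteq> 0"
  shows "(\<Sum>t\<le>x. qpoch (Q powi (- int x)) Q t * qpoch A Q t * qpoch B Q t * qpoch C Q t * Q ^ t
      / (qpoch Q Q t * qpoch d Q t * qpoch e Q t * qpoch f Q t))
    = qpoch (e / w) Q x * qpoch (e / A) Q x / (qpoch e Q x * qpoch z Q x) *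
      (\<Sum>k\<le>x. qpoch (Q powi (- int x)) Q k * qpoch A Q k * qpoch (d / B) Q k * qpoch (d / C) Q k * Q ^ k
      / (qpoch Q Q k * qpoch d Q k * qpoch g Q k * qpoch (e / w) Q k))"
proof -
  have wz: "w \<noteq> 0" "z \<noteq> 0" using nz by (simp_all add: w z)
  have rel: "d / B * (d / C) * w = d" "d / B * w = C" "d / C * w = B" "A * w * z = e" "A * z = e / w" "w * z = e / A"
    using nz by (simp_all add: w z)
  define h where "h = (\<lambda>k. qpoch (Q powi (- int x)) Q k * qpoch A Q k * qpoch (d / B) Q k * qpoch (d / C) Q k * w ^ k * Q ^ k
      / (qpoch Q Q k * qpoch d Q k * qpoch e Q k * qpoch f Q k))"
  define In where "In = (\<lambda>k m. qpoch (Q powi (- int (x - k))) Q m * qpoch (A * Q ^ k) Q m * qpoch w Q m * Q ^ m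
      / (qpoch Q Q m * qpoch (A * Q ^ k * w * z) Q m * qpoch (Q powi (1 - int (x - k)) / z) Q m))"
  define F where "F = (\<lambda>t k. qpoch (Q powi (- int x)) Q t * qpoch A Q t * Q ^ t / (qpoch Q Q t * qpoch e Q t * qpoch f Q t)
      * (qbin Q t k * qpoch (d / B) Q k * qpoch (d / C) Q k * qpoch w Q (t - k) * w ^ k / qpoch d Q k))"
  have "(\<Sum>t\<le>x. qpoch (Q powi (- int x)) Q t * qpoch A Q t * qpoch B Q t * qpoch C Q t * Q ^ t
      / (qpoch Q Q t * qpoch d Q t * qpoch e Q t * qpoch f Q t)) = (\<Sum>t\<le>x. \<Sum>k\<le>t. F t k)"
  proof (rule sum.cong)
    fix t assume "t \<in> {..x}"
    then have t: "t \<le> x" by simp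
    have dt: "qpoch d Q t \<noteq> 0" by (rule qpoch_nonzero_mono[OF p(1) t])
    have "qpoch C Q t * qpoch B Q t = (\<Sum>k\<le>t. qbin Q t k * qpoch (d / B) Q k * qpoch (d / C) Q k * qpoch (d * Q ^ k) Q (t - k) * qpoch w Q (t - k) * w ^ k)"
      using saalschutz[OF Q Q0, of t "d / B" "d / C" w] qpoch_nonzeroD[OF dt] unfolding rel by simp
    also have "\<dots> = (\<Sum>k\<le>t. (qbin Q t k * qpoch (d / B) Q k * qpoch (d / C) Q k * qpoch w Q (t - k) * w ^ k / qpoch d Q k) * qpoch d Q t)"
    proof (rule sum.cong)
      fix k assume "k \<in> {..t}"
      then have k: "k \<le> t" by simp
      have "qpoch d Q t = qpoch d Q k * qpoch (d * Q ^ k) Q (t - k)" using qpoch_add[of d Q k "t - k"] k by simp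
      moreover have "qpoch d Q k \<noteq> 0" by (rule qpoch_nonzero_mono[OF dt k])
      ultimately show "qbin Q t k * qpoch (d / B) Q k * qpoch (d / C) Q k * qpoch (d * Q ^ k) Q (t - k) * qpoch w Q (t - k) * w ^ k =
        (qbin Q t k * qpoch (d / B) Q k * qpoch (d / C) Q k * qpoch w Q (t - k) * w ^ k / qpoch d Q k) * qpoch d Q t" by simp
    qed simp
    finally have "qpoch C Q t * qpoch B Q t = (\<Sum>k\<le>t. qbin Q t k * qpoch (d / B) Q k * qpoch (d / C) Q k * qpoch w Q (t - k) * w ^ k / qpoch d Q k) * qpoch d Q t"
      unfolding sum_distrib_right .
    then have X: "(\<Sum>k\<le>t. qbin Q t k * qpoch (d / B) Q k * qpoch (d / C) Q k * qpoch w Q (t - k) * w ^ k / qpoch d Q k) = qpoch C Q t * qpoch B Q t / qpoch d Q t"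
      using dt by (simp add: nonzero_eq_divide_eq)
    then show "qpoch (Q powi (- int x)) Q t * qpoch A Q t * qpoch B Q t * qpoch C Q t * Q ^ t
      / (qpoch Q Q t * qpoch d Q t * qpoch e Q t * qpoch f Q t) = (\<Sum>k\<le>t. F t k)"
      unfolding F_def sum_distrib_left[symmetric] X by (simp add: mult_ac)
  qed simp
  also have "\<dots> = (\<Sum>k\<le>x. \<Sum>m\<le>x - k. F (k + m) k)" by (rule sum_triangle_shift)
  also have "\<dots> = (\<Sum>k\<le>x. h k * (\<Sum>m\<le>x - k. In k m))"
    unfolding sum_distrib_left
  proof (intro sum.cong refl)
    fix k m assume "k \<in> {..x}" "m \<in> {..x - k}"
    then have km: "k \<le> x" "m \<le> x - k" by auto
    have 1: "Q powi (- int x) * Q ^ k = Q powi (- int (x - k))"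
    proof -
      have "- int (x - k) = - int x + int k" using km by simp
      then show ?thesis using power_int_add[of Q "- int x" "int k"] Q0 by simp
    qed
    have 2: "f * Q ^ k = Q powi (1 - int (x - k)) / z"
    proof -
      have e: "1 - int (x - k) = 1 - int x + int k" using km by simp
      show ?thesis unfolding f e using power_int_add[of Q "1 - int x" "int k"] Q0 by simp
    qed
    have 3: "e * Q ^ k = A * Q ^ k * w * z" using rel(4) by (simp add: mult_ac)
    have nzk: "qpoch Q Q k \<noteq> 0" "qpoch Q Q m \<noteq> 0" "qpoch Q Q (k + m) \<noteq> 0" using qpoch_Q_nonzero[OF Q Q0] by auto
    show "F (k + m) k = h k * In k m"
      unfolding F_def h_def In_def qbin_def 1[symmetric] 2[symmetric] 3[symmetric]
        qpoch_add[of "Q powi (- int x)"] qpoch_add[of A] qpoch_add[of e] qpoch_add[of f] power_add add_diff_cancel_left'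
      using nzk by (simp add: mult_ac)
  qed
  also have "\<dots> = (\<Sum>k\<le>x. qpoch (e / w) Q x * qpoch (e / A) Q x / (qpoch e Q x * qpoch z Q x) *
      (qpoch (Q powi (- int x)) Q k * qpoch A Q k * qpoch (d / B) Q k * qpoch (d / C) Q k * Q ^ k
      / (qpoch Q Q k * qpoch d Q k * qpoch g Q k * qpoch (e / w) Q k)))"
  proof (rule sum.cong)
    fix k assume "k \<in> {..x}"
    then have k: "k \<le> x" by simp
    define n where "n = x - k"
    have x: "x = k + n" using k by (simp add: n_def)
    have es: "qpoch e Q x = qpoch e Q k * qpoch (e * Q ^ k) Q n" by (simp add: x qpoch_add)
    have ews: "qpoch (e / w) Q x = qpoch (e / w) Q k * qpoch (e / w * Q ^ k) Q n" by (simp only: x qpoch_add)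
    define Pz where "Pz = (\<Prod>i<k. - (z * Q ^ (x - Suc i)))"
    have Pz: "Pz \<noteq> 0" using Q0 wz by (simp add: Pz_def)
    \<comment> \<open>As e / A = w z, the reversal factors of (e/A)_x and (z)_x differ by w^k, which
      cancels the power of w left over from the first expansion.\<close>
    have Pu: "(\<Prod>i<k. - (e / A * Q ^ (x - Suc i))) = w ^ k * Pz"
    proof -
      have "(\<Prod>i<k. - (e / A * Q ^ (x - Suc i))) = (\<Prod>i<k. w * - (z * Q ^ (x - Suc i)))"
        unfolding rel(6)[symmetric] by (simp add: mult.assoc)
      then show ?thesis unfolding Pz_def prod.distrib by simp
    qed
    have u: "e / A \<noteq> 0" using nz by simp
    have zr: "qpoch z Q x = qpoch z Q n * (qpoch f Q k * Pz)"
      using qpoch_rev[OF Q Q0 wz(2) k] by (simp add: Pz_def f n_def)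
    have ur: "qpoch (e / A) Q x = qpoch (e / A) Q n * (qpoch g Q k * (w ^ k * Pz))"
      using qpoch_rev[OF Q Q0 u k] unfolding Pu by (simp add: g n_def mult.commute)
    have c: "A * Q ^ k * w * z = e * Q ^ k" using rel(4) by (simp add: mult_ac)
    have az: "A * Q ^ k * z = e / w * Q ^ k" unfolding rel(5)[symmetric] by simp
    note dk = qpoch_nonzero_mono[OF p(1) k] and ek = qpoch_nonzero_mono[OF p(2) k] and fk = qpoch_nonzero_mono[OF p(3) k]
      and ewk = qpoch_nonzero_mono[OF p(5) k] and gk = qpoch_nonzero_mono[OF p(6) k]
    have en: "qpoch (e * Q ^ k) Q n \<noteq> 0" and zn: "qpoch z Q n \<noteq> 0"
      using p(2,4) es zr by auto
    have "(\<Sum>m\<le>x - k. In k m) = qpoch (e / w * Q ^ k) Q n * qpoch (e / A) Q n / (qpoch (e * Q ^ k) Q n * qpoch z Q n)"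
      unfolding In_def n_def[symmetric]
      using saalschutz_classical[of z n "A * Q ^ k" w] zn en wz unfolding c az rel(6) by simp
    then have "h k * (\<Sum>m\<le>x - k. In k m) = h k * (qpoch (e / w * Q ^ k) Q n * qpoch (e / A) Q n / (qpoch (e * Q ^ k) Q n * qpoch z Q n))"
      by simp
    also have "\<dots> = qpoch (e / w) Q x * qpoch (e / A) Q x / (qpoch e Q x * qpoch z Q x) *
      (qpoch (Q powi (- int x)) Q k * qpoch A Q k * qpoch (d / B) Q k * qpoch (d / C) Q k * Q ^ k
      / (qpoch Q Q k * qpoch d Q k * qpoch g Q k * qpoch (e / w) Q k))"
      unfolding h_def es ews zr ur using fk gk ek ewk en zn dk Pz wz by (simp add: mult_ac)
    finally show "h k * (\<Sum>m\<le>x - k. In k m) = qpoch (e / w) Q x * qpoch (e / A) Q x / (qpoch e Q x * qpoch z Q x) *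
      (qpoch (Q powi (- int x)) Q k * qpoch A Q k * qpoch (d / B) Q k * qpoch (d / C) Q k * Q ^ k
      / (qpoch Q Q k * qpoch d Q k * qpoch g Q k * qpoch (e / w) Q k))" .
  qed simp
  finally show ?thesis unfolding sum_distrib_left .
qed

end

section \<open>Recoupling coefficients as Racah polynomials\<close>

text \<open>The sign (-1)^(s (s + 1) / 2), kept as a product so that no exponent has to be halved.
  It collects the alternating signs of \<open>raise_coeff\<close> and of
  \<open>ip_shift\<close>.\<close>

definition sgT :: "nat \<Rightarrow> real" where
  "sgT s = (\<Prod>l<s. (- 1) ^ Suc l)"

lemma sgT_Suc: "sgT (Suc s) = sgT s * (- 1) ^ Suc s"
  by (simp add: sgT_def)

lemma sgT_0 [simp]: "sgT 0 = 1"
  by (simp add: sgT_def)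

lemma sgT_square: "sgT s * sgT s = 1"
  by (induction s) (simp_all add: sgT_Suc mult_ac flip: power_add mult_2)

lemma sgT_add: "sgT (m + k) = sgT m * sgT k * (- 1) ^ (m * k)"
proof (induction k)
  case (Suc k)
  have "(- 1 :: real) ^ Suc (m + k) = (- 1) ^ Suc k * (- 1) ^ m" by (simp add: power_add)
  then show ?case using Suc by (simp add: sgT_Suc power_add mult_ac)
qed simp

lemma prod_rev: "(\<Prod>i<n. f (n - Suc i)) = (\<Prod>i<n. f i)" for f :: "nat \<Rightarrow> real"
  by (rule prod.nat_diff_reindex)

lemma prod_powr: "0 < q \<Longrightarrow> (\<Prod>i<n. q powr f i) = q powr (\<Sum>i<n. f i)" for q :: real and n :: nat
  by (induction n) (simp_all add: powr_add)

lemma sum_lessThan_real: fixes n :: nat shows "(\<Sum>i<n. real i) = real n * (real n - 1) / 2"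
  by (induction n) (simp_all add: field_simps)

section \<open>Closed forms of the coupling constants in base -q\<close>

context
  fixes q :: real assumes q: "0 < q" "q < 1"
begin

lemma Q_facts: "(- q) ^ Suc k \<noteq> 1" "- q \<noteq> 0"
proof -
  have "\<bar>(- q) ^ Suc k\<bar> < 1" unfolding power_abs using q by (intro power_Suc_less_one) auto
  then show "(- q) ^ Suc k \<noteq> 1" by auto
qed (use q in simp)

lemma kappa_pos: "0 < 1 / q - q"
proof -
  have "1 / q > 1" using q by simp
  then show ?thesis using q by linarith
qed

lemma qpoch_pos:
  assumes "0 < G" "G < 1"
  shows "0 < qpoch (G * (- q) ^ j) (- q) m"
  unfolding qpoch_def
proof (rule prod_pos)
  fix t
  have "\<bar>(- q) ^ (j + t)\<bar> \<le> 1" using q by (simp add: power_abs power_le_one)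
  then have "\<bar>G * (- q) ^ (j + t)\<bar> \<le> G * 1" unfolding abs_mult using assms by (intro mult_mono) auto
  then have "G * (- q) ^ (j + t) < 1" using assms by linarith
  then show "0 < 1 - G * (- q) ^ j * (- q) ^ t" by (simp add: power_add mult.assoc)
qed

lemma qpoch_pos0: "0 < G \<Longrightarrow> G < 1 \<Longrightarrow> 0 < qpoch G (- q) m"
  using qpoch_pos[of G 0] by simp

lemma qpoch_Q_pos: "0 < qpoch (- q) (- q) m"
  unfolding qpoch_def
proof (rule prod_pos)
  fix t
  have "\<bar>(- q) ^ Suc t\<bar> < 1" unfolding power_abs using q by (intro power_Suc_less_one) auto
  then show "0 < 1 - - q * (- q) ^ t" by (simp add: abs_less_iff)
qed

lemma qpoch_pos_div:
  assumes "0 < G" "G < 1" "m = 0 \<or> 0 < N"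
  shows "0 < qpoch ((- q) ^ N / (- q) * G) (- q) m"
proof (cases "m = 0")
  case False
  then obtain k where "N = Suc k" using assms by (cases N) auto
  then have "(- q) ^ N / (- q) * G = G * (- q) ^ k" using q by simp
  then show ?thesis using qpoch_pos[OF assms(1,2)] by simp
qed simp

lemma powr_bounds: "0 < \<mu> \<Longrightarrow> 0 < q powr (2 * \<mu>) \<and> q powr (2 * \<mu>) < 1"
  using q by (auto simp: powr_def mult_less_0_iff)

lemma powr_2u: "q powr (2 * (T + real u)) = q powr (2 * T) * (- q) ^ (2 * u)"
proof -
  have "q powr (2 * (T + real u)) = q powr (2 * T) * q powr (real (2 * u))"
    by (simp add: powr_add[symmetric] algebra_simps)
  also have "q powr (real (2 * u)) = q ^ (2 * u)" using q by (simp only: powr_realpow)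
  finally show ?thesis by (simp add: power_mult)
qed

text \<open>Raising the weight by u while lowering the index by u leaves the power of q in
  \<open>sig_eq\<close> fixed. The product over u therefore splits into two shifted factorials, as
  used in \<open>prod_sig_shift\<close>.\<close>

lemma sig_shift:
  assumes "u \<le> s"
  shows "sig q (T + real u) (s - u) = q powr (1/2 - T - real s) * (1 - (- q) ^ (s - u))
     * (1 - (- q) ^ (s + u) / (- q) * q powr (2 * T)) / (1 / q - q)"
proof -
  have e: "1/2 - (T + real u) - real (s - u) = 1/2 - T - real s" using assms by simp
  have "s + u = (s - u) + 2 * u" using assms by simp
  then have p: "(- q) ^ (s - u) * (- q) ^ (2 * u) = (- q) ^ (s + u)" by (metis power_add)
  have "(- q) ^ (s - u) / (- q) * q powr (2 * (T + real u)) = (- q) ^ (s + u) / (- q) * q powr (2 * T)"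
    unfolding powr_2u p[symmetric] by simp
  then show ?thesis unfolding sig_eq[OF q] e by simp
qed

lemma prod_sig_shift:
  "(\<Prod>u<s. sig q (T + real u) (s - u)) = q powr (real s * (1/2 - T - real s)) * qpoch (- q) (- q) s
     * qpoch ((- q) ^ s / (- q) * q powr (2 * T)) (- q) s / (1 / q - q) ^ s"
proof -
  have "(\<Prod>u<s. sig q (T + real u) (s - u)) = (\<Prod>u<s. q powr (1/2 - T - real s) * (1 - (- q) * (- q) ^ (s - Suc u))
     * (1 - (- q) ^ s / (- q) * q powr (2 * T) * (- q) ^ u) / (1 / q - q))"
  proof (rule prod.cong)
    fix u assume "u \<in> {..<s}"
    then have "u \<le> s" "s - u = Suc (s - Suc u)" by auto
    then show "sig q (T + real u) (s - u) = q powr (1/2 - T - real s) * (1 - (- q) * (- q) ^ (s - Suc u))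
     * (1 - (- q) ^ s / (- q) * q powr (2 * T) * (- q) ^ u) / (1 / q - q)"
      unfolding sig_shift[OF \<open>u \<le> s\<close>] power_add by (simp add: mult_ac)
  qed simp
  also have "\<dots> = (q powr (1/2 - T - real s)) ^ s * (\<Prod>u<s. 1 - (- q) * (- q) ^ (s - Suc u))
     * (\<Prod>u<s. 1 - (- q) ^ s / (- q) * q powr (2 * T) * (- q) ^ u) / (1 / q - q) ^ s"
    by (simp only: prod.distrib prod_dividef prod_constant card_lessThan)
  also have "(\<Prod>u<s. 1 - (- q) * (- q) ^ (s - Suc u)) = qpoch (- q) (- q) s"
    unfolding qpoch_def by (rule prod_rev[where f = "\<lambda>i. 1 - (- q) * (- q) ^ i"])
  also have "(q powr (1/2 - T - real s)) ^ s = q powr (real s * (1/2 - T - real s))"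
    using q by (simp add: powr_power)
  finally show ?thesis unfolding qpoch_def[of "(- q) ^ s / (- q) * q powr (2 * T)"] .
qed

lemma sigf_closed:
  "sigf q \<mu> s = q powr (real s * (1/2 - \<mu>) - real s * (real s + 1) / 2) * qpoch (- q) (- q) s
     * qpoch (q powr (2 * \<mu>)) (- q) s / (1 / q - q) ^ s"
proof (induction s)
  case (Suc s)
  have e: "(real s * (1/2 - \<mu>) - real s * (real s + 1) / 2) + (1/2 - \<mu> - real (Suc s)) =
     real (Suc s) * (1/2 - \<mu>) - real (Suc s) * (real (Suc s) + 1) / 2" by (simp add: field_simps)
  have "(- q) ^ Suc s / (- q) = (- q) ^ s" using q by simp
  then show ?case unfolding sigf_Suc Suc sig_eq[OF q] qpoch_Suc e[symmetric] powr_add by (simp add: field_simps)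
qed (use q in simp)

lemma prod_sig_rev: "(\<Prod>u<s. sig q \<nu> (s - u)) = sigf q \<nu> s"
proof -
  have "(\<Prod>u<s. sig q \<nu> (s - u)) = (\<Prod>u<s. sig q \<nu> (Suc (s - Suc u)))"
    by (rule prod.cong) (auto simp: Suc_diff_Suc)
  then show ?thesis unfolding sigf_def by (simp only: prod_rev[where f = "\<lambda>i. sig q \<nu> (Suc i)"])
qed

lemma sgT_rev: "(\<Prod>u<s. (- 1) ^ (s - u)) = sgT s"
proof -
  have "(\<Prod>u<s. (- 1 :: real) ^ (s - u)) = (\<Prod>u<s. (- 1) ^ Suc (s - Suc u))"
    by (rule prod.cong) (auto simp: Suc_diff_Suc)
  then show ?thesis unfolding sgT_def by (simp only: prod_rev[where f = "\<lambda>i. (- 1) ^ Suc i"])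
qed

text \<open>No sign survives: the level \<open>e\<close> enters both coefficient families through
  the same sign (-1)^e, and (-1)^(s-u) meets the opposite of (-1)^(s-u-1). What is left are the
  products of sigma, and these have closed forms.\<close>

lemma couple_norm_closed:
  assumes "0 < \<mu>"
  shows "couple_norm q \<mu> \<nu> e s = q powr (- 3 * real s * \<nu> - 3 / 2 * real s * real s + real s) * qpoch (- q) (- q) s
     * qpoch (q powr (2 * \<nu>)) (- q) s * qpoch ((- q) ^ s / (- q) * q powr (2 * (\<mu> + \<nu>))) (- q) s
     / (qpoch (q powr (2 * \<mu>)) (- q) s * (1 / q - q) ^ s)"
proof -
  define P where "P = (\<Prod>u<s. sig q (\<mu> + \<nu> + real u) (s - u))"
  define E where "E = - \<nu> - \<mu> / 2 - (real s - 1) / 2"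
  have sp: "sigf q \<mu> s > 0" by (rule sigf_pos[OF q assms])
  have "raise_coeff q \<mu> \<nu> e s s * couple_coeff q \<mu> \<nu> e s s = q powr (real s * \<mu> / 2) *
     (\<Prod>u<s. q powr E * sig q (\<mu> + \<nu> + real u) (s - u) * sig q \<nu> (s - u) / (sig q \<mu> (Suc u) * sig q \<mu> (Suc u)))"
    unfolding raise_coeff_def couple_coeff_def mult.assoc prod.distrib[symmetric]
  proof (rule arg_cong[where f = "(*) _"], rule prod.cong)
    fix u assume "u \<in> {..<s}"
    then have u: "u < s" by simp
    then have "s - u = Suc (s - Suc u)" by simp
    then have sg: "(- 1 :: real) ^ (s - u) = - ((- 1) ^ (s - Suc u))" by simp
    have 1: "kp_level q \<nu> e 0 = (- 1) ^ e * q powr (\<nu> / 2)" by (simp add: kp_level_def)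
    have 2: "kp_level q \<nu> e (s - Suc u) = (- 1) ^ e * (- 1) ^ (s - Suc u) * q powr ((real s - real u - 1 + \<nu>) / 2)"
      unfolding kp_level_def power_add using u by (simp add: of_nat_diff algebra_simps)
    have ex: "q powr (- ((\<mu> + real u) / 2)) = q powr E * q powr (\<nu> / 2) * q powr ((real s - real u - 1 + \<nu>) / 2)"
      unfolding powr_add[symmetric] by (rule arg_cong[where f = "\<lambda>x. q powr x"]) (simp add: E_def field_simps)
    have p1: "(- 1 :: real) ^ e * (- 1) ^ e = 1" "(- 1 :: real) ^ (s - Suc u) * (- 1) ^ (s - Suc u) = 1"
      by (simp_all flip: power_mult_distrib)
    define e1 where "e1 = (- 1 :: real) ^ e"
    define e2 where "e2 = (- 1 :: real) ^ (s - Suc u)"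
    have e12: "e1 * e1 = 1" "e2 * e2 = 1" "e1 \<noteq> 0" "e2 \<noteq> 0" using p1 by (auto simp: e1_def e2_def)
    have "sig q \<mu> (Suc u) \<noteq> 0" using sig_pos[OF q assms, of "Suc u"] by simp
    then show "(- 1) ^ (s - u) * sig q (\<mu> + \<nu> + real u) (s - u) / (kp_level q \<nu> e 0 * sig q \<mu> (Suc u)) *
         (- (q powr - ((\<mu> + real u) / 2) * sig q \<nu> (s - u)) / (kp_level q \<nu> e (s - Suc u) * sig q \<mu> (Suc u))) =
         q powr E * (sig q (\<mu> + \<nu> + real u) (s - u) * sig q \<nu> (s - u)) / (sig q \<mu> (Suc u) * sig q \<mu> (Suc u))"
      unfolding sg 1 2 ex e1_def[symmetric] e2_def[symmetric] using e12 q by (simp add: field_simps)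
  qed simp
  also have "\<dots> = q powr (real s * \<mu> / 2) * ((q powr E) ^ s * P * sigf q \<nu> s / (sigf q \<mu> s * sigf q \<mu> s))"
    by (simp only: prod.distrib prod_dividef prod_constant card_lessThan prod_sig_rev P_def sigf_def[symmetric])
  finally have n: "couple_norm q \<mu> \<nu> e s = q powr (real s * \<mu> / 2) * (q powr E) ^ s * P * sigf q \<nu> s / sigf q \<mu> s"
    unfolding couple_norm_def using sp by simp
  have pw: "(q powr E) ^ s = q powr (real s * E)" using q by (simp add: powr_power)
  define e1 where "e1 = real s * (1/2 - (\<mu> + \<nu>) - real s)"
  define e2 where "e2 = real s * (1/2 - \<nu>) - real s * (real s + 1) / 2"
  define e3 where "e3 = real s * (1/2 - \<mu>) - real s * (real s + 1) / 2"
  have ex: "q powr (- 3 * real s * \<nu> - 3 / 2 * real s * real s + real s) * q powr e3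
     = q powr (real s * \<mu> / 2) * q powr (real s * E) * q powr e1 * q powr e2"
    unfolding powr_add[symmetric] by (rule arg_cong[where f = "\<lambda>x. q powr x"]) (simp add: E_def e1_def e2_def e3_def field_simps)
  have ex': "q powr (- 3 * real s * \<nu> - 3 / 2 * real s * real s + real s)
     = q powr (real s * \<mu> / 2) * q powr (real s * E) * q powr e1 * q powr e2 / q powr e3"
    unfolding ex[symmetric] using q by simp
  have "0 < qpoch (q powr (2 * \<mu>)) (- q) s" using powr_bounds[OF assms] by (intro qpoch_pos0) auto
  then show ?thesis unfolding n pw P_def prod_sig_shift sigf_closed e1_def[symmetric] e2_def[symmetric] e3_def[symmetric] ex'
    using qpoch_Q_pos[of s] kappa_pos q by (simp add: field_simps)
qed

text \<open>Level 0 is the case that occurs, because the last factor of each recoupling is a single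
  module with its lowest basis vector.\<close>

lemma raise_coeff_top_closed:
  assumes "0 < \<mu>"
  shows "raise_coeff q \<mu> \<nu> 0 s s = sgT s * q powr (real s * (\<mu> - \<nu>) / 2 - real s * real s / 2 + real s / 2 - real s * \<nu>)
     * qpoch ((- q) ^ s / (- q) * q powr (2 * (\<mu> + \<nu>))) (- q) s / qpoch (q powr (2 * \<mu>)) (- q) s"
proof -
  have k: "kp_level q \<nu> 0 0 = q powr (\<nu> / 2)" by (simp add: kp_level_def)
  have "raise_coeff q \<mu> \<nu> 0 s s = q powr (real s * \<mu> / 2) * (sgT s * (\<Prod>u<s. sig q (\<mu> + \<nu> + real u) (s - u))
      / ((q powr (\<nu> / 2)) ^ s * sigf q \<mu> s))"
    unfolding raise_coeff_def k by (simp only: prod.distrib prod_dividef prod_constant card_lessThan sgT_rev sigf_def)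
  also have "(q powr (\<nu> / 2)) ^ s = q powr (real s * (\<nu> / 2))" using q by (simp add: powr_power)
  finally have n: "raise_coeff q \<mu> \<nu> 0 s s = q powr (real s * \<mu> / 2) * (sgT s * (\<Prod>u<s. sig q (\<mu> + \<nu> + real u) (s - u))
      / (q powr (real s * (\<nu> / 2)) * sigf q \<mu> s))" .
  define e1 where "e1 = real s * (1/2 - (\<mu> + \<nu>) - real s)"
  define e3 where "e3 = real s * (1/2 - \<mu>) - real s * (real s + 1) / 2"
  have ex: "q powr (real s * (\<mu> - \<nu>) / 2 - real s * real s / 2 + real s / 2 - real s * \<nu>) * (q powr (real s * (\<nu> / 2)) * q powr e3)
     = q powr (real s * \<mu> / 2) * q powr e1"
    unfolding powr_add[symmetric] by (rule arg_cong[where f = "\<lambda>x. q powr x"]) (simp add: e1_def e3_def field_simps)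
  have ex': "q powr (real s * (\<mu> - \<nu>) / 2 - real s * real s / 2 + real s / 2 - real s * \<nu>)
     = q powr (real s * \<mu> / 2) * q powr e1 / (q powr (real s * (\<nu> / 2)) * q powr e3)"
    unfolding ex[symmetric] using q by simp
  have "0 < qpoch (q powr (2 * \<mu>)) (- q) s" using powr_bounds[OF assms] by (intro qpoch_pos0) auto
  then show ?thesis unfolding n prod_sig_shift sigf_closed e1_def[symmetric] e3_def[symmetric] ex'
    using qpoch_Q_pos[of s] kappa_pos q by (simp add: field_simps)
qed

end

section \<open>The overlap sum as a terminating balanced 4phi3 series\<close>

definition ip_term :: "real \<Rightarrow> real \<Rightarrow> real \<Rightarrow> real \<Rightarrow> nat \<Rightarrow> nat \<Rightarrow> nat \<Rightarrow> nat \<Rightarrow> nat \<Rightarrow> real" where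
  "ip_term q a b c e n x N t = raise_coeff q a b e x t * (sgT (N - t) * q powr (- (real (N - t) * (a + b + c + real N - 1) / 2)))
     * (couple_coeff q a (b + c + real n) (e + n) (N - n) t * sigf q a t * q powr (- (real (N - n - t) * b / 2)) * sigf q c (N - t))"

text \<open>A summand of \<open>ip_recoupling\<close> relative to the one at t = 0, see
  \<open>ip_term_ph\<close>. The series is balanced and has the shape to which \<open>sears\<close>
  applies.\<close>

definition ph :: "real \<Rightarrow> real \<Rightarrow> real \<Rightarrow> real \<Rightarrow> nat \<Rightarrow> nat \<Rightarrow> nat \<Rightarrow> nat \<Rightarrow> real" where
  "ph Q Ga Gb Gc n x N t = qpoch (Q powi (- int x)) Q t * qpoch (Q ^ x / Q * (Ga * Gb)) Q t
     * qpoch (Q powi (int n - int N)) Q t * qpoch (Q powi (1 - int N - int n) / (Gb * Gc)) Q t * Q ^ t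
     / (qpoch Q Q t * qpoch (Q powi (- int N)) Q t * qpoch Ga Q t * qpoch (Q powi (1 - int N) / Gc) Q t)"

lemma powi_shift:
  fixes Q :: real
  assumes "Q \<noteq> 0" "k + int t = - int m"
  shows "Q powi k * Q ^ t = 1 / Q ^ m"
proof -
  have "Q powi k * Q ^ t = Q powi (k + int t)" using assms power_int_add[of Q k "int t"] by simp
  then show ?thesis unfolding assms(2) by (simp add: power_int_minus field_simps)
qed

context
  fixes q :: real assumes q: "0 < q" "q < 1"
begin

text \<open>The ratio of consecutive summands. The signs of K P cancel in pairs;
  \<open>sig_shift\<close> supplies factors 1 - X where the series has 1 - 1/X, and the monomials
  from this conversion are matched with the collected powers of q.\<close>

lemma ip_term_step:
  assumes a: "0 < a" and b: "0 < b" and c: "0 < c" and t: "t < x" "t < N - n" and nx: "n \<le> N" "x \<le> N"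
  defines "Q \<equiv> - q" and "Ga \<equiv> q powr (2 * a)" and "Gb \<equiv> q powr (2 * b)" and "Gc \<equiv> q powr (2 * c)"
  shows "ip_term q a b c e n x N (Suc t) = ip_term q a b c e n x N t *
    ((1 - Q powi (- int x) * Q ^ t) * (1 - Q ^ x / Q * (Ga * Gb) * Q ^ t) * (1 - Q powi (int n - int N) * Q ^ t)
      * (1 - Q powi (1 - int N - int n) / (Gb * Gc) * Q ^ t) * Q
     / ((1 - Q * Q ^ t) * (1 - Q powi (- int N) * Q ^ t) * (1 - Ga * Q ^ t) * (1 - Q powi (1 - int N) / Gc * Q ^ t)))"
proof -
  define K where "K = 1 / q - q"
  define Z where "Z = a + b + c + real N - 1"
  have K: "0 < K" using kappa_pos[OF q] by (simp add: K_def)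
  have Q0: "Q \<noteq> 0" using q by (simp add: Q_def)
  have G: "0 < Ga" "0 < Gb" "0 < Gc" using q by (simp_all add: Ga_def Gb_def Gc_def)
  define X1 where "X1 = Q ^ (x - t)"
  define X2 where "X2 = Q ^ (N - n - t)"
  define X3 where "X3 = Q ^ (N - t + n) / Q * (Gb * Gc)"
  define X4 where "X4 = Q ^ (N - t)"
  define X5 where "X5 = Q ^ (N - t) / Q * Gc"
  define U2 where "U2 = 1 - Q ^ (x + t) / Q * (Ga * Gb)"
  define V1 where "V1 = 1 - Q ^ Suc t"
  define V3 where "V3 = 1 - Q ^ t * Ga"
  have Xnz: "X1 \<noteq> 0" "X2 \<noteq> 0" "X3 \<noteq> 0" "X4 \<noteq> 0" "X5 \<noteq> 0"
    using Q0 G by (simp_all add: X1_def X2_def X3_def X4_def X5_def)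
  define R where "R = (1 - 1 / X1) * U2 * (1 - 1 / X2) * (1 - 1 / X3) * Q / (V1 * (1 - 1 / X4) * V3 * (1 - 1 / X5))"
  have c1: "Q powi (- int x) * Q ^ t = 1 / X1" unfolding X1_def by (rule powi_shift[OF Q0]) (use t in simp)
  have c2: "Q powi (int n - int N) * Q ^ t = 1 / X2" unfolding X2_def by (rule powi_shift[OF Q0]) (use t nx in simp)
  have c4: "Q powi (- int N) * Q ^ t = 1 / X4" unfolding X4_def by (rule powi_shift[OF Q0]) (use t nx in simp)
  have "Q powi (1 - int N - int n) * Q ^ t = 1 / Q ^ (N - Suc t + n)" by (rule powi_shift[OF Q0]) (use t nx in simp)
  moreover have "N - t + n = Suc (N - Suc t + n)" using t by simp
  ultimately have c3: "Q powi (1 - int N - int n) / (Gb * Gc) * Q ^ t = 1 / X3" using Q0 G by (simp add: X3_def field_simps)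
  have "Q powi (1 - int N) * Q ^ t = 1 / Q ^ (N - Suc t)" by (rule powi_shift[OF Q0]) (use t nx in simp)
  moreover have "N - t = Suc (N - Suc t)" using t by simp
  ultimately have c5: "Q powi (1 - int N) / Gc * Q ^ t = 1 / X5" using Q0 G by (simp add: X5_def field_simps)
  have c6: "1 - Q ^ x / Q * (Ga * Gb) * Q ^ t = U2" by (simp add: U2_def power_add mult_ac)
  have c7: "1 - Q * Q ^ t = V1" "1 - Ga * Q ^ t = V3" by (simp_all add: V1_def V3_def mult.commute)
  have goal: "((1 - Q powi (- int x) * Q ^ t) * (1 - Q ^ x / Q * (Ga * Gb) * Q ^ t) * (1 - Q powi (int n - int N) * Q ^ t)
      * (1 - Q powi (1 - int N - int n) / (Gb * Gc) * Q ^ t) * Q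
     / ((1 - Q * Q ^ t) * (1 - Q powi (- int N) * Q ^ t) * (1 - Ga * Q ^ t) * (1 - Q powi (1 - int N) / Gc * Q ^ t))) = R"
    unfolding c1 c2 c3 c4 c5 c6 c7 R_def ..
  have Vpos: "0 < sig q a (Suc t)" "0 < sig q c (N - t)" using sig_pos[OF q] a c t by simp_all
  have s1: "sig q (a + b + real t) (x - t) = q powr (1/2 - (a + b) - real x) * ((1 - X1) * U2) / K"
    using sig_shift[OF q, of t x "a + b"] t by (simp add: X1_def U2_def K_def Q_def Ga_def Gb_def powr_add[symmetric] distrib_left)
  have s2: "sig q (b + c + real n) (N - n - t) = q powr (1/2 - (b + c) - real (N - t)) * ((1 - X2) * (1 - X3)) / K"
  proof -
    have "N - n - t = N - t - n" by simp
    then show ?thesis using sig_shift[OF q, of n "N - t" "b + c"] t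
      by (simp add: X2_def X3_def K_def Q_def Gb_def Gc_def powr_add[symmetric] distrib_left)
  qed
  have s3: "sig q a (Suc t) = q powr (1/2 - a - real (Suc t)) * (V1 * V3) / K"
  proof -
    have "(- q) ^ Suc t / (- q) = (- q) ^ t" using q by simp
    then show ?thesis unfolding sig_eq[OF q] by (simp add: V1_def V3_def K_def Q_def Ga_def)
  qed
  have s4: "sig q c (N - t) = q powr (1/2 - c - real (N - t)) * ((1 - X4) * (1 - X5)) / K"
    unfolding sig_eq[OF q] by (simp add: X4_def X5_def K_def Q_def Gc_def)
  have Vnz: "V1 \<noteq> 0" "V3 \<noteq> 0" "1 - X4 \<noteq> 0" "1 - X5 \<noteq> 0" using Vpos by (auto simp: s3 s4)
  have Nt: "N - t = Suc (N - Suc t)" "N - n - t = Suc (N - n - Suc t)" using t by simp_all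
  define Rho where "Rho = ((- 1) ^ (x - t) * sig q (a + b + real t) (x - t) / kp_level q b e 0)
     * (- (q powr (- ((a + real t) / 2)) * sig q (b + c + real n) (N - n - t)) / (kp_level q (b + c + real n) (e + n) (N - n - Suc t) * sig q a (Suc t)))
     / ((- 1) ^ (N - t) * q powr (- (Z / 2)) * q powr (- (b / 2)) * sig q c (N - t))"
  have step: "ip_term q a b c e n x N (Suc t) = ip_term q a b c e n x N t * Rho"
  proof -
    have p1: "q powr (- (real (N - t) * Z / 2)) = q powr (- (real (N - Suc t) * Z / 2)) * q powr (- (Z / 2))"
      unfolding powr_add[symmetric] Nt(1) by (rule arg_cong[where f = "\<lambda>x. q powr x"]) (simp add: field_simps)
    have p2: "q powr (- (real (N - n - t) * b / 2)) = q powr (- (real (N - n - Suc t) * b / 2)) * q powr (- (b / 2))"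
      unfolding powr_add[symmetric] Nt(2) by (rule arg_cong[where f = "\<lambda>x. q powr x"]) (simp add: field_simps)
    have p3: "sgT (N - t) = sgT (N - Suc t) * (- 1) ^ (N - t)" unfolding Nt(1) by (rule sgT_Suc)
    have p4: "sigf q c (N - t) = sigf q c (N - Suc t) * sig q c (N - t)" unfolding Nt(1) by (rule sigf_Suc)
    have p5: "raise_coeff q a b e x (Suc t) = raise_coeff q a b e x t * ((- 1) ^ (x - t) * sig q (a + b + real t) (x - t) / (kp_level q b e 0 * sig q a (Suc t)))"
      by (simp add: raise_coeff_def)
    have p6: "couple_coeff q a (b + c + real n) (e + n) (N - n) (Suc t) = couple_coeff q a (b + c + real n) (e + n) (N - n) t *
       (- (q powr (- ((a + real t) / 2)) * sig q (b + c + real n) (N - n - t)) / (kp_level q (b + c + real n) (e + n) (N - n - Suc t) * sig q a (Suc t)))"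
      by (simp add: couple_coeff_def)
    show ?thesis unfolding ip_term_def Z_def[symmetric] p1 p2 p3 p4 p5 p6 sigf_Suc Rho_def
      using Vpos q by (simp add: field_simps)
  qed
  have k1: "kp_level q b e 0 = (- 1) ^ e * q powr (b / 2)" by (simp add: kp_level_def)
  have k2: "kp_level q (b + c + real n) (e + n) (N - n - Suc t) = - ((- 1) ^ e * (- 1) ^ (N - t) * q powr ((real (N - t) - 1 + b + c) / 2))"
  proof -
    define m where "m = N - n - Suc t"
    have Nt': "N - t = Suc (n + m)" using t by (simp add: m_def)
    show ?thesis unfolding m_def[symmetric] Nt' kp_level_def by (simp add: power_add algebra_simps)
  qed
  define e1 where "e1 = (- 1 :: real) ^ e"
  define e2 where "e2 = (- 1 :: real) ^ (N - t)"
  define e3 where "e3 = (- 1 :: real) ^ (x - t)"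
  have ee: "e1 * e1 = 1" "e2 * e2 = 1" "e3 * e3 = 1" "e1 \<noteq> 0" "e2 \<noteq> 0" "e3 \<noteq> 0"
    unfolding e1_def e2_def e3_def by (simp_all flip: power_mult_distrib)
  have X1q: "X1 = e3 * q powr (real x - real t)"
  proof -
    have "X1 = e3 * q ^ (x - t)" unfolding X1_def Q_def e3_def by (rule power_minus)
    also have "q ^ (x - t) = q powr (real x - real t)" using q t by (simp flip: powr_realpow add: of_nat_diff)
    finally show ?thesis .
  qed
  \<comment> \<open>Converting all factors 1 - 1/X into 1 - X costs the monomial X1 X2 X3 / (X4 X5);
    it simplifies to X1 Gb.\<close>
  have rel: "X4 * X5 * (X1 * Gb) = X1 * X2 * X3"
  proof -
    have "X2 * Q ^ (N - t + n) = X4 * X4" unfolding X2_def X4_def power_add[symmetric]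
      by (rule arg_cong[where f = "\<lambda>x. Q ^ x"]) (use t in simp)
    then show ?thesis unfolding X3_def X5_def using Q0 by (simp add: X4_def field_simps)
  qed
  have "R = - Q * ((1 - X1) * U2 * (1 - X2) * (1 - X3)) / (X1 * Gb * (V1 * (1 - X4) * V3 * (1 - X5)))"
  proof -
    have m: "1 - 1 / X1 = - ((1 - X1) / X1)" "1 - 1 / X2 = - ((1 - X2) / X2)" "1 - 1 / X3 = - ((1 - X3) / X3)"
      "1 - 1 / X4 = - ((1 - X4) / X4)" "1 - 1 / X5 = - ((1 - X5) / X5)" using Xnz by (simp_all add: field_simps)
    have "R = - Q * ((1 - X1) * U2 * (1 - X2) * (1 - X3)) * (X4 * X5) / (X1 * X2 * X3 * (V1 * (1 - X4) * V3 * (1 - X5)))"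
      unfolding R_def m by simp
    then show ?thesis unfolding rel[symmetric] using Xnz by simp
  qed
  then have RR: "R = q * ((1 - X1) * U2 * (1 - X2) * (1 - X3)) / (e3 * q powr (real x - real t) * Gb * (V1 * (1 - X4) * V3 * (1 - X5)))"
    by (simp add: X1q Q_def)
  have pw: "q powr 1 * (q powr (b / 2) * q powr ((real (N - t) - 1 + b + c) / 2) * q powr (1/2 - a - real (Suc t)) * q powr (- (Z / 2)) * q powr (- (b / 2))
       * q powr (1/2 - c - real (N - t))) =
     q powr (real x - real t) * Gb * (q powr (1/2 - (a + b) - real x) * q powr (- ((a + real t) / 2)) * q powr (1/2 - (b + c) - real (N - t)))"
    unfolding Gb_def powr_add[symmetric]
    by (rule arg_cong[where f = "\<lambda>x. q powr x"]) (use t in \<open>simp add: Z_def field_simps of_nat_diff\<close>)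
  have "Rho = R"
  proof -
    define u1 where "u1 = q powr (b / 2) * q powr ((real (N - t) - 1 + b + c) / 2) * q powr (1/2 - a - real (Suc t)) * q powr (- (Z / 2)) * q powr (- (b / 2))
       * q powr (1/2 - c - real (N - t))"
    define u2 where "u2 = q powr (1/2 - (a + b) - real x) * q powr (- ((a + real t) / 2)) * q powr (1/2 - (b + c) - real (N - t))"
    define u3 where "u3 = q powr (real x - real t) * Gb"
    have u: "u1 \<noteq> 0" "u3 \<noteq> 0" "q * u1 = u3 * u2" using pw q G by (simp_all add: u1_def u2_def u3_def)
    define W1 where "W1 = (1 - X1) * U2 * (1 - X2) * (1 - X3)"
    define W2 where "W2 = V1 * (1 - X4) * V3 * (1 - X5)"
    have W2: "W2 \<noteq> 0" using Vnz by (simp add: W2_def)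
    have "Rho = (e3 * u2 * W1) / (e1 * e1 * (e2 * e2) * u1 * W2)"
      unfolding Rho_def s1 s2 s3 s4 k1 k2 e1_def[symmetric] e2_def[symmetric] e3_def[symmetric] u1_def u2_def W1_def W2_def
    proof -
      have gen: "e3 * (p1 * A / K) / (e1 * p2) * (- (p3 * (p4 * B / K)) / (- (e1 * e2 * p5) * (p6 * C / K))) / (e2 * p7 * p8 * (p9 * D / K))
        = e3 * (p1 * p3 * p4) * (A * B) / (e1 * e1 * (e2 * e2) * (p2 * p5 * p6 * p7 * p8 * p9) * (C * D))"
        for p1 p2 p3 p4 p5 p6 p7 p8 p9 A B C D :: real
        using K by (simp add: mult_ac)
      show "e3 * (q powr (1/2 - (a + b) - real x) * ((1 - X1) * U2) / K) / (e1 * q powr (b / 2))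
         * (- (q powr (- ((a + real t) / 2)) * (q powr (1/2 - (b + c) - real (N - t)) * ((1 - X2) * (1 - X3)) / K))
           / (- (e1 * e2 * q powr ((real (N - t) - 1 + b + c) / 2)) * (q powr (1/2 - a - real (Suc t)) * (V1 * V3) / K)))
         / (e2 * q powr (- (Z / 2)) * q powr (- (b / 2)) * (q powr (1/2 - c - real (N - t)) * ((1 - X4) * (1 - X5)) / K))
         = e3 * (q powr (1/2 - (a + b) - real x) * q powr (- ((a + real t) / 2)) * q powr (1/2 - (b + c) - real (N - t)))
           * ((1 - X1) * U2 * (1 - X2) * (1 - X3)) / (e1 * e1 * (e2 * e2) * (q powr (b / 2) * q powr ((real (N - t) - 1 + b + c) / 2) * q powr (1/2 - a - real (Suc t)) * q powr (- (Z / 2)) * q powr (- (b / 2))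
       * q powr (1/2 - c - real (N - t))) * (V1 * (1 - X4) * V3 * (1 - X5)))"
        unfolding gen by (simp only: mult_ac)
    qed
    also have "\<dots> = q * W1 / (e3 * u3 * W2)"
    proof -
      have "e3 * u2 * W1 * (e3 * u3 * W2) = (e3 * e3) * (u3 * u2) * (W1 * W2)" by simp
      then have "e3 * u2 * W1 * (e3 * u3 * W2) = q * W1 * (u1 * W2)" unfolding ee u(3)[symmetric] by simp
      then show ?thesis unfolding ee using u W2 ee by (simp add: frac_eq_eq)
    qed
    also have "\<dots> = R" unfolding RR W1_def[symmetric] W2_def[symmetric] u3_def by (simp add: mult_ac)
    finally show ?thesis .
  qed
  then show ?thesis unfolding goal step by simp
qed

lemma ip_term_ph:
  assumes a: "0 < a" and b: "0 < b" and c: "0 < c" and nx: "n \<le> N" "x \<le> N"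
  shows "t \<le> x \<Longrightarrow> ip_term q a b c e n x N t = ip_term q a b c e n x N 0 *
    ph (- q) (q powr (2 * a)) (q powr (2 * b)) (q powr (2 * c)) n x N t"
proof (induction t)
  case 0 then show ?case by (simp add: ph_def)
next
  case (Suc t)
  show ?case
  proof (cases "t < N - n")
    case True
    have IH: "ip_term q a b c e n x N t = ip_term q a b c e n x N 0 * ph (- q) (q powr (2 * a)) (q powr (2 * b)) (q powr (2 * c)) n x N t"
      using Suc by simp
    show ?thesis unfolding ip_term_step[OF a b c Suc_le_lessD[OF Suc.prems] True nx] IH ph_def qpoch_Suc by (simp add: mult_ac)
  next
    case False
    then have "N - n < Suc t" by simp
    have "couple_coeff q a (b + c + real n) (e + n) (N - n) (Suc t) = 0"
      unfolding couple_coeff_def by (rule prod_zero) (use \<open>N - n < Suc t\<close> in \<open>auto intro!: bexI[of _ "N - n"]\<close>)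
    moreover have "(- q) powi (int n - int N) * (- q) ^ (N - n) = 1 / (- q) ^ 0"
      by (rule powi_shift) (use q nx in auto)
    then have "qpoch ((- q) powi (int n - int N)) (- q) (Suc t) = 0"
      unfolding qpoch_def by (intro prod_zero) (use \<open>N - n < Suc t\<close> in \<open>auto intro!: bexI[of _ "N - n"]\<close>)
    ultimately show ?thesis by (simp add: ip_term_def ph_def)
  qed
qed

end

text \<open>The square of the factor by which the univariate Racah polynomial has to be normalized.\<close>

definition racah_weight :: "real \<Rightarrow> real \<Rightarrow> real \<Rightarrow> real \<Rightarrow> nat \<Rightarrow> nat \<Rightarrow> nat \<Rightarrow> real" where
  "racah_weight q a b c n x N = (let Q = - q; G = (\<lambda>\<mu>. q powr (2 * \<mu>)); T = Q ^ N / Q * G (a + b + c) in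
     q powr (2 * b * (real N - real x - real n) - real n * real n + real n + 2 * real n * real N)
     * (qpoch T Q x * qpoch (G c) Q (N - x) * qpoch (G b) Q x * qpoch Q Q (N - n) * qpoch (G a) Q (N - n))
     / (qpoch T Q n * qpoch (G (a + b) * Q ^ (2 * x)) Q (N - x) * qpoch (G a) Q x * qpoch (G b) Q n * qpoch Q Q n * qpoch (G c) Q n
        * qpoch (Q ^ n / Q * G (b + c)) Q n * qpoch (G (b + c) * Q ^ (2 * n)) Q (N - n) * qpoch Q Q x
        * qpoch (Q ^ x / Q * G (a + b)) Q x * qpoch Q Q (N - x)))"

text \<open>The polynomial r_n stripped of its half-integer power, in terms of q^(2a), q^(2b),
  q^(2c) for the weights of the three coupled factors; \<open>racah_uni_eq\<close> gives the
  relation. The sum may stop at x because (Q^(-x))_k vanishes beyond.\<close>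

definition racah_poly :: "real \<Rightarrow> real \<Rightarrow> real \<Rightarrow> real \<Rightarrow> nat \<Rightarrow> nat \<Rightarrow> nat \<Rightarrow> real" where
  "racah_poly Q Ga Gb Gc n x N = qpoch Gb Q n * qpoch (Q ^ N / Q * (Ga * Gb * Gc)) Q n * qpoch (Q powi (- int N)) Q n *
    (\<Sum>k\<le>x. qpoch (Q powi (- int x)) Q k * qpoch (Q ^ x / Q * (Ga * Gb)) Q k * qpoch (Q powi (- int n)) Q k
       * qpoch (Q ^ n / Q * (Gb * Gc)) Q k * Q ^ k
      / (qpoch Q Q k * qpoch (Q powi (- int N)) Q k * qpoch Gb Q k * qpoch (Q ^ N / Q * (Ga * Gb * Gc)) Q k))"

section \<open>The normalized three-factor recoupling coefficient\<close>

context
  fixes q :: real assumes q: "0 < q" "q < 1"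
begin

text \<open>The sign and the power of q that arise when a shifted factorial in base -q is
  reversed.\<close>

lemma prod_neg_powr:
  "(\<Prod>i<n. - ((- q) ^ i)) = sgT n * q powr (real n * (real n - 1) / 2)" for n :: nat
proof -
  have "(\<Prod>i<n. - ((- q) ^ i)) = (\<Prod>i<n. (- 1) ^ Suc i * q powr real i)"
    by (rule prod.cong) (use q in \<open>simp_all add: powr_realpow power_minus[of q]\<close>)
  also have "\<dots> = sgT n * q powr (real n * (real n - 1) / 2)"
    by (simp only: prod.distrib prod_powr[OF q(1)] sum_lessThan_real sgT_def)
  finally show ?thesis .
qed

lemma qpoch_inv_b:
  assumes "0 < b"
  shows "qpoch ((- q) powi (1 - int x) / q powr (2 * b)) (- q) x
    = sgT x * qpoch (q powr (2 * b)) (- q) x * q powr (- 2 * b * real x - real x * (real x - 1) / 2)"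
proof -
  define Gb where "Gb = q powr (2 * b)"
  have Gb: "Gb \<noteq> 0" using q by (simp add: Gb_def)
  have "(\<Prod>i<x. - (Gb * (- q) ^ (x - Suc i))) = (\<Prod>i<x. - (Gb * (- q) ^ i))" by (rule prod_rev)
  also have "\<dots> = (\<Prod>i<x. Gb * (- ((- q) ^ i)))" by simp
  also have "\<dots> = Gb ^ x * (sgT x * q powr (real x * (real x - 1) / 2))"
    by (simp only: prod.distrib prod_neg_powr) simp
  finally have P: "(\<Prod>i<x. - (Gb * (- q) ^ (x - Suc i))) = Gb ^ x * (sgT x * q powr (real x * (real x - 1) / 2))" .
  have r: "qpoch Gb (- q) x = qpoch ((- q) powi (1 - int x) / Gb) (- q) x * (Gb ^ x * (sgT x * q powr (real x * (real x - 1) / 2)))"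
    using qpoch_rev[OF Q_facts[OF q] Gb le_refl[of x]] unfolding P by simp
  have g: "Gb ^ x * q powr (- 2 * b * real x) = 1"
    using q unfolding Gb_def by (simp add: powr_power powr_add[symmetric] mult_ac)
  have g': "q powr (real x * (real x - 1) / 2) * q powr (- (real x * (real x - 1) / 2)) = 1"
    using q by (simp add: powr_add[symmetric])
  have e: "q powr (- 2 * b * real x - real x * (real x - 1) / 2) = q powr (- 2 * b * real x) * q powr (- (real x * (real x - 1) / 2))"
    by (simp add: powr_add[symmetric])
  have "sgT x * qpoch Gb (- q) x * (q powr (- 2 * b * real x) * q powr (- (real x * (real x - 1) / 2))) =
    qpoch ((- q) powi (1 - int x) / Gb) (- q) x * ((sgT x * sgT x) * (Gb ^ x * q powr (- 2 * b * real x))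
      * (q powr (real x * (real x - 1) / 2) * q powr (- (real x * (real x - 1) / 2))))"
    unfolding r by (simp only: mult_ac)
  then show ?thesis unfolding sgT_square g g' e Gb_def[symmetric] by simp
qed

lemma qpoch_inv_N:
  assumes "n \<le> N"
  shows "qpoch (- q) (- q) N = qpoch (- q) (- q) (N - n) * qpoch ((- q) powi (- int N)) (- q) n
    * ((- 1) ^ (N * n) * sgT n * q powr (real n * real N - real n * (real n - 1) / 2))"
proof -
  have "(\<Prod>i<n. - (- q * (- q) ^ (N - Suc i))) = (\<Prod>i<n. (- 1) ^ N * ((- 1) ^ Suc i * q powr (real N - real i)))"
  proof (rule prod.cong)
    fix i assume "i \<in> {..<n}"
    then have i: "i < N" using assms by simp
    then have "- q * (- q) ^ (N - Suc i) = (- q) ^ (N - i)" by (simp flip: power_Suc add: Suc_diff_Suc)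
    also have "\<dots> = (- 1) ^ (N - i) * q ^ (N - i)" by (rule power_minus)
    also have "q ^ (N - i) = q powr (real N - real i)" using q i by (simp flip: powr_realpow add: of_nat_diff)
    also have "(- 1 :: real) ^ (N - i) = (- 1) ^ N * (- 1) ^ i"
      using i by (cases "even N"; cases "even i") simp_all
    finally show "- (- q * (- q) ^ (N - Suc i)) = (- 1) ^ N * ((- 1) ^ Suc i * q powr (real N - real i))" by simp
  qed simp
  also have "\<dots> = (- 1) ^ (N * n) * (sgT n * q powr (\<Sum>i<n. real N - real i))"
    by (simp only: prod.distrib prod_powr[OF q(1)] sgT_def prod_constant card_lessThan power_mult)
  also have "(\<Sum>i<n. real N - real i) = real n * real N - real n * (real n - 1) / 2"
    by (simp add: sum_subtractf sum_lessThan_real)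
  finally show ?thesis using qpoch_rev_Q[OF Q_facts[OF q] assms] by (simp add: mult_ac)
qed

text \<open>Sears' transformation with B = Q^(n-N), C = Q^(1-N-n) / (Gb Gc), d = Q^(-N) and e = Ga.
  Singling out Q^(-N) as \<open>d\<close> gives d/B = Q^(-n) and d/C = Q^(n-1) Gb Gc, the upper
  parameters of the Racah polynomial; the new lower parameters become Gb and Q^(N-1) Ga Gb
  Gc.\<close>

lemma sum_ph:
  assumes a: "0 < a" and b: "0 < b" and c: "0 < c" and nx: "n \<le> N" "x \<le> N"
  defines "Q \<equiv> - q" and "Ga \<equiv> q powr (2 * a)" and "Gb \<equiv> q powr (2 * b)" and "Gc \<equiv> q powr (2 * c)"
  shows "(\<Sum>t\<le>x. ph Q Ga Gb Gc n x N t) =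
    qpoch (Q ^ N / Q * (Ga * Gb * Gc)) Q x * qpoch (Q powi (1 - int x) / Gb) Q x / (qpoch Ga Q x * qpoch (Gc * Q ^ (N - x)) Q x) *
    (\<Sum>k\<le>x. qpoch (Q powi (- int x)) Q k * qpoch (Q ^ x / Q * (Ga * Gb)) Q k * qpoch (Q powi (- int n)) Q k
       * qpoch (Q ^ n / Q * (Gb * Gc)) Q k * Q ^ k
      / (qpoch Q Q k * qpoch (Q powi (- int N)) Q k * qpoch Gb Q k * qpoch (Q ^ N / Q * (Ga * Gb * Gc)) Q k))"
proof -
  have Q0: "Q \<noteq> 0" using q by (simp add: Q_def)
  have G: "0 < Ga" "0 < Gb" "0 < Gc" "Ga < 1" "Gb < 1" "Gc < 1"
    using powr_bounds[OF q a] powr_bounds[OF q b] powr_bounds[OF q c] by (simp_all add: Ga_def Gb_def Gc_def)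
  have Gabc: "0 < Ga * Gb * Gc" "Ga * Gb * Gc < 1"
  proof -
    have "Ga * Gb * Gc = q powr (2 * (a + b + c))" by (simp add: Ga_def Gb_def Gc_def powr_add[symmetric] distrib_left)
    then show "0 < Ga * Gb * Gc" "Ga * Gb * Gc < 1" using powr_bounds[OF q, of "a + b + c"] a b c by simp_all
  qed
  have pi: "Q powi (m + int k) = Q powi m * Q ^ k" for m k using Q0 power_int_add[of Q m "int k"] by simp
  have A: "Q ^ x / Q * (Ga * Gb) \<noteq> 0" using Q0 G by simp
  have B: "Q powi (int n - int N) \<noteq> 0" and C: "Q powi (1 - int N - int n) / (Gb * Gc) \<noteq> 0" and d: "Q powi (- int N) \<noteq> 0"
    using Q0 G by simp_all
  have w: "Q powi (1 - int N) / (Gb * Gc) = Q powi (int n - int N) * (Q powi (1 - int N - int n) / (Gb * Gc)) / Q powi (- int N)"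
  proof -
    have "Q powi (int n - int N) * Q powi (1 - int N - int n) = Q powi (1 - int N) * Q powi (- int N)"
      using Q0 by (simp add: power_int_add[symmetric])
    then show ?thesis using d by (simp add: field_simps)
  qed
  have z: "Gc * Q ^ (N - x) = Ga / (Q ^ x / Q * (Ga * Gb) * (Q powi (1 - int N) / (Gb * Gc)))"
  proof -
    have "Q ^ (N - x) * Q ^ x * Q powi (1 - int N) = Q"
      using pi[of "1 - int N" N] nx by (simp add: power_add[symmetric] mult.commute)
    then show ?thesis using G Q0 by (simp add: field_simps)
  qed
  have f: "Q powi (1 - int N) / Gc = Q powi (1 - int x) / (Gc * Q ^ (N - x))"
  proof -
    have "Q powi (1 - int N) * Q ^ (N - x) = Q powi (1 - int x)"
      using pi[of "1 - int N" "N - x"] nx by (simp add: of_nat_diff)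
    then show ?thesis using G Q0 by (simp add: field_simps)
  qed
  have g: "Gb = Q ^ x / Q * (Ga * Gb) * Q powi (1 - int x) / Ga"
  proof -
    have "Q ^ x * Q powi (1 - int x) = Q" using pi[of "1 - int x" x] by (simp add: mult.commute)
    then show ?thesis using G Q0 by (simp add: field_simps)
  qed
  have ew: "Ga / (Q powi (1 - int N) / (Gb * Gc)) = Q ^ N / Q * (Ga * Gb * Gc)"
  proof -
    have "Q ^ N * Q powi (1 - int N) = Q" using pi[of "1 - int N" N] by (simp add: mult.commute)
    then show ?thesis using G Q0 by (simp add: field_simps)
  qed
  have eA: "Ga / (Q ^ x / Q * (Ga * Gb)) = Q powi (1 - int x) / Gb"
  proof -
    have "Q ^ x * Q powi (1 - int x) = Q" using pi[of "1 - int x" x] by (simp add: mult.commute)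
    then show ?thesis using G Q0 by (simp add: field_simps)
  qed
  have dB: "Q powi (- int N) / Q powi (int n - int N) = Q powi (- int n)" using Q0 by (simp add: power_int_diff[symmetric])
  have dC: "Q powi (- int N) / (Q powi (1 - int N - int n) / (Gb * Gc)) = Q ^ n / Q * (Gb * Gc)"
  proof -
    have "Q powi (1 - int N - int n) * Q ^ n = Q powi (- int N) * Q"
      using pi[of "1 - int N - int n" n] pi[of "- int N" 1] by simp
    then show ?thesis using G Q0 by (simp add: field_simps)
  qed
  have p1: "qpoch (Q powi (- int N)) Q x \<noteq> 0"
  proof (rule qpoch_nonzero)
    fix k assume "k < x"
    then have e: "Q powi (- int N) * Q ^ k = 1 / Q ^ Suc (N - Suc k)"
      by (intro powi_shift[OF Q0]) (use nx in simp)
    show "Q powi (- int N) * Q ^ k \<noteq> 1" unfolding e using Q_facts(1)[OF q, of "N - Suc k"] Q0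
      by (simp add: Q_def field_simps)
  qed
  have p2: "qpoch Ga Q x \<noteq> 0" "qpoch Gb Q x \<noteq> 0" using qpoch_pos0[OF q] G by (simp_all add: Q_def less_imp_neq[symmetric])
  have p3: "qpoch (Gc * Q ^ (N - x)) Q x \<noteq> 0" using qpoch_pos[OF q G(3,6)] by (simp add: Q_def less_imp_neq[symmetric])
  have p4: "qpoch (Q ^ N / Q * (Ga * Gb * Gc)) Q x \<noteq> 0"
  proof -
    have "x = 0 \<or> 0 < N" using nx by auto
    from qpoch_pos_div[OF q Gabc this] show ?thesis by (simp add: Q_def)
  qed
  have p5: "qpoch (Q powi (1 - int N) / Gc) Q x \<noteq> 0"
  proof (rule qpoch_nonzero)
    fix k assume k: "k < x"
    then have e: "Q powi (1 - int N) * Q ^ k = 1 / Q ^ (N - Suc k)" by (intro powi_shift[OF Q0]) (use nx in simp)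
    have "0 < qpoch (Gc * Q ^ (N - Suc k)) Q 1" unfolding Q_def by (rule qpoch_pos[OF q G(3,6)])
    then have "Gc * Q ^ (N - Suc k) \<noteq> 1" by (simp add: qpoch_def)
    moreover have "Q powi (1 - int N) / Gc * Q ^ k = 1 / (Gc * Q ^ (N - Suc k))" using e by (simp add: field_simps)
    ultimately have eq: "Q powi (1 - int N) / Gc * Q ^ k = 1 / (Gc * Q ^ (N - Suc k))" and ne: "Gc * Q ^ (N - Suc k) \<noteq> 1" by blast+
    have "X \<noteq> 1 \<Longrightarrow> 1 / X \<noteq> 1" for X :: real by (cases "X = 0") auto
    then show "Q powi (1 - int N) / Gc * Q ^ k \<noteq> 1" unfolding eq using ne by blast
  qed
  have "Q ^ Suc k \<noteq> 1" for k using Q_facts(1)[OF q] by (simp add: Q_def del: power_Suc)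
  note S = sears[OF this Q0 A B C d less_imp_neq[OF G(1), symmetric] w z f g p1 p2(1) p5 p3 _ p2(2), unfolded ew eA dB dC, OF p4]
  show ?thesis unfolding ph_def S by (simp only: mult_ac)
qed

text \<open>The unnormalized overlap is a sign, a positive constant \<open>Yv\<close>, the
  polynomial and the norms of the three factors. The four couplings contribute the product
  \<open>NR\<close> of their norm constants, and Yv^2 equals \<open>racah_weight\<close> times
  \<open>NR\<close>; dividing by the square root of \<open>NR\<close> leaves the square root of the
  weight.\<close>

lemma nov_recoupling:
  assumes A: "lw q A" and B: "lw q B" and C: "lw q C" "nl C = 0" and nx: "n \<le> N" "x \<le> N"
  shows "nov (couple q A (couple q B C n) (N - n)) (couple q (couple q A B x) C (N - x)) =
    (- 1) ^ (N * x + x + N * n) * sgT n * sqrt (racah_weight q (wt A) (wt B) (wt C) n x N)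
      * racah_poly (- q) (q powr (2 * wt A)) (q powr (2 * wt B)) (q powr (2 * wt C)) n x N"
proof -
  define a b c where "a = wt A" and "b = wt B" and "c = wt C"
  have abc: "0 < a" "0 < b" "0 < c" unfolding a_def b_def c_def by (rule lwD(5)[OF A] lwD(5)[OF B] lwD(5)[OF C(1)])+
  define V where "V = couple q A (couple q B C n) (N - n)"
  define Y where "Y = couple q A B x"
  define M where "M = N - x"
  define Q where "Q = - q"
  define G where "G = (\<lambda>\<mu>. q powr (2 * \<mu>))"
  define K where "K = 1 / q - q"
  have K: "0 < K" using kappa_pos[OF q] by (simp add: K_def)
  have W: "lw q (couple q B C n)" by (rule lw_couple[OF q B C(1)])
  have V: "lw q V" unfolding V_def by (rule lw_couple[OF q A W])
  have Y: "lw q Y" unfolding Y_def by (rule lw_couple[OF q A B])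
  have Z: "lw q (couple q Y C M)" by (rule lw_couple[OF q Y C(1)])
  have wtY: "wt Y = a + b + real x" and wtW: "wt (couple q B C n) = b + c + real n" by (simp_all add: Y_def a_def b_def c_def)
  define S3 where "S3 = sq A * sq B * sq C"
  have S3: "0 < S3" unfolding S3_def by (intro mult_pos_pos lwD(3)[OF A] lwD(3)[OF B] lwD(3)[OF C(1)])
  define \<phi> where "\<phi> = (\<Sum>k\<le>x. qpoch (Q powi (- int x)) Q k * qpoch (Q ^ x / Q * (G a * G b)) Q k * qpoch (Q powi (- int n)) Q k
       * qpoch (Q ^ n / Q * (G b * G c)) Q k * Q ^ k
      / (qpoch Q Q k * qpoch (Q powi (- int N)) Q k * qpoch (G b) Q k * qpoch (Q ^ N / Q * (G a * G b * G c)) Q k))"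
  define T where "T = Q ^ N / Q * G (a + b + c)"
  have Gm: "G (u + v) = G u * G v" for u v by (simp add: G_def distrib_left powr_add)
  have T': "Q ^ N / Q * (G a * G b * G c) = T" by (simp add: T_def Gm)
  have "ov V (couple q Y C M) = raise_coeff q (a + b + real x) c 0 M M * (\<Sum>t\<le>x. ip_term q a b c (nl B) n x N t) * S3"
  proof -
    have "ov V (couple q Y C M) = raise_coeff q (wt Y) (wt C) (nl C) M M *
    (\<Sum>t\<le>x. raise_coeff q (wt A) (wt B) (nl B) x t * ((\<Prod>l<N - t. (- 1) ^ (nl C + l + 1))
       * q powr (- (real (N - t) * (wt A + wt B + wt C + real N - 1) / 2)))
      * (if t \<le> N - n then couple_coeff q (wt A) (wt B + wt C + real n) (nl B + nl C + n) (N - n) t * sigf q (wt A) t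
           * q powr (- (real (N - n - t) * wt B / 2)) * sigf q (wt C) (N - t) * sq A * sq B * sq C else 0))"
      unfolding ov_def V_def Y_def M_def
      by (rule ip_recoupling[OF q A B C(1) nx]) (use nx in \<open>simp_all add: C(2)\<close>)
    also have "(\<Sum>t\<le>x. raise_coeff q (wt A) (wt B) (nl B) x t * ((\<Prod>l<N - t. (- 1) ^ (nl C + l + 1))
       * q powr (- (real (N - t) * (wt A + wt B + wt C + real N - 1) / 2)))
      * (if t \<le> N - n then couple_coeff q (wt A) (wt B + wt C + real n) (nl B + nl C + n) (N - n) t * sigf q (wt A) t
           * q powr (- (real (N - n - t) * wt B / 2)) * sigf q (wt C) (N - t) * sq A * sq B * sq C else 0))
       = (\<Sum>t\<le>x. ip_term q a b c (nl B) n x N t * S3)"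
    proof (rule sum.cong)
      fix t assume "t \<in> {..x}"
      have cz: "couple_coeff q a (b + c + real n) (nl B + n) (N - n) t = 0" if "\<not> t \<le> N - n"
        unfolding couple_coeff_def by (rule prod_zero) (use that in \<open>auto intro!: bexI[of _ "N - n"]\<close>)
      show "raise_coeff q (wt A) (wt B) (nl B) x t * ((\<Prod>l<N - t. (- 1) ^ (nl C + l + 1))
       * q powr (- (real (N - t) * (wt A + wt B + wt C + real N - 1) / 2)))
      * (if t \<le> N - n then couple_coeff q (wt A) (wt B + wt C + real n) (nl B + nl C + n) (N - n) t * sigf q (wt A) t
           * q powr (- (real (N - n - t) * wt B / 2)) * sigf q (wt C) (N - t) * sq A * sq B * sq C else 0)
       = ip_term q a b c (nl B) n x N t * S3"
      proof (cases "t \<le> N - n")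
        case True
        then show ?thesis unfolding ip_term_def sgT_def S3_def a_def b_def c_def C(2) by (simp add: mult_ac)
      next
        case False
        then show ?thesis unfolding ip_term_def cz[OF False] by simp
      qed
    qed simp
    finally show ?thesis unfolding wtY C(2) sum_distrib_right[symmetric] by (simp add: c_def mult_ac)
  qed
  also have "(\<Sum>t\<le>x. ip_term q a b c (nl B) n x N t) = ip_term q a b c (nl B) n x N 0 * (\<Sum>t\<le>x. ph Q (G a) (G b) (G c) n x N t)"
    unfolding sum_distrib_left Q_def G_def by (rule sum.cong[OF refl], rule ip_term_ph[OF q abc nx]) simp
  also have "(\<Sum>t\<le>x. ph Q (G a) (G b) (G c) n x N t) =
    qpoch T Q x * qpoch (Q powi (1 - int x) / G b) Q x / (qpoch (G a) Q x * qpoch (G c * Q ^ M) Q x) * \<phi>"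
    unfolding \<phi>_def T'[symmetric] M_def unfolding Q_def G_def by (rule sum_ph[OF abc nx])
  finally have ov: "ov V (couple q Y C M) = raise_coeff q (a + b + real x) c 0 M M * (ip_term q a b c (nl B) n x N 0 *
     (qpoch T Q x * qpoch (Q powi (1 - int x) / G b) Q x / (qpoch (G a) Q x * qpoch (G c * Q ^ M) Q x) * \<phi>)) * S3" .
  define NR where "NR = couple_norm q b c 0 n * couple_norm q a (b + c + real n) (nl B + n) (N - n) * couple_norm q a b (nl B) x * couple_norm q (a + b + real x) c 0 M"
  have sqs: "sq V * sq (couple q Y C M) = NR * (S3 * S3)"
    unfolding V_def sq_couple[OF q A W] sq_couple[OF q B C(1)] sq_couple[OF q Y C(1)] unfolding Y_def sq_couple[OF q A B]
    by (simp add: NR_def S3_def C(2) a_def b_def c_def mult_ac)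
  have "0 < sq V * sq (couple q Y C M)" using lwD(3)[OF V] lwD(3)[OF Z] by simp
  then have NR: "0 < NR" unfolding sqs using S3 by (simp add: zero_less_mult_iff)
  have gp: "0 < G u" "G u < 1" if "0 < u" for u using powr_bounds[OF q that] by (simp_all add: G_def)
  have Nx: "N = M + x" "N = n + (N - n)" using nx by (simp_all add: M_def)
  define g1 g2 g3 gn where "g1 = qpoch T Q x" and "g2 = qpoch (Q ^ M / Q * G (a + b + real x + c)) Q M"
    and "g3 = qpoch (Q ^ (N - n) / Q * G (a + (b + c + real n))) Q (N - n)" and "gn = qpoch T Q n"
  have Gu: "G (u + real v) = G u * Q ^ (2 * v)" for u v unfolding G_def Q_def by (rule powr_2u[OF q])
  have g2T: "Q ^ M / Q * G (a + b + real x + c) = T * Q ^ x"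
  proof -
    have "G (a + b + real x + c) = G (a + b + c) * Q ^ (2 * x)" using Gu[of "a + b + c" x] by (simp add: add_ac)
    moreover have "Q ^ M * Q ^ (2 * x) = Q ^ N * Q ^ x" unfolding power_add[symmetric] Nx(1) by (rule arg_cong[where f = "\<lambda>k. Q ^ k"]) simp
    ultimately show ?thesis by (simp add: T_def mult_ac)
  qed
  have g3T: "Q ^ (N - n) / Q * G (a + (b + c + real n)) = T * Q ^ n"
  proof -
    have "G (a + (b + c + real n)) = G (a + b + c) * Q ^ (2 * n)" using Gu[of "a + b + c" n] by (simp add: add_ac)
    moreover have "Q ^ (N - n) * Q ^ (2 * n) = Q ^ N * Q ^ n" unfolding power_add[symmetric] by (rule arg_cong[where f = "\<lambda>k. Q ^ k"]) (use nx in simp)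
    ultimately show ?thesis by (simp add: T_def mult_ac)
  qed
  \<comment> \<open>Both sides are (T)_N, cut once at x and once at n.\<close>
  have raise_coeff': "g1 * g2 = gn * g3"
    unfolding g1_def g2_def g3_def gn_def g2T g3T qpoch_add[symmetric] using Nx by (simp add: add.commute)
  have T_pos: "0 < qpoch T Q m" if "m = 0 \<or> 0 < N" for m
    unfolding T_def Q_def by (rule qpoch_pos_div[OF q gp(1) gp(2) that]) (use abc in simp_all)
  have powr_bounds': "0 < g1" "0 < g2" "0 < g3" "0 < gn"
  proof -
    show "0 < g1" "0 < gn" unfolding g1_def gn_def by (rule T_pos, use nx in auto)+
    have "0 < qpoch T Q (x + M)" by (rule T_pos) (use Nx in auto)
    also have "qpoch T Q (x + M) = g1 * g2" unfolding g1_def g2_def g2T by (rule qpoch_add)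
    finally have 12: "0 < g1 * g2" .
    then show "0 < g2" using \<open>0 < g1\<close> by (rule zero_less_mult_pos)
    from 12 show "0 < g3" unfolding raise_coeff' using \<open>0 < gn\<close> by (rule zero_less_mult_pos)
  qed
  define cM cMx where "cM = qpoch (G c) Q M" and "cMx = qpoch (G c * Q ^ M) Q x"
  have cN: "qpoch (G c) Q N = cM * cMx" unfolding Nx(1) cM_def cMx_def by (rule qpoch_add)
  define h1 where "h1 = qpoch (G (a + b) * Q ^ (2 * x)) Q M"
  define ax bx bn where "ax = qpoch (G a) Q x" and "bx = qpoch (G b) Q x" and "bn = qpoch (G b) Q n"
  define Qn Qx QM QNn where "Qn = qpoch Q Q n" and "Qx = qpoch Q Q x" and "QM = qpoch Q Q M" and "QNn = qpoch Q Q (N - n)"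
  define aNn cn where "aNn = qpoch (G a) Q (N - n)" and "cn = qpoch (G c) Q n"
  define h2 h3 h4 where "h2 = qpoch (Q ^ n / Q * G (b + c)) Q n" and "h3 = qpoch (G (b + c) * Q ^ (2 * n)) Q (N - n)"
    and "h4 = qpoch (Q ^ x / Q * G (a + b)) Q x"
  define nN where "nN = qpoch (Q powi (- int N)) Q n"
  have pos: "0 < cM" "0 < cMx" "0 < h1" "0 < ax" "0 < bx" "0 < bn" "0 < Qn" "0 < Qx" "0 < QM" "0 < QNn" "0 < aNn" "0 < cn" "0 < h2" "0 < h3" "0 < h4"
  proof -
    have ab: "0 < a + b" "0 < b + c" using abc by simp_all
    show "0 < cM" "0 < ax" "0 < bx" "0 < bn" "0 < aNn" "0 < cn"
      unfolding cM_def ax_def bx_def bn_def aNn_def cn_def Q_def by (intro qpoch_pos0[OF q] gp abc)+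
    show "0 < Qn" "0 < Qx" "0 < QM" "0 < QNn"
      unfolding Qn_def Qx_def QM_def QNn_def Q_def by (rule qpoch_Q_pos[OF q])+
    show "0 < cMx" unfolding cMx_def Q_def by (intro qpoch_pos[OF q] gp abc)
    show "0 < h1" "0 < h3" unfolding h1_def h3_def Q_def by (intro qpoch_pos[OF q] gp ab)+
    show "0 < h2" "0 < h4" unfolding h2_def h4_def Q_def by (intro qpoch_pos_div[OF q] gp ab, blast)+
  qed
  have h1q: "h1 = qpoch (q powr (2 * (a + b + real x))) (- q) M" unfolding h1_def G_def Q_def powr_2u[OF q] ..
  have h3q: "h3 = qpoch (q powr (2 * (b + c + real n))) (- q) (N - n)" unfolding h3_def G_def Q_def powr_2u[OF q] ..
  define e0 where "e0 = real M * (a + b + real x - c) / 2 - real M * real M / 2 + real M / 2 - real M * c"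
  define e1 where "e1 = - 2 * b * real x - real x * (real x - 1) / 2"
  define e2 where "e2 = real n * real N - real n * (real n - 1) / 2"
  define e3 where "e3 = real N * (1/2 - c) - real N * (real N + 1) / 2"
  define u4 where "u4 = - (real N * (a + b + c + real N - 1) / 2)"
  define u5 where "u5 = - (real (N - n) * b / 2)"
  define u6 where "u6 = real x * a / 2"
  have ggt: "raise_coeff q (a + b + real x) c 0 M M = sgT M * q powr e0 * g2 / h1"
    unfolding h1q e0_def g2_def Q_def G_def by (rule raise_coeff_top_closed[OF q]) (use abc in simp)
  have tm0: "ip_term q a b c (nl B) n x N 0 = q powr u6 * (sgT N * q powr u4) * (q powr u5 * (q powr e3 * qpoch Q Q N * (cM * cMx) / K ^ N))"
    unfolding ip_term_def sigf_closed[OF q] cN[symmetric] by (simp add: u4_def u5_def u6_def e3_def raise_coeff_def Q_def G_def K_def)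
  have ib: "qpoch (Q powi (1 - int x) / G b) Q x = sgT x * bx * q powr e1"
    unfolding e1_def bx_def Q_def G_def by (rule qpoch_inv_b[OF abc(2)])
  have iN: "qpoch Q Q N = QNn * nN * ((- 1) ^ (N * n) * sgT n * q powr e2)"
    unfolding e2_def QNn_def nN_def Q_def by (rule qpoch_inv_N[OF nx(1)])
  define E1 where "E1 = e0 + e1 + e2 + e3 + u4 + u5 + u6"
  \<comment> \<open>The positive part of the overlap. The prefactors \<open>bn\<close>,
    \<open>gn\<close> and \<open>nN\<close> belong to the polynomial and are split off, so
    \<open>bn\<close> appears here as a divisor.\<close>
  define Yv where "Yv = q powr E1 * g3 * bx * QNn * cM / (h1 * ax * K ^ N * bn)"
  have Yv: "0 < Yv" unfolding Yv_def using pos powr_bounds' K q by simp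
  have sg: "sgT M * sgT N * sgT x = (- 1) ^ (N * x + x)"
  proof -
    have "sgT N = sgT M * sgT x * (- 1) ^ (M * x)" unfolding Nx(1) by (rule sgT_add)
    then have "sgT M * sgT N * sgT x = (sgT M * sgT M) * (sgT x * sgT x) * (- 1) ^ (M * x)" by simp
    also have "\<dots> = (- 1) ^ (M * x)" by (simp add: sgT_square)
    also have "\<dots> = (- 1) ^ (N * x + x)" unfolding Nx(1) by (cases "even x"; cases "even M") simp_all
    finally show ?thesis .
  qed
  have pw: "q powr E1 = q powr e0 * q powr e1 * q powr e2 * q powr e3 * q powr u4 * q powr u5 * q powr u6"
    unfolding E1_def by (simp only: powr_add)
  have main: "raise_coeff q (a + b + real x) c 0 M M * (ip_term q a b c (nl B) n x N 0 *
     (g1 * qpoch (Q powi (1 - int x) / G b) Q x / (ax * cMx) * \<phi>))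
    = (- 1) ^ (N * x + x + N * n) * sgT n * Yv * (bn * gn * nN * \<phi>)"
  proof -
    have "raise_coeff q (a + b + real x) c 0 M M * (ip_term q a b c (nl B) n x N 0 *
     (g1 * qpoch (Q powi (1 - int x) / G b) Q x / (ax * cMx) * \<phi>)) =
      (sgT M * sgT N * sgT x) * (- 1) ^ (N * n) * sgT n * (q powr E1 * (g1 * g2) * bx * QNn * cM / (h1 * ax * K ^ N)) * nN * \<phi>"
      unfolding ggt tm0 ib iN pw using pos by (simp add: mult_ac)
    then show ?thesis unfolding sg raise_coeff' Yv_def power_add using pos by (simp add: mult_ac)
  qed
  define eW where "eW = 2 * b * (real N - real x - real n) - real n * real n + real n + 2 * real n * real N"
  have racah_weight: "racah_weight q a b c n x N = q powr eW * (g1 * cM * bx * QNn * aNn) / (gn * h1 * ax * bn * Qn * cn * h2 * h3 * Qx * h4 * QM)"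
    unfolding racah_weight_def Let_def eW_def g1_def cM_def bx_def QNn_def aNn_def gn_def h1_def ax_def bn_def Qn_def cn_def h2_def h3_def
      Qx_def h4_def QM_def T_def M_def Q_def G_def ..
  define f1 where "f1 = - 3 * real n * c - 3 / 2 * real n * real n + real n"
  define f2 where "f2 = - 3 * real (N - n) * (b + c + real n) - 3 / 2 * real (N - n) * real (N - n) + real (N - n)"
  define f3 where "f3 = - 3 * real x * b - 3 / 2 * real x * real x + real x"
  define f4 where "f4 = - 3 * real M * c - 3 / 2 * real M * real M + real M"
  have n1: "couple_norm q b c 0 n = q powr f1 * Qn * cn * h2 / (bn * K ^ n)"
    unfolding couple_norm_closed[OF q abc(2)] f1_def Qn_def cn_def h2_def bn_def K_def Q_def G_def ..
  have n2: "couple_norm q a (b + c + real n) (nl B + n) (N - n) = q powr f2 * QNn * h3 * g3 / (aNn * K ^ (N - n))"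
    unfolding couple_norm_closed[OF q abc(1)] f2_def QNn_def g3_def aNn_def K_def h3q unfolding Q_def G_def ..
  have n3: "couple_norm q a b (nl B) x = q powr f3 * Qx * bx * h4 / (ax * K ^ x)"
    unfolding couple_norm_closed[OF q abc(1)] f3_def Qx_def bx_def h4_def ax_def K_def Q_def G_def ..
  have n4: "couple_norm q (a + b + real x) c 0 M = q powr f4 * QM * cM * g2 / (h1 * K ^ M)"
  proof -
    have p: "0 < a + b + real x" using abc by simp
    show ?thesis unfolding couple_norm_closed[OF q p] f4_def QM_def cM_def g2_def K_def h1q unfolding Q_def G_def ..
  qed
  \<comment> \<open>All half-integral powers of q meet here. Once N is replaced by M + x, the
    exponents agree as polynomials in a, b, c, M, x and n.\<close>
  have pE: "q powr E1 * q powr E1 = q powr eW * (q powr f1 * q powr f2 * q powr f3 * q powr f4)"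
  proof -
    have rN: "real N = real M + real x" "real (N - n) = real M + real x - real n" using nx by (simp_all add: M_def of_nat_diff)
    show ?thesis unfolding powr_add[symmetric]
      by (rule arg_cong[where f = "\<lambda>x. q powr x"])
        (unfold E1_def eW_def f1_def f2_def f3_def f4_def e0_def e1_def e2_def e3_def u4_def u5_def u6_def rN, simp add: field_simps)
  qed
  have KK: "K ^ n * K ^ (N - n) = K ^ N" "K ^ x * K ^ M = K ^ N" unfolding power_add[symmetric] using Nx by (simp_all add: add.commute)
  have "Yv * Yv = racah_weight q a b c n x N * NR"
  proof -
    have "racah_weight q a b c n x N * NR = (q powr eW * (q powr f1 * q powr f2 * q powr f3 * q powr f4)) * (g1 * g2) * g3 / gn * (bx * bx * (QNn * QNn) * (cM * cM))
        / (h1 * h1 * (ax * ax) * ((K ^ n * K ^ (N - n)) * (K ^ x * K ^ M)) * (bn * bn))"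
      unfolding NR_def n1 n2 n3 n4 racah_weight using pos powr_bounds' K by (simp add: mult_ac)
    also have "\<dots> = (q powr E1 * q powr E1) * (g3 * g3) * (bx * bx * (QNn * QNn) * (cM * cM))
        / (h1 * h1 * (ax * ax) * (K ^ N * K ^ N) * (bn * bn))"
      unfolding pE[symmetric] raise_coeff' KK using powr_bounds' by simp
    finally show ?thesis unfolding Yv_def by (simp add: mult_ac)
  qed
  then have "sqrt (racah_weight q a b c n x N) * sqrt NR = sqrt (Yv * Yv)" unfolding real_sqrt_mult[symmetric] by (rule arg_cong[OF sym])
  also have "\<dots> = Yv" using Yv by simp
  finally have "sqrt (racah_weight q a b c n x N) * sqrt NR = Yv" .
  then have Ys: "Yv / sqrt NR = sqrt (racah_weight q a b c n x N)" using NR by (simp add: field_simps)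
  have "sqrt (sq V) * sqrt (sq (couple q Y C M)) = sqrt NR * S3"
    using sqs S3 by (simp add: real_sqrt_mult[symmetric]) (simp add: real_sqrt_mult)
  then have "nov V (couple q Y C M) = (- 1) ^ (N * x + x + N * n) * sgT n * Yv * (bn * gn * nN * \<phi>) * S3 / (sqrt NR * S3)"
    unfolding nov_def ov using main by (simp add: g1_def ax_def cMx_def)
  also have "\<dots> = (- 1) ^ (N * x + x + N * n) * sgT n * (Yv / sqrt NR) * (bn * gn * nN * \<phi>)" using S3 by simp
  also have "bn * gn * nN * \<phi> = racah_poly Q (G a) (G b) (G c) n x N" unfolding racah_poly_def \<phi>_def T' bn_def gn_def nN_def ..
  finally show ?thesis unfolding Ys V_def Y_def M_def a_def b_def c_def Q_def G_def .
qed

end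

text \<open>\<open>Zf\<close> carries the telescoping part of the weights; \<open>Ef\<close> and \<open>Ff\<close> are the factors of the products over \<open>k\<close> in
  \<open>rho\<close> and \<open>hnorm\<close>.\<close>

definition Zf :: "real \<Rightarrow> real \<Rightarrow> real \<Rightarrow> real \<Rightarrow> nat \<Rightarrow> nat \<Rightarrow> real" where
  "Zf q a b b' M K = qpoch (- q) (- q) (M - K) * qpoch (q powr (2 * a)) (- q) (M - K)
     * q powr (2 * b' * real M + 2 * a * real K + 2 * real K * real M - real K * real K)
     / (qpoch (q powr (2 * (a + b)) / (- q)) (- q) (M + K) * qpoch (q powr (2 * b)) (- q) (M + K))"

definition Ef :: "real \<Rightarrow> real \<Rightarrow> real \<Rightarrow> real \<Rightarrow> real \<Rightarrow> nat \<Rightarrow> nat \<Rightarrow> real" where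
  "Ef q a b c g X X' = qpoch (q powr (2 * c)) (- q) (X' - X) / qpoch (- q) (- q) (X' - X)
     * (qpoch (q powr (2 * (a + b + c)) / (- q)) (- q) (X + X') / qpoch (q powr (2 * (a + b))) (- q) (X + X'))
     * ((1 - q powr (2 * (a + b)) / (- q) * (- q) ^ (2 * X)) / (1 - q powr (2 * (a + b)) / (- q)))
     * q powr (- 2 * g * real X)"

definition Ff :: "real \<Rightarrow> real \<Rightarrow> real \<Rightarrow> nat \<Rightarrow> nat \<Rightarrow> real" where
  "Ff q b c K K' = qpoch (- q) (- q) (K' - K) * qpoch (q powr (2 * c)) (- q) (K' - K)
     * (qpoch (q powr (2 * b)) (- q) (K + K') / qpoch (q powr (2 * (b + c)) / (- q)) (- q) (K + K'))
     * ((1 - q powr (2 * (b + c)) / (- q)) / (1 - q powr (2 * (b + c)) / (- q) * (- q) ^ (2 * K')))"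

section \<open>Telescoping of the weights along the sequence of recouplings\<close>

context
  fixes q :: real assumes q: "0 < q" "q < 1"
begin

lemma qpoch_pos_inv:
  assumes "0 < G" "G < 1"
  shows "0 < qpoch (G / (- q)) (- q) m"
proof (cases m)
  case (Suc k)
  have "0 < 1 - G / (- q)" using assms q by (simp add: add_pos_pos)
  moreover have "G / (- q) * - q = G" using q by simp
  ultimately show ?thesis unfolding Suc qpoch_Suc_left using qpoch_pos0[OF q assms] by simp
qed simp

text \<open>Here \<open>X\<close>, \<open>X'\<close> are consecutive partial sums of the first tuple
  and \<open>K\<close>, \<open>K'\<close> those of the second; \<open>b'\<close> stands for the
  preceding value of \<open>b\<close>. A factorial with parameter shifted by a power of Q is a
  quotient of two unshifted ones. Those involving both kinds of sums form the quotient of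
  \<open>Zf\<close>, the rest splits into \<open>Ef\<close> and \<open>Ff\<close>. The power of q
  left at the end is the squared modulus of the half-integer power in r_n.\<close>

lemma racah_weight_step:
  assumes a: "0 < a" and b: "0 < b" and c: "0 < c" and le: "K \<le> K'" "K \<le> X" "X \<le> X'" "K' \<le> X'"
  shows "racah_weight q a (b + real K) c (K' - K) (X - K) (X' - K) =
    Zf q a (b + c) b X' K' / Zf q a b b' X K * (Ef q a b c (b - b') X X' / Ff q b c K K')
      * q powr ((1 - 2 * real K - 2 * a - 2 * b) * real (K' - K))"
proof -
  define Q where "Q = - q"
  define G where "G = (\<lambda>\<mu>. q powr (2 * \<mu>))"
  have Q0: "Q \<noteq> 0" using q by (simp add: Q_def)
  have gp: "0 < G u" "G u < 1" if "0 < u" for u using powr_bounds[OF q that] by (simp_all add: G_def)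
  have Gu: "G (u + real v) = G u * Q ^ (2 * v)" for u v unfolding G_def Q_def by (rule powr_2u[OF q])
  define n x N where "n = K' - K" and "x = X - K" and "N = X' - K"
  have Nx: "N - x = X' - X" "N - n = X' - K'" using le by (simp_all add: n_def x_def N_def)
  define P where "P = (\<lambda>m. qpoch (G (a + b) / Q) Q m)"
  define R where "R = (\<lambda>m. qpoch (G (a + b + c) / Q) Q m)"
  define S where "S = (\<lambda>m. qpoch (G (b + c) / Q) Q m)"
  define B where "B = (\<lambda>m. qpoch (G b) Q m)"
  define A where "A = (\<lambda>m. qpoch (G a) Q m)"
  define C where "C = (\<lambda>m. qpoch (G c) Q m)"
  define D where "D = (\<lambda>m. qpoch Q Q m)"
  have pos: "0 < P m" "0 < R m" "0 < S m" "0 < B m" "0 < A m" "0 < C m" "0 < D m" for m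
  proof -
    have ab: "0 < a + b" "0 < a + b + c" "0 < b + c" using a b c by simp_all
    show "0 < P m" unfolding P_def Q_def by (rule qpoch_pos_inv[OF gp[OF ab(1)]])
    show "0 < R m" unfolding R_def Q_def by (rule qpoch_pos_inv[OF gp[OF ab(2)]])
    show "0 < S m" unfolding S_def Q_def by (rule qpoch_pos_inv[OF gp[OF ab(3)]])
    show "0 < B m" unfolding B_def Q_def by (rule qpoch_pos0[OF q gp[OF b]])
    show "0 < A m" unfolding A_def Q_def by (rule qpoch_pos0[OF q gp[OF a]])
    show "0 < C m" unfolding C_def Q_def by (rule qpoch_pos0[OF q gp[OF c]])
    show "0 < D m" unfolding D_def Q_def by (rule qpoch_Q_pos[OF q])
  qed
  have sh: "qpoch (u * Q ^ m) Q k = qpoch u Q (m + k) / qpoch u Q m" if "qpoch u Q m \<noteq> 0" for u m k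
    using that by (simp add: qpoch_add)
  have nz: "P m \<noteq> 0" "R m \<noteq> 0" "S m \<noteq> 0" "B m \<noteq> 0" for m using pos by (simp_all add: less_imp_neq[symmetric])
  have Tx: "Q ^ N / Q * G (a + (b + real K) + c) = G (a + b + c) / Q * Q ^ (X' + K)"
  proof -
    have "G (a + (b + real K) + c) = G (a + b + c) * Q ^ (2 * K)" using Gu[of "a + b + c" K] by (simp add: add_ac)
    moreover have "Q ^ N * Q ^ (2 * K) = Q ^ (X' + K)" unfolding power_add[symmetric] by (rule arg_cong[where f = "\<lambda>k. Q ^ k"]) (use le in \<open>simp add: N_def\<close>)
    ultimately show ?thesis by (simp add: mult_ac)
  qed
  have t1: "qpoch (Q ^ N / Q * G (a + (b + real K) + c)) Q x = R (X + X') / R (X' + K)"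
    unfolding Tx sh[OF nz(2)[unfolded R_def]] R_def using le by (simp add: x_def add.commute)
  have t2: "qpoch (Q ^ N / Q * G (a + (b + real K) + c)) Q n = R (X' + K') / R (X' + K)"
    unfolding Tx sh[OF nz(2)[unfolded R_def]] R_def using le by (simp add: n_def)
  have t3: "qpoch (G (b + real K)) Q x = B (X + K) / B (2 * K)"
    unfolding Gu sh[OF nz(4)[unfolded B_def]] B_def using le by (simp add: x_def add.commute mult_2)
  have t4: "qpoch (G (b + real K)) Q n = B (K + K') / B (2 * K)"
    unfolding Gu sh[OF nz(4)[unfolded B_def]] B_def using le by (simp add: n_def add.commute mult_2)
  have e5: "G (a + (b + real K)) * Q ^ (2 * x) = G (a + b) / Q * Q ^ (2 * X + 1)"
  proof -
    have "G (a + (b + real K)) = G (a + b) * Q ^ (2 * K)" using Gu[of "a + b" K] by (simp add: add_ac)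
    moreover have "Q ^ (2 * K) * Q ^ (2 * x) = Q ^ (2 * X)" unfolding power_add[symmetric] by (rule arg_cong[where f = "\<lambda>k. Q ^ k"]) (use le in \<open>simp add: x_def\<close>)
    ultimately show ?thesis using Q0 by (simp add: mult_ac)
  qed
  have t5: "qpoch (G (a + (b + real K)) * Q ^ (2 * x)) Q (X' - X) = P (X + X' + 1) / P (2 * X + 1)"
  proof -
    have "2 * X + 1 + (X' - X) = X + X' + 1" using le by simp
    then show ?thesis unfolding e5 sh[OF nz(1)[unfolded P_def]] P_def by simp
  qed
  have e6: "Q ^ x / Q * G (a + (b + real K)) = G (a + b) / Q * Q ^ (X + K)"
  proof -
    have "G (a + (b + real K)) = G (a + b) * Q ^ (2 * K)" using Gu[of "a + b" K] by (simp add: add_ac)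
    moreover have "Q ^ x * Q ^ (2 * K) = Q ^ (X + K)" unfolding power_add[symmetric] by (rule arg_cong[where f = "\<lambda>k. Q ^ k"]) (use le in \<open>simp add: x_def\<close>)
    ultimately show ?thesis using Q0 by (simp add: mult_ac)
  qed
  have t6: "qpoch (Q ^ x / Q * G (a + (b + real K))) Q x = P (2 * X) / P (X + K)"
  proof -
    have e: "X + K + x = 2 * X" using le by (simp add: x_def)
    show ?thesis unfolding e6 sh[OF nz(1)[unfolded P_def]] P_def e ..
  qed
  have bc: "G (b + real K + c) = G (b + c) * Q ^ (2 * K)" using Gu[of "b + c" K] by (simp add: add_ac)
  have e7: "Q ^ n / Q * G (b + real K + c) = G (b + c) / Q * Q ^ (K + K')"
  proof -
    have "Q ^ n * Q ^ (2 * K) = Q ^ (K + K')" unfolding power_add[symmetric] by (rule arg_cong[where f = "\<lambda>k. Q ^ k"]) (use le in \<open>simp add: n_def\<close>)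
    then show ?thesis unfolding bc using Q0 by (simp add: mult_ac)
  qed
  have t7: "qpoch (Q ^ n / Q * G (b + real K + c)) Q n = S (2 * K') / S (K + K')"
  proof -
    have e: "K + K' + n = 2 * K'" using le by (simp add: n_def)
    show ?thesis unfolding e7 sh[OF nz(3)[unfolded S_def]] S_def e ..
  qed
  have e8: "G (b + real K + c) * Q ^ (2 * n) = G (b + c) / Q * Q ^ (2 * K' + 1)"
  proof -
    have "Q ^ (2 * K) * Q ^ (2 * n) = Q ^ (2 * K')" unfolding power_add[symmetric] by (rule arg_cong[where f = "\<lambda>k. Q ^ k"]) (use le in \<open>simp add: n_def\<close>)
    then show ?thesis unfolding bc using Q0 by (simp add: mult_ac)
  qed
  have t8: "qpoch (G (b + real K + c) * Q ^ (2 * n)) Q (X' - K') = S (X' + K' + 1) / S (2 * K' + 1)"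
  proof -
    have e: "2 * K' + 1 + (X' - K') = X' + K' + 1" using le by simp
    show ?thesis unfolding e8 sh[OF nz(3)[unfolded S_def]] S_def e ..
  qed
  define w where "w = 2 * (b + real K) * (real N - real x - real n) - real n * real n + real n + 2 * real n * real N"
  have W: "racah_weight q a (b + real K) c n x N = q powr w * (R (X + X') / R (X' + K) * C (X' - X) * (B (X + K) / B (2 * K)) * D (X' - K') * A (X' - K'))
     / (R (X' + K') / R (X' + K) * (P (X + X' + 1) / P (2 * X + 1)) * A x * (B (K + K') / B (2 * K)) * D n * C n
        * (S (2 * K') / S (K + K')) * (S (X' + K' + 1) / S (2 * K' + 1)) * D x * (P (2 * X) / P (X + K)) * D (X' - X))"
    unfolding racah_weight_def Let_def Q_def[symmetric] G_def[symmetric] Nx t1 t2 t3 t4 t5 t6 t7 t8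
    unfolding A_def C_def D_def w_def by simp
  have s1: "P (X + X' + 1) = (1 - G (a + b) / Q) * qpoch (G (a + b)) Q (X + X')"
    using qpoch_Suc_left[of "G (a + b) / Q" Q "X + X'"] Q0 by (simp add: P_def)
  have s2: "S (X' + K' + 1) = (1 - G (b + c) / Q) * qpoch (G (b + c)) Q (X' + K')"
    using qpoch_Suc_left[of "G (b + c) / Q" Q "X' + K'"] Q0 by (simp add: S_def)
  have s3: "P (2 * X + 1) = P (2 * X) * (1 - G (a + b) / Q * Q ^ (2 * X))" by (simp add: P_def qpoch_Suc)
  have s4: "S (2 * K' + 1) = S (2 * K') * (1 - G (b + c) / Q * Q ^ (2 * K'))" by (simp add: S_def qpoch_Suc)
  define p1 where "p1 = qpoch (G (a + b)) Q (X + X')"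
  define p2 where "p2 = qpoch (G (b + c)) Q (X' + K')"
  define y1 y2 y3 y4 where "y1 = 1 - G (a + b) / Q" and "y2 = 1 - G (b + c) / Q"
    and "y3 = 1 - G (a + b) / Q * Q ^ (2 * X)" and "y4 = 1 - G (b + c) / Q * Q ^ (2 * K')"
  note ss = s1[folded p1_def y1_def] s2[folded p2_def y2_def] s3[folded y3_def] s4[folded y4_def]
  have ynz: "y1 \<noteq> 0" "y2 \<noteq> 0" "y3 \<noteq> 0" "y4 \<noteq> 0" "p1 \<noteq> 0" "p2 \<noteq> 0"
    using nz(1)[of "X + X' + 1"] nz(3)[of "X' + K' + 1"] nz(1)[of "2 * X + 1"] nz(3)[of "2 * K' + 1"]
    unfolding ss by auto
  define z1 where "z1 = 2 * b * real X' + 2 * a * real K' + 2 * real K' * real X' - real K' * real K'"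
  define z0 where "z0 = 2 * b' * real X + 2 * a * real K + 2 * real K * real X - real K * real K"
  define z2 where "z2 = - 2 * (b - b') * real X"
  define z3 where "z3 = (1 - 2 * real K - 2 * a - 2 * b) * real n"
  have Z1: "Zf q a (b + c) b X' K' = D (X' - K') * A (X' - K') * q powr z1 / (R (X' + K') * p2)"
    by (simp add: Zf_def D_def A_def R_def p2_def z1_def G_def Q_def add.assoc)
  have Z0: "Zf q a b b' X K = D x * A x * q powr z0 / (P (X + K) * B (X + K))"
    by (simp add: Zf_def D_def A_def P_def B_def z0_def G_def Q_def x_def)
  have E: "Ef q a b c (b - b') X X' = C (X' - X) / D (X' - X) * (R (X + X') / p1) * (y3 / y1) * q powr z2"
    by (simp add: Ef_def C_def D_def R_def p1_def y1_def y3_def z2_def G_def Q_def)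
  have F: "Ff q b c K K' = D n * C n * (B (K + K') / S (K + K')) * (y2 / y4)"
    by (simp add: Ff_def D_def C_def B_def S_def y2_def y4_def G_def Q_def n_def)
  have ex: "w + z0 = z1 + z2 + z3"
  proof -
    have r: "real n = real K' - real K" "real x = real X - real K" "real N = real X' - real K"
      using le by (simp_all add: n_def x_def N_def of_nat_diff)
    show ?thesis unfolding w_def z0_def z1_def z2_def z3_def r by (simp add: algebra_simps)
  qed
  have "q powr w * q powr z0 = q powr z1 * q powr z2 * q powr z3" unfolding powr_add[symmetric] ex ..
  then have pw: "q powr w = q powr z1 * q powr z2 * q powr z3 / q powr z0" using q by (simp add: field_simps)
  have nzA: "A m \<noteq> 0" "C m \<noteq> 0" "D m \<noteq> 0" for m using pos by (simp_all add: less_imp_neq[symmetric])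
  have "racah_weight q a (b + real K) c n x N = Zf q a (b + c) b X' K' / Zf q a b b' X K * (Ef q a b c (b - b') X X' / Ff q b c K K') * q powr z3"
    unfolding W Z1 Z0 E F ss pw using nz nzA ynz by (simp add: mult_ac)
  then show ?thesis by (simp add: n_def x_def N_def z3_def)
qed

text \<open>This and \<open>abs_qpoch_inv_a\<close> treat the two factorials of \<open>hnorm\<close>
  whose sign varies, (Q^(-M))_K and (Q^(1-M) q^(-2a))_K. Their moduli supply the factorials of
  length M - K in the last \<open>Zf\<close>.\<close>

lemma abs_qpoch_inv_N:
  assumes "K \<le> M"
  shows "\<bar>qpoch ((- q) powi (- int M)) (- q) K\<bar> = qpoch (- q) (- q) M / (qpoch (- q) (- q) (M - K) * q powr (real K * real M - real K * (real K - 1) / 2))"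
    and "qpoch ((- q) powi (- int M)) (- q) K \<noteq> 0"
proof -
  define s where "s = (- 1) ^ (M * K) * sgT K"
  have "s * s = ((- 1) ^ (M * K) * (- 1) ^ (M * K)) * (sgT K * sgT K)" by (simp add: s_def mult_ac)
  also have "\<dots> = 1" unfolding sgT_square by (simp flip: power_mult_distrib)
  finally have s1: "\<bar>s\<bar> = 1" by (metis abs_mult_self_eq abs_one mult_cancel_right1 abs_mult power2_eq_square square_eq_1_iff abs_minus_cancel)
  have e: "qpoch (- q) (- q) M = qpoch (- q) (- q) (M - K) * qpoch ((- q) powi (- int M)) (- q) K * (s * q powr (real K * real M - real K * (real K - 1) / 2))"
    unfolding s_def using qpoch_inv_N[OF q assms] by (simp add: mult.assoc)
  define p where "p = q powr (real K * real M - real K * (real K - 1) / 2)"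
  have p: "0 < p" using q by (simp add: p_def)
  have "\<bar>qpoch (- q) (- q) M\<bar> = \<bar>qpoch (- q) (- q) (M - K)\<bar> * \<bar>qpoch ((- q) powi (- int M)) (- q) K\<bar> * (\<bar>s\<bar> * \<bar>p\<bar>)"
    unfolding e p_def by (simp only: abs_mult)
  then have "qpoch (- q) (- q) M = qpoch (- q) (- q) (M - K) * \<bar>qpoch ((- q) powi (- int M)) (- q) K\<bar> * p"
    unfolding abs_of_pos[OF qpoch_Q_pos[OF q]] abs_of_pos[OF p] s1 by simp
  then show "\<bar>qpoch ((- q) powi (- int M)) (- q) K\<bar> = qpoch (- q) (- q) M / (qpoch (- q) (- q) (M - K) * q powr (real K * real M - real K * (real K - 1) / 2))"
    unfolding p_def[symmetric] using qpoch_Q_pos[OF q, of "M - K"] p by (simp add: field_simps)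
  show "qpoch ((- q) powi (- int M)) (- q) K \<noteq> 0" using e qpoch_Q_pos[OF q, of M] by auto
qed

lemma abs_qpoch_inv_a:
  assumes "K \<le> M" "0 < a"
  shows "\<bar>qpoch ((- q) powi (1 - int M) / q powr (2 * a)) (- q) K\<bar> = qpoch (q powr (2 * a)) (- q) M
      / (qpoch (q powr (2 * a)) (- q) (M - K) * q powr (2 * a * real K + real K * (real M - 1) - real K * (real K - 1) / 2))"
    and "qpoch ((- q) powi (1 - int M) / q powr (2 * a)) (- q) K \<noteq> 0"
proof -
  define Ga where "Ga = q powr (2 * a)"
  have G: "0 < Ga" "Ga < 1" using powr_bounds[OF q assms(2)] by (simp_all add: Ga_def)
  have "\<bar>\<Prod>i<K. - (Ga * (- q) ^ (M - Suc i))\<bar> = (\<Prod>i<K. q powr (2 * a + (real M - 1) - real i))"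
    unfolding abs_prod
  proof (rule prod.cong)
    fix i assume "i \<in> {..<K}"
    then have "real (M - Suc i) = (real M - 1) - real i" using assms by (simp add: of_nat_diff)
    then have "q ^ (M - Suc i) = q powr ((real M - 1) - real i)" using powr_realpow[OF q(1), of "M - Suc i"] by simp
    then show "\<bar>- (Ga * (- q) ^ (M - Suc i))\<bar> = q powr (2 * a + (real M - 1) - real i)"
      using q G by (simp add: abs_mult power_abs Ga_def powr_add[symmetric] add_diff_eq)
  qed simp
  also have "\<dots> = q powr (2 * a * real K + real K * (real M - 1) - real K * (real K - 1) / 2)"
    unfolding prod_powr[OF q(1)] by (rule arg_cong[where f = "\<lambda>x. q powr x"])
      (simp add: sum_subtractf sum.distrib sum_lessThan_real algebra_simps)
  finally have P: "\<bar>\<Prod>i<K. - (Ga * (- q) ^ (M - Suc i))\<bar> = q powr (2 * a * real K + real K * (real M - 1) - real K * (real K - 1) / 2)" .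
  have e: "qpoch Ga (- q) M = qpoch Ga (- q) (M - K) * (qpoch ((- q) powi (1 - int M) / Ga) (- q) K * (\<Prod>i<K. - (Ga * (- q) ^ (M - Suc i))))"
    by (rule qpoch_rev[OF Q_facts[OF q] _ assms(1)]) (use G in simp)
  define p where "p = q powr (2 * a * real K + real K * (real M - 1) - real K * (real K - 1) / 2)"
  have p: "0 < p" using q by (simp add: p_def)
  have "\<bar>qpoch Ga (- q) M\<bar> = \<bar>qpoch Ga (- q) (M - K)\<bar> * (\<bar>qpoch ((- q) powi (1 - int M) / Ga) (- q) K\<bar> * \<bar>\<Prod>i<K. - (Ga * (- q) ^ (M - Suc i))\<bar>)"
    unfolding e by (simp only: abs_mult)
  then have "qpoch Ga (- q) M = qpoch Ga (- q) (M - K) * (\<bar>qpoch ((- q) powi (1 - int M) / Ga) (- q) K\<bar> * p)"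
    unfolding abs_of_pos[OF qpoch_pos0[OF q G]] P p_def .
  then show "\<bar>qpoch ((- q) powi (1 - int M) / q powr (2 * a)) (- q) K\<bar> = qpoch (q powr (2 * a)) (- q) M
      / (qpoch (q powr (2 * a)) (- q) (M - K) * q powr (2 * a * real K + real K * (real M - 1) - real K * (real K - 1) / 2))"
    unfolding p_def[symmetric] Ga_def[symmetric] using qpoch_pos0[OF q G, of "M - K"] p by (simp add: field_simps)
  show "qpoch ((- q) powi (1 - int M) / q powr (2 * a)) (- q) K \<noteq> 0"
    using e qpoch_pos0[OF q G, of M] unfolding Ga_def[symmetric] by auto
qed

end

section \<open>Coupling trees\<close>

definition leaf :: "real \<Rightarrow> node" where
  "leaf g = Node [g] 0 (\<lambda>ks. if ks = [0] then 1 else 0)"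

text \<open>The clause for 0 is a dummy. The label \<open>h k\<close> is the level added when factor
  k + 1 is attached.\<close>

fun left_comb :: "real \<Rightarrow> (nat \<Rightarrow> real) \<Rightarrow> (nat \<Rightarrow> nat) \<Rightarrow> nat \<Rightarrow> node" where
  "left_comb q \<gamma> h 0 = leaf 0"
| "left_comb q \<gamma> h (Suc 0) = leaf (\<gamma> 1)"
| "left_comb q \<gamma> h (Suc (Suc d)) = couple q (left_comb q \<gamma> h (Suc d)) (leaf (\<gamma> (d + 2))) (h (d + 1))"

text \<open>The last argument counts the factors attached after position i + r. Inside the block the
  labels are j_i, ..., j_(i+r-2), and j_(i+r-1) couples the block to the left comb; with i = r = 1
  this is the left comb itself (\<open>tree_11\<close>).\<close>

primrec tree :: "real \<Rightarrow> (nat \<Rightarrow> real) \<Rightarrow> nat \<Rightarrow> nat \<Rightarrow> (nat \<Rightarrow> nat) \<Rightarrow> nat \<Rightarrow> node" where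
  "tree q \<gamma> i r j 0 = couple q (left_comb q \<gamma> j i) (left_comb q (\<lambda>l. \<gamma> (i + l)) (\<lambda>l. j (i - 1 + l)) r) (j (i + r - 1))"
| "tree q \<gamma> i r j (Suc m) = couple q (tree q \<gamma> i r j m) (leaf (\<gamma> (i + r + m + 1))) (j (i + r + m))"

lemma leaf_sel [simp]: "nw (leaf g) = [g]" "nl (leaf g) = 0" "wt (leaf g) = g"
  by (simp_all add: leaf_def wt_def)

lemma lw_leaf: "0 < g \<Longrightarrow> lw q (leaf g)"
proof -
  assume g: "0 < g"
  have "Lop q [g] (nv (leaf g)) ks = 0" for ks by (cases ks) (simp_all add: leaf_def)
  moreover have "sq (leaf g) = 1"
  proof -
    have "comps 1 0 = {[0]}" by (auto simp: comps_def length_Suc_conv)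
    then show ?thesis by (simp add: sq_def ip_def leaf_def)
  qed
  ultimately show ?thesis using g by (auto simp: lw_def leaf_def homog_def)
qed

text \<open>The product of square roots is the one in \<open>psi\<close> for a single factor, so
  there \<open>psi\<close> and the chain agree without a constant.\<close>

lemma ch_leaf:
  assumes "0 < q"
  shows "ch q (leaf g) m ks = (if ks = [m] then (\<Prod>l=1..m. sqrt (sig q g l)) else 0)"
proof (induction m arbitrary: ks)
  case 0 show ?case by (simp add: leaf_def)
next
  case (Suc m)
  have "ch q (leaf g) (Suc m) ks = Rop q [g] (\<lambda>ks. if ks = [m] then (\<Prod>l=1..m. sqrt (sig q g l)) else 0) ks"
    unfolding ch_Suc Suc[abs_def] by simp
  also have "\<dots> = (if ks = [Suc m] then (\<Prod>l=1..Suc m. sqrt (sig q g l)) else 0)"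
  proof (cases ks)
    case (Cons k z)
    have "kp q 0 0 = q powr 0" by (simp add: kp_def)
    then show ?thesis using Cons assms by (cases k; cases z) (auto simp: kp_def)
  qed simp
  finally show ?case .
qed

lemma left_comb_sel:
  "nw (left_comb q \<gamma> h (Suc d)) = map \<gamma> [1..<d + 2]"
  "nl (left_comb q \<gamma> h (Suc d)) = (\<Sum>t=1..d. h t)"
  "wt (left_comb q \<gamma> h (Suc d)) = (\<Sum>t=1..Suc d. \<gamma> t) + real (\<Sum>t=1..d. h t)"
proof (induction d)
  case (Suc d)
  { case 1 show ?case using Suc(1) by simp }
  { case 2 show ?case using Suc(2) by simp }
  { case 3 show ?case using Suc(3) by simp }
qed simp_all

text \<open>The k-th three-factor coefficient. Both families of partial sums are counted from the
  start of the block, and the level \<open>S0\<close> to its left is part of the weight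
  \<open>a\<close>. Outside the guard the differences would be truncated; there the overlap of the
  trees is 0.\<close>

definition racah_factor :: "real \<Rightarrow> (nat \<Rightarrow> real) \<Rightarrow> nat \<Rightarrow> nat \<Rightarrow> (nat \<Rightarrow> nat) \<Rightarrow> (nat \<Rightarrow> nat) \<Rightarrow> nat \<Rightarrow> real" where
  "racah_factor q \<gamma> i S0 x K k = (if K (k - 1) \<le> x k \<and> K k \<le> x (Suc k) then
     (let N = x (Suc k) - K (k - 1); y = x k - K (k - 1); n = K k - K (k - 1);
          a = gsum \<gamma> 1 i + real S0; b = gsum \<gamma> (i + 1) (i + k) + real (K (k - 1)); c = \<gamma> (i + k + 1)
      in (- 1) ^ (N * y + y + N * n) * sgT n * sqrt (racah_weight q a b c n y N)
        * racah_poly (- q) (q powr (2 * a)) (q powr (2 * b)) (q powr (2 * c)) n y N) else 0)"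

lemma map_upt_split:
  "map \<gamma> [1..<Suc a + Suc b + 1] = map \<gamma> [1..<Suc a + 1] @ map (\<lambda>l. \<gamma> (Suc a + l)) [1..<Suc b + 1]"
  by (rule nth_equalityI) (auto simp: nth_append simp del: upt_Suc)

section \<open>Overlaps between the two families of trees\<close>

context
  fixes q :: real assumes q: "0 < q" "q < 1"
begin

lemma lw_left_comb: "(\<And>t. t \<in> {1..Suc d} \<Longrightarrow> 0 < \<gamma> t) \<Longrightarrow> lw q (left_comb q \<gamma> h (Suc d))"
proof (induction d)
  case (Suc d)
  then show ?case by (auto intro!: lw_couple[OF q] lw_leaf)
qed (simp add: lw_leaf)

lemma nov_left_comb:
  "(\<And>t. t \<in> {1..Suc d} \<Longrightarrow> 0 < \<gamma> t) \<Longrightarrow>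
    nov (left_comb q \<gamma> h (Suc d)) (left_comb q \<gamma> h' (Suc d)) = (if \<forall>l\<in>{1..d}. h l = h' l then 1 else 0)"
proof (induction d)
  case 0
  then show ?case by (simp add: nov_self[OF q lw_leaf])
next
  case (Suc d)
  have lws: "lw q (left_comb q \<gamma> h (Suc d))" "lw q (left_comb q \<gamma> h' (Suc d))" by (rule lw_left_comb, use Suc.prems in simp)+
  have "0 < \<gamma> (d + 2)" using Suc.prems by simp
  note nov_couple[OF q lws lw_leaf[OF this], of "h (d + 1)" "h' (d + 1)"]
  then have "nov (left_comb q \<gamma> h (Suc (Suc d))) (left_comb q \<gamma> h' (Suc (Suc d))) =
     (if h (Suc d) = h' (Suc d) then if \<forall>l\<in>{1..d}. h l = h' l then 1 else 0 else 0)"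
    using Suc by (simp add: left_comb_sel)
  then show ?case by (auto simp: atLeastAtMostSuc_conv)
qed

text \<open>Induction on the size of the block. The last module is split off both trees, and
  \<open>recouple\<close> replaces the remaining comb \<open>y\<close> by the coupling of
  \<open>A\<close> and \<open>B\<close> at the level \<open>X\<close> that matches it. This leaves
  one three-factor coefficient and the same problem for a smaller block with label \<open>X\<close>,
  which is why \<open>s\<close> is generalized.\<close>

lemma nov_recoupled:
  fixes j j' :: "nat \<Rightarrow> nat"
  assumes \<gamma>: "\<And>t. t \<in> {1..Suc i + Suc r} \<Longrightarrow> 0 < \<gamma> t"
  defines "S0 \<equiv> psum j i" and "x \<equiv> \<lambda>k. psum j (i + k) - psum j i" and "K \<equiv> \<lambda>k. \<Sum>l=1..k. j' (i + l)"
  shows "nov (couple q (left_comb q \<gamma> j' (Suc i)) (left_comb q (\<lambda>l. \<gamma> (Suc i + l)) (\<lambda>l. j' (i + l)) (Suc r)) s) (left_comb q \<gamma> j (Suc i + Suc r))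
    = (if (\<forall>l\<in>{1..i}. j' l = j l) \<and> s + K r = x (Suc r) then \<Prod>k=1..r. racah_factor q \<gamma> (Suc i) S0 x K k else 0)"
  using \<gamma>
proof (induction r arbitrary: s)
  case 0
  have lws: "lw q (left_comb q \<gamma> j' (Suc i))" "lw q (left_comb q \<gamma> j (Suc i))" by (rule lw_left_comb, use 0 in simp)+
  have g: "0 < \<gamma> (i + 2)" using 0 by simp
  have x1: "x (Suc 0) = j (Suc i)" by (simp add: x_def psum_def)
  show ?case
    using nov_couple[OF q lws lw_leaf[OF g], of s "j (i + 1)"] nov_left_comb[of i \<gamma> j' j] 0
    by (simp add: left_comb_sel K_def x1)
next
  case (Suc r)
  define A where "A = left_comb q \<gamma> j' (Suc i)"
  define B where "B = left_comb q (\<lambda>l. \<gamma> (Suc i + l)) (\<lambda>l. j' (i + l)) (Suc r)"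
  define C where "C = leaf (\<gamma> (Suc i + r + 2))"
  define y where "y = left_comb q \<gamma> j (Suc i + Suc r)"
  define n where "n = j' (i + Suc r)"
  define m where "m = j (i + r + 2)"
  have A: "lw q A" unfolding A_def by (rule lw_left_comb, use Suc.prems in simp)
  have B: "lw q B" unfolding B_def by (rule lw_left_comb, use Suc.prems in simp)
  have C: "lw q C" "nl C = 0" unfolding C_def using Suc.prems by (simp_all add: lw_leaf)
  have ylc: "y = left_comb q \<gamma> j (Suc (Suc i + r))" by (simp add: y_def)
  have y: "lw q y" unfolding ylc by (rule lw_left_comb, use Suc.prems in simp)
  have Bs: "left_comb q (\<lambda>l. \<gamma> (Suc i + l)) (\<lambda>l. j' (i + l)) (Suc (Suc r)) = couple q B C n"
    by (simp add: B_def C_def n_def)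
  have ys: "left_comb q \<gamma> j (Suc i + Suc (Suc r)) = couple q y C m"
    by (simp add: y_def C_def m_def numeral_2_eq_2)
  have nlA: "nl A = psum j' i" unfolding A_def left_comb_sel psum_def ..
  have nlB: "nl B = K r" unfolding B_def left_comb_sel K_def ..
  have nly: "nl y = psum j (Suc i + r)" unfolding ylc left_comb_sel psum_def ..
  have nwy: "nw y = nw A @ nw B"
    using map_upt_split[of \<gamma> i r] unfolding ylc A_def B_def left_comb_sel by simp
  have mono: "psum j u \<le> psum j v" if "u \<le> v" for u v unfolding psum_def by (rule sum_mono2) (use that in auto)
  have Ks: "K (Suc r) = K r + n" by (simp add: K_def n_def)
  have xs: "x (Suc (Suc r)) = x (Suc r) + m"
  proof -
    have "psum j (i + Suc (Suc r)) = psum j (i + Suc r) + m" by (simp add: psum_def m_def)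
    then show ?thesis using mono[of i "i + Suc r"] by (simp add: x_def)
  qed
  have IH: "nov (couple q A B s) y = (if (\<forall>l\<in>{1..i}. j' l = j l) \<and> s + K r = x (Suc r) then \<Prod>k=1..r. racah_factor q \<gamma> (Suc i) S0 x K k else 0)" for s
    unfolding A_def B_def y_def by (rule Suc.IH) (use Suc.prems in simp)
  have pe: "psum j' i = psum j i" if "\<forall>l\<in>{1..i}. j' l = j l"
    unfolding psum_def by (rule sum.cong) (use that in auto)
  have xS: "x (Suc r) = psum j (Suc i + r) - psum j i" by (simp add: x_def)
  have V: "nov (couple q A (couple q B C n) s) (couple q y C m) = (if (\<forall>l\<in>{1..i}. j' l = j l) \<and> s + K (Suc r) = x (Suc (Suc r)) then \<Prod>k=1..Suc r. racah_factor q \<gamma> (Suc i) S0 x K k else 0)"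
  proof (cases "nl y < nl A + nl B")
    case True
    then have 0: "nov (couple q A (couple q B C n) s) (couple q y C m) = 0"
      unfolding nov_def recouple_zero[OF q A B C(1) y nwy True] by simp
    \<comment> \<open>Only if the first i labels agree are the two families of partial sums counted
      from the same level; otherwise the right-hand side is 0 through its condition.\<close>
    have "racah_factor q \<gamma> (Suc i) S0 x K (Suc r) = 0" if "\<forall>l\<in>{1..i}. j' l = j l"
    proof -
      have "x (Suc r) < K r" using True pe[OF that] mono[of i "Suc i + r"] unfolding nlA nlB nly xS by linarith
      then show ?thesis by (simp add: racah_factor_def)
    qed
    then show ?thesis unfolding 0 by simp
  next
    case False
    define X where "X = nl y - (nl A + nl B)"
    have nlyX: "nl y = nl A + nl B + X" using False by (simp add: X_def)
    have rec: "nov (couple q A (couple q B C n) s) (couple q y C m) = nov (couple q A B X) y * nov (couple q A (couple q B C n) s) (couple q (couple q A B X) C m)"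
      by (rule recouple[OF q A B C(1) y nwy nlyX])
    show ?thesis
    proof (cases "\<forall>l\<in>{1..i}. j' l = j l")
      case False
      then have "nov (couple q A B X) y = 0" using IH[of X] by auto
      then show ?thesis unfolding rec using False by auto
    next
      case True
      have XK: "X + K r = x (Suc r)" using nlyX pe[OF True] mono[of i "Suc i + r"] unfolding nlA nlB nly xS by linarith
      have 1: "nov (couple q A B X) y = (\<Prod>k=1..r. racah_factor q \<gamma> (Suc i) S0 x K k)" using IH[of X] True XK by simp
      show ?thesis
      proof (cases "s + K (Suc r) = x (Suc (Suc r))")
        case False
        have "ov (couple q A (couple q B C n) s) (couple q (couple q A B X) C m) = 0"
          by (rule ov_level[OF q lw_couple[OF q lw_couple[OF q A B] C(1)]]) (use False XK in \<open>simp_all add: C(2) Ks xs\<close>)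
        then show ?thesis unfolding rec using False by (simp add: nov_def)
      next
        case eq: True
        define N where "N = n + s"
        have Nm: "N - n = s" "N - X = m" "n \<le> N" "X \<le> N" using eq XK by (simp_all add: N_def Ks xs)
        have NK: "N = x (Suc (Suc r)) - K r" "X = x (Suc r) - K r" "n = K (Suc r) - K r" "K r \<le> x (Suc r)" "K (Suc r) \<le> x (Suc (Suc r))"
          using eq XK by (simp_all add: N_def Ks)
        have wA: "wt A = gsum \<gamma> 1 (Suc i) + real S0" using pe[OF True] unfolding A_def left_comb_sel gsum_def S0_def psum_def by simp
        have wB: "wt B = gsum \<gamma> (Suc i + 1) (Suc i + Suc r) + real (K r)"
        proof -
          have "(\<Sum>t=1..Suc r. \<gamma> (Suc i + t)) = gsum \<gamma> (Suc i + 1) (Suc i + Suc r)"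
            unfolding gsum_def using sum.shift_bounds_cl_nat_ivl[of \<gamma> 1 "Suc i" "Suc r"] by (simp add: add.commute)
          then show ?thesis unfolding B_def left_comb_sel K_def by simp
        qed
        have wC: "wt C = \<gamma> (Suc i + Suc r + 1)" by (simp add: C_def)
        have "nov (couple q A (couple q B C n) s) (couple q (couple q A B X) C m) = racah_factor q \<gamma> (Suc i) S0 x K (Suc r)"
          using nov_recoupling[OF q A B C Nm(3,4)] NK(4,5) unfolding Nm(1,2) wA wB wC racah_factor_def Let_def diff_Suc_1 NK(1-3)[symmetric] by simp
        then show ?thesis unfolding rec 1 using True eq by simp
      qed
    qed
  qed
  then show ?case unfolding Bs ys A_def[symmetric] .
qed

lemma tree_facts:
  assumes "0 < i" "0 < r" "\<And>t. t \<in> {1..i + r + m} \<Longrightarrow> 0 < \<gamma> t"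
  shows "lw q (tree q \<gamma> i r j m)" "nw (tree q \<gamma> i r j m) = map \<gamma> [1..<i + r + m + 1]"
  using assms(3)
proof (induction m)
  case 0
  obtain i' r' where ir: "i = Suc i'" "r = Suc r'" using assms by (metis gr0_implies_Suc)
  { case 1
    show ?case unfolding tree.simps ir by (intro lw_couple[OF q] lw_left_comb) (use 1 in \<open>auto simp: ir\<close>) }
  { case 2
    show ?case unfolding tree.simps ir couple_sel left_comb_sel using map_upt_split[of \<gamma> i' r'] by (simp del: upt_Suc) }
next
  case (Suc m)
  { case 1 show ?case unfolding tree.simps by (intro lw_couple[OF q] lw_leaf Suc(1)) (use 1 in auto) }
  { case 2 show ?case using Suc(2) 2 by simp }
qed

lemma nov_tree:
  assumes "0 < i" "0 < r" "\<And>t. t \<in> {1..i + r + m} \<Longrightarrow> 0 < \<gamma> t"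
  shows "nov (tree q \<gamma> i r j' m) (left_comb q \<gamma> j (i + r + m)) =
    (if \<forall>l\<in>{i + r..<i + r + m}. j' l = j l then nov (tree q \<gamma> i r j' 0) (left_comb q \<gamma> j (i + r)) else 0)"
  using assms(3)
proof (induction m)
  case (Suc m)
  have \<gamma>: "0 < \<gamma> t" if "t \<in> {1..i + r + m}" for t using Suc.prems that by simp
  obtain d where d: "i + r + m = Suc d" using assms by (cases "i + r + m") auto
  have T: "lw q (tree q \<gamma> i r j' m)" by (rule tree_facts(1)[OF assms(1,2) \<gamma>])
  have L: "lw q (left_comb q \<gamma> j (i + r + m))" unfolding d by (rule lw_left_comb) (use \<gamma> d in simp)
  have nw: "nw (left_comb q \<gamma> j (i + r + m)) = nw (tree q \<gamma> i r j' m)"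
  proof -
    have "nw (tree q \<gamma> i r j' m) = map \<gamma> [1..<i + r + m + 1]" by (rule tree_facts(2)[OF assms(1,2) \<gamma>])
    then show ?thesis unfolding d left_comb_sel by (simp del: upt_Suc)
  qed
  have g: "0 < \<gamma> (i + r + m + 1)" using Suc.prems by simp
  have l: "left_comb q \<gamma> j (i + r + Suc m) = couple q (left_comb q \<gamma> j (i + r + m)) (leaf (\<gamma> (i + r + m + 1))) (j (i + r + m))"
    using d by simp
  have IH: "nov (tree q \<gamma> i r j' m) (left_comb q \<gamma> j (i + r + m)) =
    (if \<forall>l\<in>{i + r..<i + r + m}. j' l = j l then nov (tree q \<gamma> i r j' 0) (left_comb q \<gamma> j (i + r)) else 0)"
    by (rule Suc.IH) (rule \<gamma>)
  show ?case unfolding l tree.simps(2) nov_couple[OF q T L lw_leaf[OF g] nw] IH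
    unfolding add_Suc_right by (simp add: atLeastLessThanSuc del: tree.simps)
qed simp

lemma tree_11: "tree q \<gamma> 1 1 j m = left_comb q \<gamma> j (m + 2)"
  by (induction m) (simp_all add: numeral_2_eq_2)

end

section \<open>The vectors of the theorem in terms of coupling trees\<close>

text \<open>Passes from finitely supported complex vectors to plain real functions, on which
  operators can be defined by recursion over the index list.\<close>

definition rep :: "('a \<Rightarrow>\<^sub>0 complex) \<Rightarrow> ('a \<Rightarrow> real) \<Rightarrow> bool" where
  "rep v f \<longleftrightarrow> (\<forall>x. Poly_Mapping.lookup v x = complex_of_real (f x))"

lemma lookup_vscale [simp]: "Poly_Mapping.lookup (vscale c v) x = c * Poly_Mapping.lookup v x"
  unfolding vscale_def by (simp add: Poly_Mapping.map.rep_eq when_def)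

lemma lookup_ket: "Poly_Mapping.lookup (ket a) x = (if a = x then 1 else 0)"
  by (simp add: ket_def lookup_single when_def)

lemma lookup_lin_ext:
  assumes "finite S" "Poly_Mapping.keys v \<subseteq> S"
  shows "Poly_Mapping.lookup (lin_ext f v) x = (\<Sum>a\<in>S. Poly_Mapping.lookup v a * Poly_Mapping.lookup (f a) x)"
proof -
  have "Poly_Mapping.lookup (lin_ext f v) x = (\<Sum>a\<in>Poly_Mapping.keys v. Poly_Mapping.lookup v a * Poly_Mapping.lookup (f a) x)"
    by (simp add: lin_ext_def lookup_sum)
  also have "\<dots> = (\<Sum>a\<in>S. Poly_Mapping.lookup v a * Poly_Mapping.lookup (f a) x)"
    by (rule sum.mono_neutral_left) (use assms in \<open>auto simp: in_keys_iff\<close>)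
  finally show ?thesis .
qed

lemma lin_ext_ket [simp]: "lin_ext f (ket a) = f a"
proof (rule poly_mapping_eqI)
  fix x
  have "Poly_Mapping.keys (ket a) \<subseteq> {a}" by (auto simp: in_keys_iff lookup_ket split: if_splits)
  then show "Poly_Mapping.lookup (lin_ext f (ket a)) x = Poly_Mapping.lookup (f a) x"
    by (subst lookup_lin_ext[of "{a}"]) (simp_all add: lookup_ket)
qed

lemma lin_ext_vscale [simp]: "lin_ext f (vscale c v) = vscale c (lin_ext f v)"
proof (rule poly_mapping_eqI)
  fix x
  have "Poly_Mapping.keys (vscale c v) \<subseteq> Poly_Mapping.keys v" by (auto simp: in_keys_iff)
  then show "Poly_Mapping.lookup (lin_ext f (vscale c v)) x = Poly_Mapping.lookup (vscale c (lin_ext f v)) x"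
    using lookup_lin_ext[of "Poly_Mapping.keys v" "vscale c v" f x] lookup_lin_ext[of "Poly_Mapping.keys v" v f x]
    by (simp add: sum_distrib_left mult.assoc)
qed

lemma lin_ext_plus [simp]: "lin_ext f (v + w) = lin_ext f v + lin_ext f w"
proof (rule poly_mapping_eqI)
  fix x
  let ?S = "Poly_Mapping.keys v \<union> Poly_Mapping.keys w"
  have "Poly_Mapping.keys (v + w) \<subseteq> ?S" by (rule Poly_Mapping.keys_add)
  then show "Poly_Mapping.lookup (lin_ext f (v + w)) x = Poly_Mapping.lookup (lin_ext f v + lin_ext f w) x"
    using lookup_lin_ext[of ?S "v + w" f x] lookup_lin_ext[of ?S v f x] lookup_lin_ext[of ?S w f x]
    by (simp add: lookup_add distrib_right sum.distrib)
qed

lemma rep_vscale: "rep v f \<Longrightarrow> rep (vscale (complex_of_real c) v) (\<lambda>x. c * f x)"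
  by (simp add: rep_def)

lemma rep_sum: "(\<And>i. i \<in> A \<Longrightarrow> rep (v i) (f i)) \<Longrightarrow> rep (\<Sum>i\<in>A. v i) (\<lambda>x. \<Sum>i\<in>A. f i x)"
  by (simp add: rep_def lookup_sum)

lemma rep_ket: "rep (ket a) (\<lambda>x. if x = a then 1 else 0)"
  by (auto simp: rep_def lookup_ket)

text \<open>Homogeneity of \<open>f\<close> fixes the length of the first words, hence the place
  where a concatenated list has to be cut.\<close>

lemma rep_tens:
  assumes "rep v f" "rep w g" "homog d N f"
  shows "rep (tens v w) (tns d f g)"
  unfolding rep_def
proof
  fix ks
  have len: "length a = d" if "a \<in> Poly_Mapping.keys v" for a
    using that assms(1,3) unfolding rep_def homog_def in_keys_iff by simp
  have "Poly_Mapping.lookup (tens v w) ks = (\<Sum>a\<in>Poly_Mapping.keys v. Poly_Mapping.lookup v a *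
      (\<Sum>b\<in>Poly_Mapping.keys w. Poly_Mapping.lookup w b * (if a @ b = ks then 1 else 0)))"
    unfolding tens_def by (simp add: lookup_lin_ext[OF finite_keys order_refl] lookup_ket)
  also have "\<dots> = (\<Sum>a\<in>Poly_Mapping.keys v. if a = take d ks then Poly_Mapping.lookup v a *
      (\<Sum>b\<in>Poly_Mapping.keys w. if b = drop d ks then Poly_Mapping.lookup w b else 0) else 0)"
  proof (rule sum.cong)
    fix a assume a: "a \<in> Poly_Mapping.keys v"
    have eq: "a @ b = ks \<longleftrightarrow> a = take d ks \<and> b = drop d ks" for b
      using len[OF a] by (auto simp: append_eq_conv_conj)
    show "Poly_Mapping.lookup v a * (\<Sum>b\<in>Poly_Mapping.keys w. Poly_Mapping.lookup w b * (if a @ b = ks then 1 else 0)) =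
      (if a = take d ks then Poly_Mapping.lookup v a * (\<Sum>b\<in>Poly_Mapping.keys w. if b = drop d ks then Poly_Mapping.lookup w b else 0) else 0)"
      unfolding eq by (cases "a = take d ks") (simp_all add: if_distrib cong: if_cong)
  qed simp
  also have "\<dots> = Poly_Mapping.lookup v (take d ks) * Poly_Mapping.lookup w (drop d ks)"
    by (auto simp: in_keys_iff)
  also have "\<dots> = complex_of_real (tns d f g ks)" using assms by (simp add: rep_def tns_def)
  finally show "Poly_Mapping.lookup (tens v w) ks = complex_of_real (tns d f g ks)" .
qed

lemma braket_rep:
  assumes "rep v f" "rep w g" "homog d N f"
  shows "braket v w = complex_of_real (ip d N f g)"
proof -
  have "braket v w = (\<Sum>a\<in>comps d N. cnj (Poly_Mapping.lookup v a) * Poly_Mapping.lookup w a)"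
    unfolding braket_def
  proof (rule sum.mono_neutral_left)
    show "Poly_Mapping.keys v \<subseteq> comps d N"
      using assms by (auto simp: rep_def in_keys_iff homog_def comps_def)
  qed (auto simp: in_keys_iff)
  then show ?thesis using assms by (simp add: rep_def ip_def)
qed

section \<open>The iterated coproduct of A_+ and the raising operator\<close>

fun cps :: "nat \<Rightarrow> gen list list list" where
  "cps 0 = []"
| "cps (Suc d) = ([A_plus] # replicate d [K_gen, P_gen]) # map ((#) [K_inv]) (cps d)"

text \<open>One round of \<open>coprod_iter\<close>, which splits the last tensor factor. The list
  \<open>cps\<close> recurs on the first factor instead, as \<open>Rop\<close> does;
  \<open>cps_step\<close> reconciles the two, which is coassociativity for A_+.\<close>

definition cstep :: "gen list list \<Rightarrow> gen list list list" where
  "cstep ws = [butlast ws @ [a, b]. (a, b) \<leftarrow> coprod (last ws)]"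

lemma cstep_Cons: "ws \<noteq> [] \<Longrightarrow> cstep (w # ws) = map ((#) w) (cstep ws)"
  by (simp add: cstep_def case_prod_unfold o_def)

lemma cps_nonempty: "ws \<in> set (cps d) \<Longrightarrow> ws \<noteq> []"
  by (cases d) auto

lemma cstep_replicate: "cstep (x # replicate (Suc d) [K_gen, P_gen]) = [x # replicate (Suc (Suc d)) [K_gen, P_gen]]"
proof -
  define w where "w = [K_gen, P_gen]"
  have r: "replicate (Suc d) w = replicate d w @ [w]" for d by (simp add: replicate_append_same)
  have "cstep (replicate (Suc d) w) = [replicate d w @ [w, w]]" unfolding r by (simp add: cstep_def w_def)
  also have "replicate d w @ [w, w] = replicate (Suc (Suc d)) w" unfolding r[of "Suc d"] r[of d] by simp
  finally have "cstep (replicate (Suc d) w) = [replicate (Suc (Suc d)) w]" .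
  then show ?thesis unfolding w_def[symmetric] by (subst cstep_Cons) simp_all
qed

lemma concat_cstep_Cons:
  "(\<And>ws. ws \<in> set X \<Longrightarrow> ws \<noteq> []) \<Longrightarrow> concat (map cstep (map ((#) w) X)) = map ((#) w) (concat (map cstep X))"
  by (induction X) (auto simp: cstep_Cons)

lemma cps_step: "concat (map cstep (cps (Suc d))) = cps (Suc (Suc d))"
proof (induction d)
  case 0 show ?case by (simp add: cstep_def)
next
  case (Suc d)
  have "concat (map cstep (cps (Suc (Suc d)))) = cstep ([A_plus] # replicate (Suc d) [K_gen, P_gen])
      @ concat (map cstep (map ((#) [K_inv]) (cps (Suc d))))" by simp
  also have "\<dots> = [[A_plus] # replicate (Suc (Suc d)) [K_gen, P_gen]] @ map ((#) [K_inv]) (cps (Suc (Suc d)))"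
  proof -
    have "concat (map cstep (map ((#) [K_inv]) (cps (Suc d)))) = map ((#) [K_inv]) (concat (map cstep (cps (Suc d))))"
      by (rule concat_cstep_Cons) (rule cps_nonempty)
    then show ?thesis unfolding cstep_replicate Suc by simp
  qed
  finally show ?case by simp
qed

lemma coprod_iter_A_plus: "coprod_iter (Suc d) [A_plus] = cps (Suc d)"
proof (induction d)
  case (Suc d)
  have "coprod_iter (Suc (Suc d)) [A_plus] = concat (map cstep (coprod_iter (Suc d) [A_plus]))"
    by (simp add: cstep_def[abs_def])
  then show ?case unfolding Suc cps_step .
qed simp

lemma lookup_cons:
  "Poly_Mapping.lookup (lin_ext (\<lambda>ms'. ket (m # ms')) v) ks = (case ks of [] \<Rightarrow> 0 | k # z \<Rightarrow> if k = m then Poly_Mapping.lookup v z else 0)"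
proof -
  have "Poly_Mapping.lookup (lin_ext (\<lambda>ms'. ket (m # ms')) v) ks = (\<Sum>a\<in>Poly_Mapping.keys v. Poly_Mapping.lookup v a * (if m # a = ks then 1 else 0))"
    by (simp add: lookup_lin_ext[OF finite_keys order_refl] lookup_ket)
  also have "\<dots> = (case ks of [] \<Rightarrow> 0 | k # z \<Rightarrow> if k = m then Poly_Mapping.lookup v z else 0)"
  proof (cases ks)
    case (Cons k z)
    have "(\<Sum>a\<in>Poly_Mapping.keys v. Poly_Mapping.lookup v a * (if m # a = ks then 1 else 0)) =
       (\<Sum>a\<in>Poly_Mapping.keys v. if a = z then (if k = m then Poly_Mapping.lookup v z else 0) else 0)"
      by (rule sum.cong) (auto simp: Cons)
    then show ?thesis by (auto simp: Cons in_keys_iff)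
  qed simp
  finally show ?thesis .
qed

lemma act_word_simps:
  "act_word q g [A_plus] m = vscale (complex_of_real (sqrt (sig q g (m + 1)))) (ket (m + 1))"
  "act_word q g [K_inv] m = vscale (complex_of_real (q powr (- ((real m + g) / 2)))) (ket m)"
  "act_word q g [K_gen, P_gen] m = vscale (complex_of_real ((- 1) ^ m * q powr ((real m + g) / 2))) (ket m)"
  by (simp_all add: act_word_def) (rule poly_mapping_eqI, simp)

lemma kp_Cons: "0 < q \<Longrightarrow> kp q (g + G) (m + b) = ((- 1) ^ m * q powr ((real m + g) / 2)) * kp q G b"
  using kp_add[of q g G m b] by (simp add: kp_def)

lemma act_KP:
  "0 < q \<Longrightarrow> length ms = length gs \<Longrightarrow> act_tensor q gs (replicate (length gs) [K_gen, P_gen]) ms =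
    vscale (complex_of_real (kp q (sum_list gs) (sum_list ms))) (ket ms)"
proof (induction gs arbitrary: ms)
  case Nil then show ?case by (intro poly_mapping_eqI) (simp add: kp_def powr_def)
next
  case (Cons g gs)
  then obtain m ms' where ms: "ms = m # ms'" "length ms' = length gs" by (cases ms) auto
  show ?case
    by (rule poly_mapping_eqI) (simp add: ms Cons act_word_simps kp_Cons)
qed

text \<open>The head of \<open>cps\<close> has A_+ on the first factor and K P on all others and
  yields the first term of \<open>Rop\<close>; the tail has K^(-1) on the first factor and yields
  the recursive term.\<close>

lemma act_A_plus:
  assumes q: "0 < q"
  shows "length ms = length gs \<Longrightarrow> rep (\<Sum>ws\<leftarrow>cps (length gs). act_tensor q gs ws ms) (Rop q gs (\<lambda>x. if x = ms then 1 else 0))"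
proof (induction gs arbitrary: ms)
  case Nil then show ?case by (simp add: rep_def)
next
  case (Cons g gs)
  then obtain m ms' where ms: "ms = m # ms'" "length ms' = length gs" by (cases ms) auto
  let ?S = "\<Sum>ws\<leftarrow>cps (length gs). act_tensor q gs ws ms'"
  have IH: "Poly_Mapping.lookup ?S z = complex_of_real (Rop q gs (\<lambda>x. if x = ms' then 1 else 0) z)" for z
    using Cons.IH[OF ms(2)] by (simp add: rep_def)
  have lin: "(\<Sum>ws\<leftarrow>X. vscale c (lin_ext (\<lambda>ms'. ket (m # ms')) (act_tensor q gs ws ms'))) =
     vscale c (lin_ext (\<lambda>ms'. ket (m # ms')) (\<Sum>ws\<leftarrow>X. act_tensor q gs ws ms'))" for X c
  proof (induction X)
    case Nil show ?case by (intro poly_mapping_eqI) (simp add: lin_ext_def)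
  next
    case (Cons w X) then show ?case by (intro poly_mapping_eqI) (simp add: lookup_add distrib_left)
  qed
  have S: "(\<Sum>ws\<leftarrow>cps (length (g # gs)). act_tensor q (g # gs) ws ms) =
     vscale (complex_of_real (sqrt (sig q g (m + 1)))) (vscale (complex_of_real (kp q (sum_list gs) (sum_list ms'))) (ket ((m + 1) # ms')))
     + vscale (complex_of_real (q powr (- ((real m + g) / 2)))) (lin_ext (\<lambda>ms'. ket (m # ms')) ?S)"
    by (simp add: ms o_def act_word_simps act_KP[OF q ms(2)] lin[symmetric])
  show ?case unfolding rep_def
  proof
    fix ks
    have R0: "Rop q gs (\<lambda>z. if k # z = m # ms' then 1 else 0) z = (if k = m then Rop q gs (\<lambda>x. if x = ms' then 1 else 0) z else 0)" for k z
      by (cases "k = m") simp_all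
    show "Poly_Mapping.lookup (\<Sum>ws\<leftarrow>cps (length (g # gs)). act_tensor q (g # gs) ws ms) ks =
      complex_of_real (Rop q (g # gs) (\<lambda>x. if x = ms then 1 else 0) ks)"
      unfolding S
    proof (cases ks)
      case Nil
      then show "Poly_Mapping.lookup (vscale (complex_of_real (sqrt (sig q g (m + 1)))) (vscale (complex_of_real (kp q (sum_list gs) (sum_list ms'))) (ket ((m + 1) # ms')))
     + vscale (complex_of_real (q powr (- ((real m + g) / 2)))) (lin_ext (\<lambda>ms'. ket (m # ms')) ?S)) ks =
      complex_of_real (Rop q (g # gs) (\<lambda>x. if x = ms then 1 else 0) ks)"
        by (simp add: lookup_add lookup_cons lookup_ket)
    next
      case (Cons k z)
      then show "Poly_Mapping.lookup (vscale (complex_of_real (sqrt (sig q g (m + 1)))) (vscale (complex_of_real (kp q (sum_list gs) (sum_list ms'))) (ket ((m + 1) # ms')))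
     + vscale (complex_of_real (q powr (- ((real m + g) / 2)))) (lin_ext (\<lambda>ms'. ket (m # ms')) ?S)) ks =
      complex_of_real (Rop q (g # gs) (\<lambda>x. if x = ms then 1 else 0) ks)"
        unfolding Cons lookup_add lookup_vscale lookup_cons IH ms Rop.simps R0
        by (cases k) (auto simp: lookup_ket)
    qed
  qed
qed

text \<open>By linearity the action on basis vectors suffices; \<open>f\<close> is written as a
  combination of indicator functions over the support of \<open>v\<close>.\<close>

lemma rep_raise:
  assumes q: "0 < q" and v: "rep v f" and f: "homog (Suc d) N f"
  shows "rep (raise q \<delta> (Suc d) v) (Rop q (map \<delta> [1..<d + 2]) f)"
proof -
  define gs where "gs = map \<delta> [1..<d + 2]"
  have lgs: "length gs = Suc d" by (simp add: gs_def)
  have len: "length a = length gs" if "a \<in> Poly_Mapping.keys v" for a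
    using that v f by (auto simp: rep_def homog_def in_keys_iff lgs)
  have "Poly_Mapping.lookup (raise q \<delta> (Suc d) v) ks = complex_of_real (Rop q gs f ks)" for ks
  proof -
    have "Poly_Mapping.lookup (raise q \<delta> (Suc d) v) ks =
       (\<Sum>a\<in>Poly_Mapping.keys v. Poly_Mapping.lookup v a * Poly_Mapping.lookup (\<Sum>ws\<leftarrow>cps (length gs). act_tensor q gs ws a) ks)"
    proof -
      have "raise q \<delta> (Suc d) v = lin_ext (\<lambda>ms. \<Sum>ws\<leftarrow>cps (length gs). act_tensor q gs ws ms) v"
        unfolding raise_def act_def coprod_iter_A_plus lgs gs_def by (simp del: upt_Suc cps.simps)
      then show ?thesis by (simp only: lookup_lin_ext[OF finite_keys order_refl])
    qed
    also have "\<dots> = (\<Sum>a\<in>Poly_Mapping.keys v. complex_of_real (f a * Rop q gs (\<lambda>x. if x = a then 1 else 0) ks))"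
      by (rule sum.cong) (use v act_A_plus[OF q len] in \<open>simp_all add: rep_def\<close>)
    also have "\<dots> = complex_of_real (Rop q gs (\<lambda>ks. \<Sum>a\<in>Poly_Mapping.keys v. f a * (if ks = a then 1 else 0)) ks)"
      by (simp add: Rop_sum Rop_cmult)
    also have "(\<lambda>ks. \<Sum>a\<in>Poly_Mapping.keys v. f a * (if ks = a then 1 else 0)) = f"
    proof
      fix ks
      have "(\<Sum>a\<in>Poly_Mapping.keys v. f a * (if ks = a then 1 else 0)) = (\<Sum>a\<in>Poly_Mapping.keys v. if ks = a then f ks else 0)"
        by (rule sum.cong) auto
      also have "\<dots> = f ks" using v by (auto simp: rep_def in_keys_iff)
      finally show "(\<Sum>a\<in>Poly_Mapping.keys v. f a * (if ks = a then 1 else 0)) = f ks" .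
    qed
    finally show ?thesis .
  qed
  then show ?thesis unfolding rep_def gs_def by blast
qed

lemma rep_raise_funpow:
  assumes q: "0 < q" and v: "rep v f" and f: "homog (Suc d) N f"
  shows "rep ((raise q \<delta> (Suc d) ^^ p) v) ((Rop q (map \<delta> [1..<d + 2]) ^^ p) f)"
proof (induction p)
  case (Suc p)
  have h: "homog (Suc d) (N + p) ((Rop q (map \<delta> [1..<d + 2]) ^^ p) f)"
  proof (induction p)
    case (Suc p)
    have "homog (length (map \<delta> [1..<d + 2])) (Suc (N + p)) (Rop q (map \<delta> [1..<d + 2]) ((Rop q (map \<delta> [1..<d + 2]) ^^ p) f))"
      by (rule homog_Rop) (use Suc in \<open>simp del: upt_Suc\<close>)
    then show ?case by (simp del: upt_Suc)
  qed (use f in simp)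
  show ?case using rep_raise[OF q Suc h, of \<delta>] by (simp del: upt_Suc)
qed (use v in simp)

lemma sum_list_map_upt: "sum_list (map \<gamma> [1..<n + 1]) = (\<Sum>t=1..n. \<gamma> t)" for \<gamma> :: "nat \<Rightarrow> real"
  by (simp add: interv_sum_list_conv_sum_set_nat atLeastLessThanSuc_atLeastAtMost del: upt_Suc)

section \<open>The recursively defined vectors as multiples of the chains of the trees\<close>

context
  fixes q :: real assumes q: "0 < q" "q < 1"
begin

text \<open>The numbers c_k multiply normalized basis vectors |h - k>, whereas the chain of a single
  module carries the product \<open>sp\<close> of square roots. Passing from k to k + 1, one root
  from c_k and one from \<open>sp\<close> combine to the sigma in \<open>couple_coeff\<close>; the
  factor \<open>sp (h n)\<close> does not depend on k.\<close>

lemma cg_couple_coeff: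
  assumes g: "0 < \<gamma> (Suc n)" and n: "0 < n" and \<mu>: "\<mu> = real (\<Sum>t=1..n - 1. h t) + (\<Sum>t=1..n. \<gamma> t)" "0 < \<mu>"
  defines "sp \<equiv> \<lambda>m. \<Prod>l=1..m. sqrt (sig q (\<gamma> (Suc n)) l)"
  shows "k \<le> h n \<Longrightarrow> cg_coeff q \<gamma> (Suc n) h k * sp (h n) = couple_coeff q \<mu> (\<gamma> (Suc n)) 0 (h n) k * sp (h n - k)"
proof (induction k)
  case 0
  show ?case using q by (simp add: cg_coeff_def)
next
  case (Suc k)
  define H where "H = h n"
  define \<nu> where "\<nu> = \<gamma> (Suc n)"
  define Z where "Z = real (\<Sum>t=1..Suc n - 1. h t) + (\<Sum>t=1..Suc n. \<gamma> t) - 1"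
  have Z: "Z = \<mu> + real H + \<nu> - 1"
  proof -
    have "(\<Sum>t=1..n. h t) = (\<Sum>t=1..n - 1. h t) + h n" using n by (cases n) simp_all
    then show ?thesis by (simp add: Z_def \<mu> H_def \<nu>_def)
  qed
  have kH: "k < H" using Suc.prems by (simp add: H_def)
  have n2: "Suc n - 2 = n - 1" by simp
  \<comment> \<open>The triangular exponent grows by k, also with the division in the natural
    numbers.\<close>
  have ev: "Suc k * (Suc k - 1) div 2 = k * (k - 1) div 2 + k"
  proof -
    have "Suc k * (Suc k - 1) = k * (k - 1) + k * 2" by (cases k) simp_all
    then show ?thesis by simp
  qed
  have pE: "q powr (- (real (Suc k) / 2) * Z) = q powr (- (real k / 2) * Z) * q powr (- (Z / 2))"
    unfolding powr_add[symmetric] by (rule arg_cong[where f = "\<lambda>x. q powr x"]) (simp add: field_simps)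
  have mE: "(- 1 :: real) ^ (Suc k * H + (k * (k - 1) div 2 + k)) = (- 1) ^ (k * H + k * (k - 1) div 2) * (- 1) ^ (H + k)"
    by (simp add: power_add mult_ac)
  have cgf: "cg_coeff q \<gamma> (Suc n) h k = (- 1) ^ (k * H + k * (k - 1) div 2) * q powr (- (real k / 2) * Z)
     * (\<Prod>l<k. sqrt (sig q \<nu> (H - l)) / sig q \<mu> (l + 1))" for k
    unfolding cg_coeff_def Z_def H_def \<nu>_def \<mu>(1) n2 diff_Suc_1 ..
  have cg: "cg_coeff q \<gamma> (Suc n) h (Suc k) = cg_coeff q \<gamma> (Suc n) h k * ((- 1) ^ (H + k) * q powr (- (Z / 2)) * (sqrt (sig q \<nu> (H - k)) / sig q \<mu> (Suc k)))"
    unfolding cgf ev pE mE prod.lessThan_Suc by (simp only: mult_ac Suc_eq_plus1)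
  have e: "H - k = Suc (H - Suc k)" using kH by simp
  have sps: "sp (H - k) = sp (H - Suc k) * sqrt (sig q \<nu> (H - k))" unfolding e sp_def \<nu>_def by simp
  have kp_level: "kp_level q \<nu> 0 (H - Suc k) = - ((- 1) ^ (H + k) * q powr ((real H - real k - 1 + \<nu>) / 2))"
  proof -
    have e': "H + k = Suc (H - Suc k) + 2 * k" using kH by simp
    have "(- 1 :: real) ^ (Suc m + 2 * k) = - ((- 1) ^ m)" for m by (simp add: power_add power_mult)
    then have p: "(- 1 :: real) ^ (H + k) = - ((- 1) ^ (H - Suc k))" by (subst e')
    have r: "real (H - Suc k) = real H - real k - 1" using kH by (simp add: of_nat_diff)
    show ?thesis unfolding kp_level_def r p by simp
  qed
  have s2: "sqrt (sig q \<nu> (H - k)) * sqrt (sig q \<nu> (H - k)) = sig q \<nu> (H - k)"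
    using sig_nonneg[OF q, of \<nu> "H - k"] g by (simp add: \<nu>_def)
  define s where "s = (- 1 :: real) ^ (H + k)"
  have ss: "s * s = 1" "s \<noteq> 0" by (auto simp: s_def simp flip: power_mult_distrib)
  have pz: "q powr (- (Z / 2)) * q powr ((real H - real k - 1 + \<nu>) / 2) = q powr (- ((\<mu> + real k) / 2))"
    unfolding powr_add[symmetric] Z by (rule arg_cong[where f = "\<lambda>x. q powr x"]) (simp add: field_simps)
  have c: "couple_coeff q \<mu> \<nu> 0 H (Suc k) = couple_coeff q \<mu> \<nu> 0 H k * (s * q powr (- (Z / 2)) * (sig q \<nu> (H - k) / sig q \<mu> (Suc k)))"
  proof -
    have inv: "inverse s = s" using ss(1) by (rule inverse_unique)
    have al: "- (x * y * z) / (- (s * y) * w) = s * x * (z / w)" if "y \<noteq> 0" for x y z w :: real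
    proof -
      have "- (x * y * z) / (- (s * y) * w) = x * (y / y) * z * inverse s / w" by (simp add: divide_inverse mult_ac)
      then show ?thesis unfolding inv using that by simp
    qed
    have "- (q powr (- ((\<mu> + real k) / 2)) * sig q \<nu> (H - k)) / (kp_level q \<nu> 0 (H - Suc k) * sig q \<mu> (Suc k))
      = s * q powr (- (Z / 2)) * (sig q \<nu> (H - k) / sig q \<mu> (Suc k))"
      unfolding kp_level s_def[symmetric] pz[symmetric] by (rule al) (use q in simp)
    then show ?thesis by (simp only: couple_coeff_def prod.lessThan_Suc)
  qed
  have IH: "cg_coeff q \<gamma> (Suc n) h k * sp H = couple_coeff q \<mu> \<nu> 0 H k * sp (H - k)" using Suc by (simp add: H_def \<nu>_def)
  have "cg_coeff q \<gamma> (Suc n) h (Suc k) * sp H =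
     cg_coeff q \<gamma> (Suc n) h k * sp H * (s * q powr (- (Z / 2)) * (sqrt (sig q \<nu> (H - k)) / sig q \<mu> (Suc k)))"
    unfolding cg s_def by (simp add: mult_ac)
  also have "\<dots> = couple_coeff q \<mu> \<nu> 0 H k * sp (H - Suc k) * (s * q powr (- (Z / 2)) * ((sqrt (sig q \<nu> (H - k)) * sqrt (sig q \<nu> (H - k))) / sig q \<mu> (Suc k)))"
    unfolding IH sps by (simp add: mult_ac del: real_sqrt_mult_self)
  also have "\<dots> = couple_coeff q \<mu> \<nu> 0 H (Suc k) * sp (H - Suc k)" unfolding s2 c by (simp add: mult_ac)
  finally show ?case by (simp add: H_def \<nu>_def)
qed

text \<open>The coupling with one further module, common to \<open>psi\<close> and
  \<open>Theta\<close>. It matters that the constant is the same for all N: the next stage of the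
  recursion sums over this exponent and has to pull the constant out.\<close>

lemma rep_step:
  assumes A: "lw q A" "nw A = map \<gamma> [1..<n + 1]" and n: "0 < n" and g: "0 < \<gamma> (Suc n)"
    and wA: "wt A = real (\<Sum>t=1..n - 1. h t) + (\<Sum>t=1..n. \<gamma> t)"
    and X: "\<And>k. rep (X k) (\<lambda>ks. c * ch q A k ks)" and c: "c \<noteq> 0"
  shows "\<exists>c'. c' \<noteq> 0 \<and> (\<forall>N. rep ((raise q \<gamma> (Suc n) ^^ N) (\<Sum>k=0..h n. vscale (complex_of_real (cg_coeff q \<gamma> (Suc n) h k))
        (tens (X k) (ket [h n - k])))) (\<lambda>ks. c' * ch q (couple q A (leaf (\<gamma> (Suc n))) (h n)) N ks))"
proof -
  define H where "H = h n"
  define \<nu> where "\<nu> = \<gamma> (Suc n)"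
  define sp where "sp = (\<lambda>m. \<Prod>l=1..m. sqrt (sig q \<nu> l))"
  define Z where "Z = couple q A (leaf \<nu>) H"
  have sp: "sp m \<noteq> 0" for m
  proof -
    have "sig q \<nu> l \<noteq> 0" if "l \<in> {1..m}" for l using sig_pos[OF q, of \<nu> l] g that by (simp add: \<nu>_def)
    then show ?thesis by (simp add: sp_def)
  qed
  have lA: "length (nw A) = n" by (simp add: A(2))
  have Z: "lw q Z" unfolding Z_def by (intro lw_couple[OF q A(1)] lw_leaf) (use g in \<open>simp add: \<nu>_def\<close>)
  have nwZ: "nw Z = map \<gamma> [1..<n + 2]" using A(2) n by (simp add: Z_def \<nu>_def)
  have hA: "homog n (nl A + k) (\<lambda>ks. c * ch q A k ks)" for k
    using homog_cmult[OF homog_ch[OF lwD(1)[OF A(1)]]] by (simp add: lA)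
  have "rep (\<Sum>k=0..H. vscale (complex_of_real (cg_coeff q \<gamma> (Suc n) h k)) (tens (X k) (ket [H - k])))
     (\<lambda>ks. \<Sum>k=0..H. cg_coeff q \<gamma> (Suc n) h k * tns n (\<lambda>ks. c * ch q A k ks) (\<lambda>x. if x = [H - k] then 1 else 0) ks)"
    by (intro rep_sum rep_vscale rep_tens[OF X rep_ket hA])
  also have "(\<lambda>ks. \<Sum>k=0..H. cg_coeff q \<gamma> (Suc n) h k * tns n (\<lambda>ks. c * ch q A k ks) (\<lambda>x. if x = [H - k] then 1 else 0) ks)
     = (\<lambda>ks. c / sp H * nv Z ks)"
  proof
    fix ks
    have "(\<Sum>k=0..H. cg_coeff q \<gamma> (Suc n) h k * tns n (\<lambda>ks. c * ch q A k ks) (\<lambda>x. if x = [H - k] then 1 else 0) ks)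
       = (\<Sum>k\<le>H. c / sp H * (couple_coeff q (wt A) \<nu> 0 H k * chain_tensor q A (leaf \<nu>) k (H - k) ks))"
    proof (rule sum.cong)
      fix k assume "k \<in> {..H}"
      then have "k \<le> h n" by (simp add: H_def)
      then have "cg_coeff q \<gamma> (Suc n) h k * sp H = couple_coeff q (wt A) \<nu> 0 H k * sp (H - k)"
        using cg_couple_coeff[OF g n wA lwD(5)[OF A(1)], of k] by (simp add: sp_def \<nu>_def H_def)
      then have cg: "cg_coeff q \<gamma> (Suc n) h k = couple_coeff q (wt A) \<nu> 0 H k * sp (H - k) / sp H" using sp by (simp add: field_simps)
      have t: "chain_tensor q A (leaf \<nu>) k (H - k) ks = ch q A k (take n ks) * (if drop n ks = [H - k] then sp (H - k) else 0)"
        unfolding chain_tensor_def tns_def lA ch_leaf[OF q(1)] sp_def ..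
      show "cg_coeff q \<gamma> (Suc n) h k * tns n (\<lambda>ks. c * ch q A k ks) (\<lambda>x. if x = [H - k] then 1 else 0) ks =
        c / sp H * (couple_coeff q (wt A) \<nu> 0 H k * chain_tensor q A (leaf \<nu>) k (H - k) ks)"
        unfolding cg t tns_def by simp
    qed auto
    then show "(\<Sum>k=0..H. cg_coeff q \<gamma> (Suc n) h k * tns n (\<lambda>ks. c * ch q A k ks) (\<lambda>x. if x = [H - k] then 1 else 0) ks)
       = c / sp H * nv Z ks"
      by (simp add: Z_def sum_distrib_left)
  qed
  finally have r: "rep (\<Sum>k=0..H. vscale (complex_of_real (cg_coeff q \<gamma> (Suc n) h k)) (tens (X k) (ket [H - k])))
     (\<lambda>ks. c / sp H * nv Z ks)" .
  have hZ: "homog (Suc n) (nl Z) (\<lambda>ks. c / sp H * nv Z ks)"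
    using homog_cmult[OF lwD(1)[OF Z], of "c / sp H"] by (simp add: nwZ del: upt_Suc)
  have "rep ((raise q \<gamma> (Suc n) ^^ N) (\<Sum>k=0..H. vscale (complex_of_real (cg_coeff q \<gamma> (Suc n) h k)) (tens (X k) (ket [H - k]))))
     (\<lambda>ks. c / sp H * ch q Z N ks)" for N
  proof -
    have "(Rop q (map \<gamma> [1..<n + 2]) ^^ N) (\<lambda>ks. c / sp H * nv Z ks) = (\<lambda>ks. c / sp H * ch q Z N ks)"
      using Rop_funpow_sum[OF q, of N "map \<gamma> [1..<n + 2]" "\<lambda>_. c / sp H" "\<lambda>_. nv Z" "{()}"]
      by (simp add: ch_def nwZ fun_eq_iff del: upt_Suc)
    then show ?thesis using rep_raise_funpow[OF q(1) r hZ, where \<delta> = \<gamma> and p = N] by (simp del: upt_Suc)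
  qed
  moreover have "c / sp H \<noteq> 0" using c sp by simp
  ultimately show ?thesis unfolding Z_def \<nu>_def H_def by blast
qed

lemma rep_psi:
  "(\<And>t. t \<in> {1..Suc d} \<Longrightarrow> 0 < \<delta> t) \<Longrightarrow> \<exists>c. c \<noteq> 0 \<and> (\<forall>p. rep (psi q \<delta> (Suc d) h p) (\<lambda>ks. c * ch q (left_comb q \<delta> h (Suc d)) p ks))"
proof (induction d)
  case 0
  have "rep (psi q \<delta> (Suc 0) h p) (\<lambda>ks. 1 * ch q (left_comb q \<delta> h (Suc 0)) p ks)" for p
    by (auto simp: rep_def lookup_ket ch_leaf[OF q(1)])
  then show ?case by (intro exI[of _ 1]) simp
next
  case (Suc d)
  have "\<exists>c. c \<noteq> 0 \<and> (\<forall>p. rep (psi q \<delta> (Suc d) h p) (\<lambda>ks. c * ch q (left_comb q \<delta> h (Suc d)) p ks))"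
    by (rule Suc.IH) (use Suc.prems in simp)
  then obtain c where c: "c \<noteq> 0" "\<And>p. rep (psi q \<delta> (Suc d) h p) (\<lambda>ks. c * ch q (left_comb q \<delta> h (Suc d)) p ks)" by blast
  have A: "lw q (left_comb q \<delta> h (Suc d))" by (rule lw_left_comb[OF q]) (use Suc.prems in simp)
  have g: "0 < \<delta> (Suc (Suc d))" using Suc.prems by simp
  show ?case
  proof -
    have nwA: "nw (left_comb q \<delta> h (Suc d)) = map \<delta> [1..<Suc d + 1]" unfolding left_comb_sel by (simp del: upt_Suc)
    have wA: "wt (left_comb q \<delta> h (Suc d)) = real (\<Sum>t=1..Suc d - 1. h t) + (\<Sum>t=1..Suc d. \<delta> t)" unfolding left_comb_sel by simp
    show ?thesis
    proof -
      have ps: "psi q \<delta> (Suc (Suc d)) h p = (raise q \<delta> (Suc (Suc d)) ^^ p) (\<Sum>k=0..h (Suc d).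
          vscale (complex_of_real (cg_coeff q \<delta> (Suc (Suc d)) h k)) (tens (psi q \<delta> (Suc d) h k) (ket [h (Suc d) - k])))" for p
        unfolding psi.simps(3) by (simp only: add_2_eq_Suc' Suc_eq_plus1[symmetric])
      have lc: "left_comb q \<delta> h (Suc (Suc d)) = couple q (left_comb q \<delta> h (Suc d)) (leaf (\<delta> (Suc (Suc d)))) (h (Suc d))"
        unfolding left_comb.simps(3) by (simp only: add_2_eq_Suc' Suc_eq_plus1[symmetric])
      show ?thesis unfolding ps lc by (rule rep_step[where h = h, OF A nwA zero_less_Suc g wA c(2) c(1)])
    qed
  qed
qed

text \<open>The numbers epsilon_p coincide with \<open>couple_coeff\<close>: alpha_(p+1) is the
  eigenvalue of K P on the right factor times sigma on the left, and beta_(s-p) is the eigenvalue of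
  K^(-1) on the left factor times sigma on the right.\<close>

lemma rep_Psi:
  assumes "\<And>t. t \<in> {1..Suc i + Suc r} \<Longrightarrow> 0 < \<gamma> t"
  shows "\<exists>c. c \<noteq> 0 \<and> (\<forall>t. rep (Psi q \<gamma> (Suc i) (Suc r) h k s t)
     (\<lambda>ks. c * ch q (couple q (left_comb q \<gamma> h (Suc i)) (left_comb q (\<lambda>l. \<gamma> (Suc i + l)) k (Suc r)) s) t ks))"
proof -
  define A where "A = left_comb q \<gamma> h (Suc i)"
  define B where "B = left_comb q (\<lambda>l. \<gamma> (Suc i + l)) k (Suc r)"
  define Z where "Z = couple q A B s"
  have A: "lw q A" unfolding A_def by (rule lw_left_comb[OF q]) (use assms in simp)
  have B: "lw q B" unfolding B_def by (rule lw_left_comb[OF q]) (use assms in simp)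
  have Z: "lw q Z" unfolding Z_def by (rule lw_couple[OF q A B])
  have nwZ: "nw Z = map \<gamma> [1..<Suc i + Suc r + 1]"
    unfolding map_upt_split Z_def A_def B_def couple_sel left_comb_sel by (simp del: upt_Suc)
  obtain c1 where c1: "c1 \<noteq> 0" "\<And>p. rep (psi q \<gamma> (Suc i) h p) (\<lambda>ks. c1 * ch q A p ks)"
  proof -
    have "\<exists>c. c \<noteq> 0 \<and> (\<forall>p. rep (psi q \<gamma> (Suc i) h p) (\<lambda>ks. c * ch q A p ks))"
      unfolding A_def by (rule rep_psi) (use assms in simp)
    then show ?thesis using that by blast
  qed
  obtain c2 where c2: "c2 \<noteq> 0" "\<And>p. rep (psi q (\<lambda>l. \<gamma> (Suc i + l)) (Suc r) k p) (\<lambda>ks. c2 * ch q B p ks)"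
  proof -
    have "\<exists>c. c \<noteq> 0 \<and> (\<forall>p. rep (psi q (\<lambda>l. \<gamma> (Suc i + l)) (Suc r) k p) (\<lambda>ks. c * ch q B p ks))"
      unfolding B_def by (rule rep_psi) (use assms in simp)
    then show ?thesis using that by blast
  qed
  define H K G1 G2 where "H = real (\<Sum>l=1..Suc i - 1. h l)" and "K = (\<Sum>l=1..Suc r - 1. k l)"
    and "G1 = (\<Sum>l=1..Suc i. \<gamma> l)" and "G2 = (\<Sum>l=Suc i + 1..Suc i + Suc r. \<gamma> l)"
  define \<alpha> where "\<alpha> = (\<lambda>p. (- 1) ^ (K + s - p) * q powr ((G2 + real s - real p + real K) / 2) * sig q (H + G1) p)"
  define \<beta> where "\<beta> = (\<lambda>p. q powr (- ((G1 + real s - real p + H) / 2)) * sig q (real K + G2) p)"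
  define \<epsilon> where "\<epsilon> = (\<lambda>p. (- 1) ^ p * (\<Prod>u=s - p + 1..s. \<beta> u) / (\<Prod>u=1..p. \<alpha> u))"
  have Psi: "Psi q \<gamma> (Suc i) (Suc r) h k s t = (raise q \<gamma> (Suc i + Suc r) ^^ t)
           (\<Sum>p=0..s. vscale (complex_of_real (\<epsilon> p)) (tens (psi q \<gamma> (Suc i) h p) (psi q (\<lambda>l. \<gamma> (Suc i + l)) (Suc r) k (s - p))))" for t
    unfolding Psi_def Let_def \<epsilon>_def \<beta>_def \<alpha>_def H_def K_def G1_def G2_def ..
  have wA: "wt A = H + G1" unfolding A_def left_comb_sel H_def G1_def by simp
  have wB: "wt B = real K + G2"
  proof -
    have "(\<Sum>t=1..Suc r. \<gamma> (Suc i + t)) = G2"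
      unfolding G2_def using sum.shift_bounds_cl_nat_ivl[of \<gamma> 1 "Suc i" "Suc r"] by (simp add: add.commute)
    then show ?thesis unfolding B_def left_comb_sel K_def by simp
  qed
  have nlB: "nl B = K" unfolding B_def left_comb_sel K_def by simp
  have eps: "p \<le> s \<Longrightarrow> \<epsilon> p = couple_coeff q (wt A) (wt B) (nl B) s p" for p
  proof (induction p)
    case 0 show ?case by (simp add: \<epsilon>_def)
  next
    case (Suc p)
    then have p: "p < s" by simp
    have i1: "(\<Prod>u=s - Suc p + 1..s. \<beta> u) = \<beta> (s - p) * (\<Prod>u=s - p + 1..s. \<beta> u)"
    proof -
      have "s - Suc p + 1 = s - p" using p by simp
      then show ?thesis using p by (simp add: prod.atLeast_Suc_atMost)
    qed
    have i2: "(\<Prod>u=1..Suc p. \<alpha> u) = (\<Prod>u=1..p. \<alpha> u) * \<alpha> (Suc p)" by simp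
    have e1: "\<epsilon> (Suc p) = \<epsilon> p * (- \<beta> (s - p) / \<alpha> (Suc p))" unfolding \<epsilon>_def i1 i2 by simp
    have e2: "\<beta> (s - p) = q powr (- ((wt A + real p) / 2)) * sig q (wt B) (s - p)"
      unfolding \<beta>_def wA wB using p by (simp add: of_nat_diff algebra_simps)
    have e3: "\<alpha> (Suc p) = kp_level q (wt B) (nl B) (s - Suc p) * sig q (wt A) (Suc p)"
    proof -
      have "K + s - Suc p = K + (s - Suc p)" using p by simp
      moreover have "(G2 + real s - real (Suc p) + real K) / 2 = (real (s - Suc p) + (real K + G2)) / 2" using p by (simp add: of_nat_diff)
      ultimately show ?thesis unfolding \<alpha>_def kp_level_def wA wB nlB by (simp only:)
    qed
    show ?case unfolding e1 e2 e3 using Suc by (simp add: couple_coeff_def)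
  qed
  have hA: "homog (length (nw A)) (nl A + p) (\<lambda>ks. c1 * ch q A p ks)" for p
    by (rule homog_cmult[OF homog_ch[OF lwD(1)[OF A]]])
  have "rep (\<Sum>p=0..s. vscale (complex_of_real (\<epsilon> p)) (tens (psi q \<gamma> (Suc i) h p) (psi q (\<lambda>l. \<gamma> (Suc i + l)) (Suc r) k (s - p))))
     (\<lambda>ks. \<Sum>p=0..s. \<epsilon> p * tns (length (nw A)) (\<lambda>ks. c1 * ch q A p ks) (\<lambda>ks. c2 * ch q B (s - p) ks) ks)"
    by (intro rep_sum rep_vscale rep_tens[OF c1(2) c2(2) hA])
  also have "(\<lambda>ks. \<Sum>p=0..s. \<epsilon> p * tns (length (nw A)) (\<lambda>ks. c1 * ch q A p ks) (\<lambda>ks. c2 * ch q B (s - p) ks) ks) = (\<lambda>ks. c1 * c2 * nv Z ks)"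
    unfolding Z_def couple_sel sum_distrib_left
    by (intro ext sum.cong) (auto simp: eps chain_tensor_def tns_def mult_ac)
  finally have r: "rep (\<Sum>p=0..s. vscale (complex_of_real (\<epsilon> p)) (tens (psi q \<gamma> (Suc i) h p) (psi q (\<lambda>l. \<gamma> (Suc i + l)) (Suc r) k (s - p))))
     (\<lambda>ks. c1 * c2 * nv Z ks)" .
  have hZ: "homog (Suc (i + Suc r)) (nl Z) (\<lambda>ks. c1 * c2 * nv Z ks)"
    using homog_cmult[OF lwD(1)[OF Z]] by (simp add: nwZ del: upt_Suc)
  have "rep (Psi q \<gamma> (Suc i) (Suc r) h k s t) (\<lambda>ks. c1 * c2 * ch q Z t ks)" for t
  proof -
    have "(Rop q (map \<gamma> [1..<i + Suc r + 2]) ^^ t) (\<lambda>ks. c1 * c2 * nv Z ks) = (\<lambda>ks. c1 * c2 * ch q Z t ks)"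
      using Rop_funpow_sum[OF q, of t "map \<gamma> [1..<i + Suc r + 2]" "\<lambda>_. c1 * c2" "\<lambda>_. nv Z" "{()}"]
      by (simp add: ch_def nwZ fun_eq_iff del: upt_Suc)
    then show ?thesis using rep_raise_funpow[OF q(1) _ hZ, where \<delta> = \<gamma> and p = t] r unfolding Psi by (simp del: upt_Suc)
  qed
  moreover have "c1 * c2 \<noteq> 0" using c1 c2 by simp
  ultimately show ?thesis unfolding Z_def A_def B_def by blast
qed

lemma wt_tree:
  assumes "\<And>t. t \<in> {1..Suc i + Suc r + m} \<Longrightarrow> 0 < \<gamma> t"
  shows "wt (tree q \<gamma> (Suc i) (Suc r) j m) = real (\<Sum>t=1..Suc i + Suc r + m - 1. j t) + (\<Sum>t=1..Suc i + Suc r + m. \<gamma> t)"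
proof -
  have nl: "nl (tree q \<gamma> (Suc i) (Suc r) j m) = (\<Sum>t=1..Suc i + Suc r + m - 1. j t)"
  proof (induction m)
    case 0
    have "(\<Sum>t=1..i + r. j t) = (\<Sum>t=1..i. j t) + (\<Sum>l=1..r. j (i + l))"
      using sum.ub_add_nat[of 1 i j r] sum.shift_bounds_cl_nat_ivl[of j 1 i r] by (simp add: add.commute)
    moreover have "nl (tree q \<gamma> (Suc i) (Suc r) j 0) = (\<Sum>t=1..Suc i - 1. j t) + (\<Sum>l=1..Suc r - 1. j (Suc i - 1 + l)) + j (Suc i + Suc r - 1)"
      unfolding tree.simps couple_sel left_comb_sel by (simp only: diff_Suc_1)
    ultimately show ?case by simp
  next
    case (Suc m)
    have "nl (tree q \<gamma> (Suc i) (Suc r) j (Suc m)) = nl (tree q \<gamma> (Suc i) (Suc r) j m) + j (Suc i + Suc r + m)" by simp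
    then show ?case unfolding Suc by simp
  qed
  have "nw (tree q \<gamma> (Suc i) (Suc r) j m) = map \<gamma> [1..<Suc i + Suc r + m + 1]"
    by (rule tree_facts(2)[OF q _ _ assms]) simp_all
  then show ?thesis unfolding wt_def nl by (simp only: sum_list_map_upt)
qed

lemma rep_Theta:
  "(\<And>t. t \<in> {1..Suc i + Suc r + m} \<Longrightarrow> 0 < \<gamma> t) \<Longrightarrow>
   \<exists>c. c \<noteq> 0 \<and> (\<forall>N. rep (Theta q \<gamma> (Suc i) (Suc r) (Suc i + Suc r + m) j N) (\<lambda>ks. c * ch q (tree q \<gamma> (Suc i) (Suc r) j m) N ks))"
proof (induction m)
  case 0
  have "Theta q \<gamma> (Suc i) (Suc r) (Suc i + Suc r + 0) j N = Psi q \<gamma> (Suc i) (Suc r) j (\<lambda>l. j (Suc i - 1 + l)) (j (Suc i + Suc r - 1)) N" for N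
    by simp
  then have Th: "Theta q \<gamma> (Suc i) (Suc r) (Suc i + Suc r + 0) j = Psi q \<gamma> (Suc i) (Suc r) j (\<lambda>l. j (Suc i - 1 + l)) (j (Suc i + Suc r - 1))"
    by (rule ext)
  show ?case unfolding tree.simps(1) Th by (rule rep_Psi) (use 0 in simp)
next
  case (Suc m)
  define n where "n = Suc i + Suc r + m"
  have \<gamma>: "\<And>t. t \<in> {1..Suc i + Suc r + m} \<Longrightarrow> 0 < \<gamma> t" using Suc.prems by simp
  have "\<exists>c. c \<noteq> 0 \<and> (\<forall>N. rep (Theta q \<gamma> (Suc i) (Suc r) n j N) (\<lambda>ks. c * ch q (tree q \<gamma> (Suc i) (Suc r) j m) N ks))"
    unfolding n_def by (rule Suc.IH) (rule \<gamma>)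
  then obtain c where c: "c \<noteq> 0" "\<And>N. rep (Theta q \<gamma> (Suc i) (Suc r) n j N) (\<lambda>ks. c * ch q (tree q \<gamma> (Suc i) (Suc r) j m) N ks)"
    by blast
  have T: "lw q (tree q \<gamma> (Suc i) (Suc r) j m)" by (rule tree_facts(1)[OF q _ _ \<gamma>]) simp_all
  have nwT: "nw (tree q \<gamma> (Suc i) (Suc r) j m) = map \<gamma> [1..<n + 1]" unfolding n_def by (rule tree_facts(2)[OF q _ _ \<gamma>]) simp_all
  have wT: "wt (tree q \<gamma> (Suc i) (Suc r) j m) = real (\<Sum>t=1..n - 1. j t) + (\<Sum>t=1..n. \<gamma> t)"
    unfolding n_def by (rule wt_tree[OF \<gamma>])
  have n0: "0 < n" and g: "0 < \<gamma> (Suc n)" using Suc.prems by (simp_all add: n_def)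
  have Th: "Theta q \<gamma> (Suc i) (Suc r) (Suc i + Suc r + Suc m) j N = (raise q \<gamma> (Suc n) ^^ N) (\<Sum>k=0..j n. vscale (complex_of_real (cg_coeff q \<gamma> (Suc n) j k))
                (tens (Theta q \<gamma> (Suc i) (Suc r) n j k) (ket [j n - k])))" for N
    unfolding n_def by simp
  have tr: "tree q \<gamma> (Suc i) (Suc r) j (Suc m) = couple q (tree q \<gamma> (Suc i) (Suc r) j m) (leaf (\<gamma> (Suc n))) (j n)"
    by (simp add: n_def)
  show ?case unfolding Th tr by (rule rep_step[where h = j, OF T nwT n0 g wT c(2) c(1)])
qed

end

section \<open>The explicit functions and the phases\<close>

text \<open>Modulo 2 the k-th exponent is x(k+1) x(k) + x(k) + K(k-1) K(k) + K(k-1) + x(k+1) K(k) +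
  x(k) K(k-1). The last two, mixed terms telescope to x(r+1) K(r). For a nonzero overlap x(r+1) is
  common to both tuples, so this remainder can be assigned to the second one.\<close>

lemma sign_separation:
  fixes x K :: "nat \<Rightarrow> nat"
  assumes K0: "K 0 = 0" and m: "\<And>k. x k \<le> x (Suc k)" "\<And>k. K k \<le> K (Suc k)"
  shows "(\<And>k. k < r \<Longrightarrow> K k \<le> x (Suc k)) \<Longrightarrow>
    (\<Prod>k=1..r. (- 1) ^ ((x (Suc k) - K (k - 1)) * (x k - K (k - 1)) + (x k - K (k - 1)) + (x (Suc k) - K (k - 1)) * (K k - K (k - 1)))
        * sgT (K k - K (k - 1))) =
    (\<Prod>k=1..r. (- 1) ^ (x (Suc k) * x k + x k)) * (\<Prod>k=1..r. (- 1) ^ (K (k - 1) * K k + K (k - 1)) * sgT (K k - K (k - 1)))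
      * ((- 1 :: real) ^ (x (Suc r) * K r))"
proof (induction r)
  case 0 show ?case using K0 by simp
next
  case (Suc r)
  define u where "u = K r"
  obtain y where y: "x (Suc r) = u + y" using Suc.prems[of r] by (metis le_add_diff_inverse lessI u_def)
  obtain z where z: "x (Suc (Suc r)) = u + y + z" using m(1)[of "Suc r"] by (metis le_add_diff_inverse y)
  obtain n where n: "K (Suc r) = u + n" using m(2)[of r] by (metis le_add_diff_inverse u_def)
  have e: "(- 1 :: real) ^ ((y + z) * y + y + (y + z) * n) =
     (- 1) ^ ((u + y + z) * (u + y) + (u + y)) * (- 1) ^ (u * (u + n) + u) * (- 1) ^ ((u + y + z) * (u + n)) * (- 1) ^ ((u + y) * u)"
    by (cases "even u"; cases "even y"; cases "even z"; cases "even n") (simp_all add: minus_one_power_iff)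
  have c: "x (Suc (Suc r)) - K (Suc r - 1) = y + z" "x (Suc r) - K (Suc r - 1) = y" "K (Suc r) - K (Suc r - 1) = n" "K (Suc r - 1) = u"
    using y z n by (simp_all add: u_def)
  define s :: real where "s = (- 1) ^ ((u + y) * u)"
  have ss: "s * s = 1" unfolding s_def power_mult_distrib[symmetric] by simp
  have IH: "(\<Prod>k=1..r. (- 1) ^ ((x (Suc k) - K (k - 1)) * (x k - K (k - 1)) + (x k - K (k - 1)) + (x (Suc k) - K (k - 1)) * (K k - K (k - 1)))
        * sgT (K k - K (k - 1))) =
    (\<Prod>k=1..r. (- 1) ^ (x (Suc k) * x k + x k)) * (\<Prod>k=1..r. (- 1) ^ (K (k - 1) * K k + K (k - 1)) * sgT (K k - K (k - 1))) * s"
    unfolding s_def y[symmetric] unfolding u_def by (rule Suc.IH) (use Suc.prems in simp)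
  have p: "(\<Prod>k=1..Suc r. f k) = (\<Prod>k=1..r. f k) * f (Suc r)" for f :: "nat \<Rightarrow> real" by simp
  have al: "A * B * s * (F * G * H * s * t) = A * F * (B * (G * t)) * H" for A B F G H t :: real
  proof -
    have "A * B * s * (F * G * H * s * t) = A * F * (B * (G * t)) * H * (s * s)" by (simp only: mult_ac)
    then show ?thesis unfolding ss by simp
  qed
  show ?case unfolding p IH unfolding c(1-3) unfolding c(4) y z n e s_def[symmetric] by (rule al)
qed

section \<open>The functions rho and h in terms of the telescoping factors\<close>

context
  fixes q :: real assumes q: "0 < q" "q < 1"
begin

lemma Zf_pos:
  assumes "0 < a" "0 < b"
  shows "0 < Zf q a b b' M K"
  unfolding Zf_def using assms q powr_bounds[OF q, of a] powr_bounds[OF q, of b] powr_bounds[OF q, of "a + b"]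
  by (intro divide_pos_pos mult_pos_pos qpoch_Q_pos qpoch_pos0 qpoch_pos_inv) auto

lemma Q_inv_pos:
  assumes "0 < \<mu>"
  shows "0 < 1 - q powr (2 * \<mu>) / (- q) * (- q) ^ (2 * X)"
proof -
  have "0 < (- q) ^ (2 * X)" using q by (simp add: power_mult)
  then have "0 < q powr (2 * \<mu>) / q * (- q) ^ (2 * X)" using q by (intro mult_pos_pos divide_pos_pos) auto
  then show ?thesis by simp
qed

lemma Ef_pos:
  assumes "0 < a" "0 < b" "0 < c"
  shows "0 < Ef q a b c g X X'"
  unfolding Ef_def using assms q powr_bounds[OF q, of c] powr_bounds[OF q, of "a + b + c"] powr_bounds[OF q, of "a + b"] Q_inv_pos[of "a + b" X] Q_inv_pos[of "a + b" 0]
  by (intro divide_pos_pos mult_pos_pos qpoch_Q_pos qpoch_pos0 qpoch_pos_inv) auto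

lemma Ff_pos:
  assumes "0 < b" "0 < c"
  shows "0 < Ff q b c K K'"
  unfolding Ff_def using assms q powr_bounds[OF q, of c] powr_bounds[OF q, of "b + c"] powr_bounds[OF q, of b] Q_inv_pos[of "b + c" K'] Q_inv_pos[of "b + c" 0]
  by (intro divide_pos_pos mult_pos_pos qpoch_Q_pos qpoch_pos0 qpoch_pos_inv) auto

text \<open>The quotients of \<open>Zf\<close> from \<open>racah_weight_step\<close> collapse to the
  last value over the first. The difference of consecutive \<beta> is a single weight, which becomes
  the exponent in \<open>Ef\<close>.\<close>

lemma prod_racah_weight:
  fixes x K :: "nat \<Rightarrow> nat" and \<delta> :: "nat \<Rightarrow> real"
  assumes K0: "K 0 = 0" and m: "\<And>k. x k \<le> x (Suc k)" "\<And>k. K k \<le> K (Suc k)" and a: "0 < a"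
  defines "\<beta> \<equiv> \<lambda>k. \<Sum>t=1..k. \<delta> t"
  shows "(\<And>t. t \<in> {1..Suc r} \<Longrightarrow> 0 < \<delta> t) \<Longrightarrow> (\<And>k. k \<le> r \<Longrightarrow> K k \<le> x (Suc k)) \<Longrightarrow>
    (\<Prod>k=1..r. racah_weight q a (\<beta> k + real (K (k - 1))) (\<delta> (Suc k)) (K k - K (k - 1)) (x k - K (k - 1)) (x (Suc k) - K (k - 1))) =
    Zf q a (\<beta> (Suc r)) (\<beta> r) (x (Suc r)) (K r) / Zf q a (\<beta> 1) 0 (x 1) 0
     * (\<Prod>k=1..r. Ef q a (\<beta> k) (\<delta> (Suc k)) (\<delta> k) (x k) (x (Suc k)) / Ff q (\<beta> k) (\<delta> (Suc k)) (K (k - 1)) (K k))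
     * (\<Prod>k=1..r. q powr ((1 - 2 * real (K (k - 1)) - 2 * a - 2 * \<beta> k) * real (K k - K (k - 1))))"
proof (induction r)
  case 0
  have "0 < Zf q a (\<beta> 1) 0 (x 1) 0" by (rule Zf_pos) (use a 0 in \<open>simp_all add: \<beta>_def\<close>)
  then show ?case by (simp add: K0 \<beta>_def)
next
  case (Suc r)
  have IH: "(\<Prod>k=1..r. racah_weight q a (\<beta> k + real (K (k - 1))) (\<delta> (Suc k)) (K k - K (k - 1)) (x k - K (k - 1)) (x (Suc k) - K (k - 1))) =
    Zf q a (\<beta> (Suc r)) (\<beta> r) (x (Suc r)) (K r) / Zf q a (\<beta> 1) 0 (x 1) 0
     * (\<Prod>k=1..r. Ef q a (\<beta> k) (\<delta> (Suc k)) (\<delta> k) (x k) (x (Suc k)) / Ff q (\<beta> k) (\<delta> (Suc k)) (K (k - 1)) (K k))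
     * (\<Prod>k=1..r. q powr ((1 - 2 * real (K (k - 1)) - 2 * a - 2 * \<beta> k) * real (K k - K (k - 1))))"
    by (rule Suc.IH) (use Suc.prems in simp_all)
  have b: "0 < \<beta> (Suc r)" unfolding \<beta>_def by (rule sum_pos) (use Suc.prems in auto)
  have c: "0 < \<delta> (Suc (Suc r))" using Suc.prems by simp
  have bb: "\<beta> (Suc r) - \<beta> r = \<delta> (Suc r)" "\<beta> (Suc (Suc r)) = \<beta> (Suc r) + \<delta> (Suc (Suc r))" by (simp_all add: \<beta>_def)
  have le: "K r \<le> K (Suc r)" "K r \<le> x (Suc r)" "x (Suc r) \<le> x (Suc (Suc r))" "K (Suc r) \<le> x (Suc (Suc r))"
    using m Suc.prems(2)[of r] Suc.prems(2)[of "Suc r"] by auto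
  have Z: "Zf q a (\<beta> (Suc r)) (\<beta> r) (x (Suc r)) (K r) \<noteq> 0" using Zf_pos[OF a b, of "\<beta> r" "x (Suc r)" "K r"] by simp
  have al: "Z1 / Z0 * P * W * (Z2 / Z1 * E * z) = Z2 / Z0 * (P * E) * (W * z)" if "Z1 \<noteq> 0" for Z1 Z0 P W Z2 E z :: real
    using that by (simp add: field_simps)
  have w: "racah_weight q a (\<beta> (Suc r) + real (K (Suc r - 1))) (\<delta> (Suc (Suc r))) (K (Suc r) - K (Suc r - 1)) (x (Suc r) - K (Suc r - 1)) (x (Suc (Suc r)) - K (Suc r - 1)) =
     Zf q a (\<beta> (Suc (Suc r))) (\<beta> (Suc r)) (x (Suc (Suc r))) (K (Suc r)) / Zf q a (\<beta> (Suc r)) (\<beta> r) (x (Suc r)) (K r)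
      * (Ef q a (\<beta> (Suc r)) (\<delta> (Suc (Suc r))) (\<delta> (Suc r)) (x (Suc r)) (x (Suc (Suc r))) / Ff q (\<beta> (Suc r)) (\<delta> (Suc (Suc r))) (K (Suc r - 1)) (K (Suc r)))
      * q powr ((1 - 2 * real (K (Suc r - 1)) - 2 * a - 2 * \<beta> (Suc r)) * real (K (Suc r) - K (Suc r - 1)))"
    unfolding diff_Suc_1 using racah_weight_step[OF q a b c le, of "\<beta> r"] unfolding bb .
  have s: "(\<Prod>k=1..Suc r. f k) = (\<Prod>k=1..r. f k) * f (Suc r)" for f :: "nat \<Rightarrow> real" by simp
  show ?case unfolding s IH w by (rule al[OF Z])
qed

lemma powi_Q:
  "(- q) powi (2 * int s - 1) = (- q) ^ (2 * s) / (- q)"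
proof -
  have "(- q) powi (2 * int s - 1) = (- q) powi (int (2 * s)) / (- q) powi 1"
    using q by (subst power_int_diff[symmetric]) simp_all
  moreover have "(- q) powi (int (2 * s)) = (- q) ^ (2 * s)" by (rule power_int_of_nat)
  ultimately show ?thesis by (simp only: power_int_1_right)
qed

text \<open>The level to the left of the block is absorbed into the weight \<open>a\<close>: as Q^2
  = q^2, each parameter with Q^(2 S0) becomes q^(2 (a + \<beta>)). The quotient in front of the
  product over k in \<open>rho\<close> contains the reciprocal of the first
  \<open>Zf\<close>.\<close>

lemma rho_closed:
  fixes j :: "nat \<Rightarrow> nat" and \<gamma> :: "nat \<Rightarrow> real"
  assumes i: "1 \<le> i"
  defines "S0 \<equiv> psum j (i - 1)" and "x \<equiv> \<lambda>k. psum j (i + k - 1) - psum j (i - 1)"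
    and "a \<equiv> gsum \<gamma> 1 i + real (psum j (i - 1))" and "\<delta> \<equiv> \<lambda>t. \<gamma> (i + t)" and "\<beta> \<equiv> \<lambda>k. \<Sum>t=1..k. \<gamma> (i + t)"
  shows "rho q \<gamma> i (Suc r) j = qpoch (- q) (- q) (x (Suc r)) * qpoch (q powr (2 * (a + \<beta> r))) (- q) (x (Suc r))
      / (qpoch (q powr (2 * \<delta> (Suc r))) (- q) (x (Suc r)) * qpoch (q powr (2 * (a + \<beta> (Suc r))) / (- q)) (- q) (x (Suc r)))
      / Zf q a (\<beta> 1) 0 (x 1) 0 * (\<Prod>k=1..r. Ef q a (\<beta> k) (\<delta> (Suc k)) (\<delta> k) (x k) (x (Suc k)))"
proof -
  have mono: "psum j (i - 1) \<le> psum j (i + k - 1)" for k unfolding psum_def by (rule sum_mono2) auto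
  have S: "psum j (i + k - 1) = S0 + x k" for k using mono[of k] by (simp add: x_def S0_def)
  have S': "psum j (i + k) = S0 + x (Suc k)" for k using S[of "Suc k"] by simp
  have G: "gsum \<gamma> 1 (i + k) = gsum \<gamma> 1 i + \<beta> k" for k
    unfolding \<beta>_def gsum_def using sum.ub_add_nat[of 1 i \<gamma> k] sum.shift_bounds_cl_nat_ivl[of \<gamma> 1 i k] by (simp add: add.commute)
  have Ga: "(- q) ^ (2 * S0) * q powr (2 * (gsum \<gamma> 1 i + \<beta> k)) = q powr (2 * (a + \<beta> k))" for k
    using powr_2u[OF q, of "gsum \<gamma> 1 i + \<beta> k" S0] by (simp add: a_def S0_def add.assoc add.commute add.left_commute mult.commute)
  have Ga0: "(- q) ^ (2 * S0) * q powr (2 * gsum \<gamma> 1 i) = q powr (2 * a)" using Ga[of 0] by (simp add: \<beta>_def)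
  have Gm: "(- q) powi (2 * int S0 - 1) * q powr (2 * (gsum \<gamma> 1 i + \<beta> k)) = q powr (2 * (a + \<beta> k)) / (- q)" for k
    unfolding powi_Q Ga[symmetric] by simp
  have Gx: "(- q) powi (2 * int (S0 + X) - 1) * q powr (2 * (gsum \<gamma> 1 i + \<beta> k)) = q powr (2 * (a + \<beta> k)) / (- q) * (- q) ^ (2 * X)" for k X
    unfolding powi_Q Ga[symmetric] by (simp add: power_add distrib_left)
  have ji: "j i = x 1" using i by (cases i) (simp_all add: x_def psum_def)
  have jk: "j (i + k) = x (Suc k) - x k" for k
    using i S[of k] S'[of k] by (cases "i + k") (simp_all add: psum_def)
  have pw: "(q powr (2 * g)) powi (- int (S0 + X) + int S0) = q powr (- 2 * g * real X)" for g X
  proof -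
    have "- int (S0 + X) + int S0 = - int X" by simp
    then show ?thesis using q by (simp only:) (simp add: power_int_minus powr_minus powr_power mult.commute)
  qed
  have b1: "\<beta> 1 = \<gamma> (i + 1)" "\<beta> (Suc k) = \<beta> k + \<delta> (Suc k)" for k by (simp_all add: \<beta>_def \<delta>_def)
  have E: "qpoch (q powr (2 * \<gamma> (i + k + 1))) (- q) (x (Suc k) - x k) / qpoch (- q) (- q) (x (Suc k) - x k)
     * (qpoch (q powr (2 * (a + \<beta> (Suc k))) / - q) (- q) (S0 + x k + (S0 + x (Suc k)) - 2 * S0)
        / qpoch (q powr (2 * (a + \<beta> k))) (- q) (S0 + x k + (S0 + x (Suc k)) - 2 * S0))
     * ((1 - q powr (2 * (a + \<beta> k)) / - q * (- q) ^ (2 * x k)) / (1 - q powr (2 * (a + \<beta> k)) / - q))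
     * q powr (- 2 * \<gamma> (i + k) * real (x k)) = Ef q a (\<beta> k) (\<delta> (Suc k)) (\<delta> k) (x k) (x (Suc k))" for k
  proof -
    have "S0 + x k + (S0 + x (Suc k)) - 2 * S0 = x k + x (Suc k)" by simp
    then show ?thesis unfolding Ef_def b1(2) by (simp only: \<delta>_def add_Suc_right Suc_eq_plus1[symmetric] add.assoc)
  qed
  have ii: "i + k + 1 = i + Suc k" for k by simp
  have pr: "(\<Prod>k=1..Suc r - 1. qpoch (q powr (2 * \<gamma> (i + k + 1))) (- q) (j (i + k)) / qpoch (- q) (- q) (j (i + k))
     * (qpoch ((- q) powi (2 * int S0 - 1) * q powr (2 * gsum \<gamma> 1 (i + k + 1))) (- q) (psum j (i + k - 1) + psum j (i + k) - 2 * S0)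
        / qpoch ((- q) ^ (2 * S0) * q powr (2 * gsum \<gamma> 1 (i + k))) (- q) (psum j (i + k - 1) + psum j (i + k) - 2 * S0))
     * ((1 - (- q) powi (2 * int (psum j (i + k - 1)) - 1) * q powr (2 * gsum \<gamma> 1 (i + k)))
       / (1 - (- q) powi (2 * int S0 - 1) * q powr (2 * gsum \<gamma> 1 (i + k))))
     * (q powr (2 * \<gamma> (i + k))) powi (- int (psum j (i + k - 1)) + int S0))
    = (\<Prod>k=1..r. Ef q a (\<beta> k) (\<delta> (Suc k)) (\<delta> k) (x k) (x (Suc k)))"
    unfolding diff_Suc_1
  proof (rule prod.cong[OF refl])
    fix k
    show "qpoch (q powr (2 * \<gamma> (i + k + 1))) (- q) (j (i + k)) / qpoch (- q) (- q) (j (i + k))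
     * (qpoch ((- q) powi (2 * int S0 - 1) * q powr (2 * gsum \<gamma> 1 (i + k + 1))) (- q) (psum j (i + k - 1) + psum j (i + k) - 2 * S0)
        / qpoch ((- q) ^ (2 * S0) * q powr (2 * gsum \<gamma> 1 (i + k))) (- q) (psum j (i + k - 1) + psum j (i + k) - 2 * S0))
     * ((1 - (- q) powi (2 * int (psum j (i + k - 1)) - 1) * q powr (2 * gsum \<gamma> 1 (i + k)))
       / (1 - (- q) powi (2 * int S0 - 1) * q powr (2 * gsum \<gamma> 1 (i + k))))
     * (q powr (2 * \<gamma> (i + k))) powi (- int (psum j (i + k - 1)) + int S0)
      = Ef q a (\<beta> k) (\<delta> (Suc k)) (\<delta> k) (x k) (x (Suc k))"
      unfolding E[symmetric] jk S S' pw
      unfolding ii G Gm Gx Ga ..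
  qed
  have M: "psum j (i + Suc r - 1) - S0 = x (Suc r)" unfolding S by simp
  have e1: "gsum \<gamma> 1 (i + Suc r - 1) = gsum \<gamma> 1 i + \<beta> r" using G[of r] by simp
  have Z: "1 / Zf q a (\<beta> 1) 0 (x 1) 0 = qpoch (q powr (2 * (a + \<beta> 1)) / (- q)) (- q) (x 1) * qpoch (q powr (2 * \<delta> 1)) (- q) (x 1)
     / (qpoch (- q) (- q) (x 1) * qpoch (q powr (2 * a)) (- q) (x 1))"
    unfolding Zf_def using q by (simp add: \<beta>_def \<delta>_def)
  have d: "q powr (2 * \<gamma> (i + m)) = q powr (2 * \<delta> m)" for m by (simp add: \<delta>_def)
  have Zd: "A / Zf q a (\<beta> 1) 0 (x 1) 0 * B = A * (1 / Zf q a (\<beta> 1) 0 (x 1) 0) * B" for A B by simp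
  show ?thesis
    unfolding rho_def Let_def qpochs_def list.map prod_list.Cons prod_list.Nil S0_def[symmetric] mult_1_right
    unfolding pr unfolding Zd Z M e1 d ji
    unfolding G Gm Ga Ga0 by simp
qed

text \<open>The same substitution. The assumption that both tuples have equal partial sums before
  the block turns each shift by - 2 S0 into a partial sum \<open>K\<close> counted from the start of
  the block.\<close>

lemma hnorm_closed:
  fixes j j' :: "nat \<Rightarrow> nat" and i r :: nat and \<gamma> :: "nat \<Rightarrow> real"
  assumes i: "1 \<le> i" and J0: "psum j' (i - 1) = psum j (i - 1)"
  defines "S0 \<equiv> psum j (i - 1)" and "K \<equiv> \<lambda>k. \<Sum>l=1..k. j' (i + l - 1)"
    and "a \<equiv> gsum \<gamma> 1 i + real (psum j (i - 1))" and "\<delta> \<equiv> \<lambda>t. \<gamma> (i + t)" and "\<beta> \<equiv> \<lambda>k. \<Sum>t=1..k. \<gamma> (i + t)"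
    and "M \<equiv> psum j (i + r) - psum j (i - 1)"
  shows "hnorm q \<gamma> i (Suc r) j j' = qpoch (q powr (2 * (a + \<beta> r))) (- q) M * qpoch (q powr (2 * \<beta> (Suc r))) (- q) M
      / (qpoch (q powr (2 * \<delta> (Suc r))) (- q) M * qpoch (q powr (2 * a)) (- q) M) * q powr (- 2 * \<beta> r * real M)
      * (qpoch (q powr (2 * \<beta> (Suc r)) * (- q) ^ M) (- q) (K r) * qpoch (q powr (2 * (a + \<beta> (Suc r))) / (- q) * (- q) ^ M) (- q) (K r)
        * qpoch ((- q) powi (1 - int M) / q powr (2 * a)) (- q) (K r) * qpoch ((- q) powi (- int M)) (- q) (K r))
      * (\<Prod>k=1..r. Ff q (\<beta> k) (\<delta> (Suc k)) (K (k - 1)) (K k))"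
proof -
  have "psum j (i - 1) \<le> psum j (i + r)" unfolding psum_def by (rule sum_mono2) auto
  then have S1: "psum j (i + r) = S0 + M" by (simp add: M_def S0_def)
  have J: "psum j' (i + k - 1) = S0 + K k" for k
  proof (induction k)
    case 0 show ?case unfolding S0_def using J0 by (simp add: K_def)
  next
    case (Suc k)
    obtain i' where "i = Suc i'" using i by (cases i) auto
    then show ?case using Suc by (simp add: K_def psum_def)
  qed
  have J': "psum j' (i + k - 2) = S0 + K (k - 1)" if "1 \<le> k" for k
    using J[of "k - 1"] that by (cases k) (simp_all add: numeral_2_eq_2)
  have g: "gsum \<gamma> (i + 1) (i + k) = \<beta> k" for k
    unfolding \<beta>_def gsum_def using sum.shift_bounds_cl_nat_ivl[of \<gamma> 1 i k] by (simp add: add.commute)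
  have G: "gsum \<gamma> 1 (i + k) = gsum \<gamma> 1 i + \<beta> k" for k
    unfolding \<beta>_def gsum_def using sum.ub_add_nat[of 1 i \<gamma> k] sum.shift_bounds_cl_nat_ivl[of \<gamma> 1 i k] by (simp add: add.commute)
  have Ga: "(- q) ^ (2 * S0) * q powr (2 * (gsum \<gamma> 1 i + \<beta> k)) = q powr (2 * (a + \<beta> k))" for k
    using powr_2u[OF q, of "gsum \<gamma> 1 i + \<beta> k" S0] by (simp add: a_def S0_def add.assoc add.commute add.left_commute mult.commute)
  have Ga0: "(- q) ^ (2 * S0) * q powr (2 * gsum \<gamma> 1 i) = q powr (2 * a)" using Ga[of 0] by (simp add: \<beta>_def)
  have Qi: "(- q) powi (s + t) = (- q) powi s * (- q) powi t" for s t using q by (intro power_int_add) auto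
  have Gp: "(- q) powi (int (S0 + M) + int S0 - 1) * q powr (2 * (gsum \<gamma> 1 i + \<beta> k)) = q powr (2 * (a + \<beta> k)) / (- q) * (- q) ^ M" for k
  proof -
    have "int (S0 + M) + int S0 - 1 = (2 * int S0 - 1) + int M" by simp
    then have "(- q) powi (int (S0 + M) + int S0 - 1) = (- q) ^ (2 * S0) / (- q) * (- q) ^ M" using Qi[of "2 * int S0 - 1" "int M"] by (simp only: powi_Q power_int_of_nat)
    then show ?thesis unfolding Ga[symmetric] by simp
  qed
  have Gi: "(- q) powi (1 - int (S0 + M) - int S0) * q powr (- 2 * gsum \<gamma> 1 i) = (- q) powi (1 - int M) / q powr (2 * a)"
  proof -
    have "1 - int (S0 + M) - int S0 = (1 - int M) + - int (2 * S0)" by simp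
    then have "(- q) powi (1 - int (S0 + M) - int S0) = (- q) powi (1 - int M) / (- q) ^ (2 * S0)"
      using Qi[of "1 - int M" "- int (2 * S0)"] by (simp only: power_int_minus power_int_of_nat divide_inverse)
    then show ?thesis unfolding Ga0[symmetric] by (simp add: powr_minus divide_inverse)
  qed
  have ii: "i + k + 1 = i + Suc k" for k by simp
  have F: "(\<Prod>k=1..Suc r - 1. qpoch (- q) (- q) (j' (i + k - 1)) * (qpoch (q powr (2 * \<gamma> (i + k + 1))) (- q) (j' (i + k - 1)))
     * (qpoch (q powr (2 * gsum \<gamma> (i + 1) (i + k))) (- q) (psum j' (i + k - 2) + psum j' (i + k - 1) - 2 * S0)
        / qpoch (- (q powr (2 * gsum \<gamma> (i + 1) (i + k + 1) - 1))) (- q) (psum j' (i + k - 2) + psum j' (i + k - 1) - 2 * S0))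
     * ((1 + q powr (2 * gsum \<gamma> (i + 1) (i + k + 1) - 1))
       / (1 + q powr (2 * gsum \<gamma> (i + 1) (i + k + 1) - 1 - 2 * real S0 + 2 * real (psum j' (i + k - 1))))))
    = (\<Prod>k=1..r. Ff q (\<beta> k) (\<delta> (Suc k)) (K (k - 1)) (K k))"
    unfolding diff_Suc_1
  proof (rule prod.cong[OF refl])
    fix k assume "k \<in> {1..r}"
    then have k: "1 \<le> k" by simp
    have jk: "j' (i + k - 1) = K k - K (k - 1)" using k by (cases k) (simp_all add: K_def)
    have s: "S0 + K (k - 1) + (S0 + K k) - 2 * S0 = K (k - 1) + K k" by simp
    have p1: "q powr (2 * \<beta> (Suc k) - 1) = q powr (2 * \<beta> (Suc k)) / q" using q by (simp add: powr_diff)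
    have p2: "q powr (2 * \<beta> (Suc k) - 1 - 2 * real S0 + 2 * real (S0 + K k)) = q powr (2 * \<beta> (Suc k)) / q * (- q) ^ (2 * K k)"
    proof -
      have "2 * \<beta> (Suc k) - 1 - 2 * real S0 + 2 * real (S0 + K k) = 2 * (\<beta> (Suc k) + real (K k)) - 1" by simp
      then show ?thesis using q powr_2u[OF q, of "\<beta> (Suc k)" "K k"] by (simp only: powr_diff powr_one) simp
    qed
    have bs: "\<beta> k + \<delta> (Suc k) = \<beta> (Suc k)" by (simp add: \<beta>_def \<delta>_def)
    have n: "A / (- q) = - (A / q)" for A by simp
    have n1: "1 - - A * B = 1 + A * B" "1 - - A = 1 + A" for A B :: real by simp_all
    show "qpoch (- q) (- q) (j' (i + k - 1)) * (qpoch (q powr (2 * \<gamma> (i + k + 1))) (- q) (j' (i + k - 1)))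
     * (qpoch (q powr (2 * gsum \<gamma> (i + 1) (i + k))) (- q) (psum j' (i + k - 2) + psum j' (i + k - 1) - 2 * S0)
        / qpoch (- (q powr (2 * gsum \<gamma> (i + 1) (i + k + 1) - 1))) (- q) (psum j' (i + k - 2) + psum j' (i + k - 1) - 2 * S0))
     * ((1 + q powr (2 * gsum \<gamma> (i + 1) (i + k + 1) - 1))
       / (1 + q powr (2 * gsum \<gamma> (i + 1) (i + k + 1) - 1 - 2 * real S0 + 2 * real (psum j' (i + k - 1)))))
     = Ff q (\<beta> k) (\<delta> (Suc k)) (K (k - 1)) (K k)"
      unfolding Ff_def bs n n1 unfolding ii unfolding jk J J'[OF k] s g unfolding p1 p2 by (simp only: \<delta>_def)
  qed
  have ir: "i + Suc r - 1 = i + r" "i + Suc r - 2 = i + r - 1" by simp_all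
  have M: "S0 + M - S0 = M" "S0 + K r - S0 = K r" by simp_all
  have pw: "(q powr (- 2 * \<beta> r)) ^ M = q powr (- 2 * \<beta> r * real M)" using q by (simp add: powr_power mult.commute)
  have d: "q powr (2 * \<gamma> (i + m)) = q powr (2 * \<delta> m)" for m by (simp add: \<delta>_def)
  show ?thesis
    unfolding hnorm_def Let_def qpochs_def list.map prod_list.Cons prod_list.Nil J0 S0_def[symmetric] mult_1_right
    unfolding F unfolding ir unfolding S1 J M d unfolding g G pw Ga Ga0 Gp Gi by (simp only: mult_ac)
qed

text \<open>The prefactors of rho and h cancel except for what makes up the last \<open>Zf\<close>,
  once the moduli of the two factorials of varying sign are inserted. The clause for
  \<open>r = 0\<close>, where these two factorials are empty, serves the case in which the two bases
  of the theorem coincide.\<close>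

lemma rho_div_hnorm:
  fixes j j' :: "nat \<Rightarrow> nat" and \<gamma> :: "nat \<Rightarrow> real"
  assumes i: "1 \<le> i" and J0: "psum j' (i - 1) = psum j (i - 1)" and \<gamma>: "\<And>t. t \<in> {1..i + Suc r} \<Longrightarrow> 0 < \<gamma> t"
  defines "x \<equiv> \<lambda>k. psum j (i + k - 1) - psum j (i - 1)" and "K \<equiv> \<lambda>k. \<Sum>l=1..k. j' (i + l - 1)"
    and "a \<equiv> gsum \<gamma> 1 i + real (psum j (i - 1))" and "\<delta> \<equiv> \<lambda>t. \<gamma> (i + t)" and "\<beta> \<equiv> \<lambda>k. \<Sum>t=1..k. \<gamma> (i + t)"
  assumes le: "K r \<le> x (Suc r)"
  shows "rho q \<gamma> i (Suc r) j / \<bar>hnorm q \<gamma> i (Suc r) j j'\<bar> = Zf q a (\<beta> (Suc r)) (\<beta> r) (x (Suc r)) (K r) / Zf q a (\<beta> 1) 0 (x 1) 0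
     * (\<Prod>k=1..r. Ef q a (\<beta> k) (\<delta> (Suc k)) (\<delta> k) (x k) (x (Suc k)) / Ff q (\<beta> k) (\<delta> (Suc k)) (K (k - 1)) (K k))"
    and "0 < rho q \<gamma> i (Suc r) j" and "hnorm q \<gamma> i (Suc r) j j' \<noteq> 0" and "r = 0 \<Longrightarrow> 0 < hnorm q \<gamma> i (Suc r) j j'"
proof -
  define M where "M = x (Suc r)"
  have M': "psum j (i + r) - psum j (i - 1) = M" by (simp add: M_def x_def)
  have kM: "K r \<le> M" using le by (simp add: M_def)
  have g0: "0 < gsum \<gamma> 1 i" unfolding gsum_def by (rule sum_pos) (use i \<gamma> in auto)
  then have a: "0 < a" by (simp add: a_def)
  have \<delta>: "0 < \<delta> k" if "1 \<le> k" "k \<le> Suc r" for k using \<gamma> that by (simp add: \<delta>_def)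
  have \<beta>: "0 < \<beta> k" if "1 \<le> k" "k \<le> Suc r" for k unfolding \<beta>_def by (rule sum_pos) (use that \<gamma> in auto)
  have br: "0 \<le> \<beta> r" unfolding \<beta>_def by (rule sum_nonneg) (use \<gamma> in \<open>auto intro: less_imp_le\<close>)
  have b1: "0 < \<beta> (Suc r)" and d1: "0 < \<delta> (Suc r)" and ab: "0 < a + \<beta> r" and ab1: "0 < a + \<beta> (Suc r)"
    using \<beta>[of "Suc r"] \<delta>[of "Suc r"] a br by auto
  define Z0 where "Z0 = Zf q a (\<beta> 1) 0 (x 1) 0"
  define E where "E = (\<Prod>k=1..r. Ef q a (\<beta> k) (\<delta> (Suc k)) (\<delta> k) (x k) (x (Suc k)))"
  define F where "F = (\<Prod>k=1..r. Ff q (\<beta> k) (\<delta> (Suc k)) (K (k - 1)) (K k))"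
  have Z0: "0 < Z0" unfolding Z0_def by (rule Zf_pos[OF a \<beta>]) simp_all
  have E: "0 < E" unfolding E_def by (rule prod_pos) (use \<beta> \<delta> a in \<open>auto intro!: Ef_pos\<close>)
  have F: "0 < F" unfolding F_def by (rule prod_pos) (use \<beta> \<delta> in \<open>auto intro!: Ff_pos\<close>)
  define T where "T = (\<lambda>\<mu> m. qpoch (q powr (2 * \<mu>)) (- q) m)"
  define I where "I = (\<lambda>\<mu> m. qpoch (q powr (2 * \<mu>) / (- q)) (- q) m)"
  have T: "0 < T \<mu> m" if "0 < \<mu>" for \<mu> m unfolding T_def by (rule qpoch_pos0[OF q]) (use powr_bounds[OF q that] in auto)
  have I: "0 < I \<mu> m" if "0 < \<mu>" for \<mu> m unfolding I_def by (rule qpoch_pos_inv[OF q]) (use powr_bounds[OF q that] in auto)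
  define Qm where "Qm = (\<lambda>m. qpoch (- q) (- q) m)"
  have Qm: "0 < Qm m" for m unfolding Qm_def by (rule qpoch_Q_pos[OF q])
  define u where "u = qpoch ((- q) powi (1 - int M) / q powr (2 * a)) (- q) (K r)"
  define v where "v = qpoch ((- q) powi (- int M)) (- q) (K r)"
  define e1 where "e1 = 2 * a * real (K r) + real (K r) * (real M - 1) - real (K r) * (real (K r) - 1) / 2"
  define e2 where "e2 = real (K r) * real M - real (K r) * (real (K r) - 1) / 2"
  have u: "\<bar>u\<bar> = T a M / (T a (M - K r) * q powr e1)" "u \<noteq> 0"
    unfolding u_def T_def e1_def by (rule abs_qpoch_inv_a[OF q kM a])+
  have v: "\<bar>v\<bar> = Qm M / (Qm (M - K r) * q powr e2)" "v \<noteq> 0"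
    unfolding v_def Qm_def e2_def by (rule abs_qpoch_inv_N[OF q kM])+
  have t1: "qpoch (q powr (2 * \<beta> (Suc r)) * (- q) ^ M) (- q) (K r) = T (\<beta> (Suc r)) (M + K r) / T (\<beta> (Suc r)) M"
    unfolding T_def qpoch_add using T[OF b1, of M] by (simp add: T_def)
  have t2: "qpoch (q powr (2 * (a + \<beta> (Suc r))) / (- q) * (- q) ^ M) (- q) (K r) = I (a + \<beta> (Suc r)) (M + K r) / I (a + \<beta> (Suc r)) M"
    unfolding I_def qpoch_add using I[OF ab1, of M] by (simp add: I_def)
  have h: "hnorm q \<gamma> i (Suc r) j j' = T (a + \<beta> r) M * T (\<beta> (Suc r)) M / (T (\<delta> (Suc r)) M * T a M) * q powr (- 2 * \<beta> r * real M)
     * (T (\<beta> (Suc r)) (M + K r) / T (\<beta> (Suc r)) M * (I (a + \<beta> (Suc r)) (M + K r) / I (a + \<beta> (Suc r)) M) * u * v) * F"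
    unfolding t1[symmetric] t2[symmetric] unfolding u_def v_def F_def T_def unfolding M'[symmetric] K_def a_def \<beta>_def \<delta>_def by (rule hnorm_closed[OF i J0])
  have rh: "rho q \<gamma> i (Suc r) j = Qm M * T (a + \<beta> r) M / (T (\<delta> (Suc r)) M * I (a + \<beta> (Suc r)) M) / Z0 * E"
    unfolding Z0_def E_def T_def I_def Qm_def M_def unfolding x_def a_def \<beta>_def \<delta>_def by (rule rho_closed[OF i])
  show "0 < rho q \<gamma> i (Suc r) j" unfolding rh by (intro mult_pos_pos divide_pos_pos Qm T I Z0 E ab ab1 d1)
  define P where "P = T (a + \<beta> r) M * T (\<beta> (Suc r)) M / (T (\<delta> (Suc r)) M * T a M) * q powr (- 2 * \<beta> r * real M)
     * (T (\<beta> (Suc r)) (M + K r) / T (\<beta> (Suc r)) M * (I (a + \<beta> (Suc r)) (M + K r) / I (a + \<beta> (Suc r)) M)) * F"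
  have P: "0 < P" unfolding P_def using q by (intro mult_pos_pos divide_pos_pos T I F a ab ab1 b1 d1) simp
  have hP: "hnorm q \<gamma> i (Suc r) j j' = P * (u * v)" unfolding h P_def by (simp only: mult_ac)
  show "hnorm q \<gamma> i (Suc r) j j' \<noteq> 0" unfolding hP using P u v by simp
  show "0 < hnorm q \<gamma> i (Suc r) j j'" if "r = 0"
  proof -
    have "K r = 0" using that by (simp add: K_def)
    then show ?thesis unfolding hP u_def v_def using P by (simp add: qpoch_def)
  qed
  have ez: "2 * \<beta> r * real M + 2 * a * real (K r) + 2 * real (K r) * real M - real (K r) * real (K r) = e1 + e2 - (- 2 * \<beta> r * real M)"
    unfolding e1_def e2_def by (simp add: field_simps)
  have Zr: "Zf q a (\<beta> (Suc r)) (\<beta> r) M (K r) = Qm (M - K r) * T a (M - K r) * (q powr e1 * q powr e2 / q powr (- 2 * \<beta> r * real M))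
     / (I (a + \<beta> (Suc r)) (M + K r) * T (\<beta> (Suc r)) (M + K r))"
    unfolding Zf_def ez powr_diff powr_add T_def I_def Qm_def ..
  have ha: "\<bar>hnorm q \<gamma> i (Suc r) j j'\<bar> = P * (T a M / (T a (M - K r) * q powr e1) * (Qm M / (Qm (M - K r) * q powr e2)))"
    unfolding hP abs_mult u v using P by simp
  have nz: "T (a + \<beta> r) m \<noteq> 0" "T (\<beta> (Suc r)) m \<noteq> 0" "T (\<delta> (Suc r)) m \<noteq> 0" "T a m \<noteq> 0" "I (a + \<beta> (Suc r)) m \<noteq> 0" "Qm m \<noteq> 0" "F \<noteq> 0" for m
    using T[OF ab, of m] T[OF b1, of m] T[OF d1, of m] T[OF a, of m] I[OF ab1, of m] Qm[of m] F by simp_all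
  have pz: "q powr e \<noteq> 0" for e using q by simp
  define y1 y2 y3 where "y1 = q powr e1" and "y2 = q powr e2" and "y3 = q powr (- 2 * \<beta> r * real M)"
  have y: "y1 \<noteq> 0" "y2 \<noteq> 0" "y3 \<noteq> 0" unfolding y1_def y2_def y3_def by (rule pz)+
  have "rho q \<gamma> i (Suc r) j / \<bar>hnorm q \<gamma> i (Suc r) j j'\<bar> = Zf q a (\<beta> (Suc r)) (\<beta> r) M (K r) / Z0 * (E / F)"
    unfolding rh ha Zr P_def y1_def[symmetric] y2_def[symmetric] y3_def[symmetric] using nz y Z0 by (simp add: divide_simps)
  then show "rho q \<gamma> i (Suc r) j / \<bar>hnorm q \<gamma> i (Suc r) j j'\<bar> = Zf q a (\<beta> (Suc r)) (\<beta> r) (x (Suc r)) (K r) / Zf q a (\<beta> 1) 0 (x 1) 0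
     * (\<Prod>k=1..r. Ef q a (\<beta> k) (\<delta> (Suc k)) (\<delta> k) (x k) (x (Suc k)) / Ff q (\<beta> k) (\<delta> (Suc k)) (K (k - 1)) (K k))"
    unfolding Z0_def E_def F_def M_def prod_dividef .
qed

end

section \<open>Univariate and multivariate Racah polynomials at base -q\<close>

context
  fixes q :: real assumes q: "0 < q" "q < 1"
begin

text \<open>For these parameters Q^N / c = - q^(1 - 2a - 2b) is negative, so its principal power
  with exponent n/2 is a positive square root times i^n.\<close>

lemma racah_uni_eq:
  assumes g: "0 < a" "0 < b" "y \<le> N"
  defines "G \<equiv> \<lambda>\<mu>. q powr (2 * \<mu>)"
  shows "racah_uni n (int y) (G b / (- q)) (G c / (- q)) ((- q) ^ N / (- q) * (G a * G b)) (int N) (- q) =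
    complex_of_real (racah_poly (- q) (G a) (G b) (G c) n y N * sqrt (q powr ((1 - 2 * a - 2 * b) * real n))) * \<i> ^ n"
proof -
  define Q where "Q = - q"
  have Q: "Q \<noteq> 0" using q by (simp add: Q_def)
  have G: "0 < G \<mu>" for \<mu> using q by (simp add: G_def)
  have e1: "G b / Q * Q = G b" using Q by simp
  have e2: "(G c / Q) * (Q ^ N / Q * (G a * G b)) * Q = Q ^ N / Q * (G a * G b * G c)" using Q by simp
  have e3: "G b / Q * (G c / Q) * Q ^ (n + 1) = Q ^ n / Q * (G b * G c)" using Q by simp
  have e4: "Q ^ N / Q * (G a * G b) * Q powi (int y - int N) = Q ^ y / Q * (G a * G b)"
    using Q by (simp add: power_int_diff)
  have "qpoch (Q powi - int y) Q t = 0" if "t \<notin> {..y}" for t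
  proof -
    have "Q powi (- int y) * Q ^ y = 1" using Q by (simp add: power_int_minus)
    then show ?thesis unfolding qpoch_def using that by (intro prod_zero) auto
  qed
  note z = this
  have S: "suminf (\<lambda>t. qpochs [Q powi (- int n), G b / Q * (G c / Q) * Q ^ (n + 1), Q powi (- int y), Q ^ N / Q * (G a * G b) * Q powi (int y - int N)] Q t
      / qpochs [G b / Q * Q, G c / Q * (Q ^ N / Q * (G a * G b)) * Q, Q powi (- int N), Q] Q t * Q ^ t) =
    (\<Sum>k\<le>y. qpoch (Q powi (- int y)) Q k * qpoch (Q ^ y / Q * (G a * G b)) Q k * qpoch (Q powi (- int n)) Q k
       * qpoch (Q ^ n / Q * (G b * G c)) Q k * Q ^ k
      / (qpoch Q Q k * qpoch (Q powi (- int N)) Q k * qpoch (G b) Q k * qpoch (Q ^ N / Q * (G a * G b * G c)) Q k))"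
    unfolding e1 e2 e3 e4
    by (subst suminf_finite[of "{..y}"]) (auto simp: z qpochs_def mult_ac intro!: sum.cong)
  have pr: "qpochs [G b / Q * Q, G c / Q * (Q ^ N / Q * (G a * G b)) * Q, Q powi (- int N)] Q n =
     qpoch (G b) Q n * qpoch (Q ^ N / Q * (G a * G b * G c)) Q n * qpoch (Q powi (- int N)) Q n"
    unfolding e1 e2 by (simp add: qpochs_def)
  define z where "z = q powr (1 - 2 * a - 2 * b)"
  have z0: "0 < z" using q by (simp add: z_def)
  have zz: "Q powi int N / (Q ^ N / Q * (G a * G b)) = - z"
  proof -
    have "z * (G a * G b) = q" unfolding z_def G_def powr_add[symmetric] using q by simp
    then have "z = q / (G a * G b)" using G[of a] G[of b] by (simp add: field_simps)
    moreover have "Q powi int N / (Q ^ N / Q * (G a * G b)) = Q / (G a * G b)" using Q by simp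
    ultimately show ?thesis by (simp add: Q_def)
  qed
  have pw: "complex_of_real (- z) powr (of_nat n / 2) = complex_of_real (sqrt (q powr ((1 - 2 * a - 2 * b) * real n))) * \<i> ^ n"
  proof -
    have L: "Ln (complex_of_real (- z)) = complex_of_real (ln z) + \<i> * pi"
      using z0 by (subst Ln_of_real') (auto simp: Ln_of_real)
    have ei: "exp (\<i> * complex_of_real (pi / 2)) = \<i>" by (simp only: cis_conv_exp[symmetric] cis_pi_half)
    have "complex_of_real (- z) powr (of_nat n / 2) = exp (complex_of_real (real n / 2 * ln z)) * exp (of_nat n * (\<i> * complex_of_real (pi / 2)))"
      unfolding powr_def L using z0 by (simp add: exp_add[symmetric] algebra_simps)
    also have "exp (of_nat n * (\<i> * complex_of_real (pi / 2))) = \<i> ^ n" unfolding exp_of_nat_mult ei ..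
    also have "exp (complex_of_real (real n / 2 * ln z)) = complex_of_real (exp (real n / 2 * ln z))" by (rule exp_of_real)
    also have "exp (real n / 2 * ln z) = sqrt (q powr ((1 - 2 * a - 2 * b) * real n))"
      using q by (simp add: z_def powr_def ln_powr flip: powr_half_sqrt)
    finally show ?thesis .
  qed
  show ?thesis unfolding racah_uni_def Q_def[symmetric] pr S zz pw by (simp add: racah_poly_def mult_ac)
qed

lemma racah_uni_zero:
  assumes "N < n"
  shows "racah_uni n y a b c (int N) (- q) = 0"
proof -
  have "(- q) powi (- int N) * (- q) ^ N = 1" using q by (simp add: power_int_minus)
  then have "qpoch ((- q) powi (- int N)) (- q) n = 0" unfolding qpoch_def using assms by (intro prod_zero) auto
  then show ?thesis by (simp add: racah_uni_def qpochs_def)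
qed

text \<open>In the k-th factor the parameters are those of the k-th recoupling: b A_k / a_1 times
  Q^(2 N_(k-1)) is q^(2 (\<beta> k + K (k - 1))) / Q, with the weight of the block of k modules
  already coupled, and a_(k+1) carries the weight of the next module. Outside the admissible range a
  factor vanishes by itself, in agreement with the guard in \<open>racah_factor\<close>.\<close>

lemma racah_multi_eq:
  fixes j j' :: "nat \<Rightarrow> nat" and i r :: nat and \<gamma> :: "nat \<Rightarrow> real"
  assumes i: "1 \<le> i" and \<gamma>: "\<And>t. t \<in> {1..i + Suc r} \<Longrightarrow> 0 < \<gamma> t"
  defines "S0 \<equiv> psum j (i - 1)" and "x \<equiv> \<lambda>k. psum j (i + k - 1) - psum j (i - 1)" and "K \<equiv> \<lambda>k. \<Sum>l=1..k. j' (i + l - 1)"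
    and "a \<equiv> gsum \<gamma> 1 i + real (psum j (i - 1))" and "\<delta> \<equiv> \<lambda>t. \<gamma> (i + t)" and "\<beta> \<equiv> \<lambda>k. \<Sum>t=1..k. \<gamma> (i + t)"
  defines "A \<equiv> \<lambda>k. if k = 1 then (- q) powi (2 * int S0 - 1) * q powr (2 * gsum \<gamma> 1 (i + 1)) else q powr (2 * \<gamma> (i + k))"
  shows "racah_multi r (\<lambda>k. j' (i + k - 1)) (\<lambda>k. int (psum j (i + k - 1)) - int S0) A (- (q powr (2 * \<gamma> (i + 1) - 1)))
      (int (psum j (i + r)) - int S0) (- q) =
    (if \<forall>k<r. K (Suc k) \<le> x (Suc (Suc k)) then
      \<Prod>k=1..r. complex_of_real (racah_poly (- q) (q powr (2 * a)) (q powr (2 * (\<beta> k + real (K (k - 1))))) (q powr (2 * \<delta> (Suc k)))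
          (K k - K (k - 1)) (x k - K (k - 1)) (x (Suc k) - K (k - 1))
         * sqrt (q powr ((1 - 2 * real (K (k - 1)) - 2 * a - 2 * \<beta> k) * real (K k - K (k - 1))))) * \<i> ^ (K k - K (k - 1))
     else 0)"
proof -
  define x' where "x' = (\<lambda>k. int (psum j (i + k - 1)) - int S0)(r + 1 := int (psum j (i + r)) - int S0)"
  define AA where "AA = (\<lambda>k. \<Prod>l=1..k. A l)"
  define U where "U = (\<lambda>k. racah_uni (j' (i + k - 1)) (x' k - int (K (k - 1)))
            (- (q powr (2 * \<gamma> (i + 1) - 1)) * AA k / A 1 * (- q) ^ (2 * K (k - 1)))
            (A (k + 1) / (- q))
            (AA k * (- q) powi (x' (k + 1) + int (K (k - 1))))
            (x' (k + 1) - int (K (k - 1)))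
            (- q))"
  have R: "racah_multi r (\<lambda>k. j' (i + k - 1)) (\<lambda>k. int (psum j (i + k - 1)) - int S0) A (- (q powr (2 * \<gamma> (i + 1) - 1)))
      (int (psum j (i + r)) - int S0) (- q) = (\<Prod>k=1..r. U k)"
    unfolding racah_multi_def Let_def U_def x'_def AA_def K_def ..
  have mono: "S0 \<le> psum j (i + k - 1)" "psum j (i + k - 1) \<le> psum j (i + Suc k - 1)" for k
    unfolding psum_def S0_def by (rule sum_mono2; auto)+
  have x': "x' k = int (x k)" for k
    using mono(1)[of k] mono(1)[of "Suc r"] by (auto simp: x'_def x_def S0_def of_nat_diff)
  have xm: "x k \<le> x (Suc k)" for k unfolding x_def by (rule diff_le_mono) (rule mono)
  have nk: "j' (i + k - 1) = K k - K (k - 1)" if "1 \<le> k" for k using that by (cases k) (simp_all add: K_def)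
  have g0: "0 < gsum \<gamma> 1 i" unfolding gsum_def by (rule sum_pos) (use i \<gamma> in auto)
  then have a: "0 < a" by (simp add: a_def)
  have \<beta>: "0 < \<beta> k" if "1 \<le> k" "k \<le> Suc r" for k unfolding \<beta>_def by (rule sum_pos) (use that \<gamma> in auto)
  have A1: "A 1 = q powr (2 * (a + \<beta> 1)) / (- q)"
  proof -
    have "gsum \<gamma> 1 (i + 1) = gsum \<gamma> 1 i + \<beta> 1" by (simp add: gsum_def \<beta>_def)
    then have "q powr (2 * (a + \<beta> 1)) = q powr (2 * gsum \<gamma> 1 (i + 1)) * (- q) ^ (2 * S0)"
      using powr_2u[OF q, of "gsum \<gamma> 1 (i + 1)" S0] by (simp add: a_def S0_def algebra_simps)
    then show ?thesis unfolding A_def powi_Q[OF q] by simp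
  qed
  have AA: "AA (Suc k) = q powr (2 * (a + \<beta> (Suc k))) / (- q)" for k
  proof (induction k)
    case 0 show ?case using A1 by (simp add: AA_def)
  next
    case (Suc k)
    have "AA (Suc (Suc k)) = AA (Suc k) * q powr (2 * \<delta> (Suc (Suc k)))" by (simp add: AA_def A_def \<delta>_def)
    also have "\<dots> = q powr (2 * (a + \<beta> (Suc k))) * q powr (2 * \<delta> (Suc (Suc k))) / (- q)" unfolding Suc by simp
    also have "q powr (2 * (a + \<beta> (Suc k))) * q powr (2 * \<delta> (Suc (Suc k))) = q powr (2 * (a + \<beta> (Suc (Suc k))))"
      unfolding powr_add[symmetric] by (simp add: \<beta>_def \<delta>_def algebra_simps)
    finally show ?case .
  qed
  have b1: "- (q powr (2 * \<gamma> (i + 1) - 1)) = q powr (2 * \<beta> 1) / (- q)" using q by (simp add: powr_diff \<beta>_def)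
  have U: "U k = complex_of_real (racah_poly (- q) (q powr (2 * a)) (q powr (2 * (\<beta> k + real (K (k - 1))))) (q powr (2 * \<delta> (Suc k)))
          (K k - K (k - 1)) (x k - K (k - 1)) (x (Suc k) - K (k - 1))
         * sqrt (q powr ((1 - 2 * real (K (k - 1)) - 2 * a - 2 * \<beta> k) * real (K k - K (k - 1))))) * \<i> ^ (K k - K (k - 1))"
    if k: "1 \<le> k" "k \<le> r" and le: "K (k - 1) \<le> x k" for k
  proof -
    define L where "L = K (k - 1)"
    have lx: "L \<le> x (Suc k)" using le xm[of k] by (simp add: L_def)
    have y: "x' k - int L = int (x k - L)" "x' (k + 1) - int L = int (x (Suc k) - L)"
      using le lx by (simp_all add: x' L_def of_nat_diff)
    have bp: "0 < \<beta> k + real L" using \<beta>[of k] k by simp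
    obtain k' where k': "k = Suc k'" using k by (cases k) auto
    have p1: "- (q powr (2 * \<gamma> (i + 1) - 1)) * AA k / A 1 * (- q) ^ (2 * L) = q powr (2 * (\<beta> k + real L)) / (- q)"
    proof -
      have "q powr (2 * \<beta> 1) * q powr (2 * (a + \<beta> k)) = q powr (2 * \<beta> k) * q powr (2 * (a + \<beta> 1))"
        unfolding powr_add[symmetric] by (simp add: algebra_simps)
      then have "q powr (2 * \<beta> 1) * q powr (2 * (a + \<beta> k)) / q powr (2 * (a + \<beta> 1)) = q powr (2 * \<beta> k)" using q by simp
      moreover have "- (q powr (2 * \<gamma> (i + 1) - 1)) * AA k / A 1 = q powr (2 * \<beta> 1) * q powr (2 * (a + \<beta> k)) / q powr (2 * (a + \<beta> 1)) / (- q)"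
        unfolding b1 A1 k' AA using q by simp
      ultimately show ?thesis unfolding powr_2u[OF q] by simp
    qed
    have p2: "A (k + 1) / (- q) = q powr (2 * \<delta> (Suc k)) / (- q)" using k by (simp add: A_def \<delta>_def)
    have p3: "AA k * (- q) powi (x' (k + 1) + int L) = (- q) ^ (x (Suc k) - L) / (- q) * (q powr (2 * a) * q powr (2 * (\<beta> k + real L)))"
    proof -
      have "x' (k + 1) + int L = int ((x (Suc k) - L) + 2 * L)" using lx by (simp add: x')
      then have "(- q) powi (x' (k + 1) + int L) = (- q) ^ (x (Suc k) - L) * (- q) ^ (2 * L)" by (simp only: power_int_of_nat power_add)
      moreover have "q powr (2 * (a + \<beta> k)) = q powr (2 * a) * q powr (2 * \<beta> k)" unfolding powr_add[symmetric] by (simp add: distrib_left)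
      ultimately show ?thesis unfolding k' AA powr_2u[OF q] unfolding k'[symmetric] by simp
    qed
    have ex: "(1 - 2 * a - 2 * (\<beta> k + real L)) = (1 - 2 * real L - 2 * a - 2 * \<beta> k)" by simp
    show ?thesis unfolding U_def L_def[symmetric] y p1 p2 p3 nk[OF k(1)]
      using racah_uni_eq[OF a bp, of "x k - L" "x (Suc k) - L" "K k - L" "\<delta> (Suc k)"] xm[of k] unfolding ex by simp
  qed
  show ?thesis
  proof (cases "\<forall>k<r. K (Suc k) \<le> x (Suc (Suc k))")
    case True
    have "(\<Prod>k=1..r. U k) = (\<Prod>k=1..r. complex_of_real (racah_poly (- q) (q powr (2 * a)) (q powr (2 * (\<beta> k + real (K (k - 1))))) (q powr (2 * \<delta> (Suc k)))
          (K k - K (k - 1)) (x k - K (k - 1)) (x (Suc k) - K (k - 1))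
         * sqrt (q powr ((1 - 2 * real (K (k - 1)) - 2 * a - 2 * \<beta> k) * real (K k - K (k - 1))))) * \<i> ^ (K k - K (k - 1)))"
    proof (rule prod.cong[OF refl])
      fix k assume k: "k \<in> {1..r}"
      have "K (k - 1) \<le> x k"
      proof (cases "k = 1")
        case False
        then obtain l where "k = Suc (Suc l)" using k by (cases k; cases "k - 1") auto
        then show ?thesis using True[rule_format, of l] k by simp
      qed (simp add: K_def)
      then show "U k = complex_of_real (racah_poly (- q) (q powr (2 * a)) (q powr (2 * (\<beta> k + real (K (k - 1))))) (q powr (2 * \<delta> (Suc k)))
          (K k - K (k - 1)) (x k - K (k - 1)) (x (Suc k) - K (k - 1))
         * sqrt (q powr ((1 - 2 * real (K (k - 1)) - 2 * a - 2 * \<beta> k) * real (K k - K (k - 1))))) * \<i> ^ (K k - K (k - 1))"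
        by (intro U) (use k in auto)
    qed
    then show ?thesis unfolding R if_P[OF True] .
  next
    case False
    \<comment> \<open>The least violation: the inequality before it holds, so the factor at
      \<open>Suc k\<close> has a nonnegative argument N with N < n, as \<open>racah_uni_zero\<close>
      requires.\<close>
    define k where "k = (LEAST k. k < r \<and> \<not> K (Suc k) \<le> x (Suc (Suc k)))"
    have k: "k < r" "x (Suc (Suc k)) < K (Suc k)" using LeastI_ex[of "\<lambda>k. k < r \<and> \<not> K (Suc k) \<le> x (Suc (Suc k))"] False
      by (auto simp: k_def)
    have le: "K k \<le> x (Suc k)"
    proof (cases k)
      case 0 then show ?thesis by (simp add: K_def)
    next
      case (Suc l)
      have "\<not> (l < r \<and> \<not> K (Suc l) \<le> x (Suc (Suc l)))" by (rule not_less_Least) (use Suc in \<open>simp add: k_def\<close>)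
      then show ?thesis using k Suc by simp
    qed
    then have le': "K k \<le> x (Suc (Suc k))" using xm[of "Suc k"] by simp
    have N: "x' (Suc k + 1) - int (K (Suc k - 1)) = int (x (Suc (Suc k)) - K k)" using le' by (simp add: x' of_nat_diff)
    have "U (Suc k) = 0" unfolding U_def N by (rule racah_uni_zero) (use nk[of "Suc k"] k le' in simp)
    then have "(\<Prod>k=1..r. U k) = 0" using k by (intro prod_zero) (auto intro!: bexI[of _ "Suc k"])
    then show ?thesis unfolding R if_not_P[OF False] .
  qed
qed

end

lemma braket_vscale: "braket (vscale a v) (vscale b w) = cnj a * b * braket v w"
proof -
  have "braket (vscale a v) (vscale b w) = (\<Sum>x\<in>Poly_Mapping.keys v. cnj a * b * (cnj (Poly_Mapping.lookup v x) * Poly_Mapping.lookup w x))"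
    unfolding braket_def lookup_vscale complex_cnj_mult
    by (rule sum.mono_neutral_cong_left) (auto simp: in_keys_iff)
  then show ?thesis by (simp add: braket_def sum_distrib_left)
qed

lemma vscale_vscale: "vscale a (vscale b v) = vscale (a * b) v"
  by (rule poly_mapping_eqI) simp

lemma abs_sgT: "\<bar>sgT s\<bar> = 1"
  using sgT_square[of s] by (metis abs_mult_self_eq abs_one real_sqrt_abs2 real_sqrt_one)

lemma prod_sqrt: "(\<Prod>k\<in>A. sqrt (f k)) = sqrt (\<Prod>k\<in>A. f k)"
  by (induction A rule: infinite_finite_induct) (simp_all add: real_sqrt_mult)

text \<open>Once the partial sums agree, the sign of \<open>hnorm\<close> is a function of the
  second tuple alone, so it can go into that tuple's phase.\<close>

lemma hnorm_psum_cong: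
  "psum j (i - 1) = psum j' (i - 1) \<Longrightarrow> psum j (i + r - 1) = psum j' (i + r - 1) \<Longrightarrow> hnorm q \<gamma> i r j j' = hnorm q \<gamma> i r j' j'"
  unfolding hnorm_def Let_def by (simp only:)

text \<open>The phases absorbed by the normalization constants of the two bases.\<close>

definition phase_source :: "nat \<Rightarrow> nat \<Rightarrow> (nat \<Rightarrow> nat) \<Rightarrow> real" where
  "phase_source i r j = (let x = \<lambda>k. psum j (i + k - 1) - psum j (i - 1) in \<Prod>k=1..r. (- 1) ^ (x (Suc k) * x k + x k))"

definition phase_target :: "real \<Rightarrow> (nat \<Rightarrow> real) \<Rightarrow> nat \<Rightarrow> nat \<Rightarrow> (nat \<Rightarrow> nat) \<Rightarrow> complex" where
  "phase_target q \<gamma> i r j = (let K = \<lambda>k. \<Sum>l=1..k. j (i + l - 1) in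
     (if 0 < hnorm q \<gamma> i (Suc r) j j then 1 else \<i>) * \<i> ^ K r
     * complex_of_real ((\<Prod>k=1..r. (- 1) ^ (K (k - 1) * K k + K (k - 1)) * sgT (K k - K (k - 1)))
       * (- 1) ^ ((psum j (i + r) - psum j (i - 1)) * K r)))"

lemma abs_phase_source: "\<bar>phase_source i r j\<bar> = 1"
  by (simp add: phase_source_def Let_def abs_prod power_abs)

lemma norm_phase_target: "norm (phase_target q \<gamma> i r j) = 1"
  unfolding phase_target_def Let_def norm_mult norm_power norm_of_real abs_mult abs_prod abs_sgT power_abs by simp

section \<open>Phases, normalization and the final overlap\<close>

context
  fixes q :: real assumes q: "0 < q" "q < 1"
begin

lemma nov_tree_closed:
  fixes j j' :: "nat \<Rightarrow> nat"
  assumes i: "1 \<le> i" and \<gamma>: "\<And>t. t \<in> {1..i + Suc r + m} \<Longrightarrow> 0 < \<gamma> t"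
  defines "x \<equiv> \<lambda>k. psum j (i + k - 1) - psum j (i - 1)" and "K \<equiv> \<lambda>k. \<Sum>l=1..k. j' (i + l - 1)"
  shows "nov (tree q \<gamma> i (Suc r) j' m) (tree q \<gamma> 1 1 j (i + Suc r + m - 2)) =
    (if (\<forall>l\<in>{i + Suc r..i + Suc r + m - 1}. j' l = j l) \<and> (\<forall>l\<in>{1..i - 1}. j' l = j l) \<and> j' (i + r) + K r = x (Suc r)
     then \<Prod>k=1..r. racah_factor q \<gamma> i (psum j (i - 1)) x K k else 0)"
proof -
  obtain i' where i': "i = Suc i'" using i by (cases i) auto
  have t: "tree q \<gamma> 1 1 j (i + Suc r + m - 2) = left_comb q \<gamma> j (i + Suc r + m)"
  proof -
    have "i + Suc r + m - 2 + 2 = i + Suc r + m" by (simp add: i')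
    then show ?thesis unfolding tree_11[OF q] by (simp only:)
  qed
  have g: "0 < \<gamma> t" if "t \<in> {1..Suc i' + Suc r}" for t using \<gamma> that by (simp add: i')
  have n1: "nov (tree q \<gamma> i (Suc r) j' m) (left_comb q \<gamma> j (i + Suc r + m)) =
    (if \<forall>l\<in>{i + Suc r..<i + Suc r + m}. j' l = j l then nov (tree q \<gamma> i (Suc r) j' 0) (left_comb q \<gamma> j (i + Suc r)) else 0)"
    by (rule nov_tree[OF q _ _ \<gamma>]) (use i in simp_all)
  have n2: "nov (tree q \<gamma> i (Suc r) j' 0) (left_comb q \<gamma> j (i + Suc r)) =
    (if (\<forall>l\<in>{1..i - 1}. j' l = j l) \<and> j' (i + r) + K r = x (Suc r) then \<Prod>k=1..r. racah_factor q \<gamma> i (psum j (i - 1)) x K k else 0)"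
  proof -
    have x': "x = (\<lambda>k. psum j (i' + k) - psum j i')" by (simp add: x_def i')
    have K': "K = (\<lambda>k. \<Sum>l=1..k. j' (i' + l))" by (simp add: K_def i')
    have e: "Suc i' - 1 = i'" "Suc i' + Suc r - 1 = Suc i' + r" by simp_all
    show ?thesis unfolding x' K' i' tree.simps(1) e
      by (rule nov_recoupled[where j' = j' and j = j and s = "j' (Suc i' + r)" and \<gamma> = \<gamma>, OF q g])
  qed
  have s: "{i + Suc r..<i + Suc r + m} = {i + Suc r..i + Suc r + m - 1}" by auto
  show ?thesis unfolding t n1 n2 s by simp
qed

text \<open>The square root contributes a factor i when \<open>hnorm\<close> is negative, the
  polynomials contribute i^(K r), and \<open>sign_separation\<close> splits the sign of the product
  of coefficients. The real signs square to 1 and can be moved to the other side, where they form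
  the two phases.\<close>

lemma racah_overlap:
  fixes j j' :: "nat \<Rightarrow> nat" and i r :: nat and \<gamma> :: "nat \<Rightarrow> real"
  assumes i: "1 \<le> i" and \<gamma>: "\<And>t. t \<in> {1..i + Suc r} \<Longrightarrow> 0 < \<gamma> t"
    and S: "psum j (i - 1) = psum j' (i - 1)" "psum j (i + r) = psum j' (i + r)"
  defines "S0 \<equiv> psum j (i - 1)" and "x \<equiv> \<lambda>k. psum j (i + k - 1) - psum j (i - 1)" and "K \<equiv> \<lambda>k. \<Sum>l=1..k. j' (i + l - 1)"
  defines "A \<equiv> \<lambda>k. if k = 1 then (- q) powi (2 * int S0 - 1) * q powr (2 * gsum \<gamma> 1 (i + 1)) else q powr (2 * \<gamma> (i + k))"
  shows "csqrt (complex_of_real (rho q \<gamma> i (Suc r) j / hnorm q \<gamma> i (Suc r) j j'))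
     * racah_multi r (\<lambda>k. j' (i + k - 1)) (\<lambda>k. int (psum j (i + k - 1)) - int S0) A (- (q powr (2 * \<gamma> (i + 1) - 1)))
      (int (psum j (i + r)) - int S0) (- q) =
     phase_target q \<gamma> i r j' * complex_of_real (phase_source i r j * (\<Prod>k=1..r. racah_factor q \<gamma> i S0 x K k))"
proof -
  define a where "a = gsum \<gamma> 1 i + real (psum j (i - 1))"
  define \<delta> where "\<delta> = (\<lambda>t. \<gamma> (i + t))"
  define \<beta> where "\<beta> = (\<lambda>k. \<Sum>t=1..k. \<delta> t)"
  define R where "R = (\<lambda>k. racah_poly (- q) (q powr (2 * a)) (q powr (2 * (\<beta> k + real (K (k - 1))))) (q powr (2 * \<delta> (Suc k)))
          (K k - K (k - 1)) (x k - K (k - 1)) (x (Suc k) - K (k - 1)))"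
  define z where "z = (\<lambda>k. q powr ((1 - 2 * real (K (k - 1)) - 2 * a - 2 * \<beta> k) * real (K k - K (k - 1))))"
  have rm: "racah_multi r (\<lambda>k. j' (i + k - 1)) (\<lambda>k. int (psum j (i + k - 1)) - int S0) A (- (q powr (2 * \<gamma> (i + 1) - 1)))
      (int (psum j (i + r)) - int S0) (- q) = (if \<forall>k<r. K (Suc k) \<le> x (Suc (Suc k)) then
      \<Prod>k=1..r. complex_of_real (R k * sqrt (z k)) * \<i> ^ (K k - K (k - 1)) else 0)"
    unfolding R_def z_def S0_def A_def x_def K_def a_def \<beta>_def \<delta>_def by (rule racah_multi_eq[where \<gamma> = \<gamma>, OF q i \<gamma>])
  have mono: "psum j (i + k - 1) \<le> psum j (i + Suc k - 1)" for k unfolding psum_def by (rule sum_mono2) auto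
  have xm: "x k \<le> x (Suc k)" for k unfolding x_def by (rule diff_le_mono) (rule mono)
  have Km: "K k \<le> K (Suc k)" for k by (simp add: K_def)
  have K0: "K 0 = 0" by (simp add: K_def)
  show ?thesis
  proof (cases "\<forall>k<r. K (Suc k) \<le> x (Suc (Suc k))")
    case False
    then obtain k where k: "k < r" "\<not> K (Suc k) \<le> x (Suc (Suc k))" by blast
    then have "racah_factor q \<gamma> i S0 x K (Suc k) = 0" by (simp add: racah_factor_def)
    then have "(\<Prod>k=1..r. racah_factor q \<gamma> i S0 x K k) = 0" using k(1) by (intro prod_zero) (auto intro!: bexI[of _ "Suc k"])
    then show ?thesis unfolding rm if_not_P[OF False] by simp
  next
    case True
    have le: "K k \<le> x (Suc k)" if "k \<le> r" for k using True that by (cases k) (auto simp: K0)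
    have \<delta>: "0 < \<delta> t" if "t \<in> {1..Suc r}" for t using \<gamma> that by (simp add: \<delta>_def)
    have g0: "0 < gsum \<gamma> 1 i" unfolding gsum_def by (rule sum_pos) (use i \<gamma> in auto)
    then have a: "0 < a" by (simp add: a_def)
    define W where "W = (\<lambda>k. racah_weight q a (\<beta> k + real (K (k - 1))) (\<delta> (Suc k)) (K k - K (k - 1)) (x k - K (k - 1)) (x (Suc k) - K (k - 1)))"
    define sg where "sg = (\<lambda>k. (- 1) ^ ((x (Suc k) - K (k - 1)) * (x k - K (k - 1)) + (x k - K (k - 1)) + (x (Suc k) - K (k - 1)) * (K k - K (k - 1)))
        * sgT (K k - K (k - 1)))"
    have g: "gsum \<gamma> (i + 1) (i + k) = \<beta> k" for k
      unfolding \<beta>_def \<delta>_def gsum_def using sum.shift_bounds_cl_nat_ivl[of \<gamma> 1 i k] by (simp add: add.commute)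
    have uf: "racah_factor q \<gamma> i S0 x K k = sg k * sqrt (W k) * R k" if "k \<in> {1..r}" for k
    proof -
      have "K (k - 1) \<le> x k \<and> K k \<le> x (Suc k)" using le[of k] le[of "k - 1"] that by (cases k) simp_all
      moreover have "\<gamma> (i + k + 1) = \<delta> (Suc k)" by (simp add: \<delta>_def)
      ultimately show ?thesis unfolding racah_factor_def Let_def g by (simp add: W_def R_def sg_def a_def S0_def)
    qed
    have le': "K r \<le> x (Suc r)" using le by simp
    define \<rho> where "\<rho> = rho q \<gamma> i (Suc r) j / \<bar>hnorm q \<gamma> i (Suc r) j j'\<bar>"
    note rh = rho_div_hnorm[where \<gamma> = \<gamma>, OF q i S(1)[symmetric] \<gamma> le'[unfolded x_def K_def]]
    have Z: "\<rho> = Zf q a (\<beta> (Suc r)) (\<beta> r) (x (Suc r)) (K r) / Zf q a (\<beta> 1) 0 (x 1) 0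
       * (\<Prod>k=1..r. Ef q a (\<beta> k) (\<delta> (Suc k)) (\<delta> k) (x k) (x (Suc k)) / Ff q (\<beta> k) (\<delta> (Suc k)) (K (k - 1)) (K k))"
      unfolding \<rho>_def a_def \<beta>_def \<delta>_def x_def K_def by (rule rh(1))
    have W: "(\<Prod>k=1..r. W k) = \<rho> * (\<Prod>k=1..r. z k)"
      unfolding W_def z_def Z \<beta>_def by (rule prod_racah_weight[where x = x and K = K and \<delta> = \<delta>, OF q K0 xm Km a \<delta> le])
    have \<rho>: "0 < \<rho>" unfolding \<rho>_def zero_less_divide_iff zero_less_abs_iff by (intro disjI1 conjI rh(2,3))
    have h: "hnorm q \<gamma> i (Suc r) j j' = hnorm q \<gamma> i (Suc r) j' j'" by (rule hnorm_psum_cong) (use S in simp_all)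
    have h0: "hnorm q \<gamma> i (Suc r) j j' \<noteq> 0" by (rule rh(3))
    have cs: "csqrt (complex_of_real (rho q \<gamma> i (Suc r) j / hnorm q \<gamma> i (Suc r) j j')) = complex_of_real (sqrt \<rho>) * (if 0 < hnorm q \<gamma> i (Suc r) j' j' then 1 else \<i>)"
      unfolding h[symmetric]
    proof (cases "0 < hnorm q \<gamma> i (Suc r) j j'")
      case True
      then have e: "rho q \<gamma> i (Suc r) j / hnorm q \<gamma> i (Suc r) j j' = \<rho>" unfolding \<rho>_def by (simp only: abs_of_pos)
      show "csqrt (complex_of_real (rho q \<gamma> i (Suc r) j / hnorm q \<gamma> i (Suc r) j j')) = complex_of_real (sqrt \<rho>) * (if 0 < hnorm q \<gamma> i (Suc r) j j' then 1 else \<i>)"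
        unfolding e if_P[OF True] using \<rho> by simp
    next
      case False
      then have "hnorm q \<gamma> i (Suc r) j j' < 0" using h0 by linarith
      then have e: "rho q \<gamma> i (Suc r) j / hnorm q \<gamma> i (Suc r) j j' = - \<rho>" unfolding \<rho>_def by (simp only: abs_of_neg minus_divide_right minus_minus)
      show "csqrt (complex_of_real (rho q \<gamma> i (Suc r) j / hnorm q \<gamma> i (Suc r) j j')) = complex_of_real (sqrt \<rho>) * (if 0 < hnorm q \<gamma> i (Suc r) j j' then 1 else \<i>)"
        unfolding e if_not_P[OF False] using \<rho> by (subst csqrt_of_real_nonpos) simp_all
    qed
    have ip: "(\<Prod>k=1..r. \<i> ^ (K k - K (k - 1))) = \<i> ^ K r" for r
    proof (induction r)
      case (Suc r)
      then show ?case using Km[of r] by (simp flip: power_add)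
    qed (simp add: K0)
    have pr: "(\<Prod>k=1..r. racah_factor q \<gamma> i S0 x K k) = (\<Prod>k=1..r. sg k) * (sqrt \<rho> * (\<Prod>k=1..r. sqrt (z k))) * (\<Prod>k=1..r. R k)"
    proof -
      have "(\<Prod>k=1..r. racah_factor q \<gamma> i S0 x K k) = (\<Prod>k=1..r. sg k * sqrt (W k) * R k)" by (rule prod.cong[OF refl uf])
      then show ?thesis unfolding prod.distrib prod_sqrt W real_sqrt_mult .
    qed
    define M where "M = x (Suc r)"
    have M: "psum j' (i + r) - psum j' (i - 1) = M" unfolding M_def x_def using S by simp
    define f where "f = (\<Prod>k=1..r. (- 1 :: real) ^ (x (Suc k) * x k + x k))"
    define g where "g = (\<Prod>k=1..r. (- 1) ^ (K (k - 1) * K k + K (k - 1)) * sgT (K k - K (k - 1)))"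
    have sgp: "(\<Prod>k=1..r. sg k) = f * g * ((- 1) ^ (M * K r))"
      unfolding sg_def f_def g_def M_def by (rule sign_separation[where x = x and K = K, OF K0 xm Km]) (use le in simp)
    have f1: "f * f = 1" unfolding f_def prod.distrib[symmetric] power_mult_distrib[symmetric] by simp
    have g1: "g * g = 1"
    proof -
      have "g * g = (\<Prod>k=1..r. ((- 1) ^ (K (k - 1) * K k + K (k - 1)) * (- 1) ^ (K (k - 1) * K k + K (k - 1))) * (sgT (K k - K (k - 1)) * sgT (K k - K (k - 1))))"
        unfolding g_def prod.distrib[symmetric] by (rule prod.cong) (simp_all only: mult_ac)
      then show ?thesis unfolding sgT_square power_mult_distrib[symmetric] by simp
    qed
    have m1: "(- 1 :: real) ^ (M * K r) * (- 1) ^ (M * K r) = 1" unfolding power_mult_distrib[symmetric] by simp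
    have phase_source: "phase_source i r j = f" unfolding phase_source_def Let_def f_def x_def ..
    have phase_target: "phase_target q \<gamma> i r j' = (if 0 < hnorm q \<gamma> i (Suc r) j' j' then 1 else \<i>) * \<i> ^ K r * complex_of_real (g * (- 1) ^ (M * K r))"
      unfolding phase_target_def Let_def M g_def K_def ..
    have rp: "(g * (- 1) ^ (M * K r)) * (f * (\<Prod>k=1..r. racah_factor q \<gamma> i S0 x K k)) = sqrt \<rho> * (\<Prod>k=1..r. R k * sqrt (z k))"
    proof -
      have "(g * (- 1) ^ (M * K r)) * (f * (\<Prod>k=1..r. racah_factor q \<gamma> i S0 x K k)) =
        (g * g) * (f * f) * ((- 1) ^ (M * K r) * (- 1) ^ (M * K r)) * (sqrt \<rho> * ((\<Prod>k=1..r. R k) * (\<Prod>k=1..r. sqrt (z k))))"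
        unfolding pr sgp by (simp only: mult_ac)
      then show ?thesis unfolding f1 g1 m1 prod.distrib by simp
    qed
    have "csqrt (complex_of_real (rho q \<gamma> i (Suc r) j / hnorm q \<gamma> i (Suc r) j j'))
      * (\<Prod>k=1..r. complex_of_real (R k * sqrt (z k)) * \<i> ^ (K k - K (k - 1))) =
      (if 0 < hnorm q \<gamma> i (Suc r) j' j' then 1 else \<i>) * \<i> ^ K r * complex_of_real (sqrt \<rho> * (\<Prod>k=1..r. R k * sqrt (z k)))"
      unfolding cs prod.distrib ip of_real_mult of_real_prod by (simp only: mult_ac)
    then show ?thesis unfolding rm if_P[OF True] phase_source phase_target rp[symmetric] of_real_mult by (simp only: mult_ac)
  qed
qed

text \<open>The constants make each vector a positive multiple of the chain vector, of norm 1; any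
  phase can still be multiplied on afterwards.\<close>

lemma rep_normalized:
  assumes i: "1 \<le> i" and r: "1 \<le> r" and \<gamma>: "\<And>t. t \<in> {1..i + r + m} \<Longrightarrow> 0 < \<gamma> t"
  shows "\<exists>\<kappa>. \<forall>j N. rep (vscale (\<kappa> j N) (Theta q \<gamma> i r (i + r + m) j N))
    (\<lambda>ks. 1 / sqrt (sigf q (wt (tree q \<gamma> i r j m)) N * sq (tree q \<gamma> i r j m)) * ch q (tree q \<gamma> i r j m) N ks)"
proof -
  obtain i' r' where ir: "i = Suc i'" "r = Suc r'" using i r by (cases i; cases r) auto
  have "\<forall>j. \<exists>c. c \<noteq> 0 \<and> (\<forall>N. rep (Theta q \<gamma> i r (i + r + m) j N) (\<lambda>ks. c * ch q (tree q \<gamma> i r j m) N ks))"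
    unfolding ir by (intro allI rep_Theta[OF q]) (use \<gamma> ir in simp)
  then obtain c where c: "\<And>j. c j \<noteq> 0" "\<And>j N. rep (Theta q \<gamma> i r (i + r + m) j N) (\<lambda>ks. c j * ch q (tree q \<gamma> i r j m) N ks)"
    by metis
  show ?thesis
  proof (intro exI allI)
    fix j N
    show "rep (vscale (complex_of_real (1 / (c j * sqrt (sigf q (wt (tree q \<gamma> i r j m)) N * sq (tree q \<gamma> i r j m))))) (Theta q \<gamma> i r (i + r + m) j N))
      (\<lambda>ks. 1 / sqrt (sigf q (wt (tree q \<gamma> i r j m)) N * sq (tree q \<gamma> i r j m)) * ch q (tree q \<gamma> i r j m) N ks)"
      using rep_vscale[OF c(2)[of j N], of "1 / (c j * sqrt (sigf q (wt (tree q \<gamma> i r j m)) N * sq (tree q \<gamma> i r j m)))"] c(1)[of j]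
      by (simp add: mult.assoc)
  qed
qed

lemma vnorm_normalized:
  assumes T: "lw q T" and v: "rep v (\<lambda>ks. 1 / sqrt (sigf q (wt T) N * sq T) * ch q T N ks)" and u: "norm u = 1"
  shows "vnorm (vscale u v) = 1"
proof -
  have "0 < sigf q (wt T) N" "0 < sq T"
    unfolding sigf_def by (intro prod_pos lwD(3)[OF T]; use sig_pos[OF q lwD(5)[OF T]] in auto)+
  then have s: "0 < sigf q (wt T) N * sq T" by simp
  have "braket v v = complex_of_real (ip (length (nw T)) (nl T + N) (\<lambda>ks. 1 / sqrt (sigf q (wt T) N * sq T) * ch q T N ks) (\<lambda>ks. 1 / sqrt (sigf q (wt T) N * sq T) * ch q T N ks))"
    by (rule braket_rep[OF v v homog_cmult[OF homog_ch[OF lwD(1)[OF T]]]])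
  also have "ip (length (nw T)) (nl T + N) (\<lambda>ks. 1 / sqrt (sigf q (wt T) N * sq T) * ch q T N ks) (\<lambda>ks. 1 / sqrt (sigf q (wt T) N * sq T) * ch q T N ks)
     = (1 / sqrt (sigf q (wt T) N * sq T) * (1 / sqrt (sigf q (wt T) N * sq T))) * (sigf q (wt T) N * sq T)"
    unfolding ip_cmult_left ip_cmult_right ip_ch[OF q T T refl refl] sq_def by (simp only: mult_ac)
  also have "\<dots> = 1"
  proof -
    have "1 / sqrt y * (1 / sqrt y) * y = 1" if "0 < y" for y using that by (simp add: field_simps)
    then show ?thesis using s by blast
  qed
  finally have "braket v v = 1" by simp
  moreover have "cnj u * u = 1" using u complex_norm_square[of u] by (simp add: mult.commute)
  ultimately show ?thesis unfolding vnorm_def braket_vscale by simp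
qed

lemma braket_normalized:
  assumes T: "lw q T" "lw q T'" "length (nw T) = length (nw T')"
    and v: "rep v (\<lambda>ks. 1 / sqrt (sigf q (wt T) 0 * sq T) * ch q T 0 ks)" and w: "rep w (\<lambda>ks. 1 / sqrt (sigf q (wt T') 0 * sq T') * ch q T' 0 ks)"
  shows "braket v w = complex_of_real (nov T T')"
proof -
  have c: "ch q A 0 = nv A" for A by (simp add: ch_def)
  have "braket v w = complex_of_real (ip (length (nw T)) (nl T + 0) (\<lambda>ks. 1 / sqrt (sigf q (wt T) 0 * sq T) * ch q T 0 ks) (\<lambda>ks. 1 / sqrt (sigf q (wt T') 0 * sq T') * ch q T' 0 ks))"
    by (rule braket_rep[OF v w homog_cmult[OF homog_ch[OF lwD(1)[OF T(1)]]]])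
  then show ?thesis unfolding ip_cmult_left ip_cmult_right c by (simp add: nov_def ov_def)
qed

end

theorem theorem1:
  fixes n i r :: nat and q :: real and \<gamma> :: "nat \<Rightarrow> real"
  assumes "i \<ge> 1" and "r \<ge> 1" and "n \<ge> i + r"
    and "0 < q" and "q < 1"
    and "\<forall>t\<in>{1..n}. \<gamma> t > 1 / 2"
  shows "\<exists>\<eta> :: nat \<Rightarrow> nat \<Rightarrow> (nat \<Rightarrow> nat) \<Rightarrow> nat \<Rightarrow> complex.
    normalization q \<gamma> n (\<eta> 1 1) 1 1 \<and> normalization q \<gamma> n (\<eta> i r) i r \<and>
    (\<forall>j\<in>tuples n. \<forall>j'\<in>tuples n.
      let S = psum j; J = psum j';
          a = (\<lambda>k. if k = 1 then (- q) powi (2 * int (S (i - 1)) - 1) * q powr (2 * gsum \<gamma> 1 (i + 1))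
                   else q powr (2 * \<gamma> (i + k)));
          b = - (q powr (2 * \<gamma> (i + 1) - 1))
      in braket (jket q \<gamma> n (\<eta> i r) i r j' 0) (jket q \<gamma> n (\<eta> 1 1) 1 1 j 0)
         = kdelta (S (i + r - 1)) (J (i + r - 1))
           * (\<Prod>l=1..i - 1. kdelta (j l) (j' l))
           * (\<Prod>l=i + r..n - 1. kdelta (j l) (j' l))
           * csqrt (complex_of_real (rho q \<gamma> i r j / hnorm q \<gamma> i r j j'))
           * racah_multi (r - 1)
               (\<lambda>k. j' (i + k - 1))
               (\<lambda>k. int (S (i + k - 1)) - int (S (i - 1)))
               a b (int (S (i + r - 1)) - int (S (i - 1))) (- q))"
proof -
  note q = \<open>0 < q\<close> \<open>q < 1\<close> and i = \<open>i \<ge> 1\<close>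
  obtain s where r: "r = Suc s" using \<open>r \<ge> 1\<close> by (cases r) auto
  define m where "m = n - (i + r)"
  have n: "n = i + Suc s + m" using \<open>n \<ge> i + r\<close> by (simp add: m_def r)
  have n2: "1 + 1 \<le> n" "n - (1 + 1) = i + Suc s + m - 2" using i n by simp_all
  have \<gamma>: "0 < \<gamma> t" if "t \<in> {1..n}" for t using assms(6) that by force
  define T where "T = (\<lambda>i r j. tree q \<gamma> i r j (n - (i + r)))"
  have T: "lw q (T i r j) \<and> nw (T i r j) = map \<gamma> [1..<n + 1]" if "1 \<le> i" "1 \<le> r" "i + r \<le> n" for i r j
  proof -
    have e: "n = i + r + (n - (i + r))" using that by simp
    have g: "\<And>t. t \<in> {1..i + r + (n - (i + r))} \<Longrightarrow> 0 < \<gamma> t" using \<gamma> e by simp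
    have "lw q (T i r j)" "nw (T i r j) = map \<gamma> [1..<i + r + (n - (i + r)) + 1]"
      unfolding T_def by (rule tree_facts[where \<gamma> = \<gamma>, OF q _ _ g]; use that in simp)+
    then show ?thesis unfolding e[symmetric] ..
  qed
  define P where "P = (\<lambda>i r \<kappa>. \<forall>j N. rep (vscale (\<kappa> j N) (Theta q \<gamma> i r n j N))
    (\<lambda>ks. 1 / sqrt (sigf q (wt (T i r j)) N * sq (T i r j)) * ch q (T i r j) N ks))"
  \<comment> \<open>Chosen as a function of i and r, so that for i = r = 1 both bases of the theorem
    use the same constants.\<close>
  define \<kappa> where "\<kappa> = (\<lambda>i r. SOME \<kappa>. P i r \<kappa>)"
  have \<kappa>: "rep (vscale (\<kappa> i r j N) (Theta q \<gamma> i r n j N)) (\<lambda>ks. 1 / sqrt (sigf q (wt (T i r j)) N * sq (T i r j)) * ch q (T i r j) N ks)"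
    if "1 \<le> i" "1 \<le> r" "i + r \<le> n" for i r j N
  proof -
    have e: "n = i + r + (n - (i + r))" using that by simp
    have g: "\<And>t. t \<in> {1..i + r + (n - (i + r))} \<Longrightarrow> 0 < \<gamma> t" using \<gamma> e by simp
    have "\<exists>\<kappa>. P i r \<kappa>"
      unfolding P_def T_def using rep_normalized[where \<gamma> = \<gamma> and m = "n - (i + r)", OF q that(1,2) g] unfolding e[symmetric] .
    then have "P i r (\<kappa> i r)" unfolding \<kappa>_def by (rule someI_ex)
    then show ?thesis unfolding P_def by blast
  qed
  \<comment> \<open>The phase of the second tuple is conjugated because \<open>braket\<close> is
    antilinear in its first argument.\<close>
  define ph where "ph = (\<lambda>(i'::nat) (r'::nat) j. if i' = 1 \<and> r' = 1 then complex_of_real (phase_source i s j) else cnj (phase_target q \<gamma> i s j))"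
  define \<eta> where "\<eta> = (\<lambda>i r j N. ph i r j * \<kappa> i r j N)"
  have jk: "jket q \<gamma> n (\<eta> i r) i r j N = vscale (ph i r j) (vscale (\<kappa> i r j N) (Theta q \<gamma> i r n j N))" for i r j N
    unfolding jket_def \<eta>_def vscale_vscale ..
  have ph1: "norm (ph i r j) = 1" for i r j
    by (simp add: ph_def norm_phase_target abs_phase_source)
  have norm: "normalization q \<gamma> n (\<eta> i r) i r" if "1 \<le> i" "1 \<le> r" "i + r \<le> n" for i r
    unfolding normalization_def jk using T[OF that] \<kappa>[OF that] ph1 by (blast intro: vnorm_normalized[OF q])
  \<comment> \<open>For i = r = 1 the branch for (1,1) is taken on both sides, so one constant must
    serve as both phases. Then s = 0, the products are empty and \<open>hnorm\<close> is positive,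
    hence both phases are 1.\<close>
  have ph_ir: "cnj (ph i r j) = phase_target q \<gamma> i s j" for j
  proof (cases "i = 1 \<and> r = 1")
    case True
    then have s: "s = 0" by (simp add: r)
    have "0 < hnorm q \<gamma> i (Suc 0) j j"
      by (rule rho_div_hnorm(4)[where \<gamma> = \<gamma>, OF q i refl]) (use \<gamma> n in simp_all)
    then show ?thesis using True by (simp add: ph_def phase_source_def phase_target_def s Let_def)
  next
    case False
    then show ?thesis unfolding ph_def if_not_P[OF False] by simp
  qed
  have pk: "(\<Prod>l\<in>B. kdelta (j l) (j' l)) = (if \<forall>l\<in>B. j' l = j l then 1 else 0)" if "finite B" for B j j'
    using that by (induction B) (auto simp: kdelta_def)
  have main: "braket (jket q \<gamma> n (\<eta> i r) i r j' 0) (jket q \<gamma> n (\<eta> 1 1) 1 1 j 0)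
         = kdelta (psum j (i + r - 1)) (psum j' (i + r - 1))
           * (\<Prod>l=1..i - 1. kdelta (j l) (j' l))
           * (\<Prod>l=i + r..n - 1. kdelta (j l) (j' l))
           * csqrt (complex_of_real (rho q \<gamma> i r j / hnorm q \<gamma> i r j j'))
           * racah_multi (r - 1) (\<lambda>k. j' (i + k - 1)) (\<lambda>k. int (psum j (i + k - 1)) - int (psum j (i - 1)))
               (\<lambda>k. if k = 1 then (- q) powi (2 * int (psum j (i - 1)) - 1) * q powr (2 * gsum \<gamma> 1 (i + 1)) else q powr (2 * \<gamma> (i + k)))
               (- (q powr (2 * \<gamma> (i + 1) - 1))) (int (psum j (i + r - 1)) - int (psum j (i - 1))) (- q)" for j j' :: "nat \<Rightarrow> nat"
  proof -
    define x where "x = (\<lambda>k. psum j (i + k - 1) - psum j (i - 1))"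
    define K where "K = (\<lambda>k. \<Sum>l=1..k. j' (i + l - 1))"
    define C where "C \<longleftrightarrow> (\<forall>l\<in>{i + Suc s..n - 1}. j' l = j l) \<and> (\<forall>l\<in>{1..i - 1}. j' l = j l)"
    define U where "U = (\<Prod>k=1..s. racah_factor q \<gamma> i (psum j (i - 1)) x K k)"
    have ir: "1 \<le> i" "1 \<le> r" "i + r \<le> n" using i r n by simp_all
    have one: "(1::nat) \<le> 1" by simp
    have ph11: "ph 1 1 j = complex_of_real (phase_source i s j)" by (simp add: ph_def)
    have "braket (vscale (\<kappa> i r j' 0) (Theta q \<gamma> i r n j' 0)) (vscale (\<kappa> 1 1 j 0) (Theta q \<gamma> 1 1 n j 0)) = complex_of_real (nov (T i r j') (T 1 1 j))"
      by (rule braket_normalized[OF q _ _ _ \<kappa>[OF ir] \<kappa>[OF one one n2(1)]]) (use T[OF ir] T[OF one one n2(1)] in simp_all)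
    then have b: "braket (jket q \<gamma> n (\<eta> i r) i r j' 0) (jket q \<gamma> n (\<eta> 1 1) 1 1 j 0) =
       phase_target q \<gamma> i s j' * complex_of_real (phase_source i s j) * complex_of_real (nov (T i r j') (T 1 1 j))"
      unfolding jk braket_vscale ph_ir ph11 by (simp only:)
    have nv: "nov (T i r j') (T 1 1 j) = (if C \<and> j' (i + s) + K s = x (Suc s) then U else 0)"
    proof -
      have Ti: "T i r j' = tree q \<gamma> i (Suc s) j' m" unfolding T_def m_def r ..
      have T1: "T 1 1 j = tree q \<gamma> 1 1 j (i + Suc s + m - 2)" unfolding T_def n2(2) ..
      have g: "\<And>t. t \<in> {1..i + Suc s + m} \<Longrightarrow> 0 < \<gamma> t" using \<gamma> n by simp
      show ?thesis unfolding Ti T1 C_def U_def x_def K_def conj_assoc unfolding n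
        by (rule nov_tree_closed[where \<gamma> = \<gamma>, OF q i g])
    qed
    show ?thesis
    proof (cases C)
      case False
      then show ?thesis unfolding b nv by (auto simp: pk C_def r simp del: prod_zero_iff)
    next
      case True
      have J0: "psum j (i - 1) = psum j' (i - 1)" unfolding psum_def by (rule sum.cong) (use True in \<open>auto simp: C_def\<close>)
      have "psum j (i - 1) \<le> psum j (i + s)" unfolding psum_def by (rule sum_mono2) auto
      then have S1: "psum j (i + s) = psum j (i - 1) + x (Suc s)" by (simp add: x_def)
      have J1: "psum j' (i + s) = psum j (i - 1) + (j' (i + s) + K s)"
      proof -
        obtain i' where i': "i = Suc i'" using i by (cases i) auto
        have "psum j' (i' + k) = psum j' i' + (\<Sum>l=1..k. j' (i' + l))" for k by (induction k) (simp_all add: psum_def)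
        from this[of "Suc s"] show ?thesis unfolding J0 by (simp add: K_def i')
      qed
      \<comment> \<open>Once the other labels agree, the level condition in the overlap of the trees
        is the Kronecker delta for the partial sums up to i + r - 1.\<close>
      have eq: "j' (i + s) + K s = x (Suc s) \<longleftrightarrow> psum j (i + s) = psum j' (i + s)" unfolding S1 J1 by auto
      have e: "i + r - 1 = i + s" "r - 1 = s" by (simp_all add: r)
      have k1: "(\<Prod>l=1..i - 1. kdelta (j l) (j' l)) = 1" "(\<Prod>l=i + r..n - 1. kdelta (j l) (j' l)) = 1"
        using True by (simp_all add: pk C_def r)
      show ?thesis
      proof (cases "psum j (i + s) = psum j' (i + s)")
        case False
        then show ?thesis unfolding b nv eq e by (simp add: kdelta_def)
      next
        case S: True
        have g: "\<And>t. t \<in> {1..i + Suc s} \<Longrightarrow> 0 < \<gamma> t" using \<gamma> n by simp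
        have "kdelta (psum j (i + s)) (psum j' (i + s)) = 1" using S by (simp add: kdelta_def)
        then show ?thesis unfolding b nv eq e k1 mult_1_left mult_1_right
          using racah_overlap[where \<gamma> = \<gamma>, OF q i g J0 S] True S by (simp add: r U_def x_def K_def mult.assoc)
      qed
    qed
  qed
  have "normalization q \<gamma> n (\<eta> 1 1) 1 1" "normalization q \<gamma> n (\<eta> i r) i r"
    using i r n by (intro norm; simp)+
  then show ?thesis unfolding Let_def using main by blast
qed

end
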